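(* Let $\Omega\subset\mathbb{R}^m$ ($m\ge1$) be a bounded Lipschitz domain, let $a_{ij},r_k,q_1,q_2\in L^\infty(\Omega)$ be real-valued ($1\le i,j,k\le m$), let $\mathfrak{P}=(a_{ij})_{m\times m}$ be symmetric and $\mathfrak{R}=(r_k)_{m\times1}$. Assume there is $\alpha>0$ such that for a.e. $x\in\Omega$, $A^T\mathfrak{P}(x)A\ge\alpha A^TA$ for all $A\in\mathbb{R}^m$, and that $$\operatorname*{ess\,inf}_{\Omega} q_1\ \ge\ \frac{\alpha}{2}+\frac{1}{2\alpha}\sum_{k=1}^m\|r_k\|^2_{L^\infty(\Omega)} .$$ Let $n\ge2$ be an integer, and let $(\mathbb{B}_h)_{0<h\le h_0}$ be a family of web-spline spaces of order $n$ and grid width $h$ on $\Omega$, as defined in the context. Then there is a constant $C>0$, independent of $h$, $\mathbf{f}$ and $\mathbf{u}$, such that the following holds. Let $\mathbf{f}\in(L^2(\Omega))^2$, let $\mathbf{u}=(u_1,u_2)\in (H_0^1(\Omega))^2$ be the solution of $$a(\mathbf{u},\mathbf{v})=\langle\mathbf{f},\mathbf{v}\rangle\qquad\text{for all }\mathbf{v}\in (H^1_0(\Omega))^2,$$ assume $\mathbf{u}\in (H^n_0(\Omega))^2$, and for $0<h\le h_0$ let $\mathbf{u}_h\in(\mathbb{B}_h)^2$ be the Ritz--Galerkin approximation, i.e. the solution of $$a(\mathbf{u}_h,\mathbf{v}_h)=\langle\mathbf{f},\mathbf{v}_h\rangle\qquad\text{for all }\mathbf{v}_h\in(\mathbb{B}_h)^2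 .$$ Then $$|\mathbf{u}-\mathbf{u}_h|_1\ \le\ C\,h^{n-1}\,\|\mathbf{u}\|_n .$$
   Context: **Bilinear form.** For $\mathbf{u}=(u_1,u_2)$, $\mathbf{v}=(v_1,v_2)\in (H_0^1(\Omega))^2$, $$a(\mathbf{u},\mathbf{v})=\int_\Omega\big[(\nabla v_1)^T\mathfrak{P}\nabla u_1+(\nabla v_2)^T\mathfrak{P}\nabla u_2\big]dx+\int_\Omega\big[v_1\,\mathfrak{R}\cdot\nabla u_1+v_2\,\mathfrak{R}\cdot\nabla u_2\big]dx+\int_\Omega\big[(q_1u_1+q_2u_2)v_1+(q_1u_2-q_2u_1)v_2\big]dx ,$$ and $\langle\mathbf{f},\mathbf{v}\rangle=\int_\Omega(f_1v_1+f_2v_2)\,dx$. **Norms.** For scalar $v$, $\|v\|_l=\big(\sum_{|\beta|\le l}\int_\Omega|D^\beta v|^2\big)^{1/2}$ is the $H^l(\Omega)$ norm and $|v|_1=\big(\int_\Omega|\nabla v|^2\big)^{1/2}$. For pairs, $\|\mathbf{v}\|_l=\|v_1\|_l+\|v_2\|_l$ and $|\mathbf{v}|_1=|v_1|_1+|v_2|_1$. **Weight function.** $w$ is a fixed smoothed version of the distance function $d(x)=\operatorname{dist}(x,\partial\Omega)$: $w\in C^\infty(\Omega)$, $c_1 d\le w\le c_2 d$ on $\Omega$ with constants $c_1,c_2>0$, and $|D^\beta w|\le c_\beta\, d^{1-|\beta|}$ on $\Omega$ for every multi-index $\beta$. **B-splines.** For $h>0$ and $k\in\mathbb{Z}^m$,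 $b_k(x)=\prod_{\nu=1}^m b(x_\nu/h-k_\nu)$, where $b$ is the univariate cardinal B-spline of order $n$ (degree $n-1$) with knots $0,1,\dots,n$; so $b_k$ has support $h(k+[0,n]^m)$ and is a polynomial of degree $n-1$ in each variable on each grid cell $\mathbb{Q}_l=h(l+[0,1]^m)$, $l\in\mathbb{Z}^m$. Let $K$ be the set of $k$ such that the support of $b_k$ meets $\Omega$. Let $I\subset K$ (inner indices) be the set of those $i$ for which at least one of the grid cells $\mathbb{Q}_{i+l}$, $l\in\{0,\dots,n-1\}^m$, in the support of $b_i$ is contained in $\overline\Omega$; for each $i\in I$ choose one such cell $\mathbb{Q}_{i+l(i)}$ and let $x_i$ be its center. Let $J=K\setminus I$ (outer indices). **Web-splines.** For $i\in I$ the weighted extended B-spline is $$B_i=\frac{w}{w(x_i)}\Big(b_i+\sum_{j\in J}e_{i,j}\,b_j\Big)\quad\text{on }\Omega,$$ where the real coefficients $e_{i,j}$ satisfy, with a constant $M$ independent of $h,i,j$: $|e_{i,j}|\le M$, and $e_{i,j}=0$ whenever $\|i-j\|\ge M$; and they are chosen so that all weighted polynomials $w\,p$ of order $n$ ($p$ a polynomial of degree at most $n-1$ in each variable), restricted to $\Omega$, belong to the web-spline space $\mathbb{B}_h=\operatorname{span}\{B_i: i\in I\}$. A family of web-spline spaces $(\mathbb{B}_h)_{0<h\le h_0}$ consists of such spaces, for all grid widths $h\in(0,h_0]$ ($h_0$ small enough that they exist), with the same $w$ and the same constant $M$. *)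

theory Defs
  imports "HOL-Probability.Essential_Supremum"
begin

section \<open>Lipschitz domains\<close>

text \<open>
  Near each boundary point the domain is the part lying above the graph of a Lipschitz function
  in a rotated coordinate system. The vector \<open>e\<close> is the vertical direction of that system, and
  \<open>y - (y \<bullet> e) *\<^sub>R e\<close> is the projection of \<open>y\<close> to the hyperplane orthogonal to \<open>e\<close>; only the
  values of \<open>\<gamma>\<close> on this hyperplane matter. In dimension one the hyperplane is \<open>{0}\<close>.
\<close>

definition lipschitz_domain :: "(real^'m) set \<Rightarrow> bool" where
  "lipschitz_domain \<Omega> \<longleftrightarrow> open \<Omega> \<and> connected \<Omega> \<and> \<Omega> \<noteq> {} \<and>
     (\<forall>p\<in>frontier \<Omega>. \<exists>r>0. \<exists>e \<gamma> L. norm e = 1 \<and> lipschitz_on L UNIV \<gamma> \<and>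
        \<Omega> \<inter> ball p r = {y \<in> ball p r. y \<bullet> e > \<gamma> (y - (y \<bullet> e) *\<^sub>R e)})"


section \<open>Classical derivatives\<close>

definition mi_order :: "nat^'m \<Rightarrow> nat" where
  "mi_order \<beta> = (\<Sum>i\<in>UNIV. \<beta> $ i)"

definition partial_deriv :: "'m \<Rightarrow> (real^'m \<Rightarrow> real) \<Rightarrow> real^'m \<Rightarrow> real" where
  "partial_deriv i f x = frechet_derivative f (at x) (axis i 1)"

definition iter_partial :: "'m list \<Rightarrow> (real^'m \<Rightarrow> real) \<Rightarrow> real^'m \<Rightarrow> real" where
  "iter_partial is f = foldr partial_deriv is f"

definition smooth_on :: "(real^'m) set \<Rightarrow> (real^'m \<Rightarrow> real) \<Rightarrow> bool" where
  "smooth_on S f \<longleftrightarrow> (\<forall>is. iter_partial is f differentiable_on S)"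

text \<open>
  The derivative for a multi-index. It is applied to smooth functions on open sets only, so by
  the symmetry of higher derivatives the order of differentiation picked here is irrelevant.
\<close>

definition mi_deriv :: "nat^'m \<Rightarrow> (real^'m \<Rightarrow> real) \<Rightarrow> real^'m \<Rightarrow> real" where
  "mi_deriv \<beta> f = iter_partial (SOME is. \<forall>i. count_list is i = \<beta> $ i) f"

definition support :: "(real^'m \<Rightarrow> real) \<Rightarrow> (real^'m) set" where
  "support f = closure {x. f x \<noteq> 0}"

definition test_functions :: "(real^'m) set \<Rightarrow> (real^'m \<Rightarrow> real) set" where
  "test_functions \<Omega> = {\<phi>. smooth_on UNIV \<phi> \<and> compact (support \<phi>) \<and> support \<phi> \<subseteq> \<Omega>}"


section \<open>Lebesgue and Sobolev spaces\<close>

text \<open>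
  Elements of these spaces are represented by functions on the whole space of which only the
  values on \<open>\<Omega>\<close>, up to a null set, are relevant.
\<close>

definition Linf :: "(real^'m) set \<Rightarrow> (real^'m \<Rightarrow> real) set" where
  "Linf \<Omega> = {f. f \<in> borel_measurable (lebesgue_on \<Omega>) \<and>
                esssup (lebesgue_on \<Omega>) (\<lambda>x. ereal \<bar>f x\<bar>) < \<infinity>}"

definition Linf_norm :: "(real^'m) set \<Rightarrow> (real^'m \<Rightarrow> real) \<Rightarrow> real" where
  "Linf_norm \<Omega> f = real_of_ereal (esssup (lebesgue_on \<Omega>) (\<lambda>x. ereal \<bar>f x\<bar>))"

definition essinf :: "(real^'m) set \<Rightarrow> (real^'m \<Rightarrow> real) \<Rightarrow> ereal" where
  "essinf \<Omega> f = - esssup (lebesgue_on \<Omega>) (\<lambda>x. ereal (- f x))"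

definition L2 :: "(real^'m) set \<Rightarrow> (real^'m \<Rightarrow> real) set" where
  "L2 \<Omega> = {f. f \<in> borel_measurable (lebesgue_on \<Omega>) \<and>
              integrable (lebesgue_on \<Omega>) (\<lambda>x. (f x)\<^sup>2)}"

definition locally_integrable :: "(real^'m) set \<Rightarrow> (real^'m \<Rightarrow> real) \<Rightarrow> bool" where
  "locally_integrable \<Omega> f \<longleftrightarrow>
     (\<forall>S. compact S \<and> S \<subseteq> \<Omega> \<longrightarrow> integrable (lebesgue_on S) f)"

definition has_weak_deriv ::
    "(real^'m) set \<Rightarrow> nat^'m \<Rightarrow> (real^'m \<Rightarrow> real) \<Rightarrow> (real^'m \<Rightarrow> real) \<Rightarrow> bool" where
  "has_weak_deriv \<Omega> \<beta> u g \<longleftrightarrow> locally_integrable \<Omega> u \<and> locally_integrable \<Omega> g \<and>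
     (\<forall>\<phi>\<in>test_functions \<Omega>.
        (\<integral>x. u x * mi_deriv \<beta> \<phi> x \<partial>lebesgue_on \<Omega>)
        = (-1) ^ mi_order \<beta> * (\<integral>x. g x * \<phi> x \<partial>lebesgue_on \<Omega>))"

text \<open>Where it exists, the weak derivative is determined up to a null subset of \<open>\<Omega>\<close>.\<close>

definition weak_deriv ::
    "(real^'m) set \<Rightarrow> nat^'m \<Rightarrow> (real^'m \<Rightarrow> real) \<Rightarrow> real^'m \<Rightarrow> real" where
  "weak_deriv \<Omega> \<beta> u = (SOME g. has_weak_deriv \<Omega> \<beta> u g)"

definition weak_grad :: "(real^'m) set \<Rightarrow> (real^'m \<Rightarrow> real) \<Rightarrow> real^'m \<Rightarrow> real^'m" where
  "weak_grad \<Omega> u x = (\<chi> i. weak_deriv \<Omega> (axis i 1) u x)"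

definition Hspace :: "nat \<Rightarrow> (real^'m) set \<Rightarrow> (real^'m \<Rightarrow> real) set" where
  "Hspace l \<Omega> = {u \<in> L2 \<Omega>. \<forall>\<beta>. mi_order \<beta> \<le> l \<longrightarrow> (\<exists>g\<in>L2 \<Omega>. has_weak_deriv \<Omega> \<beta> u g)}"

definition Hnorm :: "nat \<Rightarrow> (real^'m) set \<Rightarrow> (real^'m \<Rightarrow> real) \<Rightarrow> real" where
  "Hnorm l \<Omega> v =
     sqrt (\<Sum>\<beta> | mi_order \<beta> \<le> l. (\<integral>x. (weak_deriv \<Omega> \<beta> v x)\<^sup>2 \<partial>lebesgue_on \<Omega>))"

definition H1_seminorm :: "(real^'m) set \<Rightarrow> (real^'m \<Rightarrow> real) \<Rightarrow> real" where
  "H1_seminorm \<Omega> v = sqrt (\<integral>x. (norm (weak_grad \<Omega> v x))\<^sup>2 \<partial>lebesgue_on \<Omega>)"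

definition H0space :: "nat \<Rightarrow> (real^'m) set \<Rightarrow> (real^'m \<Rightarrow> real) set" where
  "H0space l \<Omega> = {u \<in> Hspace l \<Omega>.
     \<forall>\<epsilon>>0. \<exists>\<phi>\<in>test_functions \<Omega>. Hnorm l \<Omega> (\<lambda>x. u x - \<phi> x) < \<epsilon>}"

type_synonym 'm field_pair = "(real^'m \<Rightarrow> real) \<times> (real^'m \<Rightarrow> real)"

definition Hnorm_pair :: "nat \<Rightarrow> (real^'m) set \<Rightarrow> 'm field_pair \<Rightarrow> real" where
  "Hnorm_pair l \<Omega> v = Hnorm l \<Omega> (fst v) + Hnorm l \<Omega> (snd v)"

definition H1_seminorm_pair :: "(real^'m) set \<Rightarrow> 'm field_pair \<Rightarrow> real" where
  "H1_seminorm_pair \<Omega> v = H1_seminorm \<Omega> (fst v) + H1_seminorm \<Omega> (snd v)"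

definition diff_pair :: "'m field_pair \<Rightarrow> 'm field_pair \<Rightarrow> 'm field_pair" where
  "diff_pair u v = ((\<lambda>x. fst u x - fst v x), (\<lambda>x. snd u x - snd v x))"


section \<open>The bilinear form\<close>

definition bilinear_form ::
    "(real^'m) set \<Rightarrow> (real^'m \<Rightarrow> real^'m^'m) \<Rightarrow> (real^'m \<Rightarrow> real^'m) \<Rightarrow>
     (real^'m \<Rightarrow> real) \<Rightarrow> (real^'m \<Rightarrow> real) \<Rightarrow> 'm field_pair \<Rightarrow> 'm field_pair \<Rightarrow> real" where
  "bilinear_form \<Omega> P R q1 q2 = (\<lambda>(u1, u2) (v1, v2).
     (\<integral>x. (weak_grad \<Omega> v1 x \<bullet> (P x *v weak_grad \<Omega> u1 x)
           + weak_grad \<Omega> v2 x \<bullet> (P x *v weak_grad \<Omega> u2 x)) \<partial>lebesgue_on \<Omega>)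
   + (\<integral>x. (v1 x * (R x \<bullet> weak_grad \<Omega> u1 x)
           + v2 x * (R x \<bullet> weak_grad \<Omega> u2 x)) \<partial>lebesgue_on \<Omega>)
   + (\<integral>x. ((q1 x * u1 x + q2 x * u2 x) * v1 x
           + (q1 x * u2 x - q2 x * u1 x) * v2 x) \<partial>lebesgue_on \<Omega>))"

definition L2_pairing :: "(real^'m) set \<Rightarrow> 'm field_pair \<Rightarrow> 'm field_pair \<Rightarrow> real" where
  "L2_pairing \<Omega> = (\<lambda>(f1, f2) (v1, v2). \<integral>x. (f1 x * v1 x + f2 x * v2 x) \<partial>lebesgue_on \<Omega>)"


section \<open>Web-splines\<close>

definition weight_function :: "(real^'m) set \<Rightarrow> (real^'m \<Rightarrow> real) \<Rightarrow> bool" where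
  "weight_function \<Omega> w \<longleftrightarrow> smooth_on \<Omega> w \<and>
     (\<exists>c1>0. \<exists>c2>0. \<forall>x\<in>\<Omega>. c1 * infdist x (frontier \<Omega>) \<le> w x \<and> w x \<le> c2 * infdist x (frontier \<Omega>)) \<and>
     (\<forall>\<beta>. \<exists>c. \<forall>x\<in>\<Omega>. \<bar>mi_deriv \<beta> w x\<bar> \<le> c * infdist x (frontier \<Omega>) powi (1 - int (mi_order \<beta>)))"

text \<open>
  The cardinal B-spline of order \<open>n\<close> with knots \<open>0, \<dots>, n\<close>, by the Cox--de Boor recursion; it is
  normalized such that its integer translates sum to one.
\<close>

fun cardinal_bspline :: "nat \<Rightarrow> real \<Rightarrow> real" where
  "cardinal_bspline 0 t = 0"
| "cardinal_bspline (Suc 0) t = indicator {0..<1} t"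
| "cardinal_bspline (Suc (Suc k)) t =
     (t * cardinal_bspline (Suc k) t
      + (real (Suc (Suc k)) - t) * cardinal_bspline (Suc k) (t - 1)) / real (Suc k)"

definition bspline :: "nat \<Rightarrow> real \<Rightarrow> int^'m \<Rightarrow> real^'m \<Rightarrow> real" where
  "bspline n h k x = (\<Prod>\<nu>\<in>UNIV. cardinal_bspline n (x $ \<nu> / h - of_int (k $ \<nu>)))"

definition grid_cell :: "real \<Rightarrow> int^'m \<Rightarrow> (real^'m) set" where
  "grid_cell h l = {x. \<forall>\<nu>. h * of_int (l $ \<nu>) \<le> x $ \<nu> \<and> x $ \<nu> \<le> h * (of_int (l $ \<nu>) + 1)}"

definition cell_center :: "real \<Rightarrow> int^'m \<Rightarrow> real^'m" where
  "cell_center h l = (\<chi> \<nu>. h * (of_int (l $ \<nu>) + 1/2))"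

definition relevant_indices :: "(real^'m) set \<Rightarrow> nat \<Rightarrow> real \<Rightarrow> (int^'m) set" where
  "relevant_indices \<Omega> n h = {k. support (bspline n h k) \<inter> \<Omega> \<noteq> {}}"

definition inner_offsets :: "(real^'m) set \<Rightarrow> nat \<Rightarrow> real \<Rightarrow> int^'m \<Rightarrow> (int^'m) set" where
  "inner_offsets \<Omega> n h i =
     {l. (\<forall>\<nu>. 0 \<le> l $ \<nu> \<and> l $ \<nu> \<le> int n - 1) \<and> grid_cell h (i + l) \<subseteq> closure \<Omega>}"

definition inner_indices :: "(real^'m) set \<Rightarrow> nat \<Rightarrow> real \<Rightarrow> (int^'m) set" where
  "inner_indices \<Omega> n h = {i \<in> relevant_indices \<Omega> n h. inner_offsets \<Omega> n h i \<noteq> {}}"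

definition outer_indices :: "(real^'m) set \<Rightarrow> nat \<Rightarrow> real \<Rightarrow> (int^'m) set" where
  "outer_indices \<Omega> n h = relevant_indices \<Omega> n h - inner_indices \<Omega> n h"

text \<open>
  In the following, \<open>l i\<close> is the offset of the cell chosen for the inner index \<open>i\<close>, and \<open>e\<close> holds
  the extension coefficients.
\<close>

definition webspline ::
    "(real^'m) set \<Rightarrow> (real^'m \<Rightarrow> real) \<Rightarrow> nat \<Rightarrow> real \<Rightarrow> (int^'m \<Rightarrow> int^'m) \<Rightarrow>
     (int^'m \<Rightarrow> int^'m \<Rightarrow> real) \<Rightarrow> int^'m \<Rightarrow> real^'m \<Rightarrow> real" where
  "webspline \<Omega> w n h l e i x = w x / w (cell_center h (i + l i)) *
     (bspline n h i x + (\<Sum>j\<in>outer_indices \<Omega> n h. e i j * bspline n h j x))"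

text \<open>The span of the web-splines as functions on \<open>\<Omega>\<close>: values outside \<open>\<Omega>\<close> are arbitrary.\<close>

definition web_space ::
    "(real^'m) set \<Rightarrow> (real^'m \<Rightarrow> real) \<Rightarrow> nat \<Rightarrow> real \<Rightarrow> (int^'m \<Rightarrow> int^'m) \<Rightarrow>
     (int^'m \<Rightarrow> int^'m \<Rightarrow> real) \<Rightarrow> (real^'m \<Rightarrow> real) set" where
  "web_space \<Omega> w n h l e = {v. \<exists>c. \<forall>x\<in>\<Omega>.
     v x = (\<Sum>i\<in>inner_indices \<Omega> n h. c i * webspline \<Omega> w n h l e i x)}"

definition coordinate_polys :: "nat \<Rightarrow> (real^'m \<Rightarrow> real) set" where
  "coordinate_polys n = {p. \<exists>c. \<forall>x. p x =
     (\<Sum>\<gamma> | \<forall>\<nu>. \<gamma> $ \<nu> \<le> n - 1. c (\<gamma> :: nat^'m) * (\<Prod>\<nu>\<in>UNIV. x $ \<nu> ^ (\<gamma> $ \<nu>)))}"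

definition web_data ::
    "(real^'m) set \<Rightarrow> (real^'m \<Rightarrow> real) \<Rightarrow> nat \<Rightarrow> real \<Rightarrow> real \<Rightarrow> (int^'m \<Rightarrow> int^'m) \<Rightarrow>
     (int^'m \<Rightarrow> int^'m \<Rightarrow> real) \<Rightarrow> bool" where
  "web_data \<Omega> w n M h l e \<longleftrightarrow>
     (\<forall>i\<in>inner_indices \<Omega> n h. l i \<in> inner_offsets \<Omega> n h i) \<and>
     (\<forall>i\<in>inner_indices \<Omega> n h. \<forall>j\<in>outer_indices \<Omega> n h.
        \<bar>e i j\<bar> \<le> M \<and>
        (norm ((\<chi> \<nu>. of_int (i $ \<nu> - j $ \<nu>)) :: real^'m) \<ge> M \<longrightarrow> e i j = 0)) \<and>
     (\<forall>p\<in>coordinate_polys n. (\<lambda>x. w x * p x) \<in> web_space \<Omega> w n h l e)"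

definition web_family ::
    "(real^'m) set \<Rightarrow> (real^'m \<Rightarrow> real) \<Rightarrow> nat \<Rightarrow> real \<Rightarrow> (real \<Rightarrow> (real^'m \<Rightarrow> real) set) \<Rightarrow> bool" where
  "web_family \<Omega> w n h0 B \<longleftrightarrow> weight_function \<Omega> w \<and>
     (\<exists>M. \<forall>h. 0 < h \<and> h \<le> h0 \<longrightarrow>
        (\<exists>l e. web_data \<Omega> w n M h l e \<and> B h = web_space \<Omega> w n h l e))"

end

theory Submission
  imports Defs "HOL-Computational_Algebra.Polynomial"
begin

text \<open>
  The condition on \<open>q\<^sub>1\<close> makes the form coercive on \<open>H\<^sup>1\<close>, pointwise under the integral, so by
  Galerkin orthogonality the error is bounded by the best approximation error from the web-spline
  space. Every web-spline vanishes on the boundary and belongs to \<open>H\<^sub>0\<^sup>1\<close>.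

  For the approximation, by density it suffices to treat a test function \<open>f\<close>. Away from the boundary
  every B-spline \<open>b\<^sub>k\<close> is inner and receives no outer B-splines, so \<open>w b\<^sub>k\<close> itself is a multiple of a
  web-spline. Hence \<open>w\<close> times a quasi-interpolant of \<open>f / w\<close> that uses only these far indices is in
  the space. In cells where all neighbouring indices are far, the quasi-interpolant reproduces the
  Taylor polynomial of \<open>f / w\<close>, and the error is controlled by the derivatives of \<open>f\<close> of order at most
  \<open>n\<close>, divided by powers of the boundary distance \<open>d\<close>; in the remaining cells \<open>d\<close> is at most a multiple
  of \<open>h\<close>, and \<open>f\<close> itself is bounded by the same weighted quantity times the right power of \<open>h\<close>.
  Hardy's inequality bounds the weighted quantity by the \<open>H\<^sup>n\<close> norm. The point evaluations of the
  quasi-interpolant are compatible with square integrals because the sampling points are shifted by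
  a common \<open>y\<close> in the unit cube, and some shift is at least as good as the average over all shifts.
\<close>

section \<open>Calculus of iterated partial derivatives\<close>

text \<open>The rate is a balance of powers. A Taylor remainder of order \<open>n\<close> gains h^n,
  one derivative of a B-spline loses 1/h. The n-th derivatives of \<open>f / w\<close> are worse
  than those of \<open>f\<close> by a factor 1/d, which the \<open>w\<close> in front of the spline
  restores. Derivatives of \<open>f\<close> of order j therefore enter with weight d^-(n - j), the
  scaling that Leibniz's rule and Hardy's inequality both respect. For test functions all weighted
  quantities are finite and all derivatives classical.

  The threshold for far indices is max (3 r + 1) (M + r), where r h bounds the distance to the
  sampling points: M + r keeps outer indices out of reach of the extension coefficients; 3 r + 1
  keeps the segments from a point to its samples inside the domain, with the boundary distance
  shrinking at most by a factor of two.

  B-splines of order 2 are only Lipschitz, so membership in the Sobolev space needs an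
  approximation: |t| is replaced by smooth functions in the spline recursion, and the product with
  \<open>w\<close> is cut off near the boundary, where the smallness of \<open>w\<close> compensates
  the gradient of the cutoff.\<close>

lemma partial_deriv_eq:
  assumes "(f has_derivative f') (at x)"
  shows "partial_deriv i f x = f' (axis i 1)"
  using frechet_derivative_at[OF assms] by (simp add: partial_deriv_def)

text \<open>If \<open>f\<close> is not differentiable at the point, both sides are still the same
  unspecified value: \<open>frechet_derivative\<close> chooses from the set of derivatives, and the
  two sets coincide. The rule therefore rewrites under arbitrary iterated derivatives.\<close>

lemma partial_deriv_cong_open:
  assumes "open S" "x \<in> S" "\<And>y. y \<in> S \<Longrightarrow> f y = g y"
  shows "partial_deriv i f x = partial_deriv i g x"
proof (cases "f differentiable at x")
  case True
  then obtain f' where f: "(f has_derivative f') (at x)" by (auto simp: differentiable_def)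
  have g: "(g has_derivative f') (at x)"
    using has_derivative_transform_within_open[OF f assms(1,2)] assms(3) by simp
  show ?thesis using partial_deriv_eq[OF f] partial_deriv_eq[OF g] by simp
next
  case False
  have "(f has_derivative D) (at x) \<longleftrightarrow> (g has_derivative D) (at x)" for D
    using has_derivative_transform_within_open[OF _ assms(1,2), of f D UNIV g]
      has_derivative_transform_within_open[OF _ assms(1,2), of g D UNIV f] assms(3) by auto
  then show ?thesis by (simp add: partial_deriv_def frechet_derivative_def)
qed

lemma iter_partial_Nil [simp]: "iter_partial [] f = f"
  by (simp add: iter_partial_def)

lemma iter_partial_Cons: "iter_partial (i # is) f = partial_deriv i (iter_partial is f)"
  by (simp add: iter_partial_def)

lemma iter_partial_append: "iter_partial (is @ js) f = iter_partial is (iter_partial js f)"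
  by (simp add: iter_partial_def)

lemma iter_partial_snoc: "iter_partial (is @ [i]) f = iter_partial is (partial_deriv i f)"
  by (simp add: iter_partial_def)

lemma iter_partial_cong_open:
  assumes "open S" "x \<in> S" "\<And>y. y \<in> S \<Longrightarrow> f y = g y"
  shows "iter_partial is f x = iter_partial is g x"
  using assms(2)
proof (induction "is" arbitrary: x)
  case (Cons i "is")
  then show ?case
    using partial_deriv_cong_open[OF assms(1), of x "iter_partial is f" "iter_partial is g"]
    by (simp add: iter_partial_Cons)
qed (use assms in auto)

lemma differentiable_on_open_at:
  "open S \<Longrightarrow> f differentiable_on S \<longleftrightarrow> (\<forall>x\<in>S. f differentiable at x)"
  unfolding differentiable_on_def by (metis at_within_open)

lemma smooth_on_iter_partial: "smooth_on S f \<Longrightarrow> smooth_on S (iter_partial is f)"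
  by (simp add: smooth_on_def flip: iter_partial_append)

lemma smooth_on_partial_deriv: "smooth_on S f \<Longrightarrow> smooth_on S (partial_deriv i f)"
  using smooth_on_iter_partial[of S f "[i]"] by (simp add: iter_partial_Cons)

lemma smooth_on_imp_differentiable:
  "smooth_on S f \<Longrightarrow> open S \<Longrightarrow> x \<in> S \<Longrightarrow> f differentiable at x"
  unfolding smooth_on_def using differentiable_on_open_at[of S f]
  by (metis iter_partial_Nil)

lemma smooth_on_imp_continuous_on: "smooth_on S f \<Longrightarrow> continuous_on S f"
  unfolding smooth_on_def by (metis differentiable_imp_continuous_on iter_partial_Nil)

lemma smooth_on_subset: "smooth_on S f \<Longrightarrow> T \<subseteq> S \<Longrightarrow> smooth_on T f"
  unfolding smooth_on_def by (meson differentiable_on_subset)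

lemma has_derivative_partial_deriv:
  fixes f :: "real^'m \<Rightarrow> real"
  assumes "f differentiable at x"
  shows "(f has_derivative (\<lambda>h. \<Sum>i\<in>UNIV. h $ i * partial_deriv i f x)) (at x)"
proof -
  obtain f' where f: "(f has_derivative f') (at x)" using assms by (auto simp: differentiable_def)
  then have lin: "linear f'" using has_derivative_linear by blast
  have "f' h = (\<Sum>i\<in>UNIV. h $ i * partial_deriv i f x)" for h
  proof -
    have "h = (\<Sum>i\<in>UNIV. h $ i *\<^sub>R axis i 1)"
      using basis_expansion[of h] by (simp add: scalar_mult_eq_scaleR)
    then have "f' h = f' (\<Sum>i\<in>UNIV. h $ i *\<^sub>R axis i 1)" by simp
    also have "\<dots> = (\<Sum>i\<in>UNIV. h $ i * f' (axis i 1))"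
      using lin by (simp add: linear_sum linear_cmul)
    finally show ?thesis by (simp add: partial_deriv_eq[OF f])
  qed
  then have "f' = (\<lambda>h. \<Sum>i\<in>UNIV. h $ i * partial_deriv i f x)" by auto
  then show ?thesis using f by simp
qed

lemma DERIV_along_line:
  fixes f :: "real^'m \<Rightarrow> real"
  assumes "f differentiable at (x + t *\<^sub>R e)"
  shows "((\<lambda>t. f (x + t *\<^sub>R e)) has_real_derivative
           (\<Sum>i\<in>UNIV. e $ i * partial_deriv i f (x + t *\<^sub>R e))) (at t within T)"
proof -
  have "((\<lambda>t. x + t *\<^sub>R e) has_derivative (\<lambda>t. t *\<^sub>R e)) (at t within T)"
    by (auto intro!: derivative_eq_intros)
  moreover have "(f has_derivative (\<lambda>h. \<Sum>i\<in>UNIV. h $ i * partial_deriv i f (x + t *\<^sub>R e)))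
      (at (x + t *\<^sub>R e) within (\<lambda>t. x + t *\<^sub>R e) ` T)"
    using has_derivative_partial_deriv[OF assms] has_derivative_at_withinI by blast
  ultimately have "((f \<circ> (\<lambda>t. x + t *\<^sub>R e)) has_derivative
     ((\<lambda>h. \<Sum>i\<in>UNIV. h $ i * partial_deriv i f (x + t *\<^sub>R e)) \<circ> (\<lambda>t. t *\<^sub>R e))) (at t within T)"
    using diff_chain_within by blast
  then show ?thesis
    by (simp add: has_field_derivative_def o_def sum_distrib_right mult_commute_abs mult.assoc
        flip: sum_distrib_left)
qed

text \<open>Smoothness is a greatest fixed point: it suffices to exhibit a family of differentiable
  functions that is closed under partial derivatives. Closure is only required up to agreement on
  \<open>S\<close>, because off \<open>S\<close> nothing is known about the derivatives.\<close>

lemma smooth_on_coinduct: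
  assumes S: "open S" and f: "f \<in> F"
    and diff: "\<And>g x. g \<in> F \<Longrightarrow> x \<in> S \<Longrightarrow> g differentiable at x"
    and closed: "\<And>g i. g \<in> F \<Longrightarrow> \<exists>g'\<in>F. \<forall>x\<in>S. partial_deriv i g x = g' x"
  shows "smooth_on S f"
proof -
  have *: "\<exists>g\<in>F. \<forall>x\<in>S. iter_partial is f x = g x" for "is"
  proof (induction "is")
    case (Cons i "is")
    then obtain g where g: "g \<in> F" "\<forall>x\<in>S. iter_partial is f x = g x" by auto
    obtain g' where "g' \<in> F" "\<forall>x\<in>S. partial_deriv i g x = g' x" using closed[OF g(1)] by auto
    then show ?case using partial_deriv_cong_open[OF S, of _ "iter_partial is f" g] g(2)
      by (auto simp: iter_partial_Cons)
  qed (use f in auto)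
  show ?thesis unfolding smooth_on_def
  proof (intro allI)
    fix "is"
    obtain g where g: "g \<in> F" "\<forall>x\<in>S. iter_partial is f x = g x" using * by blast
    have "g differentiable_on S" using diff g(1) S by (simp add: differentiable_on_open_at)
    then show "iter_partial is f differentiable_on S"
      using g(2) S has_derivative_transform_within_open[of g _ _ UNIV S "iter_partial is f"]
      by (simp add: differentiable_on_open_at differentiable_def) metis
  qed
qed

text \<open>The polynomial expressions in the functions of \<open>B\<close>. They form the family
  for the coinduction: by Leibniz's rule their derivatives are again such expressions as soon as
  this holds for the generators, so sums and products need no bookkeeping of higher
  derivatives.\<close>

inductive_set alg_hull :: "(real^'m \<Rightarrow> real) set \<Rightarrow> (real^'m \<Rightarrow> real) set" for B where
  base: "f \<in> B \<Longrightarrow> f \<in> alg_hull B"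
| const: "(\<lambda>x. c) \<in> alg_hull B"
| add: "f \<in> alg_hull B \<Longrightarrow> g \<in> alg_hull B \<Longrightarrow> (\<lambda>x. f x + g x) \<in> alg_hull B"
| mult: "f \<in> alg_hull B \<Longrightarrow> g \<in> alg_hull B \<Longrightarrow> (\<lambda>x. f x * g x) \<in> alg_hull B"

lemma partial_deriv_const [simp]: "partial_deriv i (\<lambda>x. c) = (\<lambda>x. 0)"
  by (auto simp: partial_deriv_def)

lemma partial_deriv_add:
  assumes "f differentiable at x" "g differentiable at x"
  shows "partial_deriv i (\<lambda>x. f x + g x) x = partial_deriv i f x + partial_deriv i g x"
  using partial_deriv_eq[OF has_derivative_add[OF has_derivative_partial_deriv[OF assms(1)]
    has_derivative_partial_deriv[OF assms(2)]], of i]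
  by (simp add: axis_def if_distrib[of "\<lambda>x. x * _"] cong: if_cong)

lemma partial_deriv_mult:
  assumes "f differentiable at x" "g differentiable at x"
  shows "partial_deriv i (\<lambda>x. f x * g x) x = partial_deriv i f x * g x + f x * partial_deriv i g x"
  using partial_deriv_eq[OF has_derivative_mult[OF has_derivative_partial_deriv[OF assms(1)]
    has_derivative_partial_deriv[OF assms(2)]], of i]
  by (simp add: axis_def if_distrib[of "\<lambda>x. x * _"] cong: if_cong)

lemma partial_deriv_compose:
  assumes "f differentiable at x" "(h has_real_derivative h') (at (f x))"
  shows "(\<lambda>x. h (f x)) differentiable at x"
    and "partial_deriv i (\<lambda>x. h (f x)) x = h' * partial_deriv i f x"
proof -
  have D: "((\<lambda>x. h (f x)) has_derivative (\<lambda>y. h' * (\<Sum>i\<in>UNIV. y $ i * partial_deriv i f x))) (at x)"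
    using diff_chain_at[OF has_derivative_partial_deriv[OF assms(1)]
      assms(2)[unfolded has_field_derivative_def]] by (simp add: o_def)
  show "(\<lambda>x. h (f x)) differentiable at x" using D by (auto simp: differentiable_def)
  show "partial_deriv i (\<lambda>x. h (f x)) x = h' * partial_deriv i f x"
    using partial_deriv_eq[OF D, of i]
    by (simp add: axis_def if_distrib[of "\<lambda>x. x * _"] cong: if_cong)
qed

lemma partial_deriv_component:
  "partial_deriv i (\<lambda>x. x $ j) x = (if i = j then 1 else 0)"
  by (subst partial_deriv_eq[where f' = "\<lambda>h. h $ j"])
     (auto simp: axis_def intro!: bounded_linear_imp_has_derivative)

lemma smooth_on_alg_hull:
  assumes S: "open S" and f: "f \<in> alg_hull B"
    and diff: "\<And>g x. g \<in> B \<Longrightarrow> x \<in> S \<Longrightarrow> g differentiable at x"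
    and closed: "\<And>g i. g \<in> B \<Longrightarrow> \<exists>g'\<in>alg_hull B. \<forall>x\<in>S. partial_deriv i g x = g' x"
  shows "smooth_on S f"
proof (rule smooth_on_coinduct[OF S f])
  show D: "g differentiable at x" if "g \<in> alg_hull B" "x \<in> S" for g x
    using that by induction (auto intro: diff)
  fix g :: "real^'a \<Rightarrow> real" and i
  assume "g \<in> alg_hull B"
  then show "\<exists>g'\<in>alg_hull B. \<forall>x\<in>S. partial_deriv i g x = g' x"
  proof induction
    case (base f)
    then show ?case by (rule closed)
  next
    case (const c)
    then show ?case by (auto intro: alg_hull.const)
  next
    case (add f g)
    then obtain f' g' where "f' \<in> alg_hull B" "\<forall>x\<in>S. partial_deriv i f x = f' x"
      "g' \<in> alg_hull B" "\<forall>x\<in>S. partial_deriv i g x = g' x" by blast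
    then show ?case using add D
      by (intro bexI[of _ "\<lambda>x. f' x + g' x"]) (auto simp: partial_deriv_add intro: alg_hull.add)
  next
    case (mult f g)
    then obtain f' g' where "f' \<in> alg_hull B" "\<forall>x\<in>S. partial_deriv i f x = f' x"
      "g' \<in> alg_hull B" "\<forall>x\<in>S. partial_deriv i g x = g' x" by blast
    then show ?case using mult D
      by (intro bexI[of _ "\<lambda>x. f' x * g x + f x * g' x"])
         (auto simp: partial_deriv_mult intro: alg_hull.add alg_hull.mult)
  qed
qed

lemma smooth_on_alg_hull_smooth:
  assumes "open S" "f \<in> alg_hull {f. smooth_on S f}"
  shows "smooth_on S f"
  by (rule smooth_on_alg_hull[OF assms])
     (use assms(1) in \<open>blast intro: smooth_on_imp_differentiable alg_hull.base smooth_on_partial_deriv\<close>)+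

lemma smooth_on_const: "open S \<Longrightarrow> smooth_on S (\<lambda>x. c)"
  by (rule smooth_on_alg_hull_smooth) (simp_all add: alg_hull.intros)

lemma smooth_on_add:
  "open S \<Longrightarrow> smooth_on S f \<Longrightarrow> smooth_on S g \<Longrightarrow> smooth_on S (\<lambda>x. f x + g x)"
  by (rule smooth_on_alg_hull_smooth) (simp_all add: alg_hull.intros)

lemma smooth_on_mult:
  "open S \<Longrightarrow> smooth_on S f \<Longrightarrow> smooth_on S g \<Longrightarrow> smooth_on S (\<lambda>x. f x * g x)"
  by (rule smooth_on_alg_hull_smooth) (simp_all add: alg_hull.intros)

lemma smooth_on_sum:
  "open S \<Longrightarrow> (\<And>k. k \<in> K \<Longrightarrow> smooth_on S (f k)) \<Longrightarrow> smooth_on S (\<lambda>x. \<Sum>k\<in>K. f k x)"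
  by (induction K rule: infinite_finite_induct) (simp_all add: smooth_on_const smooth_on_add)

lemma smooth_on_prod:
  "open S \<Longrightarrow> (\<And>k. k \<in> K \<Longrightarrow> smooth_on S (f k)) \<Longrightarrow> smooth_on S (\<lambda>x. \<Prod>k\<in>K. f k x)"
  by (induction K rule: infinite_finite_induct) (simp_all add: smooth_on_const smooth_on_mult)

lemma smooth_on_diff:
  "open S \<Longrightarrow> smooth_on S f \<Longrightarrow> smooth_on S g \<Longrightarrow> smooth_on S (\<lambda>x. f x - g x)"
  using smooth_on_add[of S f "\<lambda>x. -1 * g x"] smooth_on_mult[of S "\<lambda>x. -1" g]
  by (simp add: smooth_on_const)

lemma smooth_on_component: "open S \<Longrightarrow> smooth_on S (\<lambda>x. x $ j)"
proof (rule smooth_on_alg_hull[where B = "{\<lambda>x. x $ j}"])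
  fix g :: "real^'a \<Rightarrow> real" and i
  assume "g \<in> {\<lambda>x. x $ j}"
  then show "\<exists>g'\<in>alg_hull {\<lambda>x. x $ j}. \<forall>x\<in>S. partial_deriv i g x = g' x"
    by (intro bexI[of _ "\<lambda>x. if i = j then 1 else 0"])
       (simp_all add: partial_deriv_component alg_hull.const)
qed (simp_all add: alg_hull.base bounded_linear_imp_differentiable bounded_linear_vec_nth)

text \<open>The outer function comes as the sequence \<open>h\<close> of its successive derivatives.
  As generators serve all smooth functions and all compositions of \<open>h k\<close> with
  \<open>f\<close>; the derivative of such a composition is the product of the two generators
  \<open>h (Suc k) (f x)\<close> and \<open>partial_deriv i f x\<close>.\<close>

lemma smooth_on_compose:
  assumes S: "open S" and f: "smooth_on S f" "f ` S \<subseteq> T"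
    and h: "\<And>k t. t \<in> T \<Longrightarrow> (h k has_real_derivative h (Suc k) t) (at t)"
  shows "smooth_on S (\<lambda>x. h 0 (f x))"
proof (rule smooth_on_alg_hull[where B = "{f. smooth_on S f} \<union> (range (\<lambda>k x. h k (f x)))", OF S])
  let ?B = "{f. smooth_on S f} \<union> (range (\<lambda>k x. h k (f x)))"
  have df: "f differentiable at x" if "x \<in> S" for x
    using smooth_on_imp_differentiable[OF f(1) S that] .
  show "(\<lambda>x. h 0 (f x)) \<in> alg_hull ?B" by (auto intro: alg_hull.base)
  show "g differentiable at x" if "g \<in> ?B" "x \<in> S" for g x
    using that partial_deriv_compose(1)[OF df h] f(2) S
    by (auto intro: smooth_on_imp_differentiable)
  fix g i
  assume "g \<in> ?B"
  then consider "smooth_on S g" | k where "g = (\<lambda>x. h k (f x))" by auto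
  then show "\<exists>g'\<in>alg_hull ?B. \<forall>x\<in>S. partial_deriv i g x = g' x"
  proof cases
    case 1
    then show ?thesis by (intro bexI[of _ "partial_deriv i g"])
       (auto intro: alg_hull.base smooth_on_partial_deriv)
  next
    case 2
    have "(\<lambda>x. h (Suc k) (f x) * partial_deriv i f x) \<in> alg_hull ?B"
      by (rule alg_hull.mult) (auto intro: alg_hull.base smooth_on_partial_deriv f)
    then show ?thesis unfolding 2
      using partial_deriv_compose(2)[OF df h] f(2) by (intro bexI) auto
  qed
qed

lemma smooth_on_powr:
  assumes S: "open S" and f: "smooth_on S f" "\<And>x. x \<in> S \<Longrightarrow> f x > 0"
  shows "smooth_on S (\<lambda>x. f x powr a)"
proof -
  define h where "h k t = (\<Prod>i<k. a - real i) * t powr (a - real k)" for k t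
  have "(h k has_real_derivative h (Suc k) t) (at t)" if "t \<in> {0<..}" for k t
  proof -
    have "((\<lambda>t. t powr (a - real k)) has_real_derivative (a - real k) * t powr (a - real k - 1)) (at t)"
      by (rule has_real_derivative_powr) (use that in auto)
    from DERIV_cmult[OF this, of "\<Prod>i<k. a - real i"] show ?thesis
      unfolding h_def by (simp add: mult_ac algebra_simps)
  qed
  from smooth_on_compose[OF S f(1), of "{0<..}" h, OF _ this] f(2) show ?thesis
    by (auto simp: h_def image_subset_iff)
qed

lemma smooth_on_cong:
  assumes "open S" "\<And>x. x \<in> S \<Longrightarrow> f x = g x"
  shows "smooth_on S f \<longleftrightarrow> smooth_on S g"
  unfolding smooth_on_def differentiable_on_open_at[OF assms(1)]
proof (intro iff_allI ball_cong refl)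
  fix "is" x assume x: "x \<in> S"
  have eq: "y \<in> S \<Longrightarrow> iter_partial is f y = iter_partial is g y" for y
    by (rule iter_partial_cong_open[OF assms(1)]) (use assms(2) in auto)
  show "iter_partial is f differentiable at x \<longleftrightarrow> iter_partial is g differentiable at x"
    using has_derivative_transform_within_open[OF _ assms(1) x, of "iter_partial is f" _ UNIV "iter_partial is g"]
      has_derivative_transform_within_open[OF _ assms(1) x, of "iter_partial is g" _ UNIV "iter_partial is f"] eq
    unfolding differentiable_def by metis
qed

lemma smooth_on_inverse:
  assumes S: "open S" and f: "smooth_on S f" "\<And>x. x \<in> S \<Longrightarrow> f x > 0"
  shows "smooth_on S (\<lambda>x. 1 / f x)"
  using smooth_on_powr[OF assms, of "-1"] smooth_on_cong[OF S, of "\<lambda>x. f x powr - 1" "\<lambda>x. 1 / f x"] f(2)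
  by (simp add: powr_minus_divide less_imp_le)

lemma smooth_on_Un:
  "open S \<Longrightarrow> open T \<Longrightarrow> smooth_on S f \<Longrightarrow> smooth_on T f \<Longrightarrow> smooth_on (S \<union> T) f"
  unfolding smooth_on_def by (auto simp: differentiable_on_open_at open_Un)

section \<open>Symmetry of second derivatives, and lists of directions in place of
  multi-indices\<close>

lemma sum_axis [simp]: "(\<Sum>j\<in>UNIV. axis i (1::real) $ j * f j) = f i"
  by (simp add: axis_def if_distrib[of "\<lambda>x. x * _"] cong: if_cong)

lemma DERIV_along_axis:
  fixes f :: "real^'m \<Rightarrow> real"
  assumes "f differentiable at (x + t *\<^sub>R axis i 1)"
  shows "((\<lambda>t. f (x + t *\<^sub>R axis i 1)) has_real_derivative
           partial_deriv i f (x + t *\<^sub>R axis i 1)) (at t within T)"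
  using DERIV_along_line[OF assms] by simp

text \<open>The mean value theorem is used once in direction \<open>i\<close> and once in direction
  \<open>j\<close>. The left-hand side is symmetric in the two directions while the right-hand side
  is not, which is what makes mixed derivatives comparable.\<close>

lemma second_difference_eq:
  fixes f :: "real^'m \<Rightarrow> real"
  assumes S: "open S" "cball x (2 * h) \<subseteq> S" and h: "h > 0" and f: "smooth_on S f"
  shows "\<exists>\<xi>\<in>cball x (2 * h). f (x + h *\<^sub>R axis i 1 + h *\<^sub>R axis j 1) - f (x + h *\<^sub>R axis i 1)
      - f (x + h *\<^sub>R axis j 1) + f x = h\<^sup>2 * partial_deriv j (partial_deriv i f) \<xi>"
proof -
  have in_ball: "x + s *\<^sub>R axis i 1 + t *\<^sub>R axis j 1 \<in> cball x (2 * h)"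
    if "0 \<le> s" "s \<le> h" "0 \<le> t" "t \<le> h" for s t
  proof -
    have "norm (s *\<^sub>R axis i (1::real) + t *\<^sub>R axis j 1) \<le> s + t"
      using norm_triangle_ineq[of "s *\<^sub>R axis i (1::real)" "t *\<^sub>R axis j 1"] that by simp
    then have "norm (x - (x + s *\<^sub>R axis i (1::real) + t *\<^sub>R axis j 1)) \<le> 2 * h"
      using that norm_minus_cancel[of "s *\<^sub>R axis i (1::real) + t *\<^sub>R axis j 1"] by simp
    then show ?thesis by (simp add: dist_norm)
  qed
  have D: "((\<lambda>s. f (x + t *\<^sub>R axis j 1 + s *\<^sub>R axis i 1)) has_real_derivative
           partial_deriv i f (x + t *\<^sub>R axis j 1 + s *\<^sub>R axis i 1)) (at s)"
    if "0 \<le> s" "s \<le> h" "0 \<le> t" "t \<le> h" for s t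
    using in_ball[OF that] S by (intro DERIV_along_axis smooth_on_imp_differentiable[OF f]) (auto simp: add_ac)
  have "\<exists>z>0. z < h \<and> (\<lambda>s. f (x + h *\<^sub>R axis j 1 + s *\<^sub>R axis i 1) - f (x + 0 *\<^sub>R axis j 1 + s *\<^sub>R axis i 1)) h
      - (\<lambda>s. f (x + h *\<^sub>R axis j 1 + s *\<^sub>R axis i 1) - f (x + 0 *\<^sub>R axis j 1 + s *\<^sub>R axis i 1)) 0
      = (h - 0) * (partial_deriv i f (x + h *\<^sub>R axis j 1 + z *\<^sub>R axis i 1)
          - partial_deriv i f (x + 0 *\<^sub>R axis j 1 + z *\<^sub>R axis i 1))"
    by (rule MVT2) (use h in \<open>(auto intro!: DERIV_diff D)[1], intro DERIV_diff D, auto\<close>)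
  then obtain s where s: "0 < s" "s < h" and
    eq: "f (x + h *\<^sub>R axis i 1 + h *\<^sub>R axis j 1) - f (x + h *\<^sub>R axis i 1)
      - f (x + h *\<^sub>R axis j 1) + f x = h * (partial_deriv i f (x + s *\<^sub>R axis i 1 + h *\<^sub>R axis j 1)
          - partial_deriv i f (x + s *\<^sub>R axis i 1))"
    by (auto simp: algebra_simps)
  have "\<exists>z>0. z < h \<and> partial_deriv i f (x + s *\<^sub>R axis i 1 + h *\<^sub>R axis j 1)
          - partial_deriv i f (x + s *\<^sub>R axis i 1 + 0 *\<^sub>R axis j 1)
      = (h - 0) * partial_deriv j (partial_deriv i f) (x + s *\<^sub>R axis i 1 + z *\<^sub>R axis j 1)"
    by (rule MVT2) (use h s S in_ball in \<open>auto intro!: DERIV_along_axis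
        smooth_on_imp_differentiable[OF smooth_on_partial_deriv[OF f]]\<close>)
  then obtain t where t: "0 < t" "t < h" and
    "partial_deriv i f (x + s *\<^sub>R axis i 1 + h *\<^sub>R axis j 1)
          - partial_deriv i f (x + s *\<^sub>R axis i 1)
      = h * partial_deriv j (partial_deriv i f) (x + s *\<^sub>R axis i 1 + t *\<^sub>R axis j 1)"
    by auto
  with eq show ?thesis using s t in_ball[of s t]
    by (intro bexI[of _ "x + s *\<^sub>R axis i 1 + t *\<^sub>R axis j 1"]) (auto simp: power2_eq_square)
qed

text \<open>Schwarz's theorem. The same second difference equals h^2 times either mixed derivative,
  each at some point within 2 h of \<open>x\<close>. If the derivatives differed at
  \<open>x\<close>, continuity would keep them within half of the gap of their values at
  \<open>x\<close> on a small ball, so they could not take a common value there.\<close>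

lemma partial_deriv_commute:
  fixes f :: "real^'m \<Rightarrow> real"
  assumes S: "open S" "x \<in> S" and f: "smooth_on S f"
  shows "partial_deriv i (partial_deriv j f) x = partial_deriv j (partial_deriv i f) x"
proof (rule ccontr)
  let ?F = "partial_deriv i (partial_deriv j f)" and ?G = "partial_deriv j (partial_deriv i f)"
  assume ne: "?F x \<noteq> ?G x"
  define \<epsilon> where "\<epsilon> = \<bar>?F x - ?G x\<bar> / 2"
  have \<epsilon>: "\<epsilon> > 0" using ne by (simp add: \<epsilon>_def)
  have "isCont ?F x" "isCont ?G x"
    using S smooth_on_imp_continuous_on[OF smooth_on_partial_deriv[OF smooth_on_partial_deriv[OF f]]]
    by (auto simp: continuous_on_eq_continuous_at)
  then obtain r1 r2 where r: "r1 > 0" "\<And>y. dist y x < r1 \<Longrightarrow> dist (?F y) (?F x) < \<epsilon>"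
    "r2 > 0" "\<And>y. dist y x < r2 \<Longrightarrow> dist (?G y) (?G x) < \<epsilon>"
    using \<epsilon> unfolding continuous_at_eps_delta by metis
  obtain r3 where r3: "r3 > 0" "cball x r3 \<subseteq> S" using S open_contains_cball by blast
  define h where "h = min (min r1 r2) r3 / 4"
  have h: "h > 0" "2 * h < r1" "2 * h < r2" "2 * h \<le> r3" using r r3 by (auto simp: h_def)
  then have "cball x (2 * h) \<subseteq> S" using r3 by (auto simp: subset_iff)
  from second_difference_eq[OF S(1) this h(1) f, of i j]
    second_difference_eq[OF S(1) this h(1) f, of j i]
  obtain \<xi> \<eta> where "\<xi> \<in> cball x (2 * h)" "\<eta> \<in> cball x (2 * h)"
    "f (x + h *\<^sub>R axis i 1 + h *\<^sub>R axis j 1) - f (x + h *\<^sub>R axis i 1)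
      - f (x + h *\<^sub>R axis j 1) + f x = h\<^sup>2 * ?G \<xi>"
    "f (x + h *\<^sub>R axis j 1 + h *\<^sub>R axis i 1) - f (x + h *\<^sub>R axis j 1)
      - f (x + h *\<^sub>R axis i 1) + f x = h\<^sup>2 * ?F \<eta>"
    by blast
  moreover from this(3,4) have "h\<^sup>2 * ?G \<xi> = h\<^sup>2 * ?F \<eta>"
    by (simp add: add.commute add.left_commute diff_diff_eq)
  ultimately have "\<xi> \<in> cball x (2 * h)" "\<eta> \<in> cball x (2 * h)" "h\<^sup>2 * ?G \<xi> = h\<^sup>2 * ?F \<eta>"
    by auto
  note * = this
  have "dist \<eta> x \<le> 2 * h" "dist \<xi> x \<le> 2 * h" using *(1,2) by (simp_all add: dist_commute)
  then have "dist \<eta> x < r1" "dist \<xi> x < r2" using h(2,3) by linarith+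
  then have "dist (?F \<eta>) (?F x) < \<epsilon>" "dist (?G \<xi>) (?G x) < \<epsilon>" by (blast intro: r)+
  moreover have "?G \<xi> = ?F \<eta>" using *(3) h(1) by simp
  ultimately show False unfolding \<epsilon>_def dist_real_def by (smt (verit) field_sum_of_halves)
qed

lemma iter_partial_remove1:
  fixes f :: "real^'m \<Rightarrow> real"
  assumes S: "open S" and f: "smooth_on S f" and "i \<in> set js" "x \<in> S"
  shows "iter_partial js f x = iter_partial (i # remove1 i js) f x"
  using assms(3,4)
proof (induction js arbitrary: x)
  case (Cons j js)
  show ?case
  proof (cases "i = j")
    case False
    then have i: "i \<in> set js" using Cons by auto
    have "iter_partial (j # js) f x = partial_deriv j (iter_partial (i # remove1 i js) f) x"
      unfolding iter_partial_Cons[of j]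
      by (rule partial_deriv_cong_open[OF S]) (use Cons i in auto)
    also have "\<dots> = partial_deriv i (partial_deriv j (iter_partial (remove1 i js) f)) x"
      unfolding iter_partial_Cons
      by (rule partial_deriv_commute[OF S]) (use Cons smooth_on_iter_partial[OF f] in auto)
    finally show ?thesis using False by (simp add: iter_partial_Cons)
  qed simp
qed simp

lemma iter_partial_permute:
  fixes f :: "real^'m \<Rightarrow> real"
  assumes S: "open S" and f: "smooth_on S f" and "mset is = mset js" "x \<in> S"
  shows "iter_partial is f x = iter_partial js f x"
  using assms(3,4)
proof (induction "is" arbitrary: js x)
  case (Cons i "is")
  then have i: "i \<in> set js" by (metis list.set_intros(1) set_mset_mset)
  have m: "mset is = mset (remove1 i js)" using Cons.prems(1) by (metis add_mset_remove_trivial mset.simps(2) mset_remove1)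
  have "iter_partial (i # is) f x = iter_partial (i # remove1 i js) f x"
    unfolding iter_partial_Cons
    by (rule partial_deriv_cong_open[OF S]) (use Cons m in auto)
  then show ?case using iter_partial_remove1[OF S f i] Cons by simp
qed simp

lemma mi_order_count: "mi_order (\<chi> i. count_list is i) = length is"
  unfolding mi_order_def using sum_count_set[of "is" UNIV] by simp

lemma ex_count_list: "\<exists>is. \<forall>i. count_list is i = (\<beta> :: nat^'m) $ i"
proof -
  obtain xs :: "'m list" where "mset xs = Abs_multiset (\<lambda>i. \<beta> $ i)" using ex_mset by blast
  then have "count (mset xs) i = \<beta> $ i" for i by simp
  then show ?thesis by (metis count_mset)
qed

text \<open>Opens the choice in \<open>mi_deriv\<close>. Derivatives are handled below as lists of
  directions, on which one can recurse; multi-indices remain only where weak derivatives and Sobolev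
  norms mention them.\<close>

lemma mi_deriv_list:
  obtains "is" where "\<And>i. count_list is i = \<beta> $ i" "length is = mi_order \<beta>"
    "mi_deriv \<beta> = iter_partial is"
proof -
  let ?is = "SOME is. \<forall>i. count_list is i = \<beta> $ i"
  have c: "\<forall>i. count_list ?is i = \<beta> $ i" by (rule someI_ex) (rule ex_count_list)
  then have "(\<chi> i. count_list ?is i) = \<beta>" by (simp add: vec_eq_iff)
  then show ?thesis using that[of ?is] c mi_order_count[of ?is]
    by (auto simp: mi_deriv_def fun_eq_iff)
qed

lemma iter_partial_eq_mi_deriv:
  fixes f :: "real^'m \<Rightarrow> real"
  assumes "open S" "smooth_on S f" "x \<in> S"
  shows "iter_partial is f x = mi_deriv (\<chi> i. count_list is i) f x"
proof -
  obtain js where js: "\<And>i. count_list js i = (\<chi> i. count_list is i) $ i"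
    "mi_deriv (\<chi> i. count_list is i) = iter_partial js"
    using mi_deriv_list by metis
  then have "mset is = mset js" by (intro multiset_eqI) (simp add: count_mset)
  then show ?thesis using iter_partial_permute[OF assms(1,2) _ assms(3)] js(2) by metis
qed

lemma mi_order_0 [simp]: "mi_order 0 = 0"
  by (simp add: mi_order_def)

lemma mi_deriv_0 [simp]: "mi_deriv (0 :: nat^'m) f = f"
  by (rule mi_deriv_list[of "0 :: nat^'m"]) (metis iter_partial_Nil length_0_conv mi_order_0)

lemma mi_order_axis [simp]: "mi_order (axis i 1) = 1"
  by (simp add: mi_order_def axis_def)

lemma mi_deriv_axis [simp]: "mi_deriv (axis (i :: 'm::finite) 1) f = partial_deriv i f"
proof (rule mi_deriv_list[of "axis i 1 :: nat^'m"])
  fix "is" assume a: "\<And>j. count_list is j = axis i 1 $ j" "length is = mi_order (axis i 1 :: nat^'m)"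
    "mi_deriv (axis i 1) = iter_partial is"
  then obtain j where j: "is = [j]" using mi_order_axis by (metis One_nat_def length_0_conv length_Suc_conv)
  then have "j = i" using a(1)[of j] by (auto simp: axis_def split: if_splits)
  then show ?thesis using a(3) j by (simp add: iter_partial_Cons)
qed

lemma finite_mi_order: "finite {\<beta> :: nat^'m. mi_order \<beta> \<le> l}"
proof -
  have "{\<beta> :: nat^'m. mi_order \<beta> \<le> l} \<subseteq> (\<lambda>is. \<chi> i. count_list is i) ` {is. set is \<subseteq> UNIV \<and> length is \<le> l}"
  proof
    fix \<beta> :: "nat^'m" assume "\<beta> \<in> {\<beta>. mi_order \<beta> \<le> l}"
    moreover obtain "is" where "\<And>i. count_list is i = \<beta> $ i" "length is = mi_order \<beta>"
      using mi_deriv_list by metis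
    ultimately show "\<beta> \<in> (\<lambda>is. \<chi> i. count_list is i) ` {is. set is \<subseteq> UNIV \<and> length is \<le> l}"
      by (intro image_eqI[of _ _ "is"]) (auto simp: vec_eq_iff)
  qed
  then show ?thesis by (rule finite_subset) (intro finite_imageI finite_lists_length_le finite)
qed

section \<open>Scaled derivative bounds for products and reciprocals\<close>

lemma iter_partial_add:
  assumes S: "open S" "x \<in> S" and f: "smooth_on S f" "smooth_on S g"
  shows "iter_partial is (\<lambda>x. f x + g x) x = iter_partial is f x + iter_partial is g x"
  using S(2)
proof (induction "is" arbitrary: x)
  case (Cons i "is")
  have "iter_partial (i # is) (\<lambda>x. f x + g x) x
      = partial_deriv i (\<lambda>x. iter_partial is f x + iter_partial is g x) x"
    unfolding iter_partial_Cons by (rule partial_deriv_cong_open[OF S(1)]) (use Cons in auto)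
  also have "\<dots> = iter_partial (i # is) f x + iter_partial (i # is) g x"
    unfolding iter_partial_Cons
    by (intro partial_deriv_add smooth_on_imp_differentiable[OF _ S(1)] smooth_on_iter_partial f Cons.prems)
  finally show ?case .
qed simp

text \<open>The bounds a / d^k are stable under Leibniz's rule. The innermost derivative is split
  off, which leaves two products in which one factor has been differentiated and its constant
  divided by \<open>d\<close>; each order thus doubles the number of terms. Everything takes place
  at the single point \<open>x\<close>, so \<open>d\<close> may be the boundary distance of that
  point.\<close>

lemma iter_partial_mult_bound:
  fixes f g :: "real^'m \<Rightarrow> real"
  assumes S: "open S" "x \<in> S" and "smooth_on S f" "smooth_on S g" and d: "d > 0"
    and "\<And>js. length js \<le> length is \<Longrightarrow> \<bar>iter_partial js f x\<bar> \<le> a / d ^ length js"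
    and "\<And>js. length js \<le> length is \<Longrightarrow> \<bar>iter_partial js g x\<bar> \<le> b / d ^ length js"
  shows "\<bar>iter_partial is (\<lambda>x. f x * g x) x\<bar> \<le> 2 ^ length is * a * b / d ^ length is"
  using assms(3,4,6,7)
proof (induction "is" arbitrary: f g a b rule: rev_induct)
  case Nil
  then have "\<bar>f x\<bar> \<le> a" "\<bar>g x\<bar> \<le> b" using Nil.prems(3,4)[of "[]"] by auto
  then show ?case by (simp add: abs_mult mult_mono')
next
  case (snoc i "is")
  have sm: "smooth_on S (partial_deriv i f)" "smooth_on S (partial_deriv i g)"
    using snoc by (auto intro: smooth_on_partial_deriv)
  have "iter_partial (is @ [i]) (\<lambda>x. f x * g x) x
     = iter_partial is (\<lambda>x. partial_deriv i f x * g x + f x * partial_deriv i g x) x"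
    unfolding iter_partial_snoc
    by (rule iter_partial_cong_open[OF S])
       (use snoc S(1) in \<open>auto intro!: partial_deriv_mult smooth_on_imp_differentiable\<close>)
  also have "\<dots> = iter_partial is (\<lambda>x. partial_deriv i f x * g x) x + iter_partial is (\<lambda>x. f x * partial_deriv i g x) x"
    by (intro iter_partial_add[OF S] smooth_on_mult S sm snoc.prems)
  finally have eq: "iter_partial (is @ [i]) (\<lambda>x. f x * g x) x
    = iter_partial is (\<lambda>x. partial_deriv i f x * g x) x + iter_partial is (\<lambda>x. f x * partial_deriv i g x) x" .
  have 1: "\<bar>iter_partial is (\<lambda>x. partial_deriv i f x * g x) x\<bar> \<le> 2 ^ length is * (a / d) * b / d ^ length is"
  proof (rule snoc.IH[OF sm(1) snoc.prems(2)])
    fix js :: "'m list" assume "length js \<le> length is"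
    then show "\<bar>iter_partial js (partial_deriv i f) x\<bar> \<le> a / d / d ^ length js"
      using snoc.prems(3)[of "js @ [i]"] by (simp add: iter_partial_snoc)
  qed (use snoc.prems in auto)
  have 2: "\<bar>iter_partial is (\<lambda>x. f x * partial_deriv i g x) x\<bar> \<le> 2 ^ length is * a * (b / d) / d ^ length is"
  proof (rule snoc.IH[OF snoc.prems(1) sm(2)])
    fix js :: "'m list" assume "length js \<le> length is"
    then show "\<bar>iter_partial js (partial_deriv i g) x\<bar> \<le> b / d / d ^ length js"
      using snoc.prems(4)[of "js @ [i]"] by (simp add: iter_partial_snoc)
  qed (use snoc.prems in auto)
  have "\<bar>iter_partial (is @ [i]) (\<lambda>x. f x * g x) x\<bar> \<le> 2 ^ length is * (a / d) * b / d ^ length is + 2 ^ length is * a * (b / d) / d ^ length is"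
    unfolding eq using 1 2 by linarith
  also have "\<dots> = 2 ^ length (is @ [i]) * a * b / d ^ length (is @ [i])"
    using d by (simp add: field_simps)
  finally show ?case .
qed

text \<open>The induction rests on the identity that the derivative of 1/w is -(1/w)(1/w) times the
  derivative of \<open>w\<close>: derivatives of 1/w of order at most \<open>k\<close> control those
  of order \<open>k + 1\<close> through two applications of the product bound. The result says that
  1/w behaves like 1/\<delta> and that every derivative costs one more factor 1/\<delta>.\<close>

lemma iter_partial_inverse_bound:
  fixes w \<delta> :: "real^'m \<Rightarrow> real"
  assumes S: "open S" and w: "smooth_on S w" and \<delta>: "\<And>x. x \<in> S \<Longrightarrow> 0 < \<delta> x"
    and c1: "c1 > 0" "\<And>x. x \<in> S \<Longrightarrow> c1 * \<delta> x \<le> w x"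
    and bound: "\<And>is. \<exists>c. \<forall>x\<in>S. \<bar>iter_partial is w x\<bar> \<le> c * \<delta> x / \<delta> x ^ length is"
  shows "\<exists>C. \<forall>x\<in>S. \<forall>is. length is \<le> k \<longrightarrow>
            \<bar>iter_partial is (\<lambda>x. 1 / w x) x\<bar> \<le> C / \<delta> x / \<delta> x ^ length is"
proof (induction k)
  have w_pos: "w x > 0" if "x \<in> S" for x
    using c1(2)[OF that] \<delta>[OF that] c1(1) by (smt (verit) mult_pos_pos)
  have "\<bar>1 / w x\<bar> \<le> 1 / c1 / \<delta> x" if "x \<in> S" for x
    using that w_pos[OF that] \<delta>[OF that] c1 by (simp add: field_simps)
  then have zero: "\<exists>C. \<forall>x\<in>S. \<bar>1 / w x\<bar> \<le> C / \<delta> x" by blast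
  {
    case 0
    then show ?case using zero by simp
  next
    case (Suc k)
    then obtain C where C: "\<And>x is. x \<in> S \<Longrightarrow> length is \<le> k \<Longrightarrow>
      \<bar>iter_partial is (\<lambda>x. 1 / w x) x\<bar> \<le> C / \<delta> x / \<delta> x ^ length is" by blast
    obtain c where c: "\<And>is x. x \<in> S \<Longrightarrow> \<bar>iter_partial is w x\<bar> \<le> c is * \<delta> x / \<delta> x ^ length is"
      using bound by metis
    \<comment> \<open>There are only finitely many lists of bounded length, so the constants
      \<open>c is\<close> have a common bound.\<close>
    define B where "B = (\<Sum>is | set is \<subseteq> UNIV \<and> length is \<le> Suc k. \<bar>c is\<bar>)"
    have B: "c is \<le> B" if "length is \<le> Suc k" for "is"
      using member_le_sum[of "is" "{is. set is \<subseteq> UNIV \<and> length is \<le> Suc k}" "\<lambda>is. \<bar>c is\<bar>"] that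
      finite_lists_length_le[of "UNIV :: 'm set" "Suc k"] unfolding B_def by (force simp del: subset_UNIV)
    have sm: "smooth_on S (\<lambda>x. 1 / w x)" by (rule smooth_on_inverse[OF S w w_pos])
    obtain C0 where C0: "\<And>x. x \<in> S \<Longrightarrow> \<bar>1 / w x\<bar> \<le> C0 / \<delta> x" using zero by blast
    \<comment> \<open>\<open>C0\<close> serves the order 0. In the last entry, the inner factor 2^k
      belongs to the product of 1/w with itself and the outer one to the product with the derivative
      of \<open>w\<close>.\<close>
    define C' where "C' = max C0 (max C (2 ^ k * (2 ^ k * C * C) * B))"
    have "\<bar>iter_partial is (\<lambda>x. 1 / w x) x\<bar> \<le> C' / \<delta> x / \<delta> x ^ length is"
      if x: "x \<in> S" and len: "length is \<le> Suc k" for x "is"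
    proof (cases "is" rule: rev_cases)
      case Nil
      have "C0 / \<delta> x \<le> C' / \<delta> x" using \<delta>[OF x] by (simp add: C'_def divide_right_mono)
      then show ?thesis using C0[OF x] Nil by simp
    next
      case (snoc js i)
      have js: "length js \<le> k" using len snoc by simp
      have d: "\<delta> x > 0" by (rule \<delta>[OF x])
      have C_pos: "0 \<le> C" using C[OF x, of "[]"] d by (smt (verit) divide_neg_pos div_by_1 list.size(3) power_0 zero_le)
      have dw: "smooth_on S (\<lambda>x. - 1 * partial_deriv i w x)"
        by (intro smooth_on_mult S smooth_on_const smooth_on_partial_deriv w)
      have "iter_partial is (\<lambda>x. 1 / w x) x
          = iter_partial js (\<lambda>x. 1 / w x * (1 / w x) * (- 1 * partial_deriv i w x)) x"
        unfolding snoc iter_partial_snoc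
      proof (rule iter_partial_cong_open[OF S x])
        fix y assume y: "y \<in> S"
        have "((\<lambda>t. 1 / t) has_real_derivative - (1 / w y * (1 / w y))) (at (w y))"
          using w_pos[OF y] by (auto intro!: derivative_eq_intros simp: power2_eq_square)
        from partial_deriv_compose(2)[OF smooth_on_imp_differentiable[OF w S y] this]
        show "partial_deriv i (\<lambda>x. 1 / w x) y = 1 / w y * (1 / w y) * (- 1 * partial_deriv i w y)" by simp
      qed
      also have "\<bar>\<dots>\<bar> \<le> 2 ^ length js * (2 ^ k * (C / \<delta> x) * (C / \<delta> x)) * B / \<delta> x ^ length js"
      proof (rule iter_partial_mult_bound[OF S x smooth_on_mult[OF S sm sm] dw d])
        fix is' :: "'m list" assume l: "length is' \<le> length js"
        have "\<bar>iter_partial is' (\<lambda>x. 1 / w x * (1 / w x)) x\<bar> \<le> 2 ^ length is' * (C / \<delta> x) * (C / \<delta> x) / \<delta> x ^ length is'"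
          by (rule iter_partial_mult_bound[OF S x sm sm d]) (use C x l js in auto)
        also have "\<dots> \<le> 2 ^ k * (C / \<delta> x) * (C / \<delta> x) / \<delta> x ^ length is'"
          using d C_pos l js by (intro divide_right_mono mult_right_mono power_increasing) auto
        finally show "\<bar>iter_partial is' (\<lambda>x. 1 / w x * (1 / w x)) x\<bar> \<le> 2 ^ k * (C / \<delta> x) * (C / \<delta> x) / \<delta> x ^ length is'" .
        \<comment> \<open>The sign is pulled out of the iterated derivative by adding the function
          with the opposite sign, which gives the zero function.\<close>
        have "iter_partial is' (\<lambda>x. - 1 * partial_deriv i w x) x + iter_partial is' (partial_deriv i w) x
            = iter_partial is' (\<lambda>x. 0) x"
          using iter_partial_add[OF S x dw smooth_on_partial_deriv[OF w], of is' i] by simp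
        also have "iter_partial is' (\<lambda>x. 0) x = 0" for is'
          by (induction is' arbitrary: x) (auto simp: iter_partial_Cons partial_deriv_cong_open[OF open_UNIV, of _ "iter_partial _ _" "\<lambda>x. 0"])
        finally have "\<bar>iter_partial is' (\<lambda>x. - 1 * partial_deriv i w x) x\<bar> = \<bar>iter_partial (is' @ [i]) w x\<bar>"
          by (simp add: iter_partial_snoc)
        also have "\<dots> \<le> B * \<delta> x / \<delta> x ^ length (is' @ [i])"
          using c[OF x, of "is' @ [i]"] B[of "is' @ [i]"] l js d
          by (smt (verit, best) Suc_le_mono divide_right_mono length_append_singleton le_trans mult_right_mono zero_le_power)
        finally show "\<bar>iter_partial is' (\<lambda>x. - 1 * partial_deriv i w x) x\<bar> \<le> B / \<delta> x ^ length is'"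
          using d by simp
      qed
      also have "\<dots> = (2 ^ length js * (2 ^ k * C * C) * B) / \<delta> x / \<delta> x ^ length is"
        using snoc d by (simp add: field_simps)
      also have "\<dots> \<le> C' / \<delta> x / \<delta> x ^ length is"
      proof -
        have "0 \<le> B" by (auto simp: B_def sum_nonneg)
        then have "2 ^ length js * (2 ^ k * C * C) * B \<le> 2 ^ k * (2 ^ k * C * C) * B"
          using C_pos js by (intro mult_right_mono power_increasing) auto
        also have "\<dots> \<le> C'" by (simp add: C'_def)
        finally show ?thesis using d by (intro divide_right_mono) auto
      qed
      finally show ?thesis .
    qed
    then show ?case by blast
  }
qed

section \<open>Test functions and weak derivatives\<close>

lemma sets_lebesgue_open: "open S \<Longrightarrow> S \<in> sets lebesgue"
  by (auto intro: borel_open)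

text \<open>Bridge between two measures: norms and weak derivatives use Lebesgue measure on the
  domain, while translations and Fubini's theorem are applied to \<open>lborel\<close>. For Borel
  functions that vanish off the domain the integrals agree.\<close>

lemma lebesgue_on_integral_eq:
  fixes G :: "'a::euclidean_space \<Rightarrow> real"
  assumes "S \<in> sets lebesgue" "G \<in> borel_measurable borel" "\<And>x. x \<notin> S \<Longrightarrow> G x = 0"
  shows "(\<integral>x. G x \<partial>lebesgue_on S) = (\<integral>x. G x \<partial>lborel)"
    and "integrable (lebesgue_on S) G \<longleftrightarrow> integrable lborel G"
proof -
  have *: "(\<lambda>x. indicator S x *\<^sub>R G x) = G" using assms(3) by (auto simp: indicator_def fun_eq_iff)
  show "(\<integral>x. G x \<partial>lebesgue_on S) = (\<integral>x. G x \<partial>lborel)"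
    using integral_restrict_space[of S lebesgue G] integral_completion[of G lborel] assms * by simp
  show "integrable (lebesgue_on S) G \<longleftrightarrow> integrable lborel G"
    using integrable_restrict_space[of S lebesgue G] integrable_completion[of G lborel] assms * by simp
qed

lemma AE_lebesgue_on_iff:
  fixes S :: "'a::euclidean_space set"
  assumes "S \<in> sets lebesgue"
  shows "(AE x in lebesgue_on S. P x) \<longleftrightarrow> (AE x in lborel. x \<in> S \<longrightarrow> P x)"
  using AE_restrict_space_iff[of S lebesgue P] assms by (simp add: AE_completion_iff)

text \<open>Holds because Lebesgue measure is complete. It makes weak derivatives, which are chosen
  arbitrarily within their class, measurable as soon as one representative is.\<close>

lemma measurable_AE_cong_lebesgue_on:
  fixes f g :: "real^'m \<Rightarrow> real"
  assumes S: "S \<in> sets lebesgue" and f: "f \<in> borel_measurable (lebesgue_on S)"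
    and ae: "AE x in lebesgue_on S. f x = g x"
  shows "g \<in> borel_measurable (lebesgue_on S)"
proof -
  have "(\<lambda>x. f x * indicator S x) \<in> borel_measurable lebesgue"
    using f borel_measurable_restrict_space_iff[of S lebesgue f] S by (simp add: mult.commute)
  moreover have "AE x in lebesgue. f x * indicator S x = g x * indicator S x"
    using ae AE_restrict_space_iff[of S lebesgue] S by (auto simp: indicator_def elim: eventually_mono)
  ultimately have "(\<lambda>x. g x * indicator S x) \<in> borel_measurable lebesgue"
    by (rule borel_measurable_AE)
  then show ?thesis using borel_measurable_restrict_space_iff[of S lebesgue g] S by (simp add: mult.commute)
qed

lemma test_functionsD:
  assumes "\<phi> \<in> test_functions U"
  shows "smooth_on UNIV \<phi>" "compact (support \<phi>)" "support \<phi> \<subseteq> U"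
  using assms by (auto simp: test_functions_def)

lemma not_in_support: "x \<notin> support f \<Longrightarrow> f x = 0"
  unfolding support_def using closure_subset[of "{x. f x \<noteq> 0}"] by auto

lemma support_subset: "closed K \<Longrightarrow> (\<And>x. x \<notin> K \<Longrightarrow> f x = 0) \<Longrightarrow> support f \<subseteq> K"
  unfolding support_def by (rule closure_minimal) auto

lemma iter_partial_support:
  assumes "x \<notin> support f"
  shows "iter_partial is f x = 0"
proof -
  have "open (- support f)" by (simp add: support_def open_Compl)
  then have "iter_partial is f x = iter_partial is (\<lambda>x. 0) x"
    using assms not_in_support by (intro iter_partial_cong_open[of "- support f"]) auto
  also have "\<dots> = 0"
  proof -
    have "iter_partial is (\<lambda>x. 0) = (\<lambda>x. 0)"
      by (induction "is") (auto simp: iter_partial_Cons)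
    then show ?thesis by simp
  qed
  finally show ?thesis .
qed

text \<open>The open sets \<open>U\<close> and \<open>- K\<close> cover the whole space; on the
  second one the function is zero, so smoothness on \<open>U\<close> extends to everywhere.\<close>

lemma test_functionsI:
  assumes U: "open U" and K: "compact K" "K \<subseteq> U" and f: "smooth_on U f" "\<And>x. x \<notin> K \<Longrightarrow> f x = 0"
  shows "f \<in> test_functions U"
proof -
  have "smooth_on (- K) f"
    using smooth_on_cong[of "- K" "\<lambda>x. 0" f] smooth_on_const[of "- K" 0] K(1) f(2)
    by (simp add: compact_imp_closed open_Compl)
  then have "smooth_on (U \<union> - K) f" using smooth_on_Un U f(1) K(1) compact_imp_closed by blast
  moreover have "U \<union> - K = UNIV" using K by auto
  moreover have "support f \<subseteq> K" using K f(2) by (intro support_subset compact_imp_closed)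
  moreover then have "compact (support f)"
    using K by (metis closed_closure compact_Int_closed inf.absorb_iff2 support_def)
  ultimately show ?thesis using K by (auto simp: test_functions_def)
qed

lemma test_functions_iter_partial:
  assumes "\<phi> \<in> test_functions U"
  shows "iter_partial is \<phi> \<in> test_functions U"
proof -
  note t = test_functionsD[OF assms]
  have "support (iter_partial is \<phi>) \<subseteq> support \<phi>"
    using iter_partial_support by (intro support_subset) (auto simp: support_def)
  moreover then have "compact (support (iter_partial is \<phi>))"
    using t(2) by (metis closed_closure compact_Int_closed inf.absorb_iff2 support_def)
  ultimately show ?thesis using t smooth_on_iter_partial by (auto simp: test_functions_def)
qed

lemma test_functions_mult:
  assumes "open U" "smooth_on U f" "\<phi> \<in> test_functions U"
  shows "(\<lambda>x. if x \<in> U then f x * \<phi> x else 0) \<in> test_functions U"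
proof (rule test_functionsI[OF assms(1)])
  note t = test_functionsD[OF assms(3)]
  show "compact (support \<phi>)" "support \<phi> \<subseteq> U" using t by auto
  show "smooth_on U (\<lambda>x. if x \<in> U then f x * \<phi> x else 0)"
    using smooth_on_cong[OF assms(1), of "\<lambda>x. f x * \<phi> x" "\<lambda>x. if x \<in> U then f x * \<phi> x else 0"]
      smooth_on_mult[OF assms(1,2) smooth_on_subset[OF t(1)]] by auto
qed (use not_in_support in auto)

lemma test_functions_continuous: "\<phi> \<in> test_functions U \<Longrightarrow> continuous_on UNIV \<phi>"
  using test_functionsD smooth_on_imp_continuous_on by blast

lemma test_functions_bounded:
  assumes "\<phi> \<in> test_functions U"
  obtains B where "B > 0" "\<And>x. \<bar>\<phi> x\<bar> \<le> B"
proof -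
  have "compact (\<phi> ` support \<phi>)"
    using test_functions_continuous[OF assms] test_functionsD(2)[OF assms]
    by (intro compact_continuous_image) (auto intro: continuous_on_subset)
  then obtain B where B: "B > 0" "\<And>y. y \<in> \<phi> ` support \<phi> \<Longrightarrow> norm y \<le> B"
    using compact_imp_bounded bounded_pos by metis
  then have "\<bar>\<phi> x\<bar> \<le> B" for x
    by (cases "x \<in> support \<phi>") (auto simp: not_in_support)
  then show ?thesis using that B(1) by blast
qed

lemma test_functions_integrable:
  assumes "\<phi> \<in> test_functions U"
  shows "integrable lborel \<phi>"
proof -
  have "integrable lborel (\<lambda>x. indicator (support \<phi>) x *\<^sub>R \<phi> x)"
    using test_functionsD(2)[OF assms] test_functions_continuous[OF assms]
    by (intro borel_integrable_compact) (auto intro: continuous_on_subset)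
  moreover have "(\<lambda>x. indicator (support \<phi>) x *\<^sub>R \<phi> x) = \<phi>"
    by (auto simp: fun_eq_iff indicator_def not_in_support)
  ultimately show ?thesis by simp
qed

section \<open>Translation invariance and integration by parts\<close>

lemma integral_translate:
  fixes f :: "'a::euclidean_space \<Rightarrow> real"
  assumes "f \<in> borel_measurable borel"
  shows "(\<integral>x. f (x + c) \<partial>lborel) = (\<integral>x. f x \<partial>lborel)"
proof -
  have "(\<integral>x. f x \<partial>lborel) = (\<integral>x. f x \<partial>distr lborel borel ((+) c))" by (simp add: lborel_distr_plus)
  also have "\<dots> = (\<integral>x. f (c + x) \<partial>lborel)" using assms by (intro integral_distr) auto
  finally show ?thesis by (simp add: add.commute)
qed

lemma nn_integral_translate:
  fixes f :: "'a::euclidean_space \<Rightarrow> ennreal"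
  assumes "f \<in> borel_measurable borel"
  shows "(\<integral>\<^sup>+x. f (x + c) \<partial>lborel) = (\<integral>\<^sup>+x. f x \<partial>lborel)"
proof -
  have "(\<integral>\<^sup>+x. f x \<partial>lborel) = (\<integral>\<^sup>+x. f x \<partial>distr lborel borel ((+) c))" by (simp add: lborel_distr_plus)
  also have "\<dots> = (\<integral>\<^sup>+x. f (c + x) \<partial>lborel)" using assms by (intro nn_integral_distr) auto
  finally show ?thesis by (simp add: add.commute)
qed

text \<open>The difference quotients of \<open>\<phi>\<close> have vanishing integral, by translation invariance.\<close>

lemma integral_partial_deriv_test:
  fixes \<phi> :: "real^'m \<Rightarrow> real"
  assumes \<phi>: "\<phi> \<in> test_functions U"
  shows "(\<integral>x. partial_deriv i \<phi> x \<partial>lborel) = 0"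
proof -
  let ?e = "axis i (1::real)" and ?h = "\<lambda>k::nat. 1 / real (Suc k)"
  let ?F = "\<lambda>k x. (\<phi> (x + ?h k *\<^sub>R ?e) - \<phi> x) / ?h k"
  note t = test_functionsD[OF \<phi>]
  have D: "partial_deriv i \<phi> \<in> test_functions U"
    using test_functions_iter_partial[OF \<phi>, of "[i]"] by (simp add: iter_partial_Cons)
  obtain B where B: "B > 0" "\<And>x. \<bar>partial_deriv i \<phi> x\<bar> \<le> B" using test_functions_bounded[OF D] by metis
  have [measurable]: "\<phi> \<in> borel_measurable borel" "partial_deriv i \<phi> \<in> borel_measurable borel"
    using test_functions_continuous[OF \<phi>] test_functions_continuous[OF D]
    by (auto intro: borel_measurable_continuous_onI)
  \<comment> \<open>All steps \<open>?h k\<close> are at most 1, so every difference quotient is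
    supported in the ball of radius r + 1. Together with the bound \<open>B\<close> from the mean
    value theorem this gives an integrable majorant.\<close>
  obtain r where r: "\<And>x. x \<in> support \<phi> \<Longrightarrow> norm x \<le> r"
    using compact_imp_bounded[OF t(2)] bounded_iff by metis
  have diff: "\<phi> differentiable at x" for x
    using smooth_on_imp_differentiable[OF t(1)] by auto
  have quot: "\<bar>?F k x\<bar> \<le> B" for k x
  proof -
    have "\<exists>z>0. z < ?h k \<and> \<phi> (x + ?h k *\<^sub>R ?e) - \<phi> (x + 0 *\<^sub>R ?e)
        = (?h k - 0) * partial_deriv i \<phi> (x + z *\<^sub>R ?e)"
      by (rule MVT2) (auto intro!: DERIV_along_axis diff)
    then obtain z where "\<phi> (x + ?h k *\<^sub>R ?e) - \<phi> x = ?h k * partial_deriv i \<phi> (x + z *\<^sub>R ?e)" by auto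
    then have "?F k x = partial_deriv i \<phi> (x + z *\<^sub>R ?e)" by (simp add: divide_simps)
    then show ?thesis using B(2) by simp
  qed
  have bnd: "norm (?F k x) \<le> B * indicator (cball 0 (r + 1)) x" for k x
  proof (cases "x \<in> cball 0 (r + 1)")
    case False
    then have x: "norm x > r + 1" by simp
    then have "x \<notin> support \<phi>" using r[of x] by auto
    moreover have "x + ?h k *\<^sub>R ?e \<notin> support \<phi>"
    proof
      assume "x + ?h k *\<^sub>R ?e \<in> support \<phi>"
      then have "norm (x + ?h k *\<^sub>R ?e) \<le> r" by (rule r)
      moreover have "norm x \<le> norm (x + ?h k *\<^sub>R ?e) + norm (?h k *\<^sub>R ?e)"
        using norm_triangle_ineq4[of "x + ?h k *\<^sub>R ?e" "?h k *\<^sub>R ?e"] by simp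
      moreover have "norm (?h k *\<^sub>R ?e) \<le> 1" by simp
      ultimately show False using x by linarith
    qed
    ultimately show ?thesis using False by (simp add: not_in_support)
  qed (use quot in simp)
  have lim: "(\<lambda>k. ?F k x) \<longlonglongrightarrow> partial_deriv i \<phi> x" for x
  proof -
    have "((\<lambda>t. \<phi> (x + t *\<^sub>R ?e)) has_real_derivative partial_deriv i \<phi> (x + 0 *\<^sub>R ?e)) (at 0)"
      by (rule DERIV_along_axis) (simp add: diff)
    then have "((\<lambda>h. (\<phi> (x + h *\<^sub>R ?e) - \<phi> x) / h) \<longlongrightarrow> partial_deriv i \<phi> x) (at 0)"
      by (simp add: DERIV_def)
    moreover have "filterlim ?h (at 0) sequentially"
      unfolding filterlim_at using LIMSEQ_inverse_real_of_nat by (simp add: inverse_eq_divide)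
    ultimately show ?thesis by (rule filterlim_compose)
  qed
  have "(\<lambda>k. \<integral>x. ?F k x \<partial>lborel) \<longlonglongrightarrow> (\<integral>x. partial_deriv i \<phi> x \<partial>lborel)"
    by (rule integral_dominated_convergence[where w = "\<lambda>x. B * indicator (cball 0 (r + 1)) x"])
       (use lim bnd in \<open>auto intro!: integrable_mult_right integrable_real_indicator emeasure_bounded_finite\<close>)
  moreover have "(\<integral>x. ?F k x \<partial>lborel) = 0" for k
  proof -
    have i1: "integrable lborel \<phi>" by (rule test_functions_integrable[OF \<phi>])
    have "integrable lborel (\<lambda>x. \<phi> (x + ?h k *\<^sub>R ?e))"
      using integrable_distr[of "(+) (?h k *\<^sub>R ?e)" lborel borel \<phi>] i1
      by (simp add: lborel_distr_plus add.commute)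
    then show ?thesis using i1 integral_translate[of \<phi> "?h k *\<^sub>R ?e"] by simp
  qed
  ultimately show ?thesis by (simp only: LIMSEQ_const_iff)
qed

lemma borel_measurable_test: "\<phi> \<in> test_functions U \<Longrightarrow> \<phi> \<in> borel_measurable borel"
  using test_functions_continuous by (auto intro: borel_measurable_continuous_onI)

text \<open>The product vanishes off the compact support of the test function, where local
  integrability of \<open>u\<close> and the boundedness of \<phi> give integrability.\<close>

lemma integrable_test_mult:
  assumes U: "open U" and u: "locally_integrable U u" and \<phi>: "\<phi> \<in> test_functions U"
  shows "integrable (lebesgue_on U) (\<lambda>x. u x * \<phi> x)"
proof -
  let ?K = "support \<phi>"
  note t = test_functionsD[OF \<phi>]
  have K: "?K \<in> sets lebesgue" "U \<in> sets lebesgue"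
    using U by (auto simp: support_def sets_lebesgue_open)
  obtain B where B: "\<And>x. \<bar>\<phi> x\<bar> \<le> B" using test_functions_bounded[OF \<phi>] by metis
  have "integrable (lebesgue_on ?K) u" using u t by (auto simp: locally_integrable_def)
  then have "integrable (lebesgue_on ?K) (\<lambda>x. \<phi> x * u x)"
  proof (rule Bochner_Integration.integrable_bound[OF integrable_mult_right[of B]])
    show "(\<lambda>x. \<phi> x * u x) \<in> borel_measurable (lebesgue_on ?K)"
    proof (rule borel_measurable_times)
      show "\<phi> \<in> borel_measurable (lebesgue_on ?K)"
        by (intro measurable_restrict_space1 measurable_completion) (simp add: borel_measurable_test[OF \<phi>])
    qed (rule borel_measurable_integrable[OF \<open>integrable (lebesgue_on ?K) u\<close>])
    show "AE x in lebesgue_on ?K. norm (\<phi> x * u x) \<le> norm (B * u x)"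
      using B by (intro AE_I2) (simp add: abs_mult mult_right_mono order_trans[OF B])
  qed
  moreover have "(\<lambda>x. indicator ?K x *\<^sub>R (\<phi> x * u x)) = (\<lambda>x. indicator U x *\<^sub>R (u x * \<phi> x))"
    using t(3) by (auto simp: fun_eq_iff indicator_def not_in_support)
  ultimately show ?thesis
    using integrable_restrict_space[of ?K lebesgue "\<lambda>x. \<phi> x * u x"]
      integrable_restrict_space[of U lebesgue "\<lambda>x. u x * \<phi> x"] K by simp
qed

lemma locally_integrable_continuous:
  fixes u :: "real^'m \<Rightarrow> real"
  assumes "continuous_on U u"
  shows "locally_integrable U u"
  unfolding locally_integrable_def
proof safe
  fix S assume S: "compact S" "S \<subseteq> U"
  then have i: "integrable lborel (\<lambda>x. indicator S x *\<^sub>R u x)"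
    using assms by (intro borel_integrable_compact) (auto intro: continuous_on_subset)
  then have "integrable lebesgue (\<lambda>x. indicator S x *\<^sub>R u x)"
    using integrable_completion[of "\<lambda>x. indicator S x *\<^sub>R u x" lborel] by auto
  moreover have "S \<in> sets lebesgue" using compact_imp_closed[OF S(1)] by (simp add: borel_closed)
  ultimately show "integrable (lebesgue_on S) u" by (subst integrable_restrict_space) auto
qed

text \<open>The product of \<open>u\<close> and \<phi>, extended by zero, is itself a test function,
  so the integral of its partial derivative vanishes; Leibniz's rule then separates the two
  terms.\<close>

lemma integration_by_parts_test:
  fixes u :: "real^'m \<Rightarrow> real"
  assumes U: "open U" and u: "smooth_on U u" and \<phi>: "\<phi> \<in> test_functions U"
  shows "(\<integral>x. u x * partial_deriv i \<phi> x \<partial>lebesgue_on U) = - (\<integral>x. partial_deriv i u x * \<phi> x \<partial>lebesgue_on U)"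
proof -
  let ?f = "\<lambda>x. if x \<in> U then u x * \<phi> x else 0"
  have f: "?f \<in> test_functions U" by (rule test_functions_mult[OF U u \<phi>])
  have Df: "partial_deriv i ?f \<in> test_functions U" and D\<phi>: "partial_deriv i \<phi> \<in> test_functions U"
    using test_functions_iter_partial[OF f, of "[i]"] test_functions_iter_partial[OF \<phi>, of "[i]"]
    by (auto simp: iter_partial_Cons)
  have *: "partial_deriv i ?f x = partial_deriv i u x * \<phi> x + u x * partial_deriv i \<phi> x" if "x \<in> U" for x
  proof -
    have "partial_deriv i ?f x = partial_deriv i (\<lambda>x. u x * \<phi> x) x"
      by (rule partial_deriv_cong_open[OF U that]) auto
    then show ?thesis
      using that u test_functionsD(1)[OF \<phi>] U
      by (simp add: partial_deriv_mult smooth_on_imp_differentiable)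
  qed
  have "0 = (\<integral>x. partial_deriv i ?f x \<partial>lborel)" using integral_partial_deriv_test[OF f] by simp
  also have "\<dots> = (\<integral>x. partial_deriv i ?f x \<partial>lebesgue_on U)"
  proof (rule lebesgue_on_integral_eq(1)[symmetric])
    show "partial_deriv i ?f x = 0" if "x \<notin> U" for x
      using not_in_support[of x] test_functionsD(3)[OF Df] that by blast
  qed (use U borel_measurable_test[OF Df] in \<open>auto simp: sets_lebesgue_open\<close>)
  also have "\<dots> = (\<integral>x. partial_deriv i u x * \<phi> x + u x * partial_deriv i \<phi> x \<partial>lebesgue_on U)"
    by (rule Bochner_Integration.integral_cong) (auto simp: *)
  also have "\<dots> = (\<integral>x. partial_deriv i u x * \<phi> x \<partial>lebesgue_on U) + (\<integral>x. u x * partial_deriv i \<phi> x \<partial>lebesgue_on U)"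
    by (intro Bochner_Integration.integral_add integrable_test_mult U \<phi> D\<phi> locally_integrable_continuous
        smooth_on_imp_continuous_on smooth_on_partial_deriv u)
  finally show ?thesis by simp
qed

text \<open>The outermost derivative of the test function is moved first and becomes the innermost
  one on \<open>u\<close>, hence the reversed list. By the symmetry of derivatives the reversal is
  harmless on smooth functions.\<close>

lemma integration_by_parts_iter:
  fixes u :: "real^'m \<Rightarrow> real"
  assumes U: "open U" and u: "smooth_on U u" and \<phi>: "\<phi> \<in> test_functions U"
  shows "(\<integral>x. u x * iter_partial is \<phi> x \<partial>lebesgue_on U)
    = (-1) ^ length is * (\<integral>x. iter_partial (rev is) u x * \<phi> x \<partial>lebesgue_on U)"
  using u
proof (induction "is" arbitrary: u)
  case (Cons i "is")
  show ?case
    using integration_by_parts_test[OF U Cons.prems test_functions_iter_partial[OF \<phi>], of i "is"]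
      Cons.IH[OF smooth_on_partial_deriv[OF Cons.prems]]
    by (simp add: iter_partial_Cons iter_partial_snoc)
qed simp

lemma has_weak_deriv_smooth:
  fixes u :: "real^'m \<Rightarrow> real"
  assumes U: "open U" and u: "smooth_on U u"
  shows "has_weak_deriv U \<beta> u (mi_deriv \<beta> u)"
proof -
  obtain "is" where l: "\<And>i. count_list is i = \<beta> $ i" "length is = mi_order \<beta>" "mi_deriv \<beta> = iter_partial is"
    by (rule mi_deriv_list[of \<beta>]) (blast)
  have "(\<integral>x. u x * mi_deriv \<beta> \<phi> x \<partial>lebesgue_on U)
      = (-1) ^ mi_order \<beta> * (\<integral>x. mi_deriv \<beta> u x * \<phi> x \<partial>lebesgue_on U)"
    if \<phi>: "\<phi> \<in> test_functions U" for \<phi>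
  proof -
    have "(\<integral>x. iter_partial (rev is) u x * \<phi> x \<partial>lebesgue_on U) = (\<integral>x. iter_partial is u x * \<phi> x \<partial>lebesgue_on U)"
      by (rule Bochner_Integration.integral_cong) (auto simp: iter_partial_permute[OF U u, of "rev is" "is"])
    then show ?thesis using integration_by_parts_iter[OF U u \<phi>, of "is"] l by simp
  qed
  then show ?thesis unfolding has_weak_deriv_def
    using u by (auto intro!: locally_integrable_continuous smooth_on_imp_continuous_on
        smooth_on_iter_partial simp: l(3))
qed

lemma has_weak_deriv_diff:
  assumes U: "open U" and u: "has_weak_deriv U \<beta> u1 g1" "has_weak_deriv U \<beta> u2 g2"
  shows "has_weak_deriv U \<beta> (\<lambda>x. u1 x - u2 x) (\<lambda>x. g1 x - g2 x)"
  unfolding has_weak_deriv_def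
proof (intro conjI ballI)
  fix \<phi> assume \<phi>: "\<phi> \<in> test_functions U"
  obtain "is" where l: "mi_deriv \<beta> = iter_partial is" by (rule mi_deriv_list[of \<beta>]) (blast)
  have "mi_deriv \<beta> \<phi> \<in> test_functions U" using test_functions_iter_partial[OF \<phi>] l by simp
  then have "integrable (lebesgue_on U) (\<lambda>x. u1 x * mi_deriv \<beta> \<phi> x)" "integrable (lebesgue_on U) (\<lambda>x. u2 x * mi_deriv \<beta> \<phi> x)"
    "integrable (lebesgue_on U) (\<lambda>x. g1 x * \<phi> x)" "integrable (lebesgue_on U) (\<lambda>x. g2 x * \<phi> x)"
    using u \<phi> U by (auto intro: integrable_test_mult simp: has_weak_deriv_def)
  then show "(\<integral>x. (u1 x - u2 x) * mi_deriv \<beta> \<phi> x \<partial>lebesgue_on U)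
      = (-1) ^ mi_order \<beta> * (\<integral>x. (g1 x - g2 x) * \<phi> x \<partial>lebesgue_on U)"
    using u \<phi> by (simp add: has_weak_deriv_def left_diff_distrib right_diff_distrib)
qed (use u in \<open>auto simp: has_weak_deriv_def locally_integrable_def\<close>)

section \<open>Bump functions\<close>

text \<open>The derivative of q(1/t) exp(-1/t) is (1/t)^2 (q - q')(1/t) exp(-1/t); the recursion
  records the polynomial in this formula.\<close>

primrec bump_poly :: "nat \<Rightarrow> real poly" where
  "bump_poly 0 = 1"
| "bump_poly (Suc k) = [:0, 0, 1:] * (bump_poly k - pderiv (bump_poly k))"

text \<open>The \<open>k\<close>-th derivative of the smooth function \<open>exp (- 1 / t)\<close>, extended by zero to \<open>t \<le> 0\<close>.\<close>

definition exp_bump :: "nat \<Rightarrow> real \<Rightarrow> real" where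
  "exp_bump k t = (if t > 0 then poly (bump_poly k) (1 / t) * exp (- (1 / t)) else 0)"

lemma poly_exp_tendsto_0: "((\<lambda>s::real. poly q s * exp (- s)) \<longlongrightarrow> 0) at_top"
proof -
  have "((\<lambda>s::real. \<Sum>i\<le>degree q. coeff q i * (s ^ i / exp s)) \<longlongrightarrow> (\<Sum>i\<le>degree q. coeff q i * 0)) at_top"
    by (intro tendsto_intros tendsto_power_div_exp_0)
  then show ?thesis by (simp add: poly_altdef exp_minus sum_distrib_right divide_inverse mult.assoc)
qed

lemma poly_exp_inverse_tendsto_0:
  "((\<lambda>t::real. poly q (1 / t) * exp (- (1 / t))) \<longlongrightarrow> 0) (at_right 0)"
  using filterlim_compose[OF poly_exp_tendsto_0 filterlim_inverse_at_top_right, of q]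
  by (simp add: inverse_eq_divide)

text \<open>At 0 the difference quotient from the right is again a polynomial in 1/t times
  exp(-1/t), with one more factor 1/t, and therefore tends to 0.\<close>

lemma DERIV_exp_bump: "(exp_bump k has_real_derivative exp_bump (Suc k) t) (at t)"
proof (cases t "0::real" rule: linorder_cases)
  case less
  have "((\<lambda>t. 0) has_real_derivative 0) (at t)" by simp
  then have "(exp_bump k has_real_derivative 0) (at t)"
    by (rule has_field_derivative_transform_within_open[where S = "{..<0}"])
       (use less in \<open>auto simp: exp_bump_def\<close>)
  then show ?thesis using less by (simp add: exp_bump_def)
next
  case greater
  have "((\<lambda>t. poly (bump_poly k) (1 / t) * exp (- (1 / t))) has_real_derivative exp_bump (Suc k) t) (at t)"
    using greater
    by (auto intro!: derivative_eq_intros DERIV_chain2[OF poly_DERIV]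
        simp: exp_bump_def power2_eq_square field_simps)
  then show ?thesis
    by (rule has_field_derivative_transform_within_open[where S = "{0<..}"])
       (use greater in \<open>auto simp: exp_bump_def\<close>)
next
  case equal
  have "((\<lambda>h. exp_bump k h / h) \<longlongrightarrow> 0) (at_left 0)"
    by (rule tendsto_eventually) (auto simp: exp_bump_def eventually_at_left_field intro!: exI[of _ "-1"])
  moreover have "((\<lambda>h. exp_bump k h / h) \<longlongrightarrow> 0) (at_right 0)"
    by (rule Lim_transform_eventually[OF poly_exp_inverse_tendsto_0[of "[:0, 1:] * bump_poly k"]])
       (auto simp: exp_bump_def eventually_at_right_field intro!: exI[of _ 1])
  ultimately have "((\<lambda>h. exp_bump k h / h) \<longlongrightarrow> 0) (at 0)" by (rule filterlim_split_at)
  then show ?thesis using equal by (simp add: DERIV_def exp_bump_def)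
qed

lemma exp_bump_0_bounds: "0 \<le> exp_bump 0 t" "exp_bump 0 t \<le> 1"
  by (auto simp: exp_bump_def)

lemma smooth_on_exp_bump:
  assumes "open S" "smooth_on S f"
  shows "smooth_on S (\<lambda>x. exp_bump 0 (f x))"
  using smooth_on_compose[OF assms, of UNIV exp_bump] DERIV_exp_bump by auto

lemma exp_bump_scaled_tendsto:
  "(\<lambda>N. exp_bump 0 (real (Suc N) * t)) \<longlonglongrightarrow> (if t > 0 then 1 else 0)"
proof (cases "t > 0")
  case True
  have "(\<lambda>N. exp (- (inverse t * inverse (real (Suc N))))) \<longlonglongrightarrow> exp (- (inverse t * 0))"
    by (intro tendsto_intros LIMSEQ_inverse_real_of_nat)
  moreover have "exp (- (inverse t * inverse (real (Suc N)))) = exp_bump 0 (real (Suc N) * t)" for N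
    using True by (simp add: exp_bump_def divide_inverse mult.commute)
  ultimately show ?thesis using True by simp
next
  case False
  then have "exp_bump 0 (real (Suc N) * t) = 0" for N
    by (auto simp: exp_bump_def zero_less_mult_iff)
  then show ?thesis using False by simp
qed

text \<open>Smooth functions between 0 and 1 which increase their slope with \<open>N\<close> and
  converge pointwise to the indicator of the open box. They turn statements about test functions
  into statements about boxes by dominated convergence.\<close>

definition box_bump :: "real^'m \<Rightarrow> real^'m \<Rightarrow> nat \<Rightarrow> real^'m \<Rightarrow> real" where
  "box_bump a b N x = (\<Prod>i\<in>UNIV. exp_bump 0 (real (Suc N) * (x $ i - a $ i)) * exp_bump 0 (real (Suc N) * (b $ i - x $ i)))"

lemma smooth_box_bump: "smooth_on UNIV (box_bump a b N)"
  unfolding box_bump_def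
  by (intro smooth_on_prod smooth_on_mult smooth_on_exp_bump smooth_on_diff smooth_on_const
      smooth_on_component open_UNIV)

lemma box_bump_bounds: "0 \<le> box_bump a b N x" "box_bump a b N x \<le> 1"
  unfolding box_bump_def
  by (auto intro!: prod_nonneg prod_le_1 mult_nonneg_nonneg mult_le_one exp_bump_0_bounds)

lemma box_bump_outside: "x \<notin> box a b \<Longrightarrow> box_bump a b N x = 0"
  by (force simp: box_bump_def mem_box_cart exp_bump_def zero_less_mult_iff)

lemma box_bump_tendsto: "(\<lambda>N. box_bump a b N x) \<longlonglongrightarrow> indicator (box a b) x"
proof -
  have "(\<lambda>N. box_bump a b N x) \<longlonglongrightarrow> (\<Prod>i\<in>UNIV. (if x $ i - a $ i > 0 then 1 else 0) * (if b $ i - x $ i > 0 then 1 else 0))"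
    unfolding box_bump_def by (intro tendsto_intros exp_bump_scaled_tendsto)
  moreover have "(\<Prod>i\<in>UNIV. (if x $ i - a $ i > 0 then 1 else 0) * (if b $ i - x $ i > 0 then 1 else (0::real))) = indicator (box a b) x"
    by (force simp: mem_box_cart indicator_def)
  ultimately show ?thesis by simp
qed

text \<open>Open boxes form an intersection-stable generator of the Borel sets, so the integral over
  every Borel set vanishes, in particular over the sets where \<open>G\<close> is positive or
  negative.\<close>

lemma AE_zero_if_box_integrals_zero:
  fixes G :: "'a::euclidean_space \<Rightarrow> real"
  assumes G: "integrable lborel G" and box: "\<And>a b. (\<integral>x. indicator (box a b) x *\<^sub>R G x \<partial>lborel) = 0"
  shows "AE x in lborel. G x = 0"
proof -
  have [measurable]: "G \<in> borel_measurable borel" using G by auto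
  have int: "integrable lborel (\<lambda>x. indicator A x *\<^sub>R G x)" if "A \<in> sets borel" for A
    using that by (intro integrable_mult_indicator[OF _ G]) auto
  \<comment> \<open>Complements in the Dynkin argument need the integral over the whole space, which
    is not a box; it is exhausted by growing cubes.\<close>
  have total: "(\<integral>x. G x \<partial>lborel) = 0"
  proof -
    have "(\<lambda>n::nat. \<integral>x. indicator (box (- real n *\<^sub>R One) (real n *\<^sub>R One)) x *\<^sub>R G x \<partial>lborel) \<longlonglongrightarrow> (\<integral>x. G x \<partial>lborel)"
    proof (rule integral_dominated_convergence[where w = "\<lambda>x. \<bar>G x\<bar>"])
      show "AE x in lborel. (\<lambda>n::nat. indicator (box (- real n *\<^sub>R One) (real n *\<^sub>R One)) x *\<^sub>R G x) \<longlonglongrightarrow> G x"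
      proof (rule AE_I2)
        fix x :: 'a
        obtain n0 where n0: "norm x < real n0" using reals_Archimedean2 by blast
        have "x \<in> box (- real n *\<^sub>R One) (real n *\<^sub>R One)" if "n \<ge> n0" for n
          using that n0 Basis_le_norm[of _ x] by (fastforce simp: mem_box abs_less_iff)
        then show "(\<lambda>n::nat. indicator (box (- real n *\<^sub>R One) (real n *\<^sub>R One)) x *\<^sub>R G x) \<longlonglongrightarrow> G x"
          by (intro tendsto_eventually) (auto simp: eventually_sequentially intro!: exI[of _ n0])
      qed
    qed (use G in \<open>auto simp: indicator_def\<close>)
    then show ?thesis by (simp only: box LIMSEQ_const_iff)
  qed
  have zero: "set_lebesgue_integral lborel A G = 0" if "A \<in> sets borel" for A
  proof -
    have "Int_stable (range (\<lambda>(a, b). box a b :: 'a set))"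
      by (auto simp: Int_stable_def box_Int_box)
    moreover have "range (\<lambda>(a, b). box a b :: 'a set) \<subseteq> Pow UNIV" by simp
    moreover have "A \<in> sigma_sets UNIV (range (\<lambda>(a, b). box a b :: 'a set))"
      using that by (simp add: borel_eq_box)
    ultimately show ?thesis
    proof (induction rule: sigma_sets_induct_disjoint)
      case (basic A)
      then show ?case using box by (auto simp: set_lebesgue_integral_def)
    next
      case empty
      then show ?case by (simp add: set_lebesgue_integral_def)
    next
      case (compl A)
      then have A: "A \<in> sets borel" by (simp add: borel_eq_box)
      have "(\<lambda>x. indicator (UNIV - A) x *\<^sub>R G x) = (\<lambda>x. G x - indicator A x *\<^sub>R G x)"
        by (auto simp: indicator_def fun_eq_iff)
      then show ?case using compl total G int[OF A] by (simp add: set_lebesgue_integral_def)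
    next
      case (union A)
      then have A: "A i \<in> sets borel" for i by (auto simp: borel_eq_box)
      have "set_lebesgue_integral lborel (\<Union>i. A i) G = (\<Sum>i. set_lebesgue_integral lborel (A i) G)"
        by (rule lebesgue_integral_countable_add)
           (use A union int in \<open>auto simp: set_integrable_def disjoint_family_on_def\<close>)
      then show ?case using union by simp
    qed
  qed
  have "AE x in lborel. indicator {x. G x > 0} x *\<^sub>R G x = 0"
    using zero[of "{x. G x > 0}"] int[of "{x. G x > 0}"] unfolding set_lebesgue_integral_def
    by (subst integral_nonneg_eq_0_iff_AE[symmetric]) (auto simp: indicator_def)
  moreover have "AE x in lborel. - (indicator {x. G x < 0} x *\<^sub>R G x) = 0"
    using zero[of "{x. G x < 0}"] int[of "{x. G x < 0}"] unfolding set_lebesgue_integral_def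
    by (subst integral_nonneg_eq_0_iff_AE[symmetric]) (auto simp: indicator_def)
  ultimately show ?thesis
    by eventually_elim (auto simp: indicator_def split: if_splits)
qed

lemma box_bump_test_function:
  assumes "open U" "cbox a b \<subseteq> U"
  shows "box_bump a b N \<in> test_functions U"
proof (rule test_functionsI[OF assms(1) compact_cbox assms(2)])
  show "smooth_on U (box_bump a b N)" using smooth_on_subset[OF smooth_box_bump] by blast
  show "box_bump a b N x = 0" if "x \<notin> cbox a b" for x
    using that box_subset_cbox[of a b] by (intro box_bump_outside) auto
qed

text \<open>The fundamental lemma of the calculus of variations. Inside a closed box contained in
  \<open>U\<close> the integral over any smaller box is a limit of integrals against
  \<open>box_bump\<close>, hence zero; countably many such closed boxes cover
  \<open>U\<close>.\<close>

lemma AE_zero_if_test_integrals_zero: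
  fixes g :: "real^'m \<Rightarrow> real"
  assumes U: "open U" and g: "locally_integrable U g"
    and test: "\<And>\<phi>. \<phi> \<in> test_functions U \<Longrightarrow> (\<integral>x. g x * \<phi> x \<partial>lebesgue_on U) = 0"
  shows "AE x in lebesgue_on U. g x = 0"
proof -
  have Ul: "U \<in> sets lebesgue" by (rule sets_lebesgue_open[OF U])
  have cbox: "AE x in lborel. x \<in> cbox c d \<longrightarrow> g x = 0" if cd: "cbox c d \<subseteq> U" for c d
  proof -
    define g' where "g' x = indicator (cbox c d) x *\<^sub>R g x" for x
    have "integrable (lebesgue_on (cbox c d)) g"
      using g cd by (auto simp: locally_integrable_def)
    then have g': "integrable lebesgue g'"
      unfolding g'_def by (subst (asm) integrable_restrict_space) auto
    \<comment> \<open>\<open>g'\<close> is only Lebesgue measurable, whereas the criterion with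
      boxes speaks about integrability with respect to \<open>lborel\<close>.\<close>
    obtain G where [measurable]: "G \<in> borel_measurable lborel" and Gg: "AE x in lborel. g' x = G x"
      using completion_ex_borel_measurable_real[OF borel_measurable_integrable[OF g']] by blast
    have AEG: "AE x in lebesgue. g' x = G x" using Gg by (simp add: AE_completion_iff)
    have [measurable]: "G \<in> borel_measurable lebesgue" by (rule measurable_completion) simp
    have [measurable]: "g' \<in> borel_measurable lebesgue" using g' by auto
    have "integrable lebesgue G"
      using g' AEG integrable_cong_AE[of g' lebesgue G] by simp
    then have G: "integrable lborel G" by (simp add: integrable_completion)
    have "(\<integral>x. indicator (box a b) x *\<^sub>R G x \<partial>lborel) = 0" for a b
    proof -
      \<comment> \<open>The corners of the intersection of both boxes. It may be empty; the open box
        with these corners is then empty as well.\<close>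
      define a' b' where "a' = (\<chi> i. max (a $ i) (c $ i))" and "b' = (\<chi> i. min (b $ i) (d $ i))"
      have [measurable]: "box p q \<in> sets lebesgue" for p q :: "real^'m" by (simp add: borel_open)
      have bb: "box a b \<inter> box c d = box a' b'"
        by (auto simp: a'_def b'_def mem_box_cart)
      have sub: "cbox a' b' \<subseteq> cbox c d" by (auto simp: a'_def b'_def mem_box_cart)
      \<comment> \<open>The faces are negligible, so the closed box may be replaced by its interior,
        where intersections with open boxes are open boxes again.\<close>
      have "cbox c d - box c d \<in> null_sets lebesgue"
        using negligible_frontier_interval[of c d] by (simp add: negligible_iff_null_sets)
      then have "AE x in lebesgue. x \<notin> cbox c d - box c d" by (rule AE_not_in)
      with AEG have eq: "AE x in lebesgue. indicator (box a b) x *\<^sub>R G x = indicator (box a' b') x *\<^sub>R g' x"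
      proof eventually_elim
        case (elim x)
        show ?case
        proof (cases "x \<in> box c d")
          case True
          then show ?thesis using elim bb by (auto simp: indicator_def)
        next
          case False
          then have "G x = 0" "x \<notin> box a' b'" using elim bb by (auto simp: g'_def)
          then show ?thesis by simp
        qed
      qed
      have "(\<integral>x. indicator (box a b) x *\<^sub>R G x \<partial>lborel) = (\<integral>x. indicator (box a b) x *\<^sub>R G x \<partial>lebesgue)"
        by (rule integral_completion[symmetric]) simp
      also have "\<dots> = (\<integral>x. indicator (box a' b') x *\<^sub>R g' x \<partial>lebesgue)"
        by (rule integral_cong_AE) (use eq in simp_all)
      also have "\<dots> = 0"
      proof -
        have "(\<lambda>N. \<integral>x. box_bump a' b' N x *\<^sub>R g' x \<partial>lebesgue) \<longlonglongrightarrow> (\<integral>x. indicator (box a' b') x *\<^sub>R g' x \<partial>lebesgue)"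
        proof (rule integral_dominated_convergence[where w = "\<lambda>x. \<bar>g' x\<bar>"])
          have "box_bump a' b' N \<in> borel_measurable lebesgue" for N
            by (rule measurable_completion)
               (simp add: borel_measurable_test[OF box_bump_test_function[OF open_UNIV, of a' b']])
          then show "(\<lambda>x. box_bump a' b' N x *\<^sub>R g' x) \<in> borel_measurable lebesgue" for N by simp
          show "AE x in lebesgue. (\<lambda>N. box_bump a' b' N x *\<^sub>R g' x) \<longlonglongrightarrow> indicator (box a' b') x *\<^sub>R g' x"
            by (intro AE_I2 tendsto_scaleR box_bump_tendsto tendsto_const)
          show "AE x in lebesgue. norm (box_bump a' b' N x *\<^sub>R g' x) \<le> \<bar>g' x\<bar>" for N
            using box_bump_bounds[of a' b' N] by (intro AE_I2) (simp add: abs_mult mult_left_le_one_le)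
        qed (use g' in simp_all)
        moreover have "(\<integral>x. box_bump a' b' N x *\<^sub>R g' x \<partial>lebesgue) = 0" for N
        proof -
          have "(\<lambda>x. box_bump a' b' N x *\<^sub>R g' x) = (\<lambda>x. indicator U x *\<^sub>R (g x * box_bump a' b' N x))"
          proof
            fix x
            show "box_bump a' b' N x *\<^sub>R g' x = indicator U x *\<^sub>R (g x * box_bump a' b' N x)"
            proof (cases "x \<in> cbox c d")
              case True
              then show ?thesis using cd by (auto simp: g'_def)
            next
              case False
              then have "x \<notin> box a' b'" using sub box_subset_cbox[of a' b'] by blast
              then show ?thesis by (simp add: box_bump_outside)
            qed
          qed
          then show ?thesis
            using test[OF box_bump_test_function[OF U, of a' b' N]] sub cd Ul
              integral_restrict_space[of U lebesgue "\<lambda>x. g x * box_bump a' b' N x"] by simp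
        qed
        ultimately show ?thesis by (simp only: LIMSEQ_const_iff)
      qed
      finally show ?thesis .
    qed
    from AE_zero_if_box_integrals_zero[OF G this] Gg show ?thesis
      by eventually_elim (auto simp: g'_def)
  qed
  obtain D where D: "countable D" "D \<subseteq> Pow U" "\<And>X. X \<in> D \<Longrightarrow> \<exists>a b. X = cbox a b" "\<Union> D = U"
    using open_countable_Union_open_cbox[OF U] by metis
  have "AE x in lborel. \<forall>X\<in>D. x \<in> X \<longrightarrow> g x = 0"
  proof (subst AE_ball_countable[OF D(1)], intro ballI)
    fix X assume X: "X \<in> D"
    obtain c d where "X = cbox c d" using D(3)[OF X] by blast
    then show "AE x in lborel. x \<in> X \<longrightarrow> g x = 0" using cbox X D(2) by blast
  qed
  then have "AE x in lborel. x \<in> U \<longrightarrow> g x = 0"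
  proof eventually_elim
    case (elim x)
    then show ?case using D(4) by blast
  qed
  then show ?thesis by (simp add: AE_lebesgue_on_iff[OF Ul])
qed

lemma has_weak_deriv_unique:
  assumes U: "open U" and "has_weak_deriv U \<beta> u g1" "has_weak_deriv U \<beta> u g2"
  shows "AE x in lebesgue_on U. g1 x = g2 x"
proof -
  have d: "has_weak_deriv U \<beta> (\<lambda>x. u x - u x) (\<lambda>x. g1 x - g2 x)"
    by (rule has_weak_deriv_diff[OF assms])
  have "AE x in lebesgue_on U. g1 x - g2 x = 0"
  proof (rule AE_zero_if_test_integrals_zero[OF U])
    show "locally_integrable U (\<lambda>x. g1 x - g2 x)" using d by (simp add: has_weak_deriv_def)
    show "(\<integral>x. (g1 x - g2 x) * \<phi> x \<partial>lebesgue_on U) = 0" if "\<phi> \<in> test_functions U" for \<phi>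
      using d that by (auto simp: has_weak_deriv_def)
  qed
  then show ?thesis by eventually_elim simp
qed

lemma has_weak_deriv_weak_deriv: "has_weak_deriv U \<beta> u g \<Longrightarrow> has_weak_deriv U \<beta> u (weak_deriv U \<beta> u)"
  unfolding weak_deriv_def by (rule someI[of "has_weak_deriv U \<beta> u"])

lemma weak_deriv_AE_eq:
  "open U \<Longrightarrow> has_weak_deriv U \<beta> u g \<Longrightarrow> AE x in lebesgue_on U. weak_deriv U \<beta> u x = g x"
  by (rule has_weak_deriv_unique[OF _ has_weak_deriv_weak_deriv])

section \<open>Square integrable functions and Sobolev norms\<close>

lemma L2_cong_AE:
  assumes "open U" "f \<in> L2 U" "AE x in lebesgue_on U. f x = g x"
  shows "g \<in> L2 U" and "(\<integral>x. (f x)\<^sup>2 \<partial>lebesgue_on U) = (\<integral>x. (g x)\<^sup>2 \<partial>lebesgue_on U)"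
proof -
  have [measurable]: "g \<in> borel_measurable (lebesgue_on U)" "f \<in> borel_measurable (lebesgue_on U)"
    using assms measurable_AE_cong_lebesgue_on[OF sets_lebesgue_open] by (auto simp: L2_def)
  have ae: "AE x in lebesgue_on U. (f x)\<^sup>2 = (g x)\<^sup>2" using assms(3) by eventually_elim simp
  then show "g \<in> L2 U"
    using assms(2) integrable_cong_AE[of "\<lambda>x. (f x)\<^sup>2" "lebesgue_on U" "\<lambda>x. (g x)\<^sup>2"] by (simp add: L2_def)
  show "(\<integral>x. (f x)\<^sup>2 \<partial>lebesgue_on U) = (\<integral>x. (g x)\<^sup>2 \<partial>lebesgue_on U)"
    by (rule integral_cong_AE) (use ae in simp_all)
qed

lemma L2_mult_integrable:
  assumes "f \<in> L2 U" "g \<in> L2 U"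
  shows "integrable (lebesgue_on U) (\<lambda>x. f x * g x)"
proof (rule Bochner_Integration.integrable_bound)
  show "integrable (lebesgue_on U) (\<lambda>x. (f x)\<^sup>2 + (g x)\<^sup>2)" using assms by (auto simp: L2_def)
  show "(\<lambda>x. f x * g x) \<in> borel_measurable (lebesgue_on U)" using assms by (auto simp: L2_def)
  show "AE x in lebesgue_on U. norm (f x * g x) \<le> norm ((f x)\<^sup>2 + (g x)\<^sup>2)"
  proof (rule AE_I2)
    fix x
    have "2 * (\<bar>f x\<bar> * \<bar>g x\<bar>) \<le> (f x)\<^sup>2 + (g x)\<^sup>2"
      using zero_le_power2[of "\<bar>f x\<bar> - \<bar>g x\<bar>"] by (simp add: power2_diff)
    moreover have "0 \<le> \<bar>f x\<bar> * \<bar>g x\<bar>" by simp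
    ultimately have "\<bar>f x\<bar> * \<bar>g x\<bar> \<le> (f x)\<^sup>2 + (g x)\<^sup>2" by linarith
    then show "norm (f x * g x) \<le> norm ((f x)\<^sup>2 + (g x)\<^sup>2)" by (simp add: abs_mult)
  qed
qed

lemma L2_bounded_mult:
  assumes "f \<in> L2 U" "h \<in> borel_measurable (lebesgue_on U)" "AE x in lebesgue_on U. \<bar>h x\<bar> \<le> K"
  shows "(\<lambda>x. h x * f x) \<in> L2 U"
proof -
  have [measurable]: "f \<in> borel_measurable (lebesgue_on U)" "h \<in> borel_measurable (lebesgue_on U)"
    using assms by (auto simp: L2_def)
  have "integrable (lebesgue_on U) (\<lambda>x. (h x * f x)\<^sup>2)"
  proof (rule Bochner_Integration.integrable_bound)
    show "integrable (lebesgue_on U) (\<lambda>x. K\<^sup>2 * (f x)\<^sup>2)" using assms by (auto simp: L2_def)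
    show "AE x in lebesgue_on U. norm ((h x * f x)\<^sup>2) \<le> norm (K\<^sup>2 * (f x)\<^sup>2)"
      using assms(3) by eventually_elim (simp add: power_mult_distrib mult_right_mono power2_le_iff_abs_le)
  qed simp
  then show ?thesis by (simp add: L2_def)
qed

lemma L2_diff: "f \<in> L2 U \<Longrightarrow> g \<in> L2 U \<Longrightarrow> (\<lambda>x. f x - g x) \<in> L2 U"
  using integrable_mult_right[OF L2_mult_integrable[of f U g], of 2]
  by (auto simp: L2_def power2_diff mult.assoc)

lemma L2_bounded:
  assumes "bounded U" "open U" "f \<in> borel_measurable (lebesgue_on U)" "AE x in lebesgue_on U. \<bar>f x\<bar> \<le> K"
  shows "f \<in> L2 U"
proof -
  have "emeasure (lebesgue_on U) (space (lebesgue_on U)) < \<infinity>"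
    using assms(1,2) emeasure_bounded_finite[of U]
    by (simp add: emeasure_restrict_space sets_lebesgue_open space_restrict_space borel_open)
  then have "finite_measure (lebesgue_on U)" by (intro finite_measureI) simp
  then have "(\<lambda>x. 1) \<in> L2 U" by (simp add: L2_def finite_measure.integrable_const)
  from L2_bounded_mult[OF this assms(3,4)] show ?thesis by simp
qed

text \<open>A compact set has finite measure, and |f| is bounded by 1 + f^2.\<close>

lemma L2_locally_integrable:
  assumes "open U" "f \<in> L2 U"
  shows "locally_integrable U f"
  unfolding locally_integrable_def
proof safe
  fix S assume S: "compact S" "S \<subseteq> U"
  have Sl: "S \<in> sets lebesgue" using compact_imp_closed[OF S(1)] by (simp add: borel_closed)
  have eq: "lebesgue_on S = restrict_space (lebesgue_on U) S"
    using S(2) by (simp add: restrict_restrict_space sets_lebesgue_open assms(1) Sl inf.absorb2)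
  have SO: "S \<inter> space (lebesgue_on U) \<in> sets (lebesgue_on U)"
    using S(2) Sl by (auto simp: sets_restrict_space space_restrict_space image_iff intro!: bexI[of _ S])
  have "integrable (lebesgue_on U) (\<lambda>x. (f x)\<^sup>2)" using assms by (simp add: L2_def)
  then have "integrable (lebesgue_on U) (\<lambda>x. indicator S x *\<^sub>R (f x)\<^sup>2)"
    using SO S(2) by (intro integrable_mult_indicator) (auto simp: space_restrict_space inf.absorb1)
  then have i1: "integrable (lebesgue_on S) (\<lambda>x. (f x)\<^sup>2)"
    unfolding eq using SO by (subst integrable_restrict_space) auto
  have "emeasure (lebesgue_on S) (space (lebesgue_on S)) < \<infinity>"
    using emeasure_bounded_finite[OF compact_imp_bounded[OF S(1)]] Sl compact_imp_closed[OF S(1)]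
    by (simp add: emeasure_restrict_space space_restrict_space)
  then have "finite_measure (lebesgue_on S)" by (intro finite_measureI) simp
  then have i2: "integrable (lebesgue_on S) (\<lambda>x. 1 + (f x)\<^sup>2)"
    using i1 by (intro Bochner_Integration.integrable_add) (simp_all add: finite_measure.integrable_const)
  show "integrable (lebesgue_on S) f"
  proof (rule Bochner_Integration.integrable_bound[OF i2])
    show "f \<in> borel_measurable (lebesgue_on S)"
      unfolding eq by (rule measurable_restrict_space1) (use assms(2) in \<open>simp add: L2_def\<close>)
    have "\<bar>f x\<bar> \<le> 1 + (f x)\<^sup>2" for x
      using zero_le_power2[of "\<bar>f x\<bar> - 1"] by (simp add: power2_diff)
    then show "AE x in lebesgue_on S. norm (f x) \<le> norm (1 + (f x)\<^sup>2)"
      by (intro AE_I2) (simp add: order_trans)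
  qed
qed

lemma has_weak_deriv_0: "locally_integrable U u \<Longrightarrow> has_weak_deriv U 0 u u"
  by (simp add: has_weak_deriv_def)

lemma Hspace_weak_deriv:
  assumes "open U" "u \<in> Hspace l U" "mi_order \<beta> \<le> l"
  shows "has_weak_deriv U \<beta> u (weak_deriv U \<beta> u)" and "weak_deriv U \<beta> u \<in> L2 U"
proof -
  obtain g where g: "g \<in> L2 U" "has_weak_deriv U \<beta> u g" using assms(2,3) by (auto simp: Hspace_def)
  show "has_weak_deriv U \<beta> u (weak_deriv U \<beta> u)" by (rule has_weak_deriv_weak_deriv[OF g(2)])
  show "weak_deriv U \<beta> u \<in> L2 U"
  proof (rule L2_cong_AE(1)[OF assms(1) g(1)])
    show "AE x in lebesgue_on U. g x = weak_deriv U \<beta> u x"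
      using weak_deriv_AE_eq[OF assms(1) g(2)] by eventually_elim simp
  qed
qed

lemma Hspace_diff:
  assumes "open U" "u \<in> Hspace l U" "v \<in> Hspace l U"
  shows "(\<lambda>x. u x - v x) \<in> Hspace l U"
  unfolding Hspace_def
proof (intro CollectI conjI allI impI)
  show "(\<lambda>x. u x - v x) \<in> L2 U" using assms(2,3) by (auto simp: Hspace_def intro: L2_diff)
  fix \<beta> :: "nat^'a" assume b: "mi_order \<beta> \<le> l"
  show "\<exists>g\<in>L2 U. has_weak_deriv U \<beta> (\<lambda>x. u x - v x) g"
    using L2_diff[OF Hspace_weak_deriv(2)[OF assms(1,2) b] Hspace_weak_deriv(2)[OF assms(1,3) b]]
      has_weak_deriv_diff[OF assms(1) Hspace_weak_deriv(1)[OF assms(1,2) b] Hspace_weak_deriv(1)[OF assms(1,3) b]]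
    by blast
qed

lemma weak_deriv_diff_AE:
  assumes "open U" "u \<in> Hspace l U" "v \<in> Hspace l U" "mi_order \<beta> \<le> l"
  shows "AE x in lebesgue_on U. weak_deriv U \<beta> (\<lambda>x. u x - v x) x = weak_deriv U \<beta> u x - weak_deriv U \<beta> v x"
  by (rule weak_deriv_AE_eq[OF assms(1)])
     (rule has_weak_deriv_diff[OF assms(1) Hspace_weak_deriv(1)[OF assms(1,2,4)] Hspace_weak_deriv(1)[OF assms(1,3,4)]])

lemma test_function_L2:
  assumes "\<phi> \<in> test_functions U" "open U"
  shows "\<phi> \<in> L2 U"
proof -
  obtain B where B: "\<And>x. \<bar>\<phi> x\<bar> \<le> B" using test_functions_bounded[OF assms(1)] by metis
  have m: "\<phi> \<in> borel_measurable (lebesgue_on U)"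
    by (intro measurable_restrict_space1 measurable_completion) (simp add: borel_measurable_test[OF assms(1)])
  have "integrable (lebesgue_on U) (\<lambda>x. \<phi> x * \<phi> x)"
    by (intro integrable_test_mult assms locally_integrable_continuous)
       (use test_functions_continuous[OF assms(1)] in \<open>auto intro: continuous_on_subset\<close>)
  then show ?thesis using m by (simp add: L2_def power2_eq_square)
qed

lemma test_function_Hspace:
  assumes \<phi>: "\<phi> \<in> test_functions U" and U: "open U"
  shows "\<phi> \<in> Hspace l U" and "AE x in lebesgue_on U. weak_deriv U \<beta> \<phi> x = mi_deriv \<beta> \<phi> x"
proof -
  have w: "has_weak_deriv U \<beta> \<phi> (mi_deriv \<beta> \<phi>)" for \<beta>
    using smooth_on_subset[OF test_functionsD(1)[OF \<phi>]] by (intro has_weak_deriv_smooth U) auto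
  have "mi_deriv \<beta> \<phi> \<in> L2 U" for \<beta>
    by (rule mi_deriv_list[of \<beta>]) (simp add: test_function_L2 test_functions_iter_partial \<phi> U)
  then show "\<phi> \<in> Hspace l U" using w test_function_L2[OF \<phi> U] by (auto simp: Hspace_def)
  show "AE x in lebesgue_on U. weak_deriv U \<beta> \<phi> x = mi_deriv \<beta> \<phi> x"
    by (rule weak_deriv_AE_eq[OF U w])
qed

lemma Hnorm_power2: "(Hnorm l U v)\<^sup>2 = (\<Sum>\<beta> | mi_order \<beta> \<le> l. (\<integral>x. (weak_deriv U \<beta> v x)\<^sup>2 \<partial>lebesgue_on U))"
  unfolding Hnorm_def by (rule real_sqrt_pow2) (auto intro!: sum_nonneg)

lemma Hnorm_nonneg: "0 \<le> Hnorm l U v"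
  unfolding Hnorm_def by (intro real_sqrt_ge_zero) (auto intro!: sum_nonneg)

lemma H1_seminorm_power2: "(H1_seminorm U v)\<^sup>2 = (\<integral>x. (norm (weak_grad U v x))\<^sup>2 \<partial>lebesgue_on U)"
  unfolding H1_seminorm_def by (rule real_sqrt_pow2) auto

lemma mi_order_le_1: "mi_order \<beta> \<le> 1 \<longleftrightarrow> \<beta> = 0 \<or> (\<exists>i. \<beta> = axis i 1)"
proof
  assume b: "mi_order \<beta> \<le> 1"
  show "\<beta> = 0 \<or> (\<exists>i. \<beta> = axis i 1)"
  proof (cases "\<exists>i. \<beta> $ i \<noteq> 0")
    case True
    then obtain i where i: "\<beta> $ i \<noteq> 0" by blast
    have s: "mi_order \<beta> = \<beta> $ i + (\<Sum>j\<in>UNIV - {i}. \<beta> $ j)"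
      unfolding mi_order_def by (rule sum.remove) auto
    then have "\<beta> $ i = 1" "(\<Sum>j\<in>UNIV - {i}. \<beta> $ j) = 0" using b i by linarith+
    then have "\<beta> $ i = 1" "\<And>j. j \<noteq> i \<Longrightarrow> \<beta> $ j = 0" by (auto simp only: sum_eq_0_iff finite_Diff finite Diff_iff UNIV_I singleton_iff)
    then have "\<beta> = axis i 1" by (auto simp: vec_eq_iff axis_def)
    then show ?thesis by blast
  qed (auto simp: vec_eq_iff)
next
  assume "\<beta> = 0 \<or> (\<exists>i. \<beta> = axis i 1)"
  then show "mi_order \<beta> \<le> 1" by (metis mi_order_0 mi_order_axis le_refl zero_le_one)
qed

section \<open>Cardinal B-splines\<close>

lemma cardinal_bspline_eq_0: "t < 0 \<or> real n \<le> t \<Longrightarrow> cardinal_bspline n t = 0"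
proof (induction n t rule: cardinal_bspline.induct)
  case (3 k t)
  then consider "t < 0" | "t \<ge> real (Suc (Suc k))" by blast
  then show ?case
  proof cases
    case 1
    then show ?thesis using 3 by simp
  next
    case 2
    then show ?thesis using 3 by simp
  qed
qed (auto simp: indicator_def)

text \<open>Induction on the order. The recursion splits each B-spline into two of lower order;
  after an index shift in the second sum the coefficient of the spline with index k is the lower
  product times (k + n - a)(t - k) + (k - a)(n - t + k), which collapses to n (t - a) and so
  releases one more factor t - a.\<close>

theorem marsden_identity:
  assumes "n \<ge> 1" "lo \<le> \<lfloor>t\<rfloor> - int n" "hi \<ge> \<lfloor>t\<rfloor>"
  shows "(t - a) ^ (n - 1) = (\<Sum>k=lo..hi. (\<Prod>j=1..<n. real_of_int k + real j - a) * cardinal_bspline n (t - real_of_int k))"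
  using assms
proof (induction n arbitrary: lo hi rule: nat_induct_at_least)
  case base
  have "(\<Sum>k=lo..hi. cardinal_bspline (Suc 0) (t - real_of_int k)) = (\<Sum>k=lo..hi. if k = \<lfloor>t\<rfloor> then 1 else 0)"
    by (intro sum.cong refl) (auto simp: indicator_def floor_eq_iff, (smt (verit) floor_eq_iff)+)
  then show ?case using base by simp
next
  case (Suc n)
  let ?M = "\<lambda>n x. \<Prod>j=1..<n. x + real j - a"
  let ?b = "\<lambda>k. cardinal_bspline n (t - real_of_int k)"
  obtain m where m: "n = Suc m" using Suc.hyps by (cases n) auto
  have rec: "cardinal_bspline (Suc n) s = (s * cardinal_bspline n s + (real (Suc n) - s) * cardinal_bspline n (s - 1)) / real n" for s
    by (simp add: m)
  have M1: "?M (Suc n) x = ?M n x * (x + real n - a)" for x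
    using Suc.hyps by (simp add: prod.atLeastLessThan_Suc)
  have M2: "?M (Suc n) (x - 1) = (x - a) * ?M n x" for x
  proof -
    have "?M (Suc n) (x - 1) = (\<Prod>j=0..<n. x + real j - a)"
      using prod.shift_bounds_Suc_ivl[of "\<lambda>j. x - 1 + real j - a" 0 n] by (simp add: algebra_simps)
    also have "\<dots> = (x - a) * ?M n x"
      using Suc.hyps by (simp add: prod.atLeast_Suc_lessThan)
    finally show ?thesis .
  qed
  \<comment> \<open>The end terms vanish, which is why the index shift may be carried out within the
    same range: the lower bound has one index to spare after passing from \<open>Suc n\<close> to
    \<open>n\<close>, and the spline with index hi + 1 starts to the right of
    \<open>t\<close>.\<close>
  have z1: "?b lo = 0" "?b (hi + 1) = 0"
    using Suc.prems by (auto intro!: cardinal_bspline_eq_0) (linarith+)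
  have lohi: "lo \<le> hi" using Suc.prems by linarith
  let ?g = "\<lambda>k. ?M (Suc n) (real_of_int k - 1) * (real (Suc n) - (t - real_of_int k + 1)) * ?b k"
  have "(\<Sum>k=lo..hi. ?M (Suc n) (real_of_int k) * (real (Suc n) - (t - real_of_int k)) * ?b (k + 1))
      = (\<Sum>k=lo..hi. ?g (k + 1))" by simp
  also have "\<dots> = (\<Sum>k=lo+1..hi+1. ?g k)"
    by (rule sum.reindex_bij_witness[of _ "\<lambda>k. k - 1" "\<lambda>k. k + 1"]) auto
  also have "\<dots> = (\<Sum>k=lo..hi. ?g k)"
  proof -
    have "(\<Sum>k=lo+1..hi+1. ?g k) = (\<Sum>k=lo..hi+1. ?g k)"
      by (rule sum.mono_neutral_left) (use z1 in \<open>auto simp: not_le\<close>, (metis z1(1) antisym_conv zle_add1_eq_le linorder_not_le)?)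
    also have "\<dots> = (\<Sum>k=lo..hi. ?g k)"
      by (rule sum.mono_neutral_right) (use z1 in \<open>auto simp: not_le\<close>, (metis z1(2) antisym_conv zle_add1_eq_le linorder_not_le)?)
    finally show ?thesis .
  qed
  finally have shift: "(\<Sum>k=lo..hi. ?M (Suc n) (real_of_int k) * (real (Suc n) - (t - real_of_int k)) * ?b (k + 1)) = (\<Sum>k=lo..hi. ?g k)" .
  have "(\<Sum>k=lo..hi. ?M (Suc n) (real_of_int k) * cardinal_bspline (Suc n) (t - real_of_int k))
     = ((\<Sum>k=lo..hi. ?M (Suc n) (real_of_int k) * (t - real_of_int k) * ?b k)
      + (\<Sum>k=lo..hi. ?M (Suc n) (real_of_int k) * (real (Suc n) - (t - real_of_int k)) * ?b (k + 1))) / real n"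
    unfolding rec sum.distrib[symmetric] sum_divide_distrib
    by (intro sum.cong refl) (simp add: algebra_simps add_divide_distrib diff_divide_distrib)
  also have "\<dots> = (\<Sum>k=lo..hi. (?M n (real_of_int k) * ((t - a) * real n)) * ?b k) / real n"
    unfolding shift unfolding M2 unfolding M1[of "real_of_int k" for k] sum.distrib[symmetric]
    by (intro arg_cong2[where f = "(/)"] sum.cong refl) (simp add: algebra_simps)
  also have "\<dots> = (t - a) * (\<Sum>k=lo..hi. ?M n (real_of_int k) * ?b k)"
    using Suc.hyps by (simp add: sum_distrib_left sum_divide_distrib mult_ac)
  also have "\<dots> = (t - a) * (t - a) ^ (n - 1)"
    using Suc.IH[of lo hi] Suc.prems by simp
  also have "\<dots> = (t - a) ^ (Suc n - 1)" by (simp add: m)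
  finally show ?case by simp
qed

text \<open>The coefficients are read off the Lagrange basis for the nodes \<open>0, \<dots>, N\<close>.\<close>

lemma monomial_as_shifted_powers:
  assumes "i \<le> N"
  obtains A :: "nat \<Rightarrow> real" where "\<And>x. x ^ i = (\<Sum>l\<le>N. A l * (x + real l) ^ N)"
proof -
  define L :: "nat \<Rightarrow> real poly" where
    "L l = (\<Prod>m\<in>{..N} - {l}. smult (1 / (real l - real m)) [:- real m, 1:])" for l
  have L: "poly (L l) (real k) = (if k = l then 1 else 0)" if "l \<le> N" "k \<le> N" for l k
  proof -
    have "poly (L l) (real k) = (\<Prod>m\<in>{..N} - {l}. (real k - real m) / (real l - real m))"
      by (simp add: L_def poly_prod diff_divide_distrib)
    also have "\<dots> = (if k = l then 1 else 0)"
      using that by (auto intro!: prod.neutral prod_zero bexI[of _ k])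
    finally show ?thesis .
  qed
  have degL: "degree (L l) \<le> N" if "l \<le> N" for l
  proof -
    have "degree (L l) \<le> sum (degree \<circ> (\<lambda>m. smult (1 / (real l - real m)) [:- real m, 1:])) ({..N} - {l})"
      unfolding L_def by (rule degree_prod_sum_le) simp
    also have "\<dots> \<le> (\<Sum>m\<in>{..N} - {l}. 1)" by (intro sum_mono) (simp add: degree_smult_le[THEN order_trans])
    also have "\<dots> = N" using that by simp
    finally show ?thesis .
  qed
  have interp: "(\<Sum>l\<le>N. smult (real l ^ j) (L l)) = monom 1 j" if "j \<le> N" for j
  proof (rule poly_eqI_degree[where A = "real ` {..N}"])
    show "poly (\<Sum>l\<le>N. smult (real l ^ j) (L l)) x = poly (monom 1 j) x" if "x \<in> real ` {..N}" for x
      using that by (auto simp: poly_sum poly_monom L if_distrib cong: if_cong)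
    have c: "card (real ` {..N}) = Suc N" by (simp add: card_image)
    have "degree (\<Sum>l\<le>N. smult (real l ^ j) (L l)) \<le> N"
      by (rule degree_sum_le, simp, rule order_trans[OF degree_smult_le], rule degL, simp)
    then show "degree (\<Sum>l\<le>N. smult (real l ^ j) (L l)) < card (real ` {..N})" using c by simp
    show "degree (monom (1::real) j) < card (real ` {..N})" using c that by (simp add: degree_monom_eq)
  qed
  \<comment> \<open>By the binomial theorem the weights have to send l^j to 1 / (N choose i) for j =
    N - i and to 0 for the other j up to N. Reading off the coefficient of degree N - i from the
    interpolating polynomial is such a functional of the nodal values.\<close>
  define A where "A l = coeff (L l) (N - i) / real (N choose i)" for l
  have A: "(\<Sum>l\<le>N. A l * real l ^ j) = (if j = N - i then 1 / real (N choose i) else 0)" if "j \<le> N" for j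
  proof -
    have "(\<Sum>l\<le>N. A l * real l ^ j) = coeff (\<Sum>l\<le>N. smult (real l ^ j) (L l)) (N - i) / real (N choose i)"
      by (simp add: A_def coeff_sum sum_divide_distrib mult_ac)
    then show ?thesis using interp[OF that] by simp
  qed
  have "(\<Sum>l\<le>N. A l * (x + real l) ^ N) = x ^ i" for x
  proof -
    have "(\<Sum>l\<le>N. A l * (x + real l) ^ N)
       = (\<Sum>l\<le>N. \<Sum>k\<le>N. real (N choose k) * x ^ k * (A l * real l ^ (N - k)))"
      by (simp add: binomial_ring sum_distrib_left mult_ac)
    also have "\<dots> = (\<Sum>k\<le>N. real (N choose k) * x ^ k * (\<Sum>l\<le>N. A l * real l ^ (N - k)))"
      by (subst sum.swap) (simp add: sum_distrib_left)
    also have "\<dots> = (\<Sum>k\<le>N. if k = i then x ^ i else 0)"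
      using assms by (intro sum.cong refl) (auto simp: A)
    also have "\<dots> = x ^ i" using assms by simp
    finally show ?thesis .
  qed
  then show ?thesis using that by metis
qed

text \<open>The point is the continuity of the coefficients in the shift \<tau>: it yields
  quasi-interpolation weights that are bounded uniformly for \<tau> in the unit interval.\<close>

lemma shifted_product_expansion:
  obtains r :: "nat \<Rightarrow> real \<Rightarrow> real" where
    "\<And>i. continuous_on UNIV (r i)"
    "\<And>x \<tau>. (\<Prod>j=1..m. x - \<tau> + real j) = (\<Sum>i\<le>m. r i \<tau> * x ^ i)"
proof -
  have "\<exists>r :: nat \<Rightarrow> real \<Rightarrow> real. (\<forall>i. continuous_on UNIV (r i)) \<and>
    (\<forall>x \<tau>. (\<Prod>j=1..m. x - \<tau> + real j) = (\<Sum>i\<le>m. r i \<tau> * x ^ i))"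
  proof (induction m)
    case 0
    show ?case by (intro exI[of _ "\<lambda>i \<tau>. 1"]) simp
  next
    case (Suc m)
    then obtain r :: "nat \<Rightarrow> real \<Rightarrow> real" where r: "\<And>i. continuous_on UNIV (r i)"
      "\<And>x \<tau>. (\<Prod>j=1..m. x - \<tau> + real j) = (\<Sum>i\<le>m. r i \<tau> * x ^ i)" by blast
    define r' where "r' i \<tau> = (if i = 0 then 0 else r (i - 1) \<tau>) + (if i \<le> m then (real (Suc m) - \<tau>) * r i \<tau> else 0)" for i \<tau>
    have "continuous_on UNIV (r' i)" for i
      unfolding r'_def by (cases "i = 0"; cases "i \<le> m") (auto intro!: continuous_intros r(1))
    moreover have "(\<Prod>j=1..Suc m. x - \<tau> + real j) = (\<Sum>i\<le>Suc m. r' i \<tau> * x ^ i)" for x \<tau>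
    proof -
      have "(\<Sum>i\<le>Suc m. r' i \<tau> * x ^ i) = (\<Sum>i\<le>Suc m. (if i = 0 then 0 else r (i - 1) \<tau>) * x ^ i)
          + (\<Sum>i\<le>Suc m. (if i \<le> m then (real (Suc m) - \<tau>) * r i \<tau> else 0) * x ^ i)"
        by (simp only: r'_def distrib_right sum.distrib)
      also have "(\<Sum>i\<le>Suc m. (if i = 0 then 0 else r (i - 1) \<tau>) * x ^ i) = x * (\<Sum>i\<le>m. r i \<tau> * x ^ i)"
        by (subst sum.atMost_Suc_shift) (simp add: sum_distrib_left mult_ac)
      also have "(\<Sum>i\<le>Suc m. (if i \<le> m then (real (Suc m) - \<tau>) * r i \<tau> else 0) * x ^ i) = (real (Suc m) - \<tau>) * (\<Sum>i\<le>m. r i \<tau> * x ^ i)"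
        by (simp add: sum_distrib_left mult_ac)
      finally show ?thesis using r(2)[of x \<tau>] by (simp add: algebra_simps)
    qed
    ultimately show ?case by blast
  qed
  then show ?thesis using that by blast
qed

text \<open>The functional with these weights sends the power (x - a)^(n - 1), sampled at the
  shifted nodes, to the coefficient product in Marsden's identity, so the resulting splines
  reproduce these powers for every \<open>a\<close>. Monomials of degree below \<open>n\<close> are
  combinations of such powers and are reproduced too. The center \<open>t0\<close> is arbitrary, so
  Taylor polynomials around any point can be inserted directly.\<close>

lemma quasi_interpolation_weights:
  assumes n: "n \<ge> 1"
  obtains \<mu> :: "real \<Rightarrow> nat \<Rightarrow> real" and K where "K > 0"
    "\<And>\<tau> l. \<tau> \<in> {0..1} \<Longrightarrow> l < n \<Longrightarrow> \<bar>\<mu> \<tau> l\<bar> \<le> K"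
    "\<And>\<tau> t t0 i lo hi. i < n \<Longrightarrow> lo \<le> \<lfloor>t\<rfloor> - int n \<Longrightarrow> hi \<ge> \<lfloor>t\<rfloor> \<Longrightarrow>
      (\<Sum>k=lo..hi. (\<Sum>l<n. \<mu> \<tau> l * (real_of_int k + real l + \<tau> - t0) ^ i) * cardinal_bspline n (t - real_of_int k)) = (t - t0) ^ i"
proof -
  define N where "N = n - 1"
  have Nn: "{..N} = {..<n}" "{1..<n} = {1..N}" using n by (auto simp: N_def)
  have "\<exists>A. \<forall>x::real. i \<le> N \<longrightarrow> x ^ i = (\<Sum>l\<le>N. A l * (x + real l) ^ N)" for i
    by (cases "i \<le> N") (rule monomial_as_shifted_powers[of i N], assumption, blast, blast)
  then have "\<forall>i. \<exists>A. \<forall>x::real. i \<le> N \<longrightarrow> x ^ i = (\<Sum>l\<le>N. A l * (x + real l) ^ N)" by (rule allI)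
  from choice[OF this] obtain A where
    "\<forall>i. \<forall>x::real. i \<le> N \<longrightarrow> x ^ i = (\<Sum>l\<le>N. A i l * (x + real l) ^ N)" by (rule exE)
  then have A: "\<And>i x. i \<le> N \<Longrightarrow> x ^ i = (\<Sum>l\<le>N. A i l * (x + real l) ^ N)" by blast
  obtain r :: "nat \<Rightarrow> real \<Rightarrow> real" where r: "\<And>i. continuous_on UNIV (r i)"
    "\<And>x \<tau>. (\<Prod>j=1..N. x - \<tau> + real j) = (\<Sum>i\<le>N. r i \<tau> * x ^ i)"
    by (rule shifted_product_expansion[of N]) (rule that)
  \<comment> \<open>The coefficient product of Marsden's identity is expanded in powers of \<tau> -
    a, and each of these in (n - 1)-th powers at integer shifts.\<close>
  define \<mu> where "\<mu> \<tau> l = (\<Sum>i\<le>N. r i \<tau> * A i l)" for \<tau> l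
  have \<mu>: "(\<Sum>l<n. \<mu> \<tau> l * (real l + \<tau> - a) ^ N) = (\<Prod>j=1..<n. real j - a)" for \<tau> a
  proof -
    have "(\<Prod>j=1..<n. real j - a) = (\<Sum>i\<le>N. r i \<tau> * (\<tau> - a) ^ i)"
      using r(2)[of "\<tau> - a" \<tau>] Nn by (simp add: algebra_simps)
    also have "\<dots> = (\<Sum>i\<le>N. r i \<tau> * (\<Sum>l\<le>N. A i l * (\<tau> - a + real l) ^ N))"
      by (intro sum.cong refl) (simp add: A[symmetric])
    also have "\<dots> = (\<Sum>l\<le>N. \<mu> \<tau> l * (\<tau> - a + real l) ^ N)"
      unfolding \<mu>_def sum_distrib_left sum_distrib_right by (subst sum.swap) (simp add: mult_ac)
    finally show ?thesis using Nn by (simp add: algebra_simps)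
  qed
  have "\<exists>K. \<forall>\<tau>\<in>{0..1}. \<bar>\<mu> \<tau> l\<bar> \<le> K" for l
  proof -
    have "continuous_on {0..1} (\<lambda>\<tau>. \<mu> \<tau> l)"
      unfolding \<mu>_def by (intro continuous_intros continuous_on_subset[OF r(1)]) auto
    then have "bounded ((\<lambda>\<tau>. \<mu> \<tau> l) ` {0..1})"
      by (intro compact_imp_bounded compact_continuous_image) auto
    then show ?thesis by (auto simp: bounded_iff)
  qed
  then obtain Kf where Kf: "\<And>l \<tau>. \<tau> \<in> {0..1} \<Longrightarrow> \<bar>\<mu> \<tau> l\<bar> \<le> Kf l" by metis
  define K where "K = 1 + (\<Sum>l<n. \<bar>Kf l\<bar>)"
  have Kb: "\<bar>\<mu> \<tau> l\<bar> \<le> K" if "\<tau> \<in> {0..1}" "l < n" for \<tau> l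
  proof -
    have "\<bar>Kf l\<bar> \<le> (\<Sum>l<n. \<bar>Kf l\<bar>)" by (rule member_le_sum) (use that in auto)
    then show ?thesis using Kf[OF that(1), of l] by (simp add: K_def)
  qed
  have Kpos: "K > 0" unfolding K_def by (intro add_pos_nonneg sum_nonneg) auto
  have rep: "(\<Sum>k=lo..hi. (\<Sum>l<n. \<mu> \<tau> l * (real_of_int k + real l + \<tau> - t0) ^ i) * cardinal_bspline n (t - real_of_int k)) = (t - t0) ^ i"
    if i: "i < n" and lo: "lo \<le> \<lfloor>t\<rfloor> - int n" and hi: "hi \<ge> \<lfloor>t\<rfloor>" for \<tau> t t0 i lo hi
  proof -
    let ?b = "\<lambda>k. cardinal_bspline n (t - real_of_int k)"
    have i': "i \<le> N" using i by (simp add: N_def)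
    have "(\<Sum>l<n. \<mu> \<tau> l * (real_of_int k + real l + \<tau> - t0) ^ i)
        = (\<Sum>s\<le>N. A i s * (\<Prod>j=1..<n. real_of_int k + real j - (t0 - real s)))" for k
    proof -
      have "(\<Sum>l<n. \<mu> \<tau> l * (real_of_int k + real l + \<tau> - t0) ^ i)
        = (\<Sum>l<n. \<mu> \<tau> l * (\<Sum>s\<le>N. A i s * (real_of_int k + real l + \<tau> - t0 + real s) ^ N))"
        by (subst A[OF i']) (rule refl)
      also have "\<dots> = (\<Sum>s\<le>N. A i s * (\<Sum>l<n. \<mu> \<tau> l * (real l + \<tau> - (t0 - real s - real_of_int k)) ^ N))"
        unfolding sum_distrib_left by (subst sum.swap) (simp add: algebra_simps)
      also have "\<dots> = (\<Sum>s\<le>N. A i s * (\<Prod>j=1..<n. real_of_int k + real j - (t0 - real s)))"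
        by (simp only: \<mu>) (simp add: algebra_simps)
      finally show ?thesis .
    qed
    then have "(\<Sum>k=lo..hi. (\<Sum>l<n. \<mu> \<tau> l * (real_of_int k + real l + \<tau> - t0) ^ i) * ?b k)
      = (\<Sum>s\<le>N. A i s * (\<Sum>k=lo..hi. (\<Prod>j=1..<n. real_of_int k + real j - (t0 - real s)) * ?b k))"
      unfolding sum_distrib_left by (simp add: sum_distrib_right mult.assoc) (subst sum.swap, rule refl)
    also have "\<dots> = (\<Sum>s\<le>N. A i s * (t - (t0 - real s)) ^ N)"
      using marsden_identity[OF n lo hi] by (simp add: N_def)
    also have "\<dots> = (t - t0) ^ i" by (subst A[OF i']) (simp add: algebra_simps)
    finally show ?thesis .
  qed
  show ?thesis by (rule that[OF Kpos Kb rep])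
qed

subsection \<open>Smoothed B-splines\<close>

text \<open>For \<open>q = abs\<close> this is the cardinal B-spline; a smooth \<open>q\<close> close to \<open>abs\<close> gives a smooth
  approximation.\<close>

fun gen_bspline :: "(real \<Rightarrow> real) \<Rightarrow> nat \<Rightarrow> real \<Rightarrow> real" where
  "gen_bspline q 0 t = 0"
| "gen_bspline q (Suc 0) t = 0"
| "gen_bspline q (Suc (Suc 0)) t = (q t - 2 * q (t - 1) + q (t - 2)) / 2"
| "gen_bspline q (Suc (Suc (Suc k))) t = (t * gen_bspline q (Suc (Suc k)) t
     + (real (Suc (Suc (Suc k))) - t) * gen_bspline q (Suc (Suc k)) (t - 1)) / real (Suc (Suc k))"

text \<open>The derivative of the recursion, with \<open>q'\<close> as an independent argument. In
  this way \<open>sgn\<close> may accompany \<open>abs\<close>, although it is not its derivative at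
  0, and the formula makes sense at the knots.\<close>

fun gen_bspline_deriv :: "(real \<Rightarrow> real) \<Rightarrow> (real \<Rightarrow> real) \<Rightarrow> nat \<Rightarrow> real \<Rightarrow> real" where
  "gen_bspline_deriv q q' 0 t = 0"
| "gen_bspline_deriv q q' (Suc 0) t = 0"
| "gen_bspline_deriv q q' (Suc (Suc 0)) t = (q' t - 2 * q' (t - 1) + q' (t - 2)) / 2"
| "gen_bspline_deriv q q' (Suc (Suc (Suc k))) t = (gen_bspline q (Suc (Suc k)) t + t * gen_bspline_deriv q q' (Suc (Suc k)) t
     - gen_bspline q (Suc (Suc k)) (t - 1)
     + (real (Suc (Suc (Suc k))) - t) * gen_bspline_deriv q q' (Suc (Suc k)) (t - 1)) / real (Suc (Suc k))"

text \<open>Half the second difference of |t| is the hat function, the B-spline of order 2; from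
  there on the two recursions coincide.\<close>

lemma gen_bspline_abs: "n \<ge> 2 \<Longrightarrow> gen_bspline abs n = cardinal_bspline n"
proof (induction n rule: nat_induct_at_least)
  case base
  have "gen_bspline abs (Suc (Suc 0)) t = cardinal_bspline (Suc (Suc 0)) t" for t
    by (auto simp: indicator_def)
  then show ?case by (auto simp: numeral_2_eq_2)
next
  case (Suc n)
  then obtain k where n: "n = Suc (Suc k)" by (metis add_2_eq_Suc le_Suc_ex)
  show ?case using Suc.IH unfolding n by (auto simp: fun_eq_iff)
qed

text \<open>Differentiability of \<open>q\<close> is asked for only at the points t - j where the
  recursion evaluates it. With \<open>abs\<close> for \<open>q\<close> this means that
  \<open>t\<close> must avoid the integer knots from 0 on.\<close>

lemma DERIV_gen_bspline:
  assumes "\<And>j::nat. (q has_real_derivative q' (t - real j)) (at (t - real j))"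
  shows "(gen_bspline q n has_real_derivative gen_bspline_deriv q q' n t) (at t)"
  using assms
proof (induction q q' n t rule: gen_bspline_deriv.induct)
  case (3 q q' t)
  have D: "((\<lambda>t. q (t - real j)) has_real_derivative q' (t - real j)) (at t)" for j
    using DERIV_shift[of q "q' (t - real j)" t "- real j"] 3[of j] by simp
  show ?case
    using D[of 0] D[of 1] D[of 2]
    by (auto intro!: derivative_eq_intros simp del: One_nat_def)
next
  case (4 q q' k t)
  have "(q has_real_derivative q' (t - 1 - real j)) (at (t - 1 - real j))" for j
    using 4(3)[of "Suc j"] by (simp add: algebra_simps)
  then have *: "(gen_bspline q (Suc (Suc k)) has_real_derivative gen_bspline_deriv q q' (Suc (Suc k)) (t - 1)) (at (t - 1))"
    using 4 by blast
  have D1: "((\<lambda>t. gen_bspline q (Suc (Suc k)) (t - 1)) has_real_derivative gen_bspline_deriv q q' (Suc (Suc k)) (t - 1)) (at t)"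
    using DERIV_shift[of "gen_bspline q (Suc (Suc k))" _ t "-1"] * by simp
  have D0: "(gen_bspline q (Suc (Suc k)) has_real_derivative gen_bspline_deriv q q' (Suc (Suc k)) t) (at t)"
    using 4 by blast
  have eq: "gen_bspline q (Suc (Suc (Suc k))) = (\<lambda>t. (t * gen_bspline q (Suc (Suc k)) t
     + (real (Suc (Suc (Suc k))) - t) * gen_bspline q (Suc (Suc k)) (t - 1)) / real (Suc (Suc k)))"
    by (simp add: fun_eq_iff)
  show ?case unfolding eq gen_bspline_deriv.simps
    by (rule DERIV_cong[OF DERIV_cdivide[OF DERIV_add[OF DERIV_mult[OF DERIV_ident D0]
        DERIV_mult[OF DERIV_diff[OF DERIV_const DERIV_ident] D1]]]])
       (intro arg_cong2[where f = "(/)"] refl, simp add: algebra_simps)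
next
  case (1 q q' t)
  have "gen_bspline q 0 = (\<lambda>t. 0)" by (simp add: fun_eq_iff)
  then show ?case by simp
next
  case (2 q q' t)
  have "gen_bspline q (Suc 0) = (\<lambda>t. 0)" by (simp add: fun_eq_iff)
  then show ?case by simp
qed

text \<open>The constant is uniform over all admissible \<open>q\<close> and \<open>q'\<close>, so
  it bounds the whole smoothing sequence and also the pair \<open>abs\<close>, \<open>sgn\<close>.
  The recursion evaluates at t - 1, hence the induction over all radii, passing from
  \<open>R\<close> to R + 1.\<close>

lemma gen_bspline_bounded:
  assumes "R \<ge> 0"
  obtains K where "K > 0" "\<And>q q' t. (\<And>t. \<bar>q t\<bar> \<le> \<bar>t\<bar> + 1) \<Longrightarrow> (\<And>t. \<bar>q' t\<bar> \<le> 1) \<Longrightarrow> \<bar>t\<bar> \<le> R \<Longrightarrow>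
     \<bar>gen_bspline q n t\<bar> \<le> K \<and> \<bar>gen_bspline_deriv q q' n t\<bar> \<le> K"
proof -
  have "\<exists>K>0. \<forall>q q' t. (\<forall>t. \<bar>q t\<bar> \<le> \<bar>t\<bar> + 1) \<longrightarrow> (\<forall>t. \<bar>q' t\<bar> \<le> 1) \<longrightarrow> \<bar>t\<bar> \<le> R \<longrightarrow>
     \<bar>gen_bspline q n t\<bar> \<le> K \<and> \<bar>gen_bspline_deriv q q' n t\<bar> \<le> K"
    using assms
  proof (induction n arbitrary: R rule: less_induct)
    case (less n R)
    consider "n < 2" | "n = 2" | k where "n = Suc (Suc (Suc k))"
      by (metis One_nat_def Suc_1 less_2_cases_iff not0_implies_Suc)
    then show ?case
    proof cases
      case 1
      then consider "n = 0" | "n = Suc 0" by linarith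
      then show ?thesis by cases (auto intro!: exI[of _ 1])
    next
      case 2
      have "\<bar>gen_bspline q n t\<bar> \<le> 2 * R + 10 \<and> \<bar>gen_bspline_deriv q q' n t\<bar> \<le> 2 * R + 10"
        if q: "\<forall>t. \<bar>q t\<bar> \<le> \<bar>t\<bar> + 1" and q': "\<forall>t. \<bar>q' t\<bar> \<le> 1" and t: "\<bar>t\<bar> \<le> R" for q q' :: "real \<Rightarrow> real" and t
      proof -
        have "\<bar>q t\<bar> \<le> \<bar>t\<bar> + 1" "\<bar>q (t - 1)\<bar> \<le> \<bar>t - 1\<bar> + 1" "\<bar>q (t - 2)\<bar> \<le> \<bar>t - 2\<bar> + 1"
          "\<bar>q' t\<bar> \<le> 1" "\<bar>q' (t - 1)\<bar> \<le> 1" "\<bar>q' (t - 2)\<bar> \<le> 1"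
          using q q' by blast+
        then show ?thesis using t unfolding 2 numeral_2_eq_2 gen_bspline.simps gen_bspline_deriv.simps
          by (auto simp: abs_le_iff)
      qed
      then show ?thesis using less.prems by (intro exI[of _ "2 * R + 10"]) auto
    next
      case 3
      let ?n = "Suc (Suc k)"
      from less.IH[of ?n "R + 1"] obtain K where K: "K > 0" "\<And>q q' t. (\<forall>t. \<bar>q t\<bar> \<le> \<bar>t\<bar> + 1) \<Longrightarrow> (\<forall>t. \<bar>q' t\<bar> \<le> 1) \<Longrightarrow> \<bar>t\<bar> \<le> R + 1 \<Longrightarrow>
        \<bar>gen_bspline q ?n t\<bar> \<le> K \<and> \<bar>gen_bspline_deriv q q' ?n t\<bar> \<le> K"
        using less.prems 3 by auto
      let ?K = "2 * K + R * K + (real n + R) * K"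
      have "\<bar>gen_bspline q n t\<bar> \<le> ?K \<and> \<bar>gen_bspline_deriv q q' n t\<bar> \<le> ?K"
        if q: "\<forall>t. \<bar>q t\<bar> \<le> \<bar>t\<bar> + 1" and q': "\<forall>t. \<bar>q' t\<bar> \<le> 1" and t: "\<bar>t\<bar> \<le> R" for q q' :: "real \<Rightarrow> real" and t
      proof -
        define a b c d where "a = gen_bspline q ?n t" and "b = gen_bspline q ?n (t - 1)"
          and "c = gen_bspline_deriv q q' ?n t" and "d = gen_bspline_deriv q q' ?n (t - 1)"
        have bd: "\<bar>a\<bar> \<le> K" "\<bar>b\<bar> \<le> K" "\<bar>c\<bar> \<le> K" "\<bar>d\<bar> \<le> K"
          using K(2)[OF q q', of t] K(2)[OF q q', of "t - 1"] t by (auto simp: a_def b_def c_def d_def)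
        have m: "\<bar>t * u\<bar> \<le> R * K" "\<bar>(real n - t) * u\<bar> \<le> (real n + R) * K" if "\<bar>u\<bar> \<le> K" for u
          unfolding abs_mult using that t less.prems by (intro mult_mono; simp)+
        have div: "\<bar>u / real ?n\<bar> \<le> \<bar>u\<bar>" for u
          by (simp add: divide_le_eq mult_le_cancel_left1 abs_mult)
        have "gen_bspline q n t = (t * a + (real n - t) * b) / real ?n"
          "gen_bspline_deriv q q' n t = (a + t * c - b + (real n - t) * d) / real ?n"
          unfolding 3 by (simp_all only: gen_bspline.simps gen_bspline_deriv.simps a_def b_def c_def d_def)
        moreover have "\<bar>t * a + (real n - t) * b\<bar> \<le> ?K" using m(1)[OF bd(1)] m(2)[OF bd(2)] K(1) by linarith
        moreover have "\<bar>a + t * c - b + (real n - t) * d\<bar> \<le> ?K" using m(1)[OF bd(3)] m(2)[OF bd(4)] bd by linarith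
        ultimately show ?thesis using div order_trans by metis
      qed
      moreover have "?K > 0" using K(1) less.prems by (intro add_pos_nonneg) auto
      ultimately show ?thesis by blast
    qed
  qed
  then show ?thesis using that by blast
qed

lemma gen_bspline_tendsto:
  assumes "\<And>t. (\<lambda>j. q j t) \<longlonglongrightarrow> q0 t"
  shows "(\<lambda>j. gen_bspline (q j) n t) \<longlonglongrightarrow> gen_bspline q0 n t"
proof -
  have "\<forall>t. (\<lambda>j. q j t) \<longlonglongrightarrow> q0 t" using assms by blast
  then show ?thesis by (induction q0 n t rule: gen_bspline.induct) (auto intro!: tendsto_intros)
qed

lemma gen_bspline_deriv_tendsto:
  assumes "\<And>t. (\<lambda>j. q j t) \<longlonglongrightarrow> q0 t" "\<And>t. (\<lambda>j. q' j t) \<longlonglongrightarrow> q0' t"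
  shows "(\<lambda>j. gen_bspline_deriv (q j) (q' j) n t) \<longlonglongrightarrow> gen_bspline_deriv q0 q0' n t"
proof -
  have "\<forall>t. (\<lambda>j. q j t) \<longlonglongrightarrow> q0 t" "\<forall>t. (\<lambda>j. q' j t) \<longlonglongrightarrow> q0' t" using assms by blast+
  then show ?thesis by (induction q0 q0' n t rule: gen_bspline_deriv.induct) (auto intro!: tendsto_intros gen_bspline_tendsto)
qed

definition sqrt_abs :: "nat \<Rightarrow> real \<Rightarrow> real" where
  "sqrt_abs j t = sqrt (t\<^sup>2 + (1 / real (Suc j))\<^sup>2)"

definition sqrt_abs' :: "nat \<Rightarrow> real \<Rightarrow> real" where
  "sqrt_abs' j t = t / sqrt_abs j t"

lemma sqrt_abs_pos: "sqrt_abs j t > 0"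
  unfolding sqrt_abs_def by (intro real_sqrt_gt_zero add_nonneg_pos) auto

lemma abs_le_sqrt_abs: "\<bar>t\<bar> \<le> sqrt_abs j t"
  unfolding sqrt_abs_def by (rule real_le_rsqrt) simp

lemma sqrt_abs_bounds: "\<bar>sqrt_abs j t\<bar> \<le> \<bar>t\<bar> + 1" "\<bar>sqrt_abs' j t\<bar> \<le> 1"
proof -
  have "sqrt_abs j t \<le> \<bar>t\<bar> + \<bar>1 / real (Suc j)\<bar>"
    unfolding sqrt_abs_def using sqrt_add_le_add_sqrt[of "t\<^sup>2" "(1 / real (Suc j))\<^sup>2"] by simp
  moreover have "\<bar>1 / real (Suc j)\<bar> \<le> 1" by simp
  ultimately show "\<bar>sqrt_abs j t\<bar> \<le> \<bar>t\<bar> + 1" using sqrt_abs_pos[of j t] by linarith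
  show "\<bar>sqrt_abs' j t\<bar> \<le> 1"
    using abs_le_sqrt_abs[of t j] sqrt_abs_pos[of j t] by (simp add: sqrt_abs'_def)
qed

lemma DERIV_sqrt_abs: "(sqrt_abs j has_real_derivative sqrt_abs' j t) (at t)"
proof -
  have "t\<^sup>2 + (1 / real (Suc j))\<^sup>2 > 0" by (intro add_nonneg_pos) auto
  then show ?thesis unfolding sqrt_abs_def sqrt_abs'_def
    by (auto intro!: derivative_eq_intros simp: divide_simps)
qed

lemma sqrt_abs_tendsto: "(\<lambda>j. sqrt_abs j t) \<longlonglongrightarrow> \<bar>t\<bar>"
proof -
  have "(\<lambda>j. sqrt (t\<^sup>2 + (inverse (real (Suc j)))\<^sup>2)) \<longlonglongrightarrow> sqrt (t\<^sup>2 + 0\<^sup>2)"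
    by (intro tendsto_intros LIMSEQ_inverse_real_of_nat)
  then show ?thesis by (simp add: sqrt_abs_def inverse_eq_divide)
qed

text \<open>At 0 the sequence is constantly 0 = sgn 0, so the smoothed derivatives converge at the
  knots as well and no exceptional points arise.\<close>

lemma sqrt_abs'_tendsto: "(\<lambda>j. sqrt_abs' j t) \<longlonglongrightarrow> sgn t"
proof (cases "t = 0")
  case False
  then have "(\<lambda>j. t / sqrt_abs j t) \<longlonglongrightarrow> t / \<bar>t\<bar>" by (intro tendsto_intros sqrt_abs_tendsto) auto
  then show ?thesis using False by (simp add: sqrt_abs'_def sgn_if abs_if split: if_splits)
qed (simp add: sqrt_abs'_def)

lemma smooth_on_sqrt_abs:
  assumes "open S" "smooth_on S f"
  shows "smooth_on S (\<lambda>x. sqrt_abs j (f x))"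
proof -
  have pos: "f x * f x + 1 / real (Suc j) * (1 / real (Suc j)) > 0" for x by (intro add_nonneg_pos) auto
  have "smooth_on S (\<lambda>x. (f x * f x + 1 / real (Suc j) * (1 / real (Suc j))) powr (1 / 2))"
    by (intro smooth_on_powr smooth_on_add smooth_on_mult smooth_on_const assms pos)
  then show ?thesis
    using smooth_on_cong[OF assms(1), of "\<lambda>x. (f x * f x + 1 / real (Suc j) * (1 / real (Suc j))) powr (1 / 2)" "\<lambda>x. sqrt_abs j (f x)"] pos
    by (simp add: sqrt_abs_def powr_half_sqrt power2_eq_square less_imp_le)
qed

lemma smooth_on_gen_bspline:
  assumes S: "open S" and q: "\<And>f. smooth_on S f \<Longrightarrow> smooth_on S (\<lambda>x. q (f x))"
  shows "smooth_on S f \<Longrightarrow> smooth_on S (\<lambda>x. gen_bspline q n (f x))"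
proof (induction n arbitrary: f rule: less_induct)
  case (less n f)
  note intros = smooth_on_add smooth_on_mult smooth_on_diff smooth_on_const S q less.prems
  consider "n = 0" | "n = Suc 0" | "n = Suc (Suc 0)" | k where "n = Suc (Suc (Suc k))"
    by (metis not0_implies_Suc)
  then show ?case
  proof cases
    case 3
    have "smooth_on S (\<lambda>x. (1 / 2) * (q (f x) - 2 * q (f x - 1) + q (f x - 2)))"
      by (intro intros)
    then show ?thesis unfolding 3 by simp
  next
    case 4
    have sub: "smooth_on S (\<lambda>x. f x - 1)" by (intro intros)
    have "smooth_on S (\<lambda>x. (1 / real (Suc (Suc k))) * (f x * gen_bspline q (Suc (Suc k)) (f x)
     + (real (Suc (Suc (Suc k))) - f x) * gen_bspline q (Suc (Suc k)) (f x - 1)))"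
      by (intro smooth_on_add smooth_on_mult smooth_on_diff smooth_on_const S less.prems)
         (use less.IH[of "Suc (Suc k)"] less.prems sub 4 in auto)
    then show ?thesis unfolding 4 by simp
  qed (auto intro: smooth_on_const[OF S])
qed

section \<open>Hardy's inequality on Lipschitz domains\<close>

text \<open>G^2 / t^(2 k + 1) vanishes near 0 and is nonnegative at \<open>T\<close>, so the
  integral of its derivative is nonnegative. The derivative consists of a mixed term and -(2 k + 1)
  G^2 / t^(2 k + 2); Young's inequality absorbs half of the latter. Estimating 2 k + 1 below by 1
  gives the constant 4 for all \<open>k\<close>.\<close>

lemma hardy_1d:
  fixes G G' :: "real \<Rightarrow> real"
  assumes D: "\<And>t. (G has_real_derivative G' t) (at t)" and cont: "continuous_on UNIV G'"
    and \<epsilon>: "\<epsilon> > 0" "\<And>t. 0 \<le> t \<Longrightarrow> t \<le> \<epsilon> \<Longrightarrow> G t = 0" and T: "T > 0"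
  shows "(\<integral>\<^sup>+t\<in>{0<..<T}. ennreal ((G t)\<^sup>2 / t ^ (2 * Suc k)) \<partial>lborel)
    \<le> 4 * (\<integral>\<^sup>+t\<in>{0<..<T}. ennreal ((G' t)\<^sup>2 / t ^ (2 * k)) \<partial>lborel)"
proof -
  \<comment> \<open>Below \<open>a\<close> the function is zero; on the interval from
    \<open>a\<close> to \<open>T\<close> all integrands are continuous, so the calculus can be done
    with ordinary integrals.\<close>
  define a where "a = min \<epsilon> T"
  have a: "0 < a" "a \<le> T" "a \<le> \<epsilon>" using \<epsilon> T by (auto simp: a_def)
  define A B where "A t = (G t)\<^sup>2 / t ^ (2 * Suc k)" and "B t = (G' t)\<^sup>2 / t ^ (2 * k)" for t
  define F where "F t = (G t)\<^sup>2 / t ^ (2 * k + 1)" for t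
  define F' where "F' t = 2 * G t * G' t / t ^ (2 * k + 1) - (2 * real k + 1) * A t" for t
  have contG: "continuous_on X G" for X
    using D DERIV_continuous continuous_at_imp_continuous_on by blast
  have contG': "continuous_on X G'" for X using cont continuous_on_subset by blast
  have pos: "t \<noteq> 0" if "t \<in> {a..T}" for t using that a by auto
  have cA: "continuous_on {a..T} A" and cB: "continuous_on {a..T} B" and cF': "continuous_on {a..T} F'"
    unfolding A_def B_def F'_def by (intro continuous_intros contG contG'; use pos in auto)+
  note iA = borel_integrable_atLeastAtMost'[OF cA] and iB = borel_integrable_atLeastAtMost'[OF cB]
    and iF' = borel_integrable_atLeastAtMost'[OF cF']
  have DF: "(F has_real_derivative F' t) (at t)" if "t \<in> {a..T}" for t
  proof -
    have t: "t \<noteq> 0" by (rule pos[OF that])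
    have "((\<lambda>t. (G t)\<^sup>2) has_real_derivative 2 * G t * G' t) (at t)"
      by (auto intro!: derivative_eq_intros D)
    from DERIV_quotient[OF this DERIV_pow[of "2 * k + 1"]] t
    have "((\<lambda>t. (G t)\<^sup>2 / t ^ (2 * k + 1)) has_real_derivative
      (2 * G t * G' t * t ^ (2 * k + 1) - (G t)\<^sup>2 * (real (2 * k + 1) * t ^ (2 * k))) / (t ^ (2 * k + 1) * t ^ (2 * k + 1))) (at t)"
      by (simp add: mult_ac power2_eq_square)
    moreover have "(2 * G t * G' t * t ^ (2 * k + 1) - (G t)\<^sup>2 * (real (2 * k + 1) * t ^ (2 * k))) / (t ^ (2 * k + 1) * t ^ (2 * k + 1)) = F' t"
      using t by (simp add: F'_def A_def divide_simps) (simp add: algebra_simps)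
    ultimately show ?thesis unfolding F_def by simp
  qed
  have FTC: "(LINT t:{a..T}|lborel. F' t) = F T - F a"
  proof -
    have "(F' has_integral (F T - F a)) {a..T}"
      using a(2) DF
      by (intro fundamental_theorem_of_calculus)
         (auto simp flip: has_real_derivative_iff_has_vector_derivative intro: has_field_derivative_at_within)
    then show ?thesis using set_borel_integral_eq_integral(2)[OF iF'] by (simp add: integral_unique)
  qed
  have "F a = 0" using \<epsilon>(2)[of a] a by (simp add: F_def)
  moreover have "F T \<ge> 0" using T by (simp add: F_def)
  ultimately have ge: "0 \<le> (LINT t:{a..T}|lborel. F' t)" using FTC \<open>F T \<ge> 0\<close> by simp
  \<comment> \<open>Young's inequality 2 x y \<le> x^2 / 2 + 2 y^2 with x = G / t^(k + 1) and y = G'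
    / t^k.\<close>
  have pt: "F' t \<le> 2 * B t - A t / 2" if "t \<in> {a..T}" for t
  proof -
    have t: "t > 0" using that a by auto
    have AB: "A t = (G t / t ^ Suc k)\<^sup>2" "B t = (G' t / t ^ k)\<^sup>2"
      unfolding A_def B_def power_even_eq power_divide by (rule refl)+
    have "t ^ (2 * k + 1) = t ^ Suc k * t ^ k" by (simp add: mult_2 power_add)
    then have GG: "G t * G' t / t ^ (2 * k + 1) = (G t / t ^ Suc k) * (G' t / t ^ k)" by simp
    have "0 \<le> (G t / t ^ Suc k - 2 * (G' t / t ^ k))\<^sup>2" by simp
    also have "\<dots> = A t - 4 * (G t * G' t / t ^ (2 * k + 1)) + 4 * B t"
      unfolding AB GG power2_diff power_mult_distrib by simp
    finally have "2 * (G t * G' t / t ^ (2 * k + 1)) \<le> A t / 2 + 2 * B t" by simp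
    moreover have "A t \<ge> 0" using t by (simp add: A_def)
    then have "A t \<le> (2 * real k + 1) * A t" by (simp add: algebra_simps)
    ultimately show ?thesis unfolding F'_def by simp
  qed
  have "(LINT t:{a..T}|lborel. F' t) \<le> (LINT t:{a..T}|lborel. 2 * B t - A t / 2)"
    using iA iB iF' pt by (intro set_integral_mono) (auto intro!: set_integral_diff(1) set_integrable_mult_right set_integrable_divide)
  also have "\<dots> = 2 * (LINT t:{a..T}|lborel. B t) - (LINT t:{a..T}|lborel. A t) / 2"
    using iA iB by (subst set_integral_diff(2)) (auto intro!: set_integrable_mult_right set_integrable_divide)
  finally have AB: "(LINT t:{a..T}|lborel. A t) \<le> 4 * (LINT t:{a..T}|lborel. B t)" using ge by linarith
  have AB_pos: "0 \<le> A t" "0 \<le> B t" for t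
    unfolding A_def B_def power_even_eq by (intro divide_nonneg_nonneg zero_le_power2)+
  have nn: "(\<integral>\<^sup>+t\<in>{a..T}. ennreal (X t) \<partial>lborel) = ennreal (LINT t:{a..T}|lborel. X t)"
    if X: "set_integrable lborel {a..T} X" "\<And>t. 0 \<le> X t" for X
  proof -
    have "(\<integral>\<^sup>+t\<in>{a..T}. ennreal (X t) \<partial>lborel) = (\<integral>\<^sup>+t. ennreal (indicator {a..T} t *\<^sub>R X t) \<partial>lborel)"
      by (rule nn_integral_cong) (auto simp: indicator_def)
    also have "\<dots> = ennreal (\<integral>t. indicator {a..T} t *\<^sub>R X t \<partial>lborel)"
      using X by (intro nn_integral_eq_integral) (auto simp: set_integrable_def)
    finally show ?thesis by (simp add: set_lebesgue_integral_def)
  qed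
  note nnA = nn[OF iA AB_pos(1)] and nnB = nn[OF iB AB_pos(2)]
  have "(\<integral>\<^sup>+t\<in>{0<..<T}. ennreal (A t) \<partial>lborel) \<le> (\<integral>\<^sup>+t\<in>{a..T}. ennreal (A t) \<partial>lborel)"
  proof (rule nn_integral_mono)
    fix t show "ennreal (A t) * indicator {0<..<T} t \<le> ennreal (A t) * indicator {a..T} t"
      using \<epsilon>(2)[of t] a by (cases "t < a") (auto simp: indicator_def A_def)
  qed
  also have "\<dots> \<le> ennreal (4 * (LINT t:{a..T}|lborel. B t))"
    unfolding nnA by (rule ennreal_leI[OF AB])
  also have "\<dots> = 4 * (\<integral>\<^sup>+t\<in>{a..T}. ennreal (B t) \<partial>lborel)"
    unfolding nnB by (subst ennreal_mult') auto
  also have "(\<integral>\<^sup>+t\<in>{a..T}. ennreal (B t) \<partial>lborel) \<le> (\<integral>\<^sup>+t\<in>{0<..<T}. ennreal (B t) \<partial>lborel)"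
  proof (rule nn_integral_mono_AE)
    show "AE t in lborel. ennreal (B t) * indicator {a..T} t \<le> ennreal (B t) * indicator {0<..<T} t"
      using AE_lborel_singleton[of T] by eventually_elim (use a in \<open>auto simp: indicator_def\<close>)
  qed
  finally show ?thesis by (simp add: A_def B_def mult_left_mono)
qed

text \<open>Fubini's theorem for lines in the direction \<open>e\<close>, each of which meets the slab in a segment
  of length one; this avoids rotating the coordinate system.\<close>

lemma nn_integral_lines:
  fixes F :: "'a::euclidean_space \<Rightarrow> ennreal"
  assumes [measurable]: "F \<in> borel_measurable borel" and e: "norm e = 1"
  shows "(\<integral>\<^sup>+x. F x \<partial>lborel)
    = (\<integral>\<^sup>+x. indicator {x. 0 \<le> x \<bullet> e \<and> x \<bullet> e < 1} x * (\<integral>\<^sup>+t. F (x + t *\<^sub>R e) \<partial>lborel) \<partial>lborel)"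
proof -
  define S where "S = {x. 0 \<le> x \<bullet> e \<and> x \<bullet> e < 1}"
  have [measurable]: "S \<in> sets borel" unfolding S_def by measurable
  have ee: "e \<bullet> e = 1" using e by (simp add: dot_square_norm)
  have "(\<integral>\<^sup>+x. indicator S x * (\<integral>\<^sup>+t. F (x + t *\<^sub>R e) \<partial>lborel) \<partial>lborel)
      = (\<integral>\<^sup>+x. \<integral>\<^sup>+t. indicator S x * F (x + t *\<^sub>R e) \<partial>lborel \<partial>lborel)"
    by (intro nn_integral_cong nn_integral_cmult[symmetric]) measurable
  also have "\<dots> = (\<integral>\<^sup>+t. \<integral>\<^sup>+x. indicator S x * F (x + t *\<^sub>R e) \<partial>lborel \<partial>lborel)"
    by (rule lborel_pair.Fubini') measurable
  also have "\<dots> = (\<integral>\<^sup>+t. \<integral>\<^sup>+x. indicator S (x - t *\<^sub>R e) * F x \<partial>lborel \<partial>lborel)"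
  proof (rule nn_integral_cong)
    fix t :: real
    show "(\<integral>\<^sup>+x. indicator S x * F (x + t *\<^sub>R e) \<partial>lborel) = (\<integral>\<^sup>+x. indicator S (x - t *\<^sub>R e) * F x \<partial>lborel)"
      using nn_integral_translate[of "\<lambda>x. indicator S (x - t *\<^sub>R e) * F x" "t *\<^sub>R e"] by simp
  qed
  also have "\<dots> = (\<integral>\<^sup>+x. \<integral>\<^sup>+t. indicator S (x - t *\<^sub>R e) * F x \<partial>lborel \<partial>lborel)"
    by (rule lborel_pair.Fubini'[symmetric]) measurable
  also have "\<dots> = (\<integral>\<^sup>+x. F x \<partial>lborel)"
  proof (rule nn_integral_cong)
    fix x
    have "(\<lambda>t. indicator S (x - t *\<^sub>R e) * F x) = (\<lambda>t. F x * indicator {x \<bullet> e - 1<..x \<bullet> e} t)"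
      by (auto simp: S_def indicator_def fun_eq_iff inner_diff_left ee)
    then show "(\<integral>\<^sup>+t. indicator S (x - t *\<^sub>R e) * F x \<partial>lborel) = F x"
      by (simp add: nn_integral_cmult_indicator)
  qed
  finally show ?thesis by (simp add: S_def)
qed

section \<open>Hardy's inequality in a cylinder over the boundary graph\<close>

definition perp :: "'a::real_inner \<Rightarrow> 'a \<Rightarrow> 'a" where
  "perp e y = y - (y \<bullet> e) *\<^sub>R e"

text \<open>The signed vertical distance from the graph. Along lines in direction \<open>e\<close>
  it is the line parameter up to a constant and so takes the place of \<open>t\<close> in
  \<open>hardy_1d\<close>.\<close>

definition height :: "'a::real_inner \<Rightarrow> ('a \<Rightarrow> real) \<Rightarrow> 'a \<Rightarrow> real" where
  "height e \<gamma> y = y \<bullet> e - \<gamma> (perp e y)"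

lemma perp_add: "norm e = 1 \<Longrightarrow> perp e (y + t *\<^sub>R e) = perp e y"
  by (simp add: perp_def inner_add_left dot_square_norm algebra_simps)

lemma height_add: "norm e = 1 \<Longrightarrow> height e \<gamma> (y + t *\<^sub>R e) = height e \<gamma> y + t"
  by (simp add: height_def perp_add inner_add_left dot_square_norm)

lemma norm_perp_diff: "norm e = 1 \<Longrightarrow> norm (perp e y - perp e z) \<le> 2 * norm (y - z)"
proof -
  assume e: "norm e = 1"
  have "perp e y - perp e z = (y - z) - ((y - z) \<bullet> e) *\<^sub>R e" by (simp add: perp_def algebra_simps)
  also have "norm \<dots> \<le> norm (y - z) + \<bar>(y - z) \<bullet> e\<bar>"
    using norm_triangle_ineq4[of "y - z" "((y - z) \<bullet> e) *\<^sub>R e"] e by simp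
  also have "\<bar>(y - z) \<bullet> e\<bar> \<le> norm (y - z)" using Cauchy_Schwarz_ineq2[of "y - z" e] e by simp
  finally show ?thesis by simp
qed

text \<open>\<open>hardy_1d\<close> on every vertical line, integrated by
  \<open>nn_integral_lines\<close>. The line meets the graph in a point outside \<open>U\<close>;
  the support of \<open>f\<close> is closed and misses it, so \<open>f\<close> vanishes on an
  initial piece of the line, whose length may depend on the line.\<close>

lemma hardy_cylinder:
  fixes f :: "real^'m \<Rightarrow> real"
  assumes f: "f \<in> test_functions U" and e: "norm e = 1" and \<gamma>: "continuous_on UNIV \<gamma>"
    and T: "T > 0"
    and bottom: "\<And>y. norm (perp e y - p') < T \<Longrightarrow> height e \<gamma> y = 0 \<Longrightarrow> y \<notin> U"
  defines "Y \<equiv> {y. norm (perp e y - p') < T \<and> 0 < height e \<gamma> y \<and> height e \<gamma> y < T}"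
  shows "(\<integral>\<^sup>+y\<in>Y. ennreal ((f y)\<^sup>2 / height e \<gamma> y ^ (2 * Suc k)) \<partial>lborel)
    \<le> 4 * (\<integral>\<^sup>+y\<in>Y. ennreal ((\<Sum>i\<in>UNIV. e $ i * partial_deriv i f y)\<^sup>2 / height e \<gamma> y ^ (2 * k)) \<partial>lborel)"
proof -
  let ?h = "height e \<gamma>"
  define g where "g y = (\<Sum>i\<in>UNIV. e $ i * partial_deriv i f y)" for y
  have contperp: "continuous_on UNIV (perp e)" unfolding perp_def by (intro continuous_intros)
  have conth: "continuous_on UNIV ?h" unfolding height_def
    by (intro continuous_intros continuous_on_compose2[OF \<gamma> contperp]) auto
  have [measurable]: "?h \<in> borel_measurable borel" "perp e \<in> borel_measurable borel"
    using conth contperp by (auto intro: borel_measurable_continuous_onI)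
  have sm: "smooth_on UNIV f" by (rule test_functionsD(1)[OF f])
  have contf: "continuous_on UNIV f" by (rule smooth_on_imp_continuous_on[OF sm])
  have contg: "continuous_on UNIV g" unfolding g_def
    by (intro continuous_intros smooth_on_imp_continuous_on smooth_on_partial_deriv sm)
  have [measurable]: "f \<in> borel_measurable borel" "g \<in> borel_measurable borel"
    using contf contg by (auto intro: borel_measurable_continuous_onI)
  have [measurable]: "Y \<in> sets borel" unfolding Y_def by measurable
  have line: "(\<integral>\<^sup>+t. ennreal ((f (x + t *\<^sub>R e))\<^sup>2 / ?h (x + t *\<^sub>R e) ^ (2 * Suc k)) * indicator Y (x + t *\<^sub>R e) \<partial>lborel)
      \<le> 4 * (\<integral>\<^sup>+t. ennreal ((g (x + t *\<^sub>R e))\<^sup>2 / ?h (x + t *\<^sub>R e) ^ (2 * k)) * indicator Y (x + t *\<^sub>R e) \<partial>lborel)"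
    (is "?L \<le> 4 * ?R") for x
  proof (cases "norm (perp e x - p') < T")
    case False
    then have "indicator Y (x + t *\<^sub>R e) = (0::ennreal)" for t by (simp add: Y_def perp_add e)
    then show ?thesis by simp
  next
    case True
    \<comment> \<open>The line is reparametrised so that its parameter is the height.\<close>
    define G where "G t = f (x - ?h x *\<^sub>R e + t *\<^sub>R e)" for t
    define G' where "G' t = g (x - ?h x *\<^sub>R e + t *\<^sub>R e)" for t
    have shift: "x + (t - ?h x) *\<^sub>R e = x - ?h x *\<^sub>R e + t *\<^sub>R e" for t by (simp add: algebra_simps)
    have hsh: "?h (x - ?h x *\<^sub>R e + t *\<^sub>R e) = t" for t
      using height_add[OF e, of \<gamma> x "t - ?h x"] by (simp add: shift)
    have Ush: "x - ?h x *\<^sub>R e + t *\<^sub>R e \<in> Y \<longleftrightarrow> t \<in> {0<..<T}" for t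
      using True hsh[of t] perp_add[OF e, of x "t - ?h x"] by (simp add: Y_def shift)
    have L: "?L = (\<integral>\<^sup>+t\<in>{0<..<T}. ennreal ((G t)\<^sup>2 / t ^ (2 * Suc k)) \<partial>lborel)"
      by (subst nn_integral_translate[of _ "- ?h x", symmetric], measurable)
         (simp add: shift G_def hsh Ush indicator_def)
    have R: "?R = (\<integral>\<^sup>+t\<in>{0<..<T}. ennreal ((G' t)\<^sup>2 / t ^ (2 * k)) \<partial>lborel)"
      by (subst nn_integral_translate[of _ "- ?h x", symmetric], measurable)
         (simp add: shift G'_def hsh Ush indicator_def)
    have DG: "(G has_real_derivative G' t) (at t)" for t
      unfolding G_def G'_def g_def
      by (rule DERIV_along_line) (rule smooth_on_imp_differentiable[OF sm open_UNIV UNIV_I])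
    have contG': "continuous_on UNIV G'" unfolding G'_def
      by (intro continuous_on_compose2[OF contg] continuous_intros) auto
    define z where "z = x - ?h x *\<^sub>R e"
    have "norm (perp e z - p') < T" "?h z = 0"
      using True perp_add[OF e, of x "- ?h x"] hsh[of 0] by (simp_all add: z_def)
    then have "z \<notin> U" using bottom by blast
    then have "z \<in> - support f" using test_functionsD(3)[OF f] by blast
    moreover have "open (- support f)" by (simp add: support_def open_Compl)
    ultimately obtain r where r: "r > 0" "ball z r \<subseteq> - support f" using open_contains_ball by blast
    have Gz: "G t = 0" if "0 \<le> t" "t \<le> r / 2" for t
    proof -
      have "z + t *\<^sub>R e \<in> ball z r" using that r(1) e by (simp add: dist_norm)
      then show ?thesis using r(2) by (auto simp: G_def z_def[symmetric] intro: not_in_support)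
    qed
    show ?thesis unfolding L R
      by (rule hardy_1d[where \<epsilon> = "r / 2", OF DG contG']) (use r(1) Gz T in auto)
  qed
  have "(\<integral>\<^sup>+y\<in>Y. ennreal ((f y)\<^sup>2 / ?h y ^ (2 * Suc k)) \<partial>lborel)
    = (\<integral>\<^sup>+x. indicator {x. 0 \<le> x \<bullet> e \<and> x \<bullet> e < 1} x * (\<integral>\<^sup>+t. ennreal ((f (x + t *\<^sub>R e))\<^sup>2 / ?h (x + t *\<^sub>R e) ^ (2 * Suc k)) * indicator Y (x + t *\<^sub>R e) \<partial>lborel) \<partial>lborel)"
    by (rule nn_integral_lines[OF _ e]) measurable
  also have "\<dots> \<le> (\<integral>\<^sup>+x. 4 * (indicator {x. 0 \<le> x \<bullet> e \<and> x \<bullet> e < 1} x * (\<integral>\<^sup>+t. ennreal ((g (x + t *\<^sub>R e))\<^sup>2 / ?h (x + t *\<^sub>R e) ^ (2 * k)) * indicator Y (x + t *\<^sub>R e) \<partial>lborel)) \<partial>lborel)"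
    by (rule nn_integral_mono, subst mult.left_commute, rule mult_left_mono[OF line]) simp
  also have "\<dots> = 4 * (\<integral>\<^sup>+x. (indicator {x. 0 \<le> x \<bullet> e \<and> x \<bullet> e < 1} x * (\<integral>\<^sup>+t. ennreal ((g (x + t *\<^sub>R e))\<^sup>2 / ?h (x + t *\<^sub>R e) ^ (2 * k)) * indicator Y (x + t *\<^sub>R e) \<partial>lborel)) \<partial>lborel)"
    by (rule nn_integral_cmult) measurable
  also have "\<dots> = 4 * (\<integral>\<^sup>+y\<in>Y. ennreal ((g y)\<^sup>2 / ?h y ^ (2 * k)) \<partial>lborel)"
    by (subst nn_integral_lines[OF _ e, symmetric], measurable)
  finally show ?thesis by (simp add: g_def)
qed

text \<open>Lists of directions are summed, so a mixed derivative is counted once for each order of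
  differentiation; this changes the square of the Sobolev norm only by bounded factors.\<close>

definition deriv_energy :: "nat \<Rightarrow> (real^'m \<Rightarrow> real) \<Rightarrow> ennreal" where
  "deriv_energy n f = (\<Sum>is | set is \<subseteq> UNIV \<and> length is \<le> n. \<integral>\<^sup>+x. ennreal ((iter_partial is f x)\<^sup>2) \<partial>lborel)"

lemma le_deriv_energy:
  fixes f :: "real^'m \<Rightarrow> real"
  assumes "length is \<le> n"
  shows "(\<integral>\<^sup>+x. ennreal ((iter_partial is f x)\<^sup>2) \<partial>lborel) \<le> deriv_energy n f"
  unfolding deriv_energy_def
  by (rule member_le_sum) (use assms finite_lists_length_le[of "UNIV :: 'm set" n] in simp_all)

text \<open>Each use of Hardy's inequality trades two powers of the height for a derivative in
  direction \<open>e\<close>. As \<open>e\<close> is a unit vector, Cauchy--Schwarz bounds its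
  square by the sum over all coordinate directions, whence a factor 4 times the dimension per
  step.\<close>

lemma hardy_cylinder_iter:
  fixes f :: "real^'m \<Rightarrow> real"
  assumes f: "f \<in> test_functions U" and e: "norm e = 1" and \<gamma>: "continuous_on UNIV \<gamma>"
    and T: "T > 0"
    and bottom: "\<And>y. norm (perp e y - p') < T \<Longrightarrow> height e \<gamma> y = 0 \<Longrightarrow> y \<notin> U"
  defines "Y \<equiv> {y. norm (perp e y - p') < T \<and> 0 < height e \<gamma> y \<and> height e \<gamma> y < T}"
  assumes "length is + k \<le> n"
  shows "(\<integral>\<^sup>+y\<in>Y. ennreal ((iter_partial is f y)\<^sup>2 / height e \<gamma> y ^ (2 * k)) \<partial>lborel)
    \<le> (4 * of_nat CARD('m)) ^ k * deriv_energy n f"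
  using assms(7)
proof (induction k arbitrary: "is")
  case 0
  have "(\<integral>\<^sup>+y\<in>Y. ennreal ((iter_partial is f y)\<^sup>2 / height e \<gamma> y ^ (2 * 0)) \<partial>lborel) \<le> (\<integral>\<^sup>+y. ennreal ((iter_partial is f y)\<^sup>2) \<partial>lborel)"
    by (rule nn_integral_mono) (auto simp: indicator_def)
  also have "\<dots> \<le> deriv_energy n f" using 0 by (intro le_deriv_energy) auto
  finally show ?case by simp
next
  case (Suc k)
  let ?h = "height e \<gamma>" and ?g = "iter_partial is f"
  have g: "?g \<in> test_functions U" by (rule test_functions_iter_partial[OF f])
  have contperp: "continuous_on UNIV (perp e)" unfolding perp_def by (intro continuous_intros)
  have conth: "continuous_on UNIV ?h" unfolding height_def
    by (intro continuous_intros continuous_on_compose2[OF \<gamma> contperp]) auto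
  have [measurable]: "?h \<in> borel_measurable borel" "perp e \<in> borel_measurable borel"
    using conth contperp by (auto intro: borel_measurable_continuous_onI)
  have [measurable]: "Y \<in> sets borel" unfolding Y_def by measurable
  have [measurable]: "iter_partial is f \<in> borel_measurable borel" for "is"
    by (rule borel_measurable_test[OF test_functions_iter_partial[OF f]])
  have "(\<integral>\<^sup>+y\<in>Y. ennreal ((?g y)\<^sup>2 / ?h y ^ (2 * Suc k)) \<partial>lborel)
    \<le> 4 * (\<integral>\<^sup>+y\<in>Y. ennreal ((\<Sum>i\<in>UNIV. e $ i * partial_deriv i ?g y)\<^sup>2 / ?h y ^ (2 * k)) \<partial>lborel)"
    unfolding Y_def by (rule hardy_cylinder[OF g e \<gamma> T bottom])
  also have "(\<integral>\<^sup>+y\<in>Y. ennreal ((\<Sum>i\<in>UNIV. e $ i * partial_deriv i ?g y)\<^sup>2 / ?h y ^ (2 * k)) \<partial>lborel)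
    \<le> (\<integral>\<^sup>+y. (\<Sum>i\<in>UNIV. ennreal ((iter_partial (i # is) f y)\<^sup>2 / ?h y ^ (2 * k)) * indicator Y y) \<partial>lborel)"
  proof (rule nn_integral_mono)
    fix y
    have "(\<Sum>i\<in>UNIV. e $ i * partial_deriv i ?g y)\<^sup>2 = (e \<bullet> (\<chi> i. partial_deriv i ?g y))\<^sup>2"
      by (simp add: inner_vec_def)
    also have "\<dots> \<le> (e \<bullet> e) * ((\<chi> i. partial_deriv i ?g y) \<bullet> (\<chi> i. partial_deriv i ?g y))"
      by (rule Cauchy_Schwarz_ineq)
    also have "\<dots> = (\<Sum>i\<in>UNIV. (iter_partial (i # is) f y)\<^sup>2)"
      using e by (simp add: dot_square_norm[of e] inner_vec_def[of "\<chi> i. partial_deriv i ?g y"] power2_eq_square iter_partial_Cons)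
    finally have "(\<Sum>i\<in>UNIV. e $ i * partial_deriv i ?g y)\<^sup>2 / ?h y ^ (2 * k)
       \<le> (\<Sum>i\<in>UNIV. (iter_partial (i # is) f y)\<^sup>2) / ?h y ^ (2 * k)"
      by (intro divide_right_mono) (auto simp: power_mult)
    also have "\<dots> = (\<Sum>i\<in>UNIV. (iter_partial (i # is) f y)\<^sup>2 / ?h y ^ (2 * k))" by (rule sum_divide_distrib)
    finally have "ennreal ((\<Sum>i\<in>UNIV. e $ i * partial_deriv i ?g y)\<^sup>2 / ?h y ^ (2 * k))
       \<le> (\<Sum>i\<in>UNIV. ennreal ((iter_partial (i # is) f y)\<^sup>2 / ?h y ^ (2 * k)))"
      by (subst sum_ennreal) (auto simp: power_mult intro: ennreal_leI)
    then show "ennreal ((\<Sum>i\<in>UNIV. e $ i * partial_deriv i ?g y)\<^sup>2 / ?h y ^ (2 * k)) * indicator Y y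
       \<le> (\<Sum>i\<in>UNIV. ennreal ((iter_partial (i # is) f y)\<^sup>2 / ?h y ^ (2 * k)) * indicator Y y)"
      by (simp add: indicator_def)
  qed
  also have "\<dots> = (\<Sum>i\<in>UNIV. \<integral>\<^sup>+y\<in>Y. ennreal ((iter_partial (i # is) f y)\<^sup>2 / ?h y ^ (2 * k)) \<partial>lborel)"
    by (rule nn_integral_sum) measurable
  also have "\<dots> \<le> (\<Sum>i\<in>(UNIV::'m set). (4 * of_nat CARD('m)) ^ k * deriv_energy n f)"
    using Suc.prems by (intro sum_mono Suc.IH) simp
  also have "4 * \<dots> = (4 * of_nat CARD('m)) ^ Suc k * deriv_energy n f"
    by (simp add: mult_ac)
  finally show ?case by (simp add: mult_left_mono)
qed

text \<open>Near a boundary point the height is at most a constant times the distance to the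
  boundary: the nearest boundary point has height at most 0, and the height is a Lipschitz function.
  So powers of the height in the denominator may be replaced by powers of the distance.\<close>

lemma hardy_local:
  fixes U :: "(real^'m) set"
  assumes U: "lipschitz_domain U" and p: "p \<in> frontier U"
  shows "\<exists>r>0. \<exists>C\<ge>0. \<forall>f\<in>test_functions U. \<forall>is k. length is + k \<le> n \<longrightarrow>
    (\<integral>\<^sup>+y\<in>U \<inter> ball p r. ennreal ((iter_partial is f y)\<^sup>2 / infdist y (frontier U) ^ (2 * k)) \<partial>lborel)
      \<le> ennreal C * deriv_energy n f"
proof -
  have op: "open U" using U by (simp add: lipschitz_domain_def)
  have "\<exists>r>0. \<exists>e \<gamma> L. norm e = 1 \<and> lipschitz_on L UNIV \<gamma> \<and>
      U \<inter> ball p r = {y \<in> ball p r. y \<bullet> e > \<gamma> (y - (y \<bullet> e) *\<^sub>R e)}"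
    using U p unfolding lipschitz_domain_def by blast
  then obtain r e \<gamma> L where r: "r > 0" and e: "norm e = 1" and L: "lipschitz_on L UNIV \<gamma>"
    and graph: "U \<inter> ball p r = {y \<in> ball p r. y \<bullet> e > \<gamma> (y - (y \<bullet> e) *\<^sub>R e)}" by blast
  let ?h = "height e \<gamma>"
  have L0: "L \<ge> 0" using L by (simp add: lipschitz_on_def)
  have \<gamma>c: "continuous_on UNIV \<gamma>" by (rule lipschitz_on_continuous_on[OF L])
  have inU: "y \<in> U \<longleftrightarrow> ?h y > 0" if "y \<in> ball p r" for y
    using graph that by (auto simp: height_def perp_def set_eq_iff)
  \<comment> \<open>A Lipschitz constant of the height: 1 for the component along \<open>e\<close>,
    and L times the factor 2 of \<open>norm_perp_diff\<close> for the graph.\<close>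
  define Kl where "Kl = 1 + 2 * L"
  have Kl: "Kl \<ge> 1" using L0 by (simp add: Kl_def)
  have hlip: "\<bar>?h y - ?h z\<bar> \<le> Kl * norm (y - z)" for y z
  proof -
    have "\<bar>\<gamma> (perp e y) - \<gamma> (perp e z)\<bar> \<le> L * norm (perp e y - perp e z)"
      using lipschitz_onD[OF L, of "perp e y" "perp e z"] by (simp add: dist_norm)
    also have "\<dots> \<le> L * (2 * norm (y - z))" by (intro mult_left_mono norm_perp_diff e L0)
    finally have "\<bar>\<gamma> (perp e y) - \<gamma> (perp e z)\<bar> \<le> L * (2 * norm (y - z))" .
    moreover have "\<bar>y \<bullet> e - z \<bullet> e\<bar> \<le> norm (y - z)"
      using Cauchy_Schwarz_ineq2[of "y - z" e] e by (simp add: inner_diff_left)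
    ultimately show ?thesis by (simp add: height_def Kl_def algebra_simps)
  qed
  have pr: "p \<in> ball p r" using r by simp
  have pn: "p \<notin> U" using p op by (simp add: frontier_def interior_open)
  \<comment> \<open>Since \<open>p\<close> lies outside the open set \<open>U\<close>, its height is
    not positive; since it is a limit of points of \<open>U\<close>, whose heights are positive, it
    is not negative.\<close>
  have hp: "?h p = 0"
  proof (rule antisym)
    show "?h p \<le> 0" using inU[OF pr] pn by simp
    show "0 \<le> ?h p"
    proof (rule ccontr)
      assume "\<not> 0 \<le> ?h p"
      define d where "d = min r (- ?h p / Kl)"
      have d: "d > 0" using r Kl \<open>\<not> 0 \<le> ?h p\<close> by (simp add: d_def divide_neg_pos)
      have "p \<in> closure U" using p by (simp add: frontier_def)
      then obtain y where y: "y \<in> U" "dist y p < d" using d closure_approachable by blast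
      then have "y \<in> ball p r" by (simp add: d_def dist_commute)
      then have "?h y > 0" using inU y by blast
      moreover have "?h y - ?h p \<le> Kl * norm (y - p)" using hlip[of y p] by linarith
      moreover have "Kl * norm (y - p) < - ?h p"
      proof -
        have "norm (y - p) < - ?h p / Kl" using y(2) by (simp add: d_def dist_norm)
        then show ?thesis using Kl by (smt (verit) pos_less_divide_eq mult.commute)
      qed
      ultimately show False by linarith
    qed
  qed
  \<comment> \<open>A graph point over the disc of radius \<open>T\<close> is at distance less than
    T (1 + L) from \<open>p\<close>, hence in the ball where the graph describes the domain; this
    excludes the base of the cylinder from \<open>U\<close>.\<close>
  define T where "T = r / (2 * (1 + L))"
  have T: "T > 0" "T * (1 + L) < r" "T < r"
    using r L0 by (auto simp: T_def divide_simps)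
  \<comment> \<open>Within distance \<open>r2\<close> of \<open>p\<close>, heights and horizontal
    distances stay below \<open>T\<close>, and the nearest boundary point is within 2 r2 of
    \<open>p\<close> and so in the ball of radius \<open>r\<close>.\<close>
  define r2 where "r2 = T / (2 * Kl)"
  have r2: "r2 > 0" "Kl * r2 < T" "2 * r2 \<le> T"
    using T Kl by (auto simp: r2_def divide_simps)
  have bottom: "y \<notin> U" if y: "norm (perp e y - perp e p) < T" "?h y = 0" for y
  proof -
    have "y - p = (perp e y - perp e p) + (y \<bullet> e - p \<bullet> e) *\<^sub>R e" by (simp add: perp_def algebra_simps)
    then have "norm (y - p) \<le> norm (perp e y - perp e p) + \<bar>y \<bullet> e - p \<bullet> e\<bar>"
      using norm_triangle_ineq[of "perp e y - perp e p" "(y \<bullet> e - p \<bullet> e) *\<^sub>R e"] e by simp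
    also have "y \<bullet> e - p \<bullet> e = \<gamma> (perp e y) - \<gamma> (perp e p)" using y(2) hp by (simp add: height_def)
    also have "\<bar>\<gamma> (perp e y) - \<gamma> (perp e p)\<bar> \<le> L * norm (perp e y - perp e p)"
      using lipschitz_onD[OF L, of "perp e y" "perp e p"] by (simp add: dist_norm)
    also have "norm (perp e y - perp e p) + L * norm (perp e y - perp e p) = norm (perp e y - perp e p) * (1 + L)"
      by (simp add: algebra_simps)
    also have "\<dots> \<le> T * (1 + L)" using y(1) L0 by (intro mult_right_mono) auto
    finally have "y \<in> ball p r" using T(2) by (simp add: dist_norm norm_minus_commute)
    then show ?thesis using inU y(2) by auto
  qed
  define Y where "Y = {y. norm (perp e y - perp e p) < T \<and> 0 < ?h y \<and> ?h y < T}"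
  have sub: "y \<in> Y \<and> 0 < infdist y (frontier U) \<and> ?h y \<le> Kl * infdist y (frontier U)" if y: "y \<in> U \<inter> ball p r2" for y
  proof -
    have yp: "norm (y - p) < r2" using y by (simp add: dist_norm norm_minus_commute)
    have "y \<in> ball p r" using yp r2 T by (simp add: dist_norm norm_minus_commute)
    then have hy: "?h y > 0" using inU y by blast
    have "?h y \<le> Kl * norm (y - p)" using hlip[of y p] hp by simp
    also have "\<dots> \<le> Kl * r2" using yp Kl by (intro mult_left_mono) auto
    finally have hT: "?h y < T" using r2(2) by simp
    have "norm (perp e y - perp e p) < T" using norm_perp_diff[OF e, of y p] yp r2 by linarith
    then have yU: "y \<in> Y" using hy hT by (simp add: Y_def)
    have ne: "frontier U \<noteq> {}" using p by blast
    obtain z where z: "z \<in> frontier U" "infdist y (frontier U) = dist y z"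
      using infdist_attains_inf[OF frontier_closed ne] by metis
    have "dist y z \<le> dist y p" using infdist_le[OF p, of y] z(2) by simp
    then have "dist p z < r" using dist_triangle[of p z y] yp r2 T by (simp add: dist_norm norm_minus_commute)
    then have "z \<in> ball p r" by simp
    moreover have "z \<notin> U" using z(1) op by (simp add: frontier_def interior_open)
    ultimately have hz: "?h z \<le> 0" using inU by force
    have "?h y \<le> Kl * norm (y - z)" using hlip[of y z] hz by linarith
    then have *: "?h y \<le> Kl * infdist y (frontier U)" using z(2) by (simp add: dist_norm)
    then have "0 < infdist y (frontier U)" using hy Kl by (smt (verit) infdist_nonneg mult_not_zero)
    then show ?thesis using yU * by blast
  qed
  define C where "C = Kl ^ (2 * n) * (4 * real CARD('m)) ^ n"
  have main: "(\<integral>\<^sup>+y\<in>U \<inter> ball p r2. ennreal ((iter_partial is f y)\<^sup>2 / infdist y (frontier U) ^ (2 * k)) \<partial>lborel)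
      \<le> ennreal C * deriv_energy n f" if f: "f \<in> test_functions U" and len: "length is + k \<le> n" for f "is" k
  proof -
    have [measurable]: "iter_partial is f \<in> borel_measurable borel"
      by (rule borel_measurable_test[OF test_functions_iter_partial[OF f]])
    have contperp: "continuous_on UNIV (perp e)" unfolding perp_def by (intro continuous_intros)
    have conth: "continuous_on UNIV ?h" unfolding height_def
      by (intro continuous_intros continuous_on_compose2[OF \<gamma>c contperp]) auto
    have [measurable]: "?h \<in> borel_measurable borel" "perp e \<in> borel_measurable borel"
      using conth contperp by (auto intro: borel_measurable_continuous_onI)
    have [measurable]: "Y \<in> sets borel" unfolding Y_def by measurable
    have "(\<integral>\<^sup>+y\<in>U \<inter> ball p r2. ennreal ((iter_partial is f y)\<^sup>2 / infdist y (frontier U) ^ (2 * k)) \<partial>lborel)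
      \<le> (\<integral>\<^sup>+y. ennreal (Kl ^ (2 * n)) * (ennreal ((iter_partial is f y)\<^sup>2 / ?h y ^ (2 * k)) * indicator Y y) \<partial>lborel)"
    proof (rule nn_integral_mono)
      fix y
      show "ennreal ((iter_partial is f y)\<^sup>2 / infdist y (frontier U) ^ (2 * k)) * indicator (U \<inter> ball p r2) y
         \<le> ennreal (Kl ^ (2 * n)) * (ennreal ((iter_partial is f y)\<^sup>2 / ?h y ^ (2 * k)) * indicator Y y)"
      proof (cases "y \<in> U \<inter> ball p r2")
        case True
        let ?d = "infdist y (frontier U)"
        have s: "y \<in> Y" "0 < ?d" "?h y \<le> Kl * ?d" using sub[OF True] by auto
        have hy: "0 < ?h y" using s(1) by (simp add: Y_def)
        have "?h y ^ (2 * k) \<le> (Kl * ?d) ^ (2 * k)" using s hy by (intro power_mono) auto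
        also have "\<dots> = Kl ^ (2 * k) * ?d ^ (2 * k)" by (simp add: power_mult_distrib)
        also have "\<dots> \<le> Kl ^ (2 * n) * ?d ^ (2 * k)"
          using Kl len s(2) by (intro mult_right_mono power_increasing) auto
        finally have "1 / ?d ^ (2 * k) \<le> Kl ^ (2 * n) * (1 / ?h y ^ (2 * k))"
          using s(2) hy by (simp add: divide_simps mult.commute)
        then have "(iter_partial is f y)\<^sup>2 * (1 / ?d ^ (2 * k)) \<le> (iter_partial is f y)\<^sup>2 * (Kl ^ (2 * n) * (1 / ?h y ^ (2 * k)))"
          by (intro mult_left_mono) auto
        then have "(iter_partial is f y)\<^sup>2 / ?d ^ (2 * k) \<le> Kl ^ (2 * n) * ((iter_partial is f y)\<^sup>2 / ?h y ^ (2 * k))"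
          by (simp add: mult_ac)
        then show ?thesis using True s(1) Kl by (simp add: ennreal_leI flip: ennreal_mult')
      qed simp
    qed
    also have "\<dots> = ennreal (Kl ^ (2 * n)) * (\<integral>\<^sup>+y\<in>Y. ennreal ((iter_partial is f y)\<^sup>2 / ?h y ^ (2 * k)) \<partial>lborel)"
      by (rule nn_integral_cmult) measurable
    also have "\<dots> \<le> ennreal (Kl ^ (2 * n)) * ((4 * of_nat CARD('m)) ^ k * deriv_energy n f)"
      unfolding Y_def by (intro mult_left_mono hardy_cylinder_iter[OF f e \<gamma>c T(1) bottom len]) auto
    also have "\<dots> \<le> ennreal (Kl ^ (2 * n)) * ((4 * of_nat CARD('m)) ^ n * deriv_energy n f)"
    proof -
      have "(1::ennreal) \<le> 4 * of_nat CARD('m)"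
      proof -
        have "(1::nat) \<le> 4 * CARD('m)" using zero_less_card_finite[where 'a='m] by linarith
        then have "(of_nat 1 :: ennreal) \<le> of_nat (4 * CARD('m))" by (rule of_nat_mono)
        then show ?thesis by simp
      qed
      then show ?thesis using len by (intro mult_left_mono mult_right_mono power_increasing) auto
    qed
    also have "\<dots> = ennreal C * deriv_energy n f"
    proof -
      have "(4 * of_nat CARD('m)) ^ n = ennreal ((4 * real CARD('m)) ^ n)"
        by (simp add: ennreal_power[symmetric] ennreal_mult ennreal_of_nat_eq_real_of_nat)
      then show ?thesis using Kl by (simp add: C_def ennreal_mult mult.assoc)
    qed
    finally show ?thesis .
  qed
  have "C \<ge> 0" using Kl by (simp add: C_def)
  then show ?thesis using r2(1) main by blast
qed

text \<open>Finitely many of the local balls cover the compact boundary. What remains of the closure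
  is a compact subset of \<open>U\<close>, at positive distance from the boundary, where the weight
  is harmless.\<close>

theorem hardy_lipschitz_domain:
  fixes U :: "(real^'m) set"
  assumes bd: "bounded U" and U: "lipschitz_domain U"
  obtains C where "C > 0" "\<And>f is k. f \<in> test_functions U \<Longrightarrow> length is + k \<le> n \<Longrightarrow>
    (\<integral>\<^sup>+y\<in>U. ennreal ((iter_partial is f y)\<^sup>2 / infdist y (frontier U) ^ (2 * k)) \<partial>lborel)
      \<le> ennreal C * deriv_energy n f"
proof -
  have op: "open U" and ne: "U \<noteq> {}" using U by (auto simp: lipschitz_domain_def)
  define Q where "Q p r C \<longleftrightarrow> (\<forall>f\<in>test_functions U. \<forall>is k. length is + k \<le> n \<longrightarrow>
    (\<integral>\<^sup>+y\<in>U \<inter> ball p r. ennreal ((iter_partial is f y)\<^sup>2 / infdist y (frontier U) ^ (2 * k)) \<partial>lborel)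
      \<le> ennreal C * deriv_energy n f)" for p r C
  have "\<exists>r>0. \<exists>C\<ge>0. Q p r C" if "p \<in> frontier U" for p
    unfolding Q_def by (rule hardy_local[OF U that])
  then have "\<forall>p\<in>frontier U. \<exists>r. r > 0 \<and> (\<exists>C\<ge>0. Q p r C)" by blast
  from bchoice[OF this] obtain r where r: "\<forall>p\<in>frontier U. r p > 0 \<and> (\<exists>C\<ge>0. Q p (r p) C)" by blast
  then have "\<forall>p\<in>frontier U. \<exists>C. C \<ge> 0 \<and> Q p (r p) C" by blast
  from bchoice[OF this] obtain C where C: "\<forall>p\<in>frontier U. C p \<ge> 0 \<and> Q p (r p) (C p)" by blast
  have rC: "r p > 0 \<and> C p \<ge> 0 \<and> (\<forall>f\<in>test_functions U. \<forall>is k. length is + k \<le> n \<longrightarrow>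
    (\<integral>\<^sup>+y\<in>U \<inter> ball p (r p). ennreal ((iter_partial is f y)\<^sup>2 / infdist y (frontier U) ^ (2 * k)) \<partial>lborel)
      \<le> ennreal (C p) * deriv_energy n f)" if "p \<in> frontier U" for p
    using r C that unfolding Q_def by blast
  have "compact (frontier U)" using bd by (simp add: compact_frontier_bounded)
  moreover have "frontier U \<subseteq> (\<Union>p\<in>frontier U. ball p (r p))" using rC by force
  ultimately obtain D where D: "D \<subseteq> frontier U" "finite D" "frontier U \<subseteq> (\<Union>p\<in>D. ball p (r p))"
    using compactE_image[of "frontier U" "frontier U" "\<lambda>p. ball p (r p)"] by (metis open_ball)
  define Z where "Z = closure U - (\<Union>p\<in>D. ball p (r p))"
  have "compact Z" unfolding Z_def using bd by (intro compact_diff) auto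
  have ZU: "Z \<subseteq> U" using D(3) op by (auto simp: Z_def frontier_def interior_open)
  have fne: "frontier U \<noteq> {}" using bd ne op
    by (metis frontier_eq_empty not_bounded_UNIV)
  have "\<exists>\<delta>>0. \<forall>y\<in>Z. \<delta> \<le> infdist y (frontier U)"
  proof (cases "Z = {}")
    case False
    have "continuous_on Z (\<lambda>y. infdist y (frontier U))" by (intro continuous_intros)
    from continuous_attains_inf[OF \<open>compact Z\<close> False this]
    obtain y0 where y0: "y0 \<in> Z" "\<And>y. y \<in> Z \<Longrightarrow> infdist y0 (frontier U) \<le> infdist y (frontier U)"
      by blast
    have "y0 \<notin> frontier U" using y0(1) ZU op by (auto simp: frontier_def interior_open)
    then have "infdist y0 (frontier U) > 0" using infdist_pos_not_in_closed[OF frontier_closed fne] by blast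
    then show ?thesis using y0 by blast
  qed (auto intro: exI[of _ 1])
  then obtain \<delta>' where \<delta>': "\<delta>' > 0" "\<And>y. y \<in> Z \<Longrightarrow> \<delta>' \<le> infdist y (frontier U)" by blast
  \<comment> \<open>With \<delta> at most 1 the factor 1 / \<delta>^(2 n) dominates 1 / \<delta>^(2
    k) for all k up to \<open>n\<close>.\<close>
  define \<delta> where "\<delta> = min 1 \<delta>'"
  have \<delta>: "\<delta> > 0" "\<delta> \<le> 1" "\<And>y. y \<in> Z \<Longrightarrow> \<delta> \<le> infdist y (frontier U)"
    using \<delta>' by (auto simp: \<delta>_def min_le_iff_disj)
  define C0 where "C0 = 1 / \<delta> ^ (2 * n) + (\<Sum>p\<in>D. C p)"
  have Cp: "0 \<le> C p" if "p \<in> D" for p using rC that D(1) by blast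
  have "C0 > 0" unfolding C0_def using \<delta> Cp by (intro add_pos_nonneg sum_nonneg) auto
  moreover have "(\<integral>\<^sup>+y\<in>U. ennreal ((iter_partial is f y)\<^sup>2 / infdist y (frontier U) ^ (2 * k)) \<partial>lborel)
      \<le> ennreal C0 * deriv_energy n f" if f: "f \<in> test_functions U" and len: "length is + k \<le> n" for f "is" k
  proof -
    let ?F = "\<lambda>y. ennreal ((iter_partial is f y)\<^sup>2 / infdist y (frontier U) ^ (2 * k))"
    have [measurable]: "iter_partial is f \<in> borel_measurable borel"
      by (rule borel_measurable_test[OF test_functions_iter_partial[OF f]])
    have [measurable]: "(\<lambda>y. infdist y (frontier U)) \<in> borel_measurable borel"
      by (intro borel_measurable_continuous_onI continuous_intros)
    have [measurable]: "U \<in> sets borel" using op by simp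
    have "(\<integral>\<^sup>+y\<in>U. ?F y \<partial>lborel) \<le> (\<integral>\<^sup>+y. (ennreal (1 / \<delta> ^ (2 * n)) * ennreal ((iter_partial is f y)\<^sup>2)
        + (\<Sum>p\<in>D. ?F y * indicator (U \<inter> ball p (r p)) y)) \<partial>lborel)"
    proof (rule nn_integral_mono)
      fix y
      show "?F y * indicator U y \<le> ennreal (1 / \<delta> ^ (2 * n)) * ennreal ((iter_partial is f y)\<^sup>2)
        + (\<Sum>p\<in>D. ?F y * indicator (U \<inter> ball p (r p)) y)"
      proof (cases "y \<in> U")
        case yO: True
        show ?thesis
        proof (cases "\<exists>p\<in>D. y \<in> ball p (r p)")
          case True
          then obtain p where p: "p \<in> D" "y \<in> ball p (r p)" by blast
          have "?F y * indicator U y = ?F y * indicator (U \<inter> ball p (r p)) y" using p yO by simp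
          also have "\<dots> \<le> (\<Sum>p\<in>D. ?F y * indicator (U \<inter> ball p (r p)) y)"
            by (rule member_le_sum[OF p(1)]) (use D(2) in auto)
          also have "\<dots> \<le> ennreal (1 / \<delta> ^ (2 * n)) * ennreal ((iter_partial is f y)\<^sup>2) + \<dots>" by simp
          finally show ?thesis .
        next
          case False
          then have "y \<in> Z" using yO closure_subset by (auto simp: Z_def)
          then have d: "\<delta> \<le> infdist y (frontier U)" by (rule \<delta>(3))
          have "\<delta> ^ (2 * n) \<le> \<delta> ^ (2 * k)" using \<delta> len by (intro power_decreasing) auto
          also have "\<dots> \<le> infdist y (frontier U) ^ (2 * k)" using d \<delta> by (intro power_mono) auto
          finally have "(iter_partial is f y)\<^sup>2 / infdist y (frontier U) ^ (2 * k) \<le> (iter_partial is f y)\<^sup>2 / \<delta> ^ (2 * n)"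
            using \<delta>(1) d by (intro divide_left_mono mult_pos_pos zero_less_power) auto
          then have "?F y \<le> ennreal (1 / \<delta> ^ (2 * n)) * ennreal ((iter_partial is f y)\<^sup>2)"
            using \<delta> by (simp add: ennreal_leI flip: ennreal_mult')
          then show ?thesis using yO by (simp add: add_increasing2)
        qed
      qed simp
    qed
    also have "\<dots> = ennreal (1 / \<delta> ^ (2 * n)) * (\<integral>\<^sup>+y. ennreal ((iter_partial is f y)\<^sup>2) \<partial>lborel)
        + (\<Sum>p\<in>D. \<integral>\<^sup>+y\<in>U \<inter> ball p (r p). ?F y \<partial>lborel)"
    proof -
      have [measurable]: "?F \<in> borel_measurable borel" by measurable
      have m: "(\<lambda>y. ?F y * indicator (U \<inter> ball p (r p)) y) \<in> borel_measurable lborel" for p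
      proof -
        have [measurable]: "U \<inter> ball p (r p) \<in> sets borel" using op by (simp add: open_Int borel_open)
        show ?thesis by measurable
      qed
      have "(\<integral>\<^sup>+y. (\<Sum>p\<in>D. ?F y * indicator (U \<inter> ball p (r p)) y) \<partial>lborel) = (\<Sum>p\<in>D. \<integral>\<^sup>+y\<in>U \<inter> ball p (r p). ?F y \<partial>lborel)"
        by (rule nn_integral_sum) (rule m)
      moreover have "(\<integral>\<^sup>+y. ennreal (1 / \<delta> ^ (2 * n)) * ennreal ((iter_partial is f y)\<^sup>2) \<partial>lborel) = ennreal (1 / \<delta> ^ (2 * n)) * (\<integral>\<^sup>+y. ennreal ((iter_partial is f y)\<^sup>2) \<partial>lborel)"
        by (rule nn_integral_cmult) measurable
      moreover have "(\<lambda>y. \<Sum>p\<in>D. ?F y * indicator (U \<inter> ball p (r p)) y) \<in> borel_measurable lborel"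
        by (intro borel_measurable_sum m)
      ultimately show ?thesis by (subst nn_integral_add) simp_all
    qed
    also have "\<dots> \<le> ennreal (1 / \<delta> ^ (2 * n)) * deriv_energy n f + (\<Sum>p\<in>D. ennreal (C p) * deriv_energy n f)"
      using len rC D(1) f by (intro add_mono mult_left_mono sum_mono le_deriv_energy) auto
    also have "\<dots> = ennreal C0 * deriv_energy n f"
      using \<delta> Cp by (simp add: C0_def ennreal_plus sum_nonneg distrib_right sum_distrib_right flip: sum_ennreal)
    finally show ?thesis .
  qed
  ultimately show ?thesis using that by blast
qed

section \<open>Quasi-optimality of the Galerkin approximation\<close>

lemma Linf_AE_bound:
  assumes "f \<in> Linf U"
  shows "AE x in lebesgue_on U. \<bar>f x\<bar> \<le> Linf_norm U f"
proof -
  let ?s = "esssup (lebesgue_on U) (\<lambda>x. ereal \<bar>f x\<bar>)"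
  have ae: "AE x in lebesgue_on U. ereal \<bar>f x\<bar> \<le> ?s" by (rule esssup_AE)
  have "?s < \<infinity>" using assms by (simp add: Linf_def)
  then show ?thesis using ae by (cases ?s) (auto simp: Linf_norm_def)
qed

lemma essinf_AE_bound:
  assumes "essinf U q \<ge> ereal c"
  shows "AE x in lebesgue_on U. c \<le> q x"
proof -
  let ?s = "esssup (lebesgue_on U) (\<lambda>x. ereal (- q x))"
  have "?s \<le> ereal (- c)" using assms by (cases ?s) (auto simp: essinf_def)
  moreover have "AE x in lebesgue_on U. ereal (- q x) \<le> ?s" by (rule esssup_AE)
  ultimately have "AE x in lebesgue_on U. ereal (- q x) \<le> ereal (- c)" by (auto elim!: eventually_mono intro: order_trans simp del: ereal_less_eq)
  then show ?thesis by simp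
qed

text \<open>The integrand of the bilinear form, with values and gradients at one point as
  independent variables. Coercivity and boundedness become algebraic inequalities in these
  variables.\<close>

definition form_density ::
  "real^'m^'m \<Rightarrow> real^'m \<Rightarrow> real \<Rightarrow> real \<Rightarrow> real \<Rightarrow> real^'m \<Rightarrow> real \<Rightarrow> real^'m \<Rightarrow> real \<Rightarrow> real^'m \<Rightarrow> real \<Rightarrow> real^'m \<Rightarrow> real" where
  "form_density P R q1 q2 a1 g1 a2 g2 b1 k1 b2 k2 =
     k1 \<bullet> (P *v g1) + k2 \<bullet> (P *v g2) + (b1 * (R \<bullet> g1) + b2 * (R \<bullet> g2))
     + ((q1 * a1 + q2 * a2) * b1 + (q1 * a2 - q2 * a1) * b2)"

text \<open>Here \<open>a\<close>, \<open>b\<close>, \<open>c\<close> stand for the exact solution,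
  the Galerkin solution and a competitor. With error e = a - b and z = c - b, bilinearity gives the
  value at (e, e) as the value at (e, a - c) plus that at (a, z) minus that at (b, z); the last two
  cancel after integration.\<close>

lemma form_density_diff:
  "form_density P R q1 q2 (a1 - b1) (g1 - k1) (a2 - b2) (g2 - k2) (a1 - b1) (g1 - k1) (a2 - b2) (g2 - k2)
   = form_density P R q1 q2 (a1 - b1) (g1 - k1) (a2 - b2) (g2 - k2) (a1 - c1) (g1 - l1) (a2 - c2) (g2 - l2)
   + form_density P R q1 q2 a1 g1 a2 g2 (c1 - b1) (l1 - k1) (c2 - b2) (l2 - k2)
   - form_density P R q1 q2 b1 k1 b2 k2 (c1 - b1) (l1 - k1) (c2 - b2) (l2 - k2)"
  by (simp add: form_density_def matrix_vector_mult_diff_distrib inner_diff_left inner_diff_right algebra_simps)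

text \<open>Expands the square of \<alpha> g + a R and divides by 2 \<alpha>; this splitting makes
  the constants match the lower bound on \<open>q1\<close>.\<close>

lemma inner_mult_ge:
  fixes R g :: "real^'m"
  assumes \<alpha>: "\<alpha> > 0" and R: "(norm R)\<^sup>2 \<le> S"
  shows "a * (R \<bullet> g) \<ge> - (\<alpha> / 2 * (norm g)\<^sup>2) - S / (2 * \<alpha>) * a\<^sup>2"
proof -
  have "0 \<le> (norm (\<alpha> *\<^sub>R g + a *\<^sub>R R))\<^sup>2" by simp
  also have "\<dots> = \<alpha>\<^sup>2 * (norm g)\<^sup>2 + 2 * \<alpha> * (a * (R \<bullet> g)) + a\<^sup>2 * (norm R)\<^sup>2"
    unfolding power2_norm_eq_inner by (simp add: inner_add_left inner_add_right inner_commute power2_eq_square algebra_simps)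
  also have "\<dots> \<le> \<alpha>\<^sup>2 * (norm g)\<^sup>2 + 2 * \<alpha> * (a * (R \<bullet> g)) + a\<^sup>2 * S"
    using R by (simp add: mult_left_mono)
  finally have "0 \<le> (\<alpha>\<^sup>2 * (norm g)\<^sup>2 + 2 * \<alpha> * (a * (R \<bullet> g)) + a\<^sup>2 * S) / (2 * \<alpha>)" using \<alpha> by simp
  also have "\<dots> = \<alpha> / 2 * (norm g)\<^sup>2 + a * (R \<bullet> g) + S / (2 * \<alpha>) * a\<^sup>2"
    using \<alpha> by (simp add: field_simps power2_eq_square)
  finally show ?thesis by linarith
qed

text \<open>The terms with \<open>q2\<close> cancel on the diagonal. Half of the ellipticity pays
  for the convection term, and the part S / (2 \<alpha>) of the lower bound on \<open>q1\<close>
  absorbs what this leaves; \<alpha> / 2 remains for both values and gradients.\<close>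

lemma form_density_coercive:
  assumes \<alpha>: "\<alpha> > 0" and P: "\<And>g. g \<bullet> (P *v g) \<ge> \<alpha> * (g \<bullet> g)" and R: "(norm R)\<^sup>2 \<le> S"
    and q: "q1 \<ge> \<alpha> / 2 + S / (2 * \<alpha>)"
  shows "form_density P R q1 q2 a1 g1 a2 g2 a1 g1 a2 g2 \<ge> \<alpha> / 2 * ((a1\<^sup>2 + (norm g1)\<^sup>2) + (a2\<^sup>2 + (norm g2)\<^sup>2))"
proof -
  have P': "g \<bullet> (P *v g) \<ge> \<alpha> * (norm g)\<^sup>2" for g using P[of g] by (simp add: power2_norm_eq_inner)
  have q': "q1 * a\<^sup>2 \<ge> \<alpha> / 2 * a\<^sup>2 + S / (2 * \<alpha>) * a\<^sup>2" for a
    using mult_right_mono[OF q, of "a\<^sup>2"] by (simp add: distrib_right)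
  have "form_density P R q1 q2 a1 g1 a2 g2 a1 g1 a2 g2
    = g1 \<bullet> (P *v g1) + g2 \<bullet> (P *v g2) + (a1 * (R \<bullet> g1) + a2 * (R \<bullet> g2)) + (q1 * a1\<^sup>2 + q1 * a2\<^sup>2)"
    by (simp add: form_density_def algebra_simps power2_eq_square)
  moreover have "\<alpha> / 2 * ((a1\<^sup>2 + (norm g1)\<^sup>2) + (a2\<^sup>2 + (norm g2)\<^sup>2))
    = \<alpha> / 2 * a1\<^sup>2 + \<alpha> / 2 * (norm g1)\<^sup>2 + \<alpha> / 2 * a2\<^sup>2 + \<alpha> / 2 * (norm g2)\<^sup>2"
    "\<alpha> * (norm g)\<^sup>2 = \<alpha> / 2 * (norm g)\<^sup>2 + \<alpha> / 2 * (norm g)\<^sup>2" for g :: "real^'a"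
    by (simp_all add: algebra_simps)
  ultimately show ?thesis
    using P'[of g1] P'[of g2] q'[of a1] q'[of a2] inner_mult_ge[OF \<alpha> R, of g1 a1] inner_mult_ge[OF \<alpha> R, of g2 a2]
    by (smt (verit))
qed

text \<open>Eight products are estimated by Young's inequality with weight \<alpha> / 8. Each of the
  four quantities of the first argument occurs in two of them, which adds up to \<alpha> / 4, half
  of the coercivity constant; each value of the second argument occurs in three, whence the factor
  6.\<close>

lemma form_density_bound:
  assumes \<alpha>: "\<alpha> > 0" and K: "K \<ge> 0" and P: "\<And>g. norm (P *v g) \<le> K * norm g" and R: "norm R \<le> K"
    and q: "\<bar>q1\<bar> \<le> K" "\<bar>q2\<bar> \<le> K"
  shows "form_density P R q1 q2 a1 g1 a2 g2 b1 k1 b2 k2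
    \<le> \<alpha> / 4 * ((a1\<^sup>2 + (norm g1)\<^sup>2) + (a2\<^sup>2 + (norm g2)\<^sup>2))
      + 6 * K\<^sup>2 / \<alpha> * ((b1\<^sup>2 + (norm k1)\<^sup>2) + (b2\<^sup>2 + (norm k2)\<^sup>2))"
proof -
  have young: "K * (x * y) \<le> \<alpha> / 8 * x\<^sup>2 + 2 * K\<^sup>2 / \<alpha> * y\<^sup>2" for x y
  proof -
    have "0 \<le> (\<alpha> * x - 4 * K * y)\<^sup>2 / (8 * \<alpha>)" using \<alpha> by simp
    also have "\<dots> = \<alpha> / 8 * x\<^sup>2 + 2 * K\<^sup>2 / \<alpha> * y\<^sup>2 - K * (x * y)"
      using \<alpha> by (simp add: power2_diff field_simps power2_eq_square)
    finally show ?thesis by linarith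
  qed
  have kPg: "k \<bullet> (P *v g) \<le> \<alpha> / 8 * (norm g)\<^sup>2 + 2 * K\<^sup>2 / \<alpha> * (norm k)\<^sup>2" for k g
  proof -
    have "k \<bullet> (P *v g) \<le> norm k * norm (P *v g)" by (rule norm_cauchy_schwarz)
    also have "\<dots> \<le> norm k * (K * norm g)" by (rule mult_left_mono[OF P]) simp
    also have "\<dots> = K * (norm g * norm k)" by simp
    finally show ?thesis using young[of "norm g" "norm k"] by linarith
  qed
  have bRg: "b * (R \<bullet> g) \<le> \<alpha> / 8 * (norm g)\<^sup>2 + 2 * K\<^sup>2 / \<alpha> * b\<^sup>2" for b g
  proof -
    have "b * (R \<bullet> g) \<le> \<bar>b\<bar> * \<bar>R \<bullet> g\<bar>" by (metis abs_ge_self abs_mult)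
    also have "\<dots> \<le> \<bar>b\<bar> * (norm R * norm g)" by (rule mult_left_mono[OF Cauchy_Schwarz_ineq2]) simp
    also have "\<dots> \<le> \<bar>b\<bar> * (K * norm g)" using R by (intro mult_left_mono mult_right_mono) auto
    also have "\<dots> = K * (norm g * \<bar>b\<bar>)" by simp
    finally show ?thesis using young[of "norm g" "\<bar>b\<bar>"] by simp
  qed
  have qab: "q * a * b \<le> \<alpha> / 8 * a\<^sup>2 + 2 * K\<^sup>2 / \<alpha> * b\<^sup>2" if "\<bar>q\<bar> \<le> K" for q a b
  proof -
    have "q * a * b \<le> \<bar>q\<bar> * (\<bar>a\<bar> * \<bar>b\<bar>)" by (metis abs_ge_self abs_mult mult.assoc)
    also have "\<dots> \<le> K * (\<bar>a\<bar> * \<bar>b\<bar>)" using that by (intro mult_right_mono) auto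
    finally show ?thesis using young[of "\<bar>a\<bar>" "\<bar>b\<bar>"] by simp
  qed
  have q2': "\<bar>- q2\<bar> \<le> K" using q by simp
  define t where "t = 2 * K\<^sup>2 / \<alpha>"
  have t: "t \<ge> 0" using \<alpha> by (simp add: t_def)
  have t6: "6 * K\<^sup>2 / \<alpha> = 3 * t" by (simp add: t_def)
  have "form_density P R q1 q2 a1 g1 a2 g2 b1 k1 b2 k2
    = k1 \<bullet> (P *v g1) + k2 \<bullet> (P *v g2) + b1 * (R \<bullet> g1) + b2 * (R \<bullet> g2)
     + q1 * a1 * b1 + q2 * a2 * b1 + q1 * a2 * b2 + - q2 * a1 * b2"
    by (simp add: form_density_def algebra_simps)
  also have "\<dots> \<le> (\<alpha> / 8 * (norm g1)\<^sup>2 + t * (norm k1)\<^sup>2) + (\<alpha> / 8 * (norm g2)\<^sup>2 + t * (norm k2)\<^sup>2)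
     + (\<alpha> / 8 * (norm g1)\<^sup>2 + t * b1\<^sup>2) + (\<alpha> / 8 * (norm g2)\<^sup>2 + t * b2\<^sup>2)
     + (\<alpha> / 8 * a1\<^sup>2 + t * b1\<^sup>2) + (\<alpha> / 8 * a2\<^sup>2 + t * b1\<^sup>2) + (\<alpha> / 8 * a2\<^sup>2 + t * b2\<^sup>2) + (\<alpha> / 8 * a1\<^sup>2 + t * b2\<^sup>2)"
    unfolding t_def by (intro add_mono kPg bRg qab q q2')
  also have "\<dots> = \<alpha> / 4 * ((a1\<^sup>2 + (norm g1)\<^sup>2) + (a2\<^sup>2 + (norm g2)\<^sup>2)) + t * ((norm k1)\<^sup>2 + (norm k2)\<^sup>2 + 3 * (b1\<^sup>2 + b2\<^sup>2))"
    by (simp add: algebra_simps)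
  also have "\<dots> \<le> \<alpha> / 4 * ((a1\<^sup>2 + (norm g1)\<^sup>2) + (a2\<^sup>2 + (norm g2)\<^sup>2)) + t * (3 * ((b1\<^sup>2 + (norm k1)\<^sup>2) + (b2\<^sup>2 + (norm k2)\<^sup>2)))"
    using t by (intro add_left_mono mult_left_mono) auto
  finally show ?thesis unfolding t6 by (simp only: mult.assoc mult.left_commute[of t 3])
qed

lemma norm_matrix_vector_le:
  fixes A :: "real^'n^'m"
  assumes "\<And>i j. \<bar>A $ i $ j\<bar> \<le> K"
  shows "norm (A *v g) \<le> real CARD('m) * (real CARD('n) * K) * norm g"
proof -
  have "norm (A *v g) \<le> (\<Sum>i\<in>UNIV. \<bar>(A *v g) $ i\<bar>)" by (rule norm_le_l1_cart)
  also have "\<dots> \<le> (\<Sum>i\<in>(UNIV::'m set). (real CARD('n) * K) * norm g)"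
  proof (rule sum_mono)
    fix i
    have "\<bar>(A *v g) $ i\<bar> \<le> (\<Sum>j\<in>UNIV. \<bar>A $ i $ j * g $ j\<bar>)"
      unfolding matrix_vector_mult_def by (simp add: sum_abs)
    also have "\<dots> \<le> (\<Sum>j\<in>(UNIV::'n set). K * norm g)"
      unfolding abs_mult using assms order_trans[OF abs_ge_zero assms]
      by (intro sum_mono mult_mono component_le_norm_cart) auto
    finally show "\<bar>(A *v g) $ i\<bar> \<le> (real CARD('n) * K) * norm g" by simp
  qed
  finally show ?thesis by (simp add: mult.assoc)
qed

definition H1_energy :: "(real^'m) set \<Rightarrow> (real^'m \<Rightarrow> real) \<Rightarrow> real" where
  "H1_energy U v = (\<integral>x. ((v x)\<^sup>2 + (norm (weak_grad U v x))\<^sup>2) \<partial>lebesgue_on U)"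

lemma Hspace_1_L2:
  assumes "open U" "v \<in> Hspace 1 U"
  shows "v \<in> L2 U" and "(\<lambda>x. weak_grad U v x $ i) \<in> L2 U"
  using Hspace_weak_deriv(2)[OF assms, of "axis i 1"] assms(2) mi_order_axis[of i]
  by (simp_all add: Hspace_def weak_grad_def)

lemma norm_power2_vec: "(norm (g :: real^'m))\<^sup>2 = (\<Sum>i\<in>UNIV. (g $ i)\<^sup>2)"
  unfolding power2_norm_eq_inner inner_vec_def by (simp add: power2_eq_square)

lemma H1_energy_integrable:
  assumes "open U" "v \<in> Hspace 1 U"
  shows "integrable (lebesgue_on U) (\<lambda>x. (v x)\<^sup>2)" "integrable (lebesgue_on U) (\<lambda>x. (norm (weak_grad U v x))\<^sup>2)"
    "integrable (lebesgue_on U) (\<lambda>x. (v x)\<^sup>2 + (norm (weak_grad U v x))\<^sup>2)"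
proof -
  show 1: "integrable (lebesgue_on U) (\<lambda>x. (v x)\<^sup>2)" "integrable (lebesgue_on U) (\<lambda>x. (norm (weak_grad U v x))\<^sup>2)"
    unfolding norm_power2_vec using Hspace_1_L2[OF assms] by (auto simp: L2_def)
  show "integrable (lebesgue_on U) (\<lambda>x. (v x)\<^sup>2 + (norm (weak_grad U v x))\<^sup>2)"
    by (rule Bochner_Integration.integrable_add[OF 1])
qed

lemma H1_seminorm_le_energy:
  assumes "open U" "v \<in> Hspace 1 U"
  shows "(H1_seminorm U v)\<^sup>2 \<le> H1_energy U v"
  unfolding H1_seminorm_power2 H1_energy_def
  by (rule integral_mono) (use H1_energy_integrable[OF assms] in auto)

lemma weak_grad_diff_AE:
  assumes "open U" "u \<in> Hspace 1 U" "v \<in> Hspace 1 U"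
  shows "AE x in lebesgue_on U. weak_grad U (\<lambda>x. u x - v x) x = weak_grad U u x - weak_grad U v x"
proof -
  have "AE x in lebesgue_on U. \<forall>i\<in>UNIV. weak_deriv U (axis i 1) (\<lambda>x. u x - v x) x = weak_deriv U (axis i 1) u x - weak_deriv U (axis i 1) v x"
    by (rule AE_finite_allI[OF finite], rule weak_deriv_diff_AE[OF assms order_eq_refl[OF mi_order_axis]])
  then show ?thesis by eventually_elim (simp add: weak_grad_def vec_eq_iff)
qed

lemma H1_energy_add_le:
  assumes "open U" "u \<in> Hspace 1 U" "v \<in> Hspace 1 U" "z \<in> Hspace 1 U"
  shows "H1_energy U (\<lambda>x. u x - v x) \<le> 2 * H1_energy U (\<lambda>x. u x - z x) + 2 * H1_energy U (\<lambda>x. z x - v x)"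
proof -
  have sq: "(a + b)\<^sup>2 \<le> 2 * a\<^sup>2 + 2 * b\<^sup>2" for a b :: real
    using zero_le_power2[of "a - b"] by (simp add: power2_diff power2_sum)
  have I: "integrable (lebesgue_on U) (\<lambda>x. (u x - v x)\<^sup>2 + (norm (weak_grad U (\<lambda>x. u x - v x) x))\<^sup>2)"
    "integrable (lebesgue_on U) (\<lambda>x. (u x - z x)\<^sup>2 + (norm (weak_grad U (\<lambda>x. u x - z x) x))\<^sup>2)"
    "integrable (lebesgue_on U) (\<lambda>x. (z x - v x)\<^sup>2 + (norm (weak_grad U (\<lambda>x. z x - v x) x))\<^sup>2)"
    by (rule H1_energy_integrable(3)[OF assms(1) Hspace_diff[OF assms(1)]]; use assms in simp)+
  have "H1_energy U (\<lambda>x. u x - v x) \<le> (\<integral>x. (2 * ((u x - z x)\<^sup>2 + (norm (weak_grad U (\<lambda>x. u x - z x) x))\<^sup>2)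
      + 2 * ((z x - v x)\<^sup>2 + (norm (weak_grad U (\<lambda>x. z x - v x) x))\<^sup>2)) \<partial>lebesgue_on U)"
    unfolding H1_energy_def
  proof (rule integral_mono_AE)
    show "AE x in lebesgue_on U. (u x - v x)\<^sup>2 + (norm (weak_grad U (\<lambda>x. u x - v x) x))\<^sup>2
      \<le> 2 * ((u x - z x)\<^sup>2 + (norm (weak_grad U (\<lambda>x. u x - z x) x))\<^sup>2)
      + 2 * ((z x - v x)\<^sup>2 + (norm (weak_grad U (\<lambda>x. z x - v x) x))\<^sup>2)"
      using weak_grad_diff_AE[OF assms(1,2,3)] weak_grad_diff_AE[OF assms(1,2,4)] weak_grad_diff_AE[OF assms(1,4,3)]
    proof eventually_elim
      case (elim x)
      let ?a = "weak_grad U u x - weak_grad U z x" and ?b = "weak_grad U z x - weak_grad U v x"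
      have "norm (weak_grad U u x - weak_grad U v x) \<le> norm ?a + norm ?b"
        using norm_triangle_ineq[of ?a ?b] by simp
      then have "(norm (weak_grad U u x - weak_grad U v x))\<^sup>2 \<le> (norm ?a + norm ?b)\<^sup>2"
        by (intro power_mono) auto
      then have "(norm (weak_grad U u x - weak_grad U v x))\<^sup>2 \<le> 2 * (norm ?a)\<^sup>2 + 2 * (norm ?b)\<^sup>2"
        using sq[of "norm ?a" "norm ?b"] by linarith
      moreover have "(u x - v x)\<^sup>2 \<le> 2 * (u x - z x)\<^sup>2 + 2 * (z x - v x)\<^sup>2"
        using sq[of "u x - z x" "z x - v x"] by simp
      ultimately show ?case unfolding elim by (simp add: distrib_left)
    qed
  qed (intro Bochner_Integration.integrable_add integrable_mult_right I)+
  also have "\<dots> = 2 * H1_energy U (\<lambda>x. u x - z x) + 2 * H1_energy U (\<lambda>x. z x - v x)"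
    unfolding H1_energy_def
    by (subst Bochner_Integration.integral_add) (intro integrable_mult_right I, intro integrable_mult_right I, simp only: integral_mult_right_zero)
  finally show ?thesis .
qed

abbreviation pair_density where
  "pair_density U P R q1 q2 u v x \<equiv> form_density (P x) (R x) (q1 x) (q2 x)
     (fst u x) (weak_grad U (fst u) x) (snd u x) (weak_grad U (snd u) x)
     (fst v x) (weak_grad U (fst v) x) (snd v x) (weak_grad U (snd v) x)"

lemma bilinear_form_density:
  fixes P :: "real^'m \<Rightarrow> real^'m^'m"
  assumes U: "open U" and P: "\<And>i j. (\<lambda>x. P x $ i $ j) \<in> Linf U" and R: "\<And>k. (\<lambda>x. R x $ k) \<in> Linf U"
    and q: "q1 \<in> Linf U" "q2 \<in> Linf U"
    and u: "u \<in> Hspace 1 U \<times> Hspace 1 U" and v: "v \<in> Hspace 1 U \<times> Hspace 1 U"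
  shows "integrable (lebesgue_on U) (pair_density U P R q1 q2 u v)"
    and "bilinear_form U P R q1 q2 u v = (\<integral>x. pair_density U P R q1 q2 u v x \<partial>lebesgue_on U)"
proof -
  obtain u1 u2 v1 v2 where uv: "u = (u1, u2)" "v = (v1, v2)" by (cases u, cases v)
  have H: "u1 \<in> Hspace 1 U" "u2 \<in> Hspace 1 U" "v1 \<in> Hspace 1 U" "v2 \<in> Hspace 1 U" using u v uv by auto
  note L = H[THEN Hspace_1_L2(1)[OF U]] H[THEN Hspace_1_L2(2)[OF U]]
  have int: "integrable (lebesgue_on U) (\<lambda>x. a x * (c x * b x))" if "a \<in> L2 U" "b \<in> L2 U" "c \<in> Linf U" for a b c
    using that(3) by (intro L2_mult_integrable that(1) L2_bounded_mult[OF that(2) _ Linf_AE_bound[OF that(3)]]) (simp add: Linf_def)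
  have 1: "integrable (lebesgue_on U) (\<lambda>x. weak_grad U b x \<bullet> (P x *v weak_grad U a x))"
    if "a \<in> Hspace 1 U" "b \<in> Hspace 1 U" for a b
    unfolding inner_vec_def matrix_vector_mult_def using that
    by (auto simp: sum_distrib_left intro!: Bochner_Integration.integrable_sum int P Hspace_1_L2[OF U])
  have 2: "integrable (lebesgue_on U) (\<lambda>x. b x * (R x \<bullet> weak_grad U a x))"
    if "a \<in> Hspace 1 U" "b \<in> Hspace 1 U" for a b
    unfolding inner_vec_def using that
    by (auto simp: sum_distrib_left intro!: Bochner_Integration.integrable_sum int R Hspace_1_L2[OF U])
  have 3: "integrable (lebesgue_on U) (\<lambda>x. (q1 x * u1 x + q2 x * u2 x) * v1 x + (q1 x * u2 x - q2 x * u1 x) * v2 x)"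
  proof -
    have "integrable (lebesgue_on U) (\<lambda>x. v1 x * (q1 x * u1 x) + v1 x * (q2 x * u2 x) + (v2 x * (q1 x * u2 x) - v2 x * (q2 x * u1 x)))"
      by (intro Bochner_Integration.integrable_add Bochner_Integration.integrable_diff int L q)
    then show ?thesis by (rule back_subst[where P = "integrable (lebesgue_on U)"]) (auto simp: algebra_simps)
  qed
  have I: "integrable (lebesgue_on U) (\<lambda>x. weak_grad U v1 x \<bullet> (P x *v weak_grad U u1 x) + weak_grad U v2 x \<bullet> (P x *v weak_grad U u2 x))"
    "integrable (lebesgue_on U) (\<lambda>x. v1 x * (R x \<bullet> weak_grad U u1 x) + v2 x * (R x \<bullet> weak_grad U u2 x))"
    by (intro Bochner_Integration.integrable_add 1 2 H)+
  show "integrable (lebesgue_on U) (pair_density U P R q1 q2 u v)"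
    unfolding form_density_def uv fst_conv snd_conv by (intro Bochner_Integration.integrable_add I 3)
  show "bilinear_form U P R q1 q2 u v = (\<integral>x. pair_density U P R q1 q2 u v x \<partial>lebesgue_on U)"
    unfolding form_density_def bilinear_form_def uv fst_conv snd_conv prod.case
    by (subst Bochner_Integration.integral_add[OF Bochner_Integration.integrable_add[OF I] 3], subst Bochner_Integration.integral_add[OF I]) (rule refl)
qed

lemma diff_pair_Hspace:
  "open U \<Longrightarrow> u \<in> Hspace l U \<times> Hspace l U \<Longrightarrow> v \<in> Hspace l U \<times> Hspace l U \<Longrightarrow> diff_pair u v \<in> Hspace l U \<times> Hspace l U"
  by (auto simp: diff_pair_def intro: Hspace_diff)

text \<open>Absorbing the error by a pointwise Young inequality makes the boundedness of the form
  on the product space unnecessary.\<close>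

lemma cea:
  fixes P :: "real^'m \<Rightarrow> real^'m^'m"
  assumes U: "open U" and P: "\<And>i j. (\<lambda>x. P x $ i $ j) \<in> Linf U" and R: "\<And>k. (\<lambda>x. R x $ k) \<in> Linf U"
    and q: "q1 \<in> Linf U" "q2 \<in> Linf U" and \<alpha>: "\<alpha> > 0"
    and ell: "AE x in lebesgue_on U. \<forall>A. A \<bullet> (P x *v A) \<ge> \<alpha> * (A \<bullet> A)"
    and q1: "essinf U q1 \<ge> ereal (\<alpha> / 2 + 1 / (2 * \<alpha>) * (\<Sum>k\<in>UNIV. (Linf_norm U (\<lambda>x. R x $ k))\<^sup>2))"
  obtains C where "C \<ge> 0" "\<And>u uh vh. u \<in> Hspace 1 U \<times> Hspace 1 U \<Longrightarrow> uh \<in> Hspace 1 U \<times> Hspace 1 U \<Longrightarrow>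
     vh \<in> Hspace 1 U \<times> Hspace 1 U \<Longrightarrow>
     bilinear_form U P R q1 q2 u (diff_pair vh uh) = bilinear_form U P R q1 q2 uh (diff_pair vh uh) \<Longrightarrow>
     H1_energy U (fst (diff_pair u uh)) + H1_energy U (snd (diff_pair u uh))
       \<le> C * (H1_energy U (fst (diff_pair u vh)) + H1_energy U (snd (diff_pair u vh)))"
proof -
  let ?nP = "\<lambda>i j. Linf_norm U (\<lambda>x. P x $ i $ j)" and ?nR = "\<lambda>k. Linf_norm U (\<lambda>x. R x $ k)"
  define KP where "KP = (\<Sum>i\<in>UNIV. \<Sum>j\<in>UNIV. \<bar>?nP i j\<bar>)"
  define S where "S = (\<Sum>k\<in>UNIV. (?nR k)\<^sup>2)"
  \<comment> \<open>One bound for all coefficients: the first summand dominates the operator norm of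
    \<open>P x\<close>, the second the Euclidean norm of \<open>R x\<close>.\<close>
  define K where "K = real CARD('m) * (real CARD('m) * KP) + sqrt S + \<bar>Linf_norm U q1\<bar> + \<bar>Linf_norm U q2\<bar>"
  have S0: "S \<ge> 0" by (simp add: S_def sum_nonneg)
  have KP0: "KP \<ge> 0" by (simp add: KP_def sum_nonneg)
  have Kge: "real CARD('m) * (real CARD('m) * KP) \<le> K" "sqrt S \<le> K" "\<bar>Linf_norm U q1\<bar> \<le> K" "\<bar>Linf_norm U q2\<bar> \<le> K"
    using S0 KP0 by (simp_all add: K_def)
  then have K0: "K \<ge> 0" by linarith
  have aeP: "AE x in lebesgue_on U. \<forall>i\<in>UNIV. \<forall>j\<in>UNIV. \<bar>P x $ i $ j\<bar> \<le> ?nP i j"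
    by (intro AE_finite_allI finite Linf_AE_bound P)
  have aeR: "AE x in lebesgue_on U. \<forall>k\<in>UNIV. \<bar>R x $ k\<bar> \<le> ?nR k"
    by (intro AE_finite_allI finite Linf_AE_bound R)
  have nP: "?nP i j \<le> KP" for i j
  proof -
    have "\<bar>?nP i j\<bar> \<le> (\<Sum>j\<in>UNIV. \<bar>?nP i j\<bar>)" by (rule member_le_sum) auto
    also have "\<dots> \<le> KP" unfolding KP_def by (rule member_le_sum[of i]) (auto intro: sum_nonneg)
    finally show ?thesis by linarith
  qed
  have coeff: "AE x in lebesgue_on U. (\<forall>g. norm (P x *v g) \<le> K * norm g) \<and> (norm (R x))\<^sup>2 \<le> S \<and>
      \<bar>q1 x\<bar> \<le> K \<and> \<bar>q2 x\<bar> \<le> K \<and> q1 x \<ge> \<alpha> / 2 + S / (2 * \<alpha>) \<and> (\<forall>g. g \<bullet> (P x *v g) \<ge> \<alpha> * (g \<bullet> g))"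
    using aeP aeR Linf_AE_bound[OF q(1)] Linf_AE_bound[OF q(2)] essinf_AE_bound[OF q1] ell
  proof eventually_elim
    case (elim x)
    have "norm (P x *v g) \<le> K * norm g" for g
    proof -
      have "norm (P x *v g) \<le> real CARD('m) * (real CARD('m) * KP) * norm g"
        by (rule norm_matrix_vector_le) (use elim(1) nP order_trans in blast)
      also have "\<dots> \<le> K * norm g" using Kge by (intro mult_right_mono) auto
      finally show ?thesis .
    qed
    moreover have "(norm (R x))\<^sup>2 \<le> S"
      unfolding norm_power2_vec S_def
    proof (rule sum_mono)
      fix k
      show "(R x $ k)\<^sup>2 \<le> (?nR k)\<^sup>2" using elim(2) by (metis UNIV_I abs_ge_zero power2_abs power_mono)
    qed
    moreover have "\<bar>q1 x\<bar> \<le> K" "\<bar>q2 x\<bar> \<le> K" using elim Kge by linarith+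
    moreover have "q1 x \<ge> \<alpha> / 2 + S / (2 * \<alpha>)" using elim(5) by (simp add: S_def)
    ultimately show ?case using elim(6) by blast
  qed
  let ?D = "pair_density U P R q1 q2"
  let ?N = "\<lambda>v x. ((fst v x)\<^sup>2 + (norm (weak_grad U (fst v) x))\<^sup>2) + ((snd v x)\<^sup>2 + (norm (weak_grad U (snd v) x))\<^sup>2)"
  \<comment> \<open>The quotient of 6 K^2 / \<alpha> by \<alpha> / 4, the part of the coercivity
    that survives the absorption.\<close>
  define C where "C = 24 * K\<^sup>2 / \<alpha>\<^sup>2"
  have "C \<ge> 0" using \<alpha> by (simp add: C_def)
  moreover have "H1_energy U (fst (diff_pair u uh)) + H1_energy U (snd (diff_pair u uh))
       \<le> C * (H1_energy U (fst (diff_pair u vh)) + H1_energy U (snd (diff_pair u vh)))"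
    if u: "u \<in> Hspace 1 U \<times> Hspace 1 U" and uh: "uh \<in> Hspace 1 U \<times> Hspace 1 U" and vh: "vh \<in> Hspace 1 U \<times> Hspace 1 U"
      and orth: "bilinear_form U P R q1 q2 u (diff_pair vh uh) = bilinear_form U P R q1 q2 uh (diff_pair vh uh)" for u uh vh
  proof -
    let ?e = "diff_pair u uh" and ?\<eta> = "diff_pair u vh" and ?z = "diff_pair vh uh"
    note H = diff_pair_Hspace[OF U u uh] diff_pair_Hspace[OF U u vh] diff_pair_Hspace[OF U vh uh]
    note I = bilinear_form_density(1)[OF U P R q] and B = bilinear_form_density(2)[OF U P R q]
    have N: "integrable (lebesgue_on U) (?N v)"
      "(\<integral>x. ?N v x \<partial>lebesgue_on U) = H1_energy U (fst v) + H1_energy U (snd v)" if "v \<in> Hspace 1 U \<times> Hspace 1 U" for v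
      using that H1_energy_integrable(3)[OF U] by (auto simp: H1_energy_def)
    have "AE x in lebesgue_on U. ?D ?e ?e x = ?D ?e ?\<eta> x + ?D u ?z x - ?D uh ?z x"
    proof -
      have g: "AE x in lebesgue_on U. weak_grad U (fst (diff_pair a b)) x = weak_grad U (fst a) x - weak_grad U (fst b) x"
        "AE x in lebesgue_on U. weak_grad U (snd (diff_pair a b)) x = weak_grad U (snd a) x - weak_grad U (snd b) x"
        if "a \<in> Hspace 1 U \<times> Hspace 1 U" "b \<in> Hspace 1 U \<times> Hspace 1 U" for a b
        using that weak_grad_diff_AE[OF U] by (auto simp: diff_pair_def)
      show ?thesis
        using g[OF u uh] g[OF u vh] g[OF vh uh]
      proof eventually_elim
        case (elim x)
        have p: "fst (diff_pair a b) x = fst a x - fst b x" "snd (diff_pair a b) x = snd a x - snd b x" for a b :: "'m field_pair"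
          by (simp_all add: diff_pair_def)
        show ?case unfolding elim p by (rule form_density_diff)
      qed
    qed
    then have "(\<integral>x. ?D ?e ?e x \<partial>lebesgue_on U) = (\<integral>x. ?D ?e ?\<eta> x + ?D u ?z x - ?D uh ?z x \<partial>lebesgue_on U)"
      by (intro integral_cong_AE borel_measurable_integrable Bochner_Integration.integrable_diff Bochner_Integration.integrable_add I H u uh)
    also have "\<dots> = (\<integral>x. ?D ?e ?\<eta> x \<partial>lebesgue_on U) + bilinear_form U P R q1 q2 u ?z - bilinear_form U P R q1 q2 uh ?z"
      unfolding B[OF u H(3)] B[OF uh H(3)]
      by (simp only: Bochner_Integration.integral_diff Bochner_Integration.integral_add Bochner_Integration.integrable_add I H u uh)
    finally have eq: "(\<integral>x. ?D ?e ?e x \<partial>lebesgue_on U) = (\<integral>x. ?D ?e ?\<eta> x \<partial>lebesgue_on U)" using orth by simp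
    have "\<alpha> / 2 * (\<integral>x. ?N ?e x \<partial>lebesgue_on U) = (\<integral>x. \<alpha> / 2 * ?N ?e x \<partial>lebesgue_on U)" by simp
    also have "\<dots> \<le> (\<integral>x. ?D ?e ?e x \<partial>lebesgue_on U)"
    proof (rule integral_mono_AE)
      show "AE x in lebesgue_on U. \<alpha> / 2 * ?N ?e x \<le> ?D ?e ?e x"
        using coeff by eventually_elim (rule form_density_coercive[OF \<alpha>], auto)
    qed (use N(1)[OF H(1)] I[OF H(1) H(1)] in auto)
    also have "\<dots> \<le> (\<integral>x. \<alpha> / 4 * ?N ?e x + 6 * K\<^sup>2 / \<alpha> * ?N ?\<eta> x \<partial>lebesgue_on U)"
      unfolding eq
    proof (rule integral_mono_AE)
      show "AE x in lebesgue_on U. ?D ?e ?\<eta> x \<le> \<alpha> / 4 * ?N ?e x + 6 * K\<^sup>2 / \<alpha> * ?N ?\<eta> x"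
        using coeff
      proof eventually_elim
        case (elim x)
        have "norm (R x) \<le> K" using elim Kge(2) real_le_rsqrt[of "norm (R x)" S] by auto
        then show ?case by (intro form_density_bound[OF \<alpha> K0]) (use elim in auto)
      qed
    qed (use N(1)[OF H(1)] N(1)[OF H(2)] I[OF H(1) H(2)] in auto)
    also have "\<dots> = \<alpha> / 4 * (\<integral>x. ?N ?e x \<partial>lebesgue_on U) + 6 * K\<^sup>2 / \<alpha> * (\<integral>x. ?N ?\<eta> x \<partial>lebesgue_on U)"
      using N(1)[OF H(1)] N(1)[OF H(2)] by (subst Bochner_Integration.integral_add) auto
    finally have "\<alpha> / 4 * (\<integral>x. ?N ?e x \<partial>lebesgue_on U) \<le> 6 * K\<^sup>2 / \<alpha> * (\<integral>x. ?N ?\<eta> x \<partial>lebesgue_on U)"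
      by linarith
    then have "(\<integral>x. ?N ?e x \<partial>lebesgue_on U) \<le> C * (\<integral>x. ?N ?\<eta> x \<partial>lebesgue_on U)"
      using \<alpha> by (simp add: C_def field_simps power2_eq_square)
    then show ?thesis unfolding N(2)[OF H(1)] N(2)[OF H(2)] .
  qed
  ultimately show ?thesis using that by blast
qed

section \<open>Local approximation\<close>

text \<open>A ball is connected, so one that meets both \<open>U\<close> and its complement meets
  the boundary, which is impossible below the boundary distance of its center.\<close>

lemma ball_infdist_frontier_subset:
  fixes U :: "'a::euclidean_space set"
  assumes "x \<in> U" "dist x y < infdist x (frontier U)"
  shows "y \<in> U"
proof (rule ccontr)
  assume "y \<notin> U"
  have "0 < infdist x (frontier U)" using assms(2) zero_le_dist[of x y] by linarith
  then have "x \<in> ball x (infdist x (frontier U)) \<inter> U" using assms(1) by simp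
  moreover have "y \<in> ball x (infdist x (frontier U)) - U" using assms(2) \<open>y \<notin> U\<close> by simp
  ultimately have "ball x (infdist x (frontier U)) \<inter> frontier U \<noteq> {}"
    by (intro connected_Int_frontier connected_ball) blast+
  then obtain z where "z \<in> frontier U" "dist x z < infdist x (frontier U)" by auto
  then show False using infdist_le[of z "frontier U" x] by simp
qed

lemma infdist_diff_le: "\<bar>infdist x A - infdist y A\<bar> \<le> dist x y"
  using infdist_triangle[of x A y] infdist_triangle[of y A x] by (simp add: dist_commute abs_le_iff)

lemma finite_lists_le: "finite {is :: 'm::finite list. length is \<le> n}"
  using finite_lists_length_le[of "UNIV :: 'm set" n] by simp

lemma finite_lists_eq: "finite {is :: 'm::finite list. length is = n}"
  using finite_lists_length_eq[of "UNIV :: 'm set" n] by simp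

text \<open>All terms have the homogeneity of an n-th derivative. This single quantity controls both
  the Taylor remainders of \<open>f / w\<close> in the interior and the values of \<open>f\<close>
  and its gradient near the boundary, and Hardy's inequality bounds its integral.\<close>

definition weighted_energy :: "(real^'m) set \<Rightarrow> nat \<Rightarrow> (real^'m \<Rightarrow> real) \<Rightarrow> real^'m \<Rightarrow> real" where
  "weighted_energy U n f x =
     (\<Sum>is | length is \<le> n. (iter_partial is f x)\<^sup>2 / infdist x (frontier U) ^ (2 * (n - length is)))"

lemma weighted_energy_nonneg: "0 \<le> weighted_energy U n f x"
  unfolding weighted_energy_def by (intro sum_nonneg divide_nonneg_nonneg) (auto simp: power_mult)

lemma iter_partial_le_weighted_energy:
  fixes f :: "real^'m \<Rightarrow> real"
  assumes d: "0 < infdist x (frontier U)" and "length is \<le> n"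
  shows "(iter_partial is f x)\<^sup>2 \<le> weighted_energy U n f x * infdist x (frontier U) ^ (2 * (n - length is))"
proof -
  have "(iter_partial is f x)\<^sup>2 / infdist x (frontier U) ^ (2 * (n - length is)) \<le> weighted_energy U n f x"
    unfolding weighted_energy_def
    by (rule member_le_sum[where f = "\<lambda>is. (iter_partial is f x)\<^sup>2 / infdist x (frontier U) ^ (2 * (n - length is))"])
       (use assms finite_lists_le in \<open>auto simp: power_mult\<close>)
  then show ?thesis using d by (simp add: pos_divide_le_eq)
qed

text \<open>Leibniz's rule with the bounds for 1/w loses exactly one factor 1/d relative to the
  scaling of \<open>weighted_energy\<close>; the factor d^2 on the left restores it.\<close>

lemma quotient_deriv_bound:
  fixes w :: "real^'m \<Rightarrow> real" and U :: "(real^'m) set"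
  assumes U: "open U" and w: "smooth_on U w" and d: "\<And>x. x \<in> U \<Longrightarrow> 0 < infdist x (frontier U)"
    and c1: "c1 > 0" "\<And>x. x \<in> U \<Longrightarrow> c1 * infdist x (frontier U) \<le> w x"
    and bound: "\<And>is. \<exists>c. \<forall>x\<in>U. \<bar>iter_partial is w x\<bar> \<le> c * infdist x (frontier U) / infdist x (frontier U) ^ length is"
  obtains C where "C > 0" "\<And>f x is. smooth_on U f \<Longrightarrow> x \<in> U \<Longrightarrow> length is = n \<Longrightarrow>
     (infdist x (frontier U))\<^sup>2 * (iter_partial is (\<lambda>x. f x * (1 / w x)) x)\<^sup>2 \<le> C * weighted_energy U n f x"
proof -
  let ?d = "\<lambda>x. infdist x (frontier U)"
  have wpos: "w x > 0" if "x \<in> U" for x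
    using c1(2)[OF that] d[OF that] c1(1) by (smt (verit) mult_pos_pos)
  obtain C0 where C0: "\<And>x is. x \<in> U \<Longrightarrow> length is \<le> n \<Longrightarrow> \<bar>iter_partial is (\<lambda>x. 1 / w x) x\<bar> \<le> C0 / ?d x / ?d x ^ length is"
    using iter_partial_inverse_bound[OF U w d c1 bound, of n] by blast
  define N where "N = real (card {is :: 'm list. length is \<le> n})"
  define C where "C = 1 + 4 ^ n * C0\<^sup>2 * N"
  have "(?d x)\<^sup>2 * (iter_partial is (\<lambda>x. f x * (1 / w x)) x)\<^sup>2 \<le> C * weighted_energy U n f x"
    if f: "smooth_on U f" and x: "x \<in> U" and len: "length is = n" for f x and "is" :: "'m list"
  proof -
    have dx: "?d x > 0" by (rule d[OF x])
    \<comment> \<open>The smallest convenient constant for which the derivatives of \<open>f\<close>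
      satisfy the hypothesis of \<open>iter_partial_mult_bound\<close> at \<open>x\<close>; after
      division by d^n its square is controlled by \<open>weighted_energy\<close>.\<close>
    define a where "a = (\<Sum>js | length js \<le> n. \<bar>iter_partial js f x\<bar> * ?d x ^ length js)"
    have "\<bar>iter_partial is (\<lambda>x. f x * (1 / w x)) x\<bar> \<le> 2 ^ length is * a * (C0 / ?d x) / ?d x ^ length is"
    proof (rule iter_partial_mult_bound[OF U x f smooth_on_inverse[OF U w wpos] dx])
      fix js :: "'m list" assume js: "length js \<le> length is"
      have "\<bar>iter_partial js f x\<bar> * ?d x ^ length js \<le> a"
        unfolding a_def
        by (rule member_le_sum[where f = "\<lambda>js. \<bar>iter_partial js f x\<bar> * ?d x ^ length js"])
           (use js len finite_lists_le dx in auto)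
      then show "\<bar>iter_partial js f x\<bar> \<le> a / ?d x ^ length js" using dx by (simp add: pos_le_divide_eq)
      show "\<bar>iter_partial js (\<lambda>x. 1 / w x) x\<bar> \<le> C0 / ?d x / ?d x ^ length js" using C0 x js len by simp
    qed
    then have "(iter_partial is (\<lambda>x. f x * (1 / w x)) x)\<^sup>2 \<le> (2 ^ n * a * (C0 / ?d x) / ?d x ^ n)\<^sup>2"
      using len by (metis abs_ge_zero power2_abs power_mono)
    also have "\<dots> = 4 ^ n * C0\<^sup>2 * a\<^sup>2 / ?d x ^ (2 * n) / (?d x)\<^sup>2"
    proof -
      have "((2::real) ^ n)\<^sup>2 = 4 ^ n" by (simp add: power2_eq_square flip: power_mult_distrib)
      moreover have "(?d x ^ n)\<^sup>2 = ?d x ^ (2 * n)" by (simp add: power_even_eq)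
      ultimately show ?thesis by (simp add: power_mult_distrib power_divide mult_ac)
    qed
    finally have "(?d x)\<^sup>2 * (iter_partial is (\<lambda>x. f x * (1 / w x)) x)\<^sup>2 \<le> (?d x)\<^sup>2 * (4 ^ n * C0\<^sup>2 * a\<^sup>2 / ?d x ^ (2 * n) / (?d x)\<^sup>2)"
      by (rule mult_left_mono) simp
    also have "\<dots> = 4 ^ n * C0\<^sup>2 * (a\<^sup>2 / ?d x ^ (2 * n))" using dx by simp
    finally have 1: "(?d x)\<^sup>2 * (iter_partial is (\<lambda>x. f x * (1 / w x)) x)\<^sup>2 \<le> 4 ^ n * C0\<^sup>2 * (a\<^sup>2 / ?d x ^ (2 * n))" .
    have "a\<^sup>2 \<le> (\<Sum>js | length js \<le> n. (\<bar>iter_partial js f x\<bar> * ?d x ^ length js)\<^sup>2) * N"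
      unfolding a_def N_def by (rule sum_squared_le_sum_of_squares)
    then have "a\<^sup>2 / ?d x ^ (2 * n) \<le> (\<Sum>js | length js \<le> n. (\<bar>iter_partial js f x\<bar> * ?d x ^ length js)\<^sup>2) * N / ?d x ^ (2 * n)"
      using dx by (intro divide_right_mono) auto
    also have "\<dots> = N * (\<Sum>js | length js \<le> n. (\<bar>iter_partial js f x\<bar> * ?d x ^ length js)\<^sup>2 / ?d x ^ (2 * n))"
      by (simp only: sum_divide_distrib[symmetric]) simp
    also have "(\<Sum>js | length js \<le> n. (\<bar>iter_partial js f x\<bar> * ?d x ^ length js)\<^sup>2 / ?d x ^ (2 * n)) = weighted_energy U n f x"
      unfolding weighted_energy_def
    proof (intro sum.cong refl)
      fix js :: "'m list" assume "js \<in> {js. length js \<le> n}"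
      then have "2 * n = length js * 2 + 2 * (n - length js)" by simp
      then have "?d x ^ (2 * n) = (?d x ^ length js)\<^sup>2 * ?d x ^ (2 * (n - length js))"
        by (simp only: power_mult power_add)
      then show "(\<bar>iter_partial js f x\<bar> * ?d x ^ length js)\<^sup>2 / ?d x ^ (2 * n)
         = (iter_partial js f x)\<^sup>2 / ?d x ^ (2 * (n - length js))"
        using dx by (simp add: power_mult_distrib)
    qed
    finally have "4 ^ n * C0\<^sup>2 * (a\<^sup>2 / ?d x ^ (2 * n)) \<le> 4 ^ n * C0\<^sup>2 * (N * weighted_energy U n f x)"
      by (intro mult_left_mono) auto
    also have "\<dots> \<le> C * weighted_energy U n f x"
      using weighted_energy_nonneg[of U n f x] by (simp add: C_def distrib_right mult.assoc)
    finally show ?thesis using 1 by linarith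
  qed
  moreover have "C > 0" by (auto simp: C_def N_def intro!: add_pos_nonneg)
  ultimately show ?thesis using that by blast
qed

subsection \<open>Taylor polynomials\<close>

definition direction_monomial :: "'m list \<Rightarrow> real^'m \<Rightarrow> real" where
  "direction_monomial is v = (\<Prod>i\<leftarrow>is. v $ i)"

text \<open>Because lists are summed, a multi-index \<beta> of order k appears k! / \<beta>! times,
  so that the factor 1 / k! gives the usual coefficients.\<close>

definition taylor_poly :: "nat \<Rightarrow> (real^'m \<Rightarrow> real) \<Rightarrow> real^'m \<Rightarrow> real^'m \<Rightarrow> real" where
  "taylor_poly n f x z = (\<Sum>k<n. 1 / fact k * (\<Sum>is | length is = k. iter_partial is f x * direction_monomial is (z - x)))"

lemma direction_monomial_Cons: "direction_monomial (i # is) v = v $ i * direction_monomial is v"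
  by (simp add: direction_monomial_def)

lemma direction_monomial_Nil [simp]: "direction_monomial [] v = 1"
  by (simp add: direction_monomial_def)

lemma direction_monomial_count:
  "direction_monomial is v = (\<Prod>\<nu>\<in>UNIV. v $ \<nu> ^ count_list is \<nu>)" for v :: "real^'m"
proof (induction "is")
  case (Cons i "is")
  have "(\<Prod>\<nu>\<in>UNIV. v $ \<nu> ^ count_list (i # is) \<nu>) = (\<Prod>\<nu>\<in>UNIV. (if \<nu> = i then v $ i else 1) * v $ \<nu> ^ count_list is \<nu>)"
    by (intro prod.cong refl) auto
  also have "\<dots> = v $ i * (\<Prod>\<nu>\<in>UNIV. v $ \<nu> ^ count_list is \<nu>)" by (simp add: prod.distrib)
  finally show ?case using Cons by (simp add: direction_monomial_Cons)
qed simp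

lemma abs_direction_monomial_le: "\<bar>direction_monomial is v\<bar> \<le> norm v ^ length is"
proof (induction "is")
  case (Cons i "is")
  then show ?case
    by (simp add: direction_monomial_Cons abs_mult mult_mono' component_le_norm_cart)
qed simp

lemma sum_lists_Suc:
  fixes g :: "'m::finite list \<Rightarrow> real"
  shows "(\<Sum>is | length is = Suc k. g is) = (\<Sum>is | length is = k. \<Sum>i\<in>UNIV. g (i # is))"
proof -
  have "(\<Sum>is | length is = Suc k. g is) = (\<Sum>p\<in>{is. length is = k} \<times> UNIV. g (snd p # fst p))"
    by (rule sum.reindex_bij_witness[of _ "\<lambda>p. snd p # fst p" "\<lambda>is. (tl is, hd is)"])
       (auto simp: length_Suc_conv)
  then show ?thesis by (simp add: sum.cartesian_product case_prod_beta)
qed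

text \<open>The integral form of the remainder along the segment, whose kernel is at most 1, squared
  by Cauchy--Schwarz. An integral over the segment is kept instead of a supremum because it can be
  averaged over the end point later.\<close>

lemma taylor_remainder:
  fixes f :: "real^'m \<Rightarrow> real"
  assumes S: "open S" and f: "smooth_on S f" and n: "n \<ge> 1"
    and seg: "\<And>t. t \<in> {0..1} \<Longrightarrow> x + t *\<^sub>R (z - x) \<in> S"
  shows "ennreal ((f z - taylor_poly n f x z)\<^sup>2)
    \<le> ennreal (real (card {is :: 'm list. length is = n}) * norm (z - x) ^ (2 * n))
      * (\<integral>\<^sup>+t\<in>{0..1}. ennreal (\<Sum>is | length is = n. (iter_partial is f (x + t *\<^sub>R (z - x)))\<^sup>2) \<partial>lborel)"
proof -
  define v where "v = z - x"
  define g where "g k t = (\<Sum>is | length is = k. direction_monomial is v * iter_partial is f (x + t *\<^sub>R v))" for k t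
  have segv: "x + t *\<^sub>R v \<in> S" if "t \<in> {0..1}" for t using seg[OF that] by (simp add: v_def)
  have Dg: "(g k has_vector_derivative g (Suc k) t) (at t within {0..1})" if t: "t \<in> {0..1}" for k t
  proof -
    have "((\<lambda>t. iter_partial is f (x + t *\<^sub>R v)) has_real_derivative
      (\<Sum>i\<in>UNIV. v $ i * iter_partial (i # is) f (x + t *\<^sub>R v))) (at t within {0..1})" for "is"
      unfolding iter_partial_Cons
      by (rule DERIV_along_line) (intro smooth_on_imp_differentiable[OF smooth_on_iter_partial[OF f] S] segv t)
    then have "(g k has_real_derivative (\<Sum>is | length is = k. direction_monomial is v * (\<Sum>i\<in>UNIV. v $ i * iter_partial (i # is) f (x + t *\<^sub>R v)))) (at t within {0..1})"
      unfolding g_def[abs_def] by (intro DERIV_sum DERIV_cmult)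
    also have "(\<Sum>is | length is = k. direction_monomial is v * (\<Sum>i\<in>UNIV. v $ i * iter_partial (i # is) f (x + t *\<^sub>R v))) = g (Suc k) t"
      unfolding g_def sum_lists_Suc by (simp add: direction_monomial_Cons sum_distrib_left mult_ac)
    finally show ?thesis by (simp add: has_real_derivative_iff_has_vector_derivative)
  qed
  have "((\<lambda>t. ((1 - t) ^ (n - 1) / fact (n - 1)) *\<^sub>R g n t) has_integral
      g 0 1 - (\<Sum>i<n. ((1 - 0) ^ i / fact i) *\<^sub>R g i 0)) {0..1}"
    by (rule Taylor_has_integral) (use n Dg in auto)
  moreover have "g 0 1 = f z" by (simp add: g_def v_def)
  moreover have "(\<Sum>i<n. ((1 - 0) ^ i / fact i) *\<^sub>R g i 0) = taylor_poly n f x z"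
    by (simp add: taylor_poly_def g_def v_def mult.commute)
  ultimately have hi: "((\<lambda>t. ((1 - t) ^ (n - 1) / fact (n - 1)) *\<^sub>R g n t) has_integral f z - taylor_poly n f x z) {0..1}" by simp
  define F where "F t = (1 - t) ^ (n - 1) / fact (n - 1) * g n t" for t
  have contg: "continuous_on {0..1} (g n)"
    using Dg by (intro continuous_on_vector_derivative) auto
  have contF: "continuous_on {0..1} F" unfolding F_def by (intro continuous_intros contg) auto
  note iF = borel_integrable_atLeastAtMost'[OF contF]
  have Fr: "f z - taylor_poly n f x z = (LINT t:{0..1}|lborel. F t)" (is "?R = _")
  proof -
    have "(F has_integral ?R) {0..1}" using hi by (simp add: F_def[abs_def])
    then show ?thesis using set_borel_integral_eq_integral(2)[OF iF] by (simp only: integral_unique)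
  qed
  have iF2: "set_integrable lborel {0..1} (\<lambda>t. (F t)\<^sup>2)"
    by (intro borel_integrable_atLeastAtMost' continuous_intros contF)
  \<comment> \<open>The square of a mean is at most the mean of the squares: the variance of
    \<open>F\<close> on the unit interval is nonnegative.\<close>
  have sq: "?R\<^sup>2 \<le> (LINT t:{0..1}|lborel. (F t)\<^sup>2)"
  proof -
    define r where "r = ?R"
    have rF: "(LINT t:{0..1}|lborel. F t) = r" using Fr by (simp add: r_def)
    have "0 \<le> (LINT t:{0..1}|lborel. (F t - r)\<^sup>2)"
      unfolding set_lebesgue_integral_def by (intro Bochner_Integration.integral_nonneg) auto
    also have "\<dots> = (LINT t:{0..1}|lborel. (F t)\<^sup>2 - 2 * r * F t + r\<^sup>2)"
      by (simp add: power2_diff algebra_simps)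
    also have "\<dots> = (LINT t:{0..1}|lborel. (F t)\<^sup>2) - 2 * r * (LINT t:{0..1}|lborel. F t) + (LINT t:{0..(1::real)}|lborel. r\<^sup>2)"
    proof -
      have ic: "set_integrable lborel {0..1::real} (\<lambda>t. r\<^sup>2)" by (intro borel_integrable_atLeastAtMost' continuous_intros)
      have im: "set_integrable lborel {0..1} (\<lambda>t. 2 * r * F t)" using iF by (intro set_integrable_mult_right)
      show ?thesis
        by (subst set_integral_add(2)[OF set_integral_diff(1)[OF iF2 im] ic], subst set_integral_diff(2)[OF iF2 im]) simp
    qed
    also have "(LINT t:{0..(1::real)}|lborel. r\<^sup>2) = r\<^sup>2" by (simp add: set_lebesgue_integral_def)
    finally show ?thesis unfolding rF r_def[symmetric] by (simp add: power2_eq_square)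
  qed
  define c where "c = real (card {is :: 'm list. length is = n}) * norm v ^ (2 * n)"
  have c0: "c \<ge> 0" by (simp add: c_def)
  have pt: "(F t)\<^sup>2 \<le> c * (\<Sum>is | length is = n. (iter_partial is f (x + t *\<^sub>R v))\<^sup>2)" if t: "t \<in> {0..1}" for t
  proof -
    have "(1 - t) ^ (n - 1) / fact (n - 1) \<le> 1"
      using t by (simp add: divide_le_eq power_le_one order_trans[OF power_le_one fact_ge_1])
    moreover have "0 \<le> (1 - t) ^ (n - 1) / fact (n - 1)" using t by simp
    ultimately have "\<bar>(1 - t) ^ (n - 1) / fact (n - 1)\<bar> \<le> 1" by linarith
    then have "\<bar>F t\<bar> \<le> 1 * \<bar>g n t\<bar>" unfolding F_def abs_mult[of _ "g n t"] by (rule mult_right_mono) simp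
    then have "(F t)\<^sup>2 \<le> (g n t)\<^sup>2" by (simp add: abs_le_square_iff[symmetric])
    also have "\<dots> \<le> (\<Sum>is | length is = n. (direction_monomial is v * iter_partial is f (x + t *\<^sub>R v))\<^sup>2) * real (card {is :: 'm list. length is = n})"
      unfolding g_def by (rule sum_squared_le_sum_of_squares)
    also have "(\<Sum>is | length is = n. (direction_monomial is v * iter_partial is f (x + t *\<^sub>R v))\<^sup>2)
      \<le> (\<Sum>is | length is = n. norm v ^ (2 * n) * (iter_partial is f (x + t *\<^sub>R v))\<^sup>2)"
    proof (rule sum_mono)
      fix "is" :: "'m list" assume "is \<in> {is. length is = n}"
      then have "\<bar>direction_monomial is v\<bar> \<le> norm v ^ n" using abs_direction_monomial_le[of "is" v] by simp
      then have "(direction_monomial is v)\<^sup>2 \<le> (norm v ^ n)\<^sup>2"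
        by (metis abs_ge_zero power2_abs power_mono)
      also have "(norm v ^ n)\<^sup>2 = norm v ^ (2 * n)" by (simp add: power_even_eq)
      finally show "(direction_monomial is v * iter_partial is f (x + t *\<^sub>R v))\<^sup>2 \<le> norm v ^ (2 * n) * (iter_partial is f (x + t *\<^sub>R v))\<^sup>2"
        by (simp add: power_mult_distrib mult_right_mono)
    qed
    finally show ?thesis by (simp add: c_def mult_right_mono mult_ac flip: sum_distrib_left)
  qed
  have "ennreal (?R\<^sup>2) \<le> ennreal (LINT t:{0..1}|lborel. (F t)\<^sup>2)" by (rule ennreal_leI[OF sq])
  also have "\<dots> = (\<integral>\<^sup>+t. ennreal (indicator {0..1} t *\<^sub>R (F t)\<^sup>2) \<partial>lborel)"
    using iF2 unfolding set_lebesgue_integral_def set_integrable_def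
    by (intro nn_integral_eq_integral[symmetric]) auto
  also have "\<dots> \<le> (\<integral>\<^sup>+t. ennreal c * (ennreal (\<Sum>is | length is = n. (iter_partial is f (x + t *\<^sub>R v))\<^sup>2) * indicator {0..1} t) \<partial>lborel)"
  proof (rule nn_integral_mono)
    fix t
    show "ennreal (indicator {0..1} t *\<^sub>R (F t)\<^sup>2) \<le> ennreal c * (ennreal (\<Sum>is | length is = n. (iter_partial is f (x + t *\<^sub>R v))\<^sup>2) * indicator {0..1} t)"
      using pt[of t] c0 by (cases "t \<in> {0..1}") (auto simp: ennreal_leI sum_nonneg simp flip: ennreal_mult')
  qed
  also have "\<dots> = ennreal c * (\<integral>\<^sup>+t\<in>{0..1}. ennreal (\<Sum>is | length is = n. (iter_partial is f (x + t *\<^sub>R v))\<^sup>2) \<partial>lborel)"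
  proof (rule nn_integral_cmult)
    have "continuous_on {0..1} (\<lambda>t. \<Sum>is | length is = n. (iter_partial is f (x + t *\<^sub>R v))\<^sup>2)"
      by (intro continuous_intros continuous_on_compose2[OF smooth_on_imp_continuous_on[OF smooth_on_iter_partial[OF f]]])
         (use segv in auto)
    then have "(\<lambda>t. indicator {0..1} t *\<^sub>R (\<Sum>is | length is = n. (iter_partial is f (x + t *\<^sub>R v))\<^sup>2)) \<in> borel_measurable borel"
      by (intro borel_measurable_continuous_on_indicator) auto
    then have "(\<lambda>t. ennreal (indicator {0..1} t *\<^sub>R (\<Sum>is | length is = n. (iter_partial is f (x + t *\<^sub>R v))\<^sup>2))) \<in> borel_measurable lborel" by simp
    also have "(\<lambda>t. ennreal (indicator {0..1} t *\<^sub>R (\<Sum>is | length is = n. (iter_partial is f (x + t *\<^sub>R v))\<^sup>2)))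
      = (\<lambda>t. ennreal (\<Sum>is | length is = n. (iter_partial is f (x + t *\<^sub>R v))\<^sup>2) * indicator {0..1} t)"
      by (auto simp: indicator_def fun_eq_iff)
    finally show "(\<lambda>t. ennreal (\<Sum>is | length is = n. (iter_partial is f (x + t *\<^sub>R v))\<^sup>2) * indicator {0..1} t) \<in> borel_measurable lborel" .
  qed
  finally show ?thesis by (simp add: c_def v_def)
qed

lemma partial_deriv_direction_monomial:
  fixes x :: "real^'m"
  shows "(\<lambda>z. direction_monomial is (z - x)) differentiable at y"
    and "partial_deriv i (\<lambda>z. direction_monomial is (z - x)) x = (if is = [i] then 1 else 0)"
proof -
  have lin: "(\<lambda>z. z $ j - x $ j) differentiable at y" "partial_deriv i (\<lambda>z. z $ j - x $ j) y = (if i = j then 1 else 0)" for j y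
  proof -
    have D: "((\<lambda>z. z $ j - x $ j) has_derivative (\<lambda>h. h $ j)) (at y)"
      using has_derivative_diff[OF bounded_linear_imp_has_derivative[OF bounded_linear_vec_nth] has_derivative_const] by (simp only: diff_zero)
    then show "(\<lambda>z. z $ j - x $ j) differentiable at y" by (auto simp: differentiable_def)
    show "partial_deriv i (\<lambda>z. z $ j - x $ j) y = (if i = j then 1 else 0)"
      using partial_deriv_eq[OF D] by (simp add: axis_def)
  qed
  have d: "(\<lambda>z. direction_monomial is (z - x)) differentiable at y" for "is" y
  proof (induction "is")
    case (Cons j "is")
    then show ?case using differentiable_mult[OF lin(1)[of j y] Cons] by (simp add: direction_monomial_Cons)
  qed (simp add: direction_monomial_def)
  then show "(\<lambda>z. direction_monomial is (z - x)) differentiable at y" .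
  show "partial_deriv i (\<lambda>z. direction_monomial is (z - x)) x = (if is = [i] then 1 else 0)"
  proof (cases "is")
    case (Cons j js)
    have "partial_deriv i (\<lambda>z. (z $ j - x $ j) * direction_monomial js (z - x)) x
        = (if i = j then 1 else 0) * direction_monomial js 0"
      using partial_deriv_mult[OF lin(1)[of j x] d[of js x], of i] lin(2) by simp
    also have "direction_monomial js (0 :: real^'m) = (if js = [] then 1 else 0)"
      by (cases js) (auto simp: direction_monomial_Cons)
    finally show ?thesis unfolding Cons by (simp add: direction_monomial_Cons split: if_splits)
  qed simp
qed

lemma differentiable_partial_deriv_sum:
  assumes "finite T" "\<And>k. k \<in> T \<Longrightarrow> f k differentiable at x"
  shows "(\<lambda>x. \<Sum>k\<in>T. c k * f k x) differentiable at x \<and>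
    partial_deriv i (\<lambda>x. \<Sum>k\<in>T. c k * f k x) x = (\<Sum>k\<in>T. c k * partial_deriv i (f k) x)"
  using assms by (induction T) (auto simp: partial_deriv_add partial_deriv_mult)

text \<open>The value comes from the term of order 0 and the first derivatives from the terms of
  order 1, which are present since n \<ge> 2.\<close>

lemma taylor_poly_at:
  fixes f :: "real^'m \<Rightarrow> real"
  assumes n: "n \<ge> 2"
  shows "taylor_poly n f x x = f x" and "taylor_poly n f x differentiable at y"
    and "partial_deriv i (taylor_poly n f x) x = partial_deriv i f x"
proof -
  have z: "direction_monomial is (0 :: real^'m) = (if is = [] then 1 else 0)" for "is"
    by (cases "is") (auto simp: direction_monomial_Cons)
  have "taylor_poly n f x x = (\<Sum>k<n. if k = 0 then f x else 0)"
    unfolding taylor_poly_def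
  proof (intro sum.cong refl)
    fix k assume "k \<in> {..<n}"
    show "1 / fact k * (\<Sum>is | length is = k. iter_partial is f x * direction_monomial is (x - x)) = (if k = 0 then f x else 0)"
      using z by (cases "k = 0") (auto intro!: sum.neutral)
  qed
  then show "taylor_poly n f x x = f x" using n by simp
  let ?T = "\<lambda>k z. \<Sum>is | length is = k. iter_partial is f x * direction_monomial is (z - x)"
  have 1: "?T k differentiable at y \<and> partial_deriv i (?T k) y = (\<Sum>is | length is = k. iter_partial is f x * partial_deriv i (\<lambda>z. direction_monomial is (z - x)) y)" for k y
    by (rule differentiable_partial_deriv_sum[OF finite_lists_eq partial_deriv_direction_monomial(1)])
  have 2: "(\<lambda>z. \<Sum>k<n. 1 / fact k * ?T k z) differentiable at y \<and> partial_deriv i (\<lambda>z. \<Sum>k<n. 1 / fact k * ?T k z) y = (\<Sum>k<n. 1 / fact k * partial_deriv i (?T k) y)" for y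
    by (rule differentiable_partial_deriv_sum) (use 1 in auto)
  then show "taylor_poly n f x differentiable at y" unfolding taylor_poly_def[abs_def] by blast
  have T1: "partial_deriv i (?T k) x = (if k = 1 then partial_deriv i f x else 0)" for k
  proof -
    have "partial_deriv i (?T k) x = (\<Sum>is | length is = k. if is = [i] then partial_deriv i f x else 0)"
      using 1[of k x] by (auto simp: partial_deriv_direction_monomial(2) iter_partial_Cons intro!: sum.cong)
    then show ?thesis by (auto simp: finite_lists_eq)
  qed
  have "partial_deriv i (taylor_poly n f x) x = (\<Sum>k<n. 1 / fact k * (if k = 1 then partial_deriv i f x else 0))"
    using 2[of x] T1 unfolding taylor_poly_def[abs_def] by simp
  also have "\<dots> = (\<Sum>k<n. if k = 1 then partial_deriv i f x else 0)" by (intro sum.cong refl) auto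
  also have "\<dots> = partial_deriv i f x" using n by simp
  finally show "partial_deriv i (taylor_poly n f x) x = partial_deriv i f x" .
qed

subsection \<open>Quasi-interpolation\<close>

definition sample_offsets :: "nat \<Rightarrow> ('m::finite \<Rightarrow> nat) set" where
  "sample_offsets n = PiE UNIV (\<lambda>_. {..<n})"

definition sample_point :: "real \<Rightarrow> int^'m \<Rightarrow> ('m \<Rightarrow> nat) \<Rightarrow> real^'m \<Rightarrow> real^'m" where
  "sample_point h k l y = (\<chi> \<nu>. h * (of_int (k $ \<nu>) + real (l \<nu>) + y $ \<nu>))"

text \<open>The tensor product of the univariate functionals of
  \<open>quasi_interpolation_weights\<close>, where the component of \<open>y\<close> in each
  direction is the shift \<tau> for that direction.\<close>

definition quasi_coeff :: "(real \<Rightarrow> nat \<Rightarrow> real) \<Rightarrow> nat \<Rightarrow> real \<Rightarrow> real^'m \<Rightarrow> (real^'m \<Rightarrow> real) \<Rightarrow> int^'m \<Rightarrow> real" where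
  "quasi_coeff \<mu> n h y f k = (\<Sum>l\<in>sample_offsets n. (\<Prod>\<nu>\<in>UNIV. \<mu> (y $ \<nu>) (l \<nu>)) * f (sample_point h k l y))"

lemma quasi_coeff_diff:
  "quasi_coeff \<mu> n h y (\<lambda>z. f z - g z) k = quasi_coeff \<mu> n h y f k - quasi_coeff \<mu> n h y g k"
  by (simp add: quasi_coeff_def right_diff_distrib sum_subtractf)

lemma quasi_coeff_sum:
  "quasi_coeff \<mu> n h y (\<lambda>z. \<Sum>a\<in>A. c a * f a z) k = (\<Sum>a\<in>A. c a * quasi_coeff \<mu> n h y (f a) k)"
  unfolding quasi_coeff_def sum_distrib_left by (subst sum.swap) (simp add: mult_ac)

text \<open>Contains every index whose B-spline can be nonzero in the cell with index
  \<open>k0\<close>. The lower end is the one that \<open>marsden_identity\<close> asks for, so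
  there are n + 1 indices per direction.\<close>

definition index_box :: "int^'m \<Rightarrow> nat \<Rightarrow> (int^'m) set" where
  "index_box k0 n = {k. \<forall>\<nu>. k0 $ \<nu> - int n \<le> k $ \<nu> \<and> k $ \<nu> \<le> k0 $ \<nu>}"

lemma bij_index_box:
  "bij_betw vec_lambda (PiE UNIV (\<lambda>\<nu>. {k0 $ \<nu> - int n..k0 $ \<nu>})) (index_box k0 n)"
  by (rule bij_betw_byWitness[where f' = vec_nth]) (auto simp: index_box_def PiE_def extensional_def)

lemma finite_index_box: "finite (index_box (k0 :: int^'m) n)"
  using bij_betw_finite[OF bij_index_box[of k0 n]] finite_PiE[of UNIV "\<lambda>\<nu>. {k0 $ \<nu> - int n..k0 $ \<nu>}"] by auto

text \<open>Coefficient, B-spline and monomial are all products over the coordinates, so the sum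
  over the box factors into univariate sums, each of which is reproduced.\<close>

lemma quasi_coeff_monomial:
  fixes z x0 y :: "real^'m"
  assumes h: "h > 0" and k0: "\<And>\<nu>. k0 $ \<nu> = \<lfloor>z $ \<nu> / h\<rfloor>" and \<gamma>: "\<And>\<nu>. \<gamma> \<nu> < n"
    and \<mu>: "\<And>\<tau> t t0 i lo hi. i < n \<Longrightarrow> lo \<le> \<lfloor>t\<rfloor> - int n \<Longrightarrow> hi \<ge> \<lfloor>t\<rfloor> \<Longrightarrow>
      (\<Sum>k=lo..hi. (\<Sum>l<n. \<mu> \<tau> l * (real_of_int k + real l + \<tau> - t0) ^ i) * cardinal_bspline n (t - real_of_int k)) = (t - t0) ^ i"
  shows "(\<Sum>k\<in>index_box k0 n. quasi_coeff \<mu> n h y (\<lambda>z. \<Prod>\<nu>\<in>UNIV. (z $ \<nu> - x0 $ \<nu>) ^ \<gamma> \<nu>) k * bspline n h k z)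
    = (\<Prod>\<nu>\<in>UNIV. (z $ \<nu> - x0 $ \<nu>) ^ \<gamma> \<nu>)"
proof -
  let ?A = "\<lambda>\<nu> k. (\<Sum>l<n. \<mu> (y $ \<nu>) l * (real_of_int k + real l + y $ \<nu> - x0 $ \<nu> / h) ^ \<gamma> \<nu>)"
  have hp: "(h * a - c) ^ g = h ^ g * (a - c / h) ^ g" for a c :: real and g
    using h by (simp add: right_diff_distrib flip: power_mult_distrib)
  have coeff: "quasi_coeff \<mu> n h y (\<lambda>z. \<Prod>\<nu>\<in>UNIV. (z $ \<nu> - x0 $ \<nu>) ^ \<gamma> \<nu>) k = (\<Prod>\<nu>\<in>UNIV. h ^ \<gamma> \<nu> * ?A \<nu> (k $ \<nu>))" for k
  proof -
    have "quasi_coeff \<mu> n h y (\<lambda>z. \<Prod>\<nu>\<in>UNIV. (z $ \<nu> - x0 $ \<nu>) ^ \<gamma> \<nu>) k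
      = (\<Sum>l\<in>PiE UNIV (\<lambda>_. {..<n}). \<Prod>\<nu>\<in>UNIV. \<mu> (y $ \<nu>) (l \<nu>) * (h ^ \<gamma> \<nu> * (real_of_int (k $ \<nu>) + real (l \<nu>) + y $ \<nu> - x0 $ \<nu> / h) ^ \<gamma> \<nu>))"
      unfolding quasi_coeff_def sample_offsets_def sample_point_def vec_lambda_beta hp prod.distrib ..
    also have "\<dots> = (\<Prod>\<nu>\<in>UNIV. \<Sum>l<n. \<mu> (y $ \<nu>) l * (h ^ \<gamma> \<nu> * (real_of_int (k $ \<nu>) + real l + y $ \<nu> - x0 $ \<nu> / h) ^ \<gamma> \<nu>))"
      by (rule prod_sum_PiE[symmetric]) auto
    finally show ?thesis by (simp add: sum_distrib_left mult_ac)
  qed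
  have "(\<Sum>k\<in>index_box k0 n. quasi_coeff \<mu> n h y (\<lambda>z. \<Prod>\<nu>\<in>UNIV. (z $ \<nu> - x0 $ \<nu>) ^ \<gamma> \<nu>) k * bspline n h k z)
    = (\<Sum>k\<in>index_box k0 n. \<Prod>\<nu>\<in>UNIV. h ^ \<gamma> \<nu> * (?A \<nu> (k $ \<nu>) * cardinal_bspline n (z $ \<nu> / h - real_of_int (k $ \<nu>))))"
    unfolding coeff bspline_def prod.distrib[symmetric] by (simp only: mult.assoc)
  also have "\<dots> = (\<Sum>k\<in>PiE UNIV (\<lambda>\<nu>. {k0 $ \<nu> - int n..k0 $ \<nu>}). \<Prod>\<nu>\<in>UNIV. h ^ \<gamma> \<nu> * (?A \<nu> (k \<nu>) * cardinal_bspline n (z $ \<nu> / h - real_of_int (k \<nu>))))"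
    by (subst sum.reindex_bij_betw[OF bij_index_box[of k0 n], symmetric]) simp
  also have "\<dots> = (\<Prod>\<nu>\<in>UNIV. \<Sum>k=k0 $ \<nu> - int n..k0 $ \<nu>. h ^ \<gamma> \<nu> * (?A \<nu> k * cardinal_bspline n (z $ \<nu> / h - real_of_int k)))"
    by (rule prod_sum_PiE[symmetric]) auto
  also have "\<dots> = (\<Prod>\<nu>\<in>UNIV. h ^ \<gamma> \<nu> * (z $ \<nu> / h - x0 $ \<nu> / h) ^ \<gamma> \<nu>)"
    unfolding sum_distrib_left[symmetric] by (intro prod.cong refl) (simp add: \<mu> \<gamma> k0)
  also have "\<dots> = (\<Prod>\<nu>\<in>UNIV. (z $ \<nu> - x0 $ \<nu>) ^ \<gamma> \<nu>)"
    using hp[of "z $ \<nu> / h" "x0 $ \<nu>" for \<nu>] h by simp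
  finally show ?thesis .
qed

lemma quasi_coeff_taylor:
  fixes z x y :: "real^'m"
  assumes h: "h > 0" and k0: "\<And>\<nu>. k0 $ \<nu> = \<lfloor>z $ \<nu> / h\<rfloor>"
    and \<mu>: "\<And>\<tau> t t0 i lo hi. i < n \<Longrightarrow> lo \<le> \<lfloor>t\<rfloor> - int n \<Longrightarrow> hi \<ge> \<lfloor>t\<rfloor> \<Longrightarrow>
      (\<Sum>k=lo..hi. (\<Sum>l<n. \<mu> \<tau> l * (real_of_int k + real l + \<tau> - t0) ^ i) * cardinal_bspline n (t - real_of_int k)) = (t - t0) ^ i"
  shows "(\<Sum>k\<in>index_box k0 n. quasi_coeff \<mu> n h y (taylor_poly n f x) k * bspline n h k z) = taylor_poly n f x z"
proof -
  let ?m = "\<lambda>is z. direction_monomial is (z - x)"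
  have mono: "(\<Sum>k\<in>index_box k0 n. quasi_coeff \<mu> n h y (?m is) k * bspline n h k z) = ?m is z" if "length is < n" for "is"
  proof -
    have "count_list is \<nu> < n" for \<nu> using count_le_length[of "is" \<nu>] that by simp
    from quasi_coeff_monomial[OF h k0 this \<mu>, where ?x0.0 = x and y = y] show ?thesis
      by (simp add: direction_monomial_count)
  qed
  let ?D = "\<lambda>is. iter_partial is f x" and ?q = "\<lambda>is k. quasi_coeff \<mu> n h y (?m is) k"
  have qt: "quasi_coeff \<mu> n h y (taylor_poly n f x) k = (\<Sum>j<n. 1 / fact j * (\<Sum>is | length is = j. ?D is * ?q is k))" for k
    unfolding taylor_poly_def[abs_def] by (simp only: quasi_coeff_sum)
  have "(\<Sum>k\<in>index_box k0 n. quasi_coeff \<mu> n h y (taylor_poly n f x) k * bspline n h k z)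
     = (\<Sum>k\<in>index_box k0 n. \<Sum>j<n. \<Sum>is | length is = j. 1 / fact j * (?D is * ?q is k) * bspline n h k z)"
    by (simp only: qt sum_distrib_left sum_distrib_right)
  also have "\<dots> = (\<Sum>j<n. \<Sum>is | length is = j. \<Sum>k\<in>index_box k0 n. 1 / fact j * (?D is * ?q is k) * bspline n h k z)"
    by (subst sum.swap, rule sum.cong[OF refl], rule sum.swap)
  also have "\<dots> = (\<Sum>j<n. 1 / fact j * (\<Sum>is | length is = j. ?D is * (\<Sum>k\<in>index_box k0 n. ?q is k * bspline n h k z)))"
    by (simp only: sum_distrib_left mult.assoc)
  also have "\<dots> = taylor_poly n f x z"
    unfolding taylor_poly_def by (intro sum.cong refl arg_cong2[where f = "(*)"]) (simp add: mono)
  finally show ?thesis .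
qed

lemma bspline_eq_0:
  assumes "k0 $ \<nu> = \<lfloor>z $ \<nu> / h\<rfloor>" "k $ \<nu> < k0 $ \<nu> - int n \<or> k0 $ \<nu> < k $ \<nu>"
  shows "bspline n h k z = 0"
proof -
  have "z $ \<nu> / h - real_of_int (k $ \<nu>) < 0 \<or> real n \<le> z $ \<nu> / h - real_of_int (k $ \<nu>)"
    using assms by linarith
  then have "cardinal_bspline n (z $ \<nu> / h - real_of_int (k $ \<nu>)) = 0" by (rule cardinal_bspline_eq_0)
  then show ?thesis unfolding bspline_def by (intro prod_zero) auto
qed

lemma abs_quasi_coeff_le:
  fixes y :: "real^'m"
  assumes K: "K > 0" "\<And>\<tau> l. \<tau> \<in> {0..1} \<Longrightarrow> l < n \<Longrightarrow> \<bar>\<mu> \<tau> l\<bar> \<le> K" and y: "\<And>\<nu>. y $ \<nu> \<in> {0..1}"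
  shows "\<bar>quasi_coeff \<mu> n h y f k\<bar> \<le> K ^ CARD('m) * (\<Sum>l\<in>sample_offsets n. \<bar>f (sample_point h k l y)\<bar>)"
proof -
  have "\<bar>quasi_coeff \<mu> n h y f k\<bar> \<le> (\<Sum>l\<in>sample_offsets n. \<bar>(\<Prod>\<nu>\<in>UNIV. \<mu> (y $ \<nu>) (l \<nu>)) * f (sample_point h k l y)\<bar>)"
    unfolding quasi_coeff_def by (rule sum_abs)
  also have "\<dots> \<le> (\<Sum>l\<in>sample_offsets n. K ^ CARD('m) * \<bar>f (sample_point h k l y)\<bar>)"
  proof (rule sum_mono)
    fix l :: "'m \<Rightarrow> nat" assume l: "l \<in> sample_offsets n"
    have "\<bar>\<Prod>\<nu>\<in>UNIV. \<mu> (y $ \<nu>) (l \<nu>)\<bar> = (\<Prod>\<nu>\<in>UNIV. \<bar>\<mu> (y $ \<nu>) (l \<nu>)\<bar>)" by (rule abs_prod)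
    also have "\<dots> \<le> (\<Prod>\<nu>\<in>(UNIV::'m set). K)"
    proof (rule prod_mono)
      fix \<nu> :: 'm
      have "l \<nu> < n" using l by (auto simp: sample_offsets_def PiE_def)
      then show "0 \<le> \<bar>\<mu> (y $ \<nu>) (l \<nu>)\<bar> \<and> \<bar>\<mu> (y $ \<nu>) (l \<nu>)\<bar> \<le> K" using K(2) y by simp
    qed
    finally show "\<bar>(\<Prod>\<nu>\<in>UNIV. \<mu> (y $ \<nu>) (l \<nu>)) * f (sample_point h k l y)\<bar> \<le> K ^ CARD('m) * \<bar>f (sample_point h k l y)\<bar>"
      by (simp add: abs_mult mult_right_mono)
  qed
  finally show ?thesis by (simp add: sum_distrib_left)
qed

lemmas [simp] = mi_deriv_axis[unfolded One_nat_def] mi_order_axis[unfolded One_nat_def]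

section \<open>Web-spline spaces are contained in the Sobolev space\<close>

lemma finite_measure_lebesgue_on:
  assumes "bounded U" "open U"
  shows "finite_measure (lebesgue_on U)"
proof (rule finite_measureI)
  have "emeasure (lebesgue_on U) (space (lebesgue_on U)) < \<infinity>"
    using assms emeasure_bounded_finite[of U]
    by (simp add: emeasure_restrict_space sets_lebesgue_open space_restrict_space borel_open)
  then show "emeasure (lebesgue_on U) (space (lebesgue_on U)) \<noteq> \<infinity>" by simp
qed

lemma measurable_AE_limit:
  fixes v :: "real^'m \<Rightarrow> real"
  assumes "open U" "\<And>j. u j \<in> borel_measurable (lebesgue_on U)"
    and "AE x in lebesgue_on U. (\<lambda>j. u j x) \<longlonglongrightarrow> v x"
  shows "v \<in> borel_measurable (lebesgue_on U)"
proof (rule measurable_AE_cong_lebesgue_on[OF sets_lebesgue_open[OF assms(1)]])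
  show "(\<lambda>x. lim (\<lambda>j. u j x)) \<in> borel_measurable (lebesgue_on U)"
    by (rule borel_measurable_lim_metric[OF assms(2)])
  show "AE x in lebesgue_on U. lim (\<lambda>j. u j x) = v x"
    using assms(3) by eventually_elim (rule limI)
qed

text \<open>On a domain of finite measure uniform bounds are integrable majorants, so dominated
  convergence passes to the limit in the identity defining the weak derivative and also gives
  convergence of the derivatives in mean square.\<close>

lemma has_weak_deriv_limit:
  fixes v :: "real^'m \<Rightarrow> real"
  assumes U: "open U" "bounded U"
    and wd: "\<And>j. has_weak_deriv U \<beta> (u j) (d j)"
    and meas: "\<And>j. u j \<in> borel_measurable (lebesgue_on U)" "\<And>j. d j \<in> borel_measurable (lebesgue_on U)"
    and bound: "\<And>j x. x \<in> U \<Longrightarrow> \<bar>u j x\<bar> \<le> K" "\<And>j x. x \<in> U \<Longrightarrow> \<bar>d j x\<bar> \<le> K"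
    and lim: "AE x in lebesgue_on U. (\<lambda>j. u j x) \<longlonglongrightarrow> v x" "AE x in lebesgue_on U. (\<lambda>j. d j x) \<longlonglongrightarrow> g x"
  shows "v \<in> L2 U" "g \<in> L2 U" "has_weak_deriv U \<beta> v g"
    "(\<lambda>j. \<integral>x. (g x - d j x)\<^sup>2 \<partial>lebesgue_on U) \<longlonglongrightarrow> 0"
proof -
  interpret finite_measure "lebesgue_on U" by (rule finite_measure_lebesgue_on[OF U(2,1)])
  have [measurable]: "v \<in> borel_measurable (lebesgue_on U)" "g \<in> borel_measurable (lebesgue_on U)"
    "\<And>j. u j \<in> borel_measurable (lebesgue_on U)" "\<And>j. d j \<in> borel_measurable (lebesgue_on U)"
    using measurable_AE_limit[OF U(1) meas(1) lim(1)] measurable_AE_limit[OF U(1) meas(2) lim(2)] meas by auto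
  have lim_bd: "AE x in lebesgue_on U. \<bar>b x\<bar> \<le> K"
    if "\<And>j x. x \<in> U \<Longrightarrow> \<bar>a j x\<bar> \<le> K" "AE x in lebesgue_on U. (\<lambda>j. a j x) \<longlonglongrightarrow> b x" for a and b :: "real^'m \<Rightarrow> real"
    using that(2) AE_space
  proof eventually_elim
    case (elim x)
    then have "x \<in> U" by (simp add: space_restrict_space)
    show ?case
      by (rule LIMSEQ_le_const2[OF tendsto_rabs[OF elim(1)]]) (use that(1) \<open>x \<in> U\<close> in auto)
  qed
  have bdv: "AE x in lebesgue_on U. \<bar>v x\<bar> \<le> K" and bdg: "AE x in lebesgue_on U. \<bar>g x\<bar> \<le> K"
    by (rule lim_bd[OF bound(1) lim(1)] lim_bd[OF bound(2) lim(2)]; assumption)+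
  show v: "v \<in> L2 U" by (rule L2_bounded[OF U(2,1) _ bdv]) simp
  show g: "g \<in> L2 U" by (rule L2_bounded[OF U(2,1) _ bdg]) simp
  have conv: "(\<lambda>j. \<integral>x. a j x * \<phi> x \<partial>lebesgue_on U) \<longlonglongrightarrow> (\<integral>x. b x * \<phi> x \<partial>lebesgue_on U)"
    if \<phi>: "\<phi> \<in> test_functions U" and a: "\<And>j x. x \<in> U \<Longrightarrow> \<bar>a j x\<bar> \<le> K" "AE x in lebesgue_on U. (\<lambda>j. a j x) \<longlonglongrightarrow> b x"
      and [measurable]: "\<And>j. a j \<in> borel_measurable (lebesgue_on U)" "b \<in> borel_measurable (lebesgue_on U)"
    for a and b \<phi> :: "real^'m \<Rightarrow> real"
  proof -
    obtain B where B: "\<And>x. \<bar>\<phi> x\<bar> \<le> B" using test_functions_bounded[OF \<phi>] by metis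
    have [measurable]: "\<phi> \<in> borel_measurable (lebesgue_on U)"
      using test_function_L2[OF \<phi> U(1)] by (simp add: L2_def)
    show ?thesis
    proof (rule integral_dominated_convergence[where w = "\<lambda>x. K * B"])
      show "AE x in lebesgue_on U. (\<lambda>j. a j x * \<phi> x) \<longlonglongrightarrow> b x * \<phi> x"
        using a(2) by eventually_elim (intro tendsto_intros)
      show "AE x in lebesgue_on U. norm (a j x * \<phi> x) \<le> K * B" for j
      proof (rule AE_I2)
        fix x assume "x \<in> space (lebesgue_on U)"
        then have "\<bar>a j x\<bar> \<le> K" using a(1) by (simp add: space_restrict_space)
        then show "norm (a j x * \<phi> x) \<le> K * B"
          using B[of x] by (simp add: abs_mult mult_mono')
      qed
    qed simp_all
  qed
  show "has_weak_deriv U \<beta> v g"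
    unfolding has_weak_deriv_def
  proof (intro conjI ballI)
    show "locally_integrable U v" "locally_integrable U g"
      using L2_locally_integrable[OF U(1)] v g by auto
    fix \<phi> assume \<phi>: "\<phi> \<in> test_functions U"
    obtain "is" where l: "mi_deriv \<beta> = iter_partial is" by (rule mi_deriv_list[of \<beta>]) (blast)
    have D\<phi>: "mi_deriv \<beta> \<phi> \<in> test_functions U" using test_functions_iter_partial[OF \<phi>] l by simp
    have 1: "(\<lambda>j. \<integral>x. u j x * mi_deriv \<beta> \<phi> x \<partial>lebesgue_on U) \<longlonglongrightarrow> (\<integral>x. v x * mi_deriv \<beta> \<phi> x \<partial>lebesgue_on U)"
      by (rule conv[OF D\<phi> bound(1) lim(1)]) simp_all
    have "(\<lambda>j. (-1) ^ mi_order \<beta> * (\<integral>x. d j x * \<phi> x \<partial>lebesgue_on U)) \<longlonglongrightarrow> (-1) ^ mi_order \<beta> * (\<integral>x. g x * \<phi> x \<partial>lebesgue_on U)"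
      by (intro tendsto_mult tendsto_const conv[OF \<phi> bound(2) lim(2)]) simp_all
    moreover have "(\<lambda>j. (-1) ^ mi_order \<beta> * (\<integral>x. d j x * \<phi> x \<partial>lebesgue_on U)) = (\<lambda>j. \<integral>x. u j x * mi_deriv \<beta> \<phi> x \<partial>lebesgue_on U)"
      using wd \<phi> by (simp add: has_weak_deriv_def)
    ultimately show "(\<integral>x. v x * mi_deriv \<beta> \<phi> x \<partial>lebesgue_on U) = (-1) ^ mi_order \<beta> * (\<integral>x. g x * \<phi> x \<partial>lebesgue_on U)"
      using LIMSEQ_unique[OF 1] by simp
  qed
  have "(\<lambda>j. \<integral>x. (g x - d j x)\<^sup>2 \<partial>lebesgue_on U) \<longlonglongrightarrow> (\<integral>x. 0 \<partial>lebesgue_on U)"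
  proof (rule integral_dominated_convergence[where w = "\<lambda>x. (2 * K)\<^sup>2"])
    show "AE x in lebesgue_on U. (\<lambda>j. (g x - d j x)\<^sup>2) \<longlonglongrightarrow> 0"
      using lim(2) by eventually_elim (auto intro!: tendsto_eq_intros)
    show "AE x in lebesgue_on U. norm ((g x - d j x)\<^sup>2) \<le> (2 * K)\<^sup>2" for j
      using bdg AE_space
    proof eventually_elim
      case (elim x)
      have "\<bar>d j x\<bar> \<le> K" using bound(2) elim(2) by (simp add: space_restrict_space)
      then have "\<bar>g x - d j x\<bar> \<le> 2 * K" using elim(1) by linarith
      from power_mono[OF this, of 2] show ?case by simp
    qed
  qed simp_all
  then show "(\<lambda>j. \<integral>x. (g x - d j x)\<^sup>2 \<partial>lebesgue_on U) \<longlonglongrightarrow> 0" by simp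
qed

text \<open>The criterion by which splines enter the space: test functions with uniformly bounded
  values and gradients that converge almost everywhere also converge in the Sobolev norm of order 1,
  and their limit inherits the boundary condition.\<close>

lemma H0space_limit:
  fixes v :: "real^'m \<Rightarrow> real"
  assumes U: "open U" "bounded U"
    and \<Phi>: "\<And>j. \<Phi> j \<in> test_functions U"
    and bound: "\<And>j x. x \<in> U \<Longrightarrow> \<bar>\<Phi> j x\<bar> \<le> K" "\<And>j x i. x \<in> U \<Longrightarrow> \<bar>partial_deriv i (\<Phi> j) x\<bar> \<le> K"
    and lim: "AE x in lebesgue_on U. (\<lambda>j. \<Phi> j x) \<longlonglongrightarrow> v x"
      "\<And>i. AE x in lebesgue_on U. (\<lambda>j. partial_deriv i (\<Phi> j) x) \<longlonglongrightarrow> g i x"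
  shows "v \<in> H0space 1 U" "AE x in lebesgue_on U. weak_deriv U (axis i 1) v x = g i x"
proof -
  have D\<Phi>: "partial_deriv i (\<Phi> j) \<in> test_functions U" for i j
    using test_functions_iter_partial[OF \<Phi>, of "[i]"] by (simp add: iter_partial_Cons)
  have m: "\<phi> \<in> borel_measurable (lebesgue_on U)" if "\<phi> \<in> test_functions U" for \<phi>
    using test_function_L2[OF that U(1)] by (simp add: L2_def)
  have w: "has_weak_deriv U \<beta> (\<Phi> j) (mi_deriv \<beta> (\<Phi> j))" for \<beta> j
    using smooth_on_subset[OF test_functionsD(1)[OF \<Phi>]] by (intro has_weak_deriv_smooth U) auto
  have w1: "has_weak_deriv U (axis i 1) (\<Phi> j) (partial_deriv i (\<Phi> j))" for i j
    using w[of "axis i 1" j] unfolding mi_deriv_axis .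
  have w0: "has_weak_deriv U 0 (\<Phi> j) (\<Phi> j)" for j using w[of 0 j] by simp
  note L1 = has_weak_deriv_limit[OF U w1 m[OF \<Phi>] m[OF D\<Phi>] bound(1) bound(2) lim(1) lim(2)]
  note L0 = has_weak_deriv_limit[OF U w0 m[OF \<Phi>] m[OF \<Phi>] bound(1) bound(1) lim(1) lim(1)]
  have v1: "v \<in> Hspace 1 U" unfolding Hspace_def mi_order_le_1
    using L0(1,3) L1(2,3) by blast
  show "AE x in lebesgue_on U. weak_deriv U (axis i 1) v x = g i x" for i
    by (rule weak_deriv_AE_eq[OF U(1) L1(3)])
  \<comment> \<open>A multi-index of order at most 1 is 0 or a unit vector; \<open>D\<close> picks
    the weak derivative that belongs to it.\<close>
  define D where "D \<beta> = (if \<beta> = 0 then v else g (SOME i. \<beta> = axis i 1))" for \<beta> :: "nat^'m"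
  have axis_ne: "axis i (1::nat) \<noteq> (0 :: nat^'m)" for i by (simp add: axis_eq_0_iff)
  have Dax: "\<exists>i. \<beta> = axis i 1 \<and> D \<beta> = g i" if "\<beta> = axis i0 1" for \<beta> :: "nat^'m" and i0
    using that axis_ne someI[of "\<lambda>i. \<beta> = axis i 1" i0] by (auto simp: D_def)
  have conv: "(\<lambda>j. \<integral>x. (weak_deriv U \<beta> (\<lambda>x. v x - \<Phi> j x) x)\<^sup>2 \<partial>lebesgue_on U) \<longlonglongrightarrow> 0"
    if b: "mi_order \<beta> \<le> 1" for \<beta>
  proof -
    have "has_weak_deriv U \<beta> v (D \<beta>) \<and> D \<beta> \<in> L2 U \<and> (\<lambda>j. \<integral>x. (D \<beta> x - mi_deriv \<beta> (\<Phi> j) x)\<^sup>2 \<partial>lebesgue_on U) \<longlonglongrightarrow> 0"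
    proof -
      consider "\<beta> = 0" | i where "\<beta> = axis i 1" using b mi_order_le_1 by blast
      then show ?thesis
      proof cases
        case 1
        then show ?thesis using L0 by (simp add: D_def)
      next
        case 2
        then obtain i' where "\<beta> = axis i' 1" "D \<beta> = g i'" using Dax by blast
        then show ?thesis using L1(2,3,4)[of i'] by simp
      qed
    qed
    then have h: "has_weak_deriv U \<beta> v (D \<beta>)" "D \<beta> \<in> L2 U"
      and c: "(\<lambda>j. \<integral>x. (D \<beta> x - mi_deriv \<beta> (\<Phi> j) x)\<^sup>2 \<partial>lebesgue_on U) \<longlonglongrightarrow> 0" by auto
    have "(\<integral>x. (weak_deriv U \<beta> (\<lambda>x. v x - \<Phi> j x) x)\<^sup>2 \<partial>lebesgue_on U) = (\<integral>x. (D \<beta> x - mi_deriv \<beta> (\<Phi> j) x)\<^sup>2 \<partial>lebesgue_on U)" for j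
    proof (rule L2_cong_AE(2)[OF U(1), symmetric])
      have "mi_deriv \<beta> (\<Phi> j) \<in> test_functions U"
        by (rule mi_deriv_list[of \<beta>]) (simp add: test_functions_iter_partial \<Phi>)
      then show "(\<lambda>x. D \<beta> x - mi_deriv \<beta> (\<Phi> j) x) \<in> L2 U"
        by (intro L2_diff h(2) test_function_L2 U)
      show "AE x in lebesgue_on U. D \<beta> x - mi_deriv \<beta> (\<Phi> j) x = weak_deriv U \<beta> (\<lambda>x. v x - \<Phi> j x) x"
        using weak_deriv_AE_eq[OF U(1) has_weak_deriv_diff[OF U(1) h(1) w[of \<beta> j]]] by eventually_elim simp
    qed
    then show ?thesis using c by simp
  qed
  have "(\<lambda>j. Hnorm 1 U (\<lambda>x. v x - \<Phi> j x)) \<longlonglongrightarrow> sqrt (\<Sum>\<beta> | mi_order (\<beta> :: nat^'m) \<le> 1. 0)"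
    unfolding Hnorm_def by (intro tendsto_intros conv) auto
  then have H: "(\<lambda>j. Hnorm 1 U (\<lambda>x. v x - \<Phi> j x)) \<longlonglongrightarrow> 0" by simp
  show "v \<in> H0space 1 U" unfolding H0space_def
  proof (intro CollectI conjI v1 allI impI)
    fix \<epsilon> :: real assume "\<epsilon> > 0"
    then have "eventually (\<lambda>j. Hnorm 1 U (\<lambda>x. v x - \<Phi> j x) < \<epsilon>) sequentially"
      using order_tendstoD(2)[OF H] by blast
    then obtain j where "Hnorm 1 U (\<lambda>x. v x - \<Phi> j x) < \<epsilon>" by (auto simp: eventually_sequentially)
    then show "\<exists>\<phi>\<in>test_functions U. Hnorm 1 U (\<lambda>x. v x - \<phi> x) < \<epsilon>" using \<Phi> by blast
  qed
qed

section \<open>Smoothed tensor-product splines and the boundary cutoff\<close>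

definition gen_tensor :: "(real \<Rightarrow> real) \<Rightarrow> nat \<Rightarrow> real \<Rightarrow> int^'m \<Rightarrow> real^'m \<Rightarrow> real" where
  "gen_tensor q n h k x = (\<Prod>\<nu>\<in>UNIV. gen_bspline q n (x $ \<nu> / h - of_int (k $ \<nu>)))"

definition gen_tensor_deriv :: "(real \<Rightarrow> real) \<Rightarrow> (real \<Rightarrow> real) \<Rightarrow> nat \<Rightarrow> real \<Rightarrow> int^'m \<Rightarrow> 'm \<Rightarrow> real^'m \<Rightarrow> real" where
  "gen_tensor_deriv q q' n h k i x = gen_bspline_deriv q q' n (x $ i / h - of_int (k $ i)) / h
     * (\<Prod>\<nu>\<in>UNIV - {i}. gen_bspline q n (x $ \<nu> / h - of_int (k $ \<nu>)))"

text \<open>The weak partial derivative of a B-spline, defined at every point by the convention sgn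
  0 = 0; off the grid hyperplanes it is the classical one.\<close>

abbreviation bspline_deriv :: "nat \<Rightarrow> real \<Rightarrow> int^'m \<Rightarrow> 'm \<Rightarrow> real^'m \<Rightarrow> real" where
  "bspline_deriv \<equiv> gen_tensor_deriv abs sgn"

lemma gen_tensor_abs: "n \<ge> 2 \<Longrightarrow> gen_tensor abs n h k = bspline n h k"
  by (simp add: gen_tensor_def bspline_def fun_eq_iff gen_bspline_abs)

lemma gen_tensor_partial_deriv:
  assumes "\<And>\<nu> j. (q has_real_derivative q' (x $ \<nu> / h - of_int (k $ \<nu>) - real j)) (at (x $ \<nu> / h - of_int (k $ \<nu>) - real j))"
  shows "gen_tensor q n h k differentiable at x"
    and "partial_deriv i (gen_tensor q n h k) x = gen_tensor_deriv q q' n h k i x"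
proof -
  have "((\<lambda>x. gen_bspline q n (x $ \<nu> / h - of_int (k $ \<nu>))) has_derivative
    (\<lambda>y. gen_bspline_deriv q q' n (x $ \<nu> / h - of_int (k $ \<nu>)) * (y $ \<nu> / h))) (at x)" for \<nu>
  proof -
    have "((\<lambda>x. x $ \<nu> / h - of_int (k $ \<nu>)) has_derivative (\<lambda>y. y $ \<nu> / h)) (at x)"
      using has_derivative_diff[OF bounded_linear_imp_has_derivative[OF bounded_linear_compose[OF bounded_linear_divide
        bounded_linear_vec_nth]] has_derivative_const] by (simp only: diff_zero)
    from diff_chain_at[OF this DERIV_gen_bspline[OF assms, unfolded has_field_derivative_def]]
    show ?thesis by (simp add: o_def)
  qed
  then have D: "(gen_tensor q n h k has_derivative (\<lambda>y. \<Sum>i\<in>UNIV. gen_bspline_deriv q q' n (x $ i / h - of_int (k $ i)) * (y $ i / h)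
      * (\<Prod>j\<in>UNIV - {i}. gen_bspline q n (x $ j / h - of_int (k $ j))))) (at x)"
    unfolding gen_tensor_def[abs_def] by (rule has_derivative_prod)
  then show "gen_tensor q n h k differentiable at x" by (auto simp: differentiable_def)
  have "(\<Sum>j\<in>UNIV. gen_bspline_deriv q q' n (x $ j / h - of_int (k $ j)) * (axis i 1 $ j / h)
      * (\<Prod>l\<in>UNIV - {j}. gen_bspline q n (x $ l / h - of_int (k $ l))))
    = (\<Sum>j\<in>UNIV. axis i 1 $ j * gen_tensor_deriv q q' n h k j x)"
    by (intro sum.cong refl) (simp add: gen_tensor_deriv_def)
  then show "partial_deriv i (gen_tensor q n h k) x = gen_tensor_deriv q q' n h k i x"
    using partial_deriv_eq[OF D] by simp
qed

lemma gen_tensor_bounded: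
  assumes R: "R \<ge> 0"
  obtains K where "K > 0" "\<And>h q q' k x i. h > 0 \<Longrightarrow> (\<And>t. \<bar>q t\<bar> \<le> \<bar>t\<bar> + 1) \<Longrightarrow> (\<And>t. \<bar>q' t\<bar> \<le> 1) \<Longrightarrow>
     (\<And>\<nu>. \<bar>x $ \<nu> / h - of_int (k $ \<nu>)\<bar> \<le> R) \<Longrightarrow>
     \<bar>gen_tensor q n h (k :: int^'m) x\<bar> \<le> K \<and> \<bar>gen_tensor_deriv q q' n h k i x\<bar> \<le> K / h"
proof -
  obtain K0 where K0: "K0 > 0" "\<And>q q' t. (\<And>t. \<bar>q t\<bar> \<le> \<bar>t\<bar> + 1) \<Longrightarrow> (\<And>t. \<bar>q' t\<bar> \<le> 1) \<Longrightarrow> \<bar>t\<bar> \<le> R \<Longrightarrow>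
     \<bar>gen_bspline q n t\<bar> \<le> K0 \<and> \<bar>gen_bspline_deriv q q' n t\<bar> \<le> K0" using gen_bspline_bounded[OF R] by metis
  define K where "K = (max 1 K0) ^ CARD('m)"
  have b: "\<bar>\<Prod>\<nu>\<in>A. f \<nu>\<bar> \<le> (max 1 K0) ^ card A" if "\<And>\<nu>. \<bar>f \<nu>\<bar> \<le> K0" for A :: "'m set" and f
  proof -
    have "\<bar>\<Prod>\<nu>\<in>A. f \<nu>\<bar> = (\<Prod>\<nu>\<in>A. \<bar>f \<nu>\<bar>)" by (rule abs_prod)
    also have "\<dots> \<le> (\<Prod>\<nu>\<in>A. max 1 K0)" using that by (intro prod_mono) (simp add: max.coboundedI2)
    finally show ?thesis by simp
  qed
  have "\<bar>gen_tensor q n h k x\<bar> \<le> K \<and> \<bar>gen_tensor_deriv q q' n h k i x\<bar> \<le> K / h"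
    if h: "h > 0" and q: "\<And>t. \<bar>q t\<bar> \<le> \<bar>t\<bar> + 1" "\<And>t. \<bar>q' t\<bar> \<le> 1" and x: "\<And>\<nu>. \<bar>x $ \<nu> / h - of_int (k $ \<nu>)\<bar> \<le> R"
    for h q q' and k :: "int^'m" and x i
  proof
    let ?t = "\<lambda>\<nu>. x $ \<nu> / h - of_int (k $ \<nu>)"
    have g: "\<bar>gen_bspline q n (?t \<nu>)\<bar> \<le> K0" "\<bar>gen_bspline_deriv q q' n (?t \<nu>)\<bar> \<le> K0" for \<nu>
      using K0(2)[OF q x] by auto
    show "\<bar>gen_tensor q n h k x\<bar> \<le> K" unfolding gen_tensor_def K_def using b[where A = UNIV, OF g(1)] by simp
    have "\<bar>gen_bspline_deriv q q' n (?t i) * (\<Prod>\<nu>\<in>UNIV - {i}. gen_bspline q n (?t \<nu>))\<bar> \<le> max 1 K0 * (max 1 K0) ^ card (UNIV - {i})"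
      unfolding abs_mult by (intro mult_mono b g) (use g(2)[of i] in auto)
    also have "\<dots> = K" unfolding K_def by (simp add: card_Diff_singleton flip: power_Suc)
    finally show "\<bar>gen_tensor_deriv q q' n h k i x\<bar> \<le> K / h"
      using h by (simp add: gen_tensor_deriv_def abs_mult divide_right_mono)
  qed
  moreover have "K > 0" by (simp add: K_def)
  ultimately show ?thesis using that by blast
qed

text \<open>With s = (j + 1) w this is the cutoff's derivative times \<open>w\<close>:
  differentiating the cutoff produces a factor j + 1, and the bound shows that multiplication by
  \<open>w\<close> makes up for it uniformly in j. With u = 1 / (s - 1) the expression becomes (u +
  u^2) exp(-u).\<close>

lemma exp_bump_1_bound: "\<bar>exp_bump 1 (s - 1) * s\<bar> \<le> 3"
proof (cases "s > 1")
  case True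
  define u where "u = 1 / (s - 1)"
  have u: "u > 0" using True by (simp add: u_def)
  have s: "s = 1 / u + 1" using True by (simp add: u_def)
  have "exp_bump 1 (s - 1) * s = (u + u\<^sup>2) * exp (- u)"
    using True u by (simp add: exp_bump_def s power2_eq_square field_simps)
  also have "\<dots> = (u + u\<^sup>2) / exp u" by (simp add: exp_minus divide_inverse)
  also have "\<dots> \<le> 3"
  proof -
    have "1 + u + u\<^sup>2 / 2 \<le> exp u" using exp_lower_Taylor_quadratic[of u] u by simp
    then have "u + u\<^sup>2 \<le> 3 * exp u" using u zero_le_power2[of u] by linarith
    then show ?thesis by (simp add: divide_le_eq)
  qed
  finally have "exp_bump 1 (s - 1) * s \<le> 3" .
  moreover have "exp_bump 1 (s - 1) * s \<ge> 0" using True by (simp add: exp_bump_def)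
  ultimately show ?thesis by simp
qed (simp add: exp_bump_def)

lemma exp_bump_1_tendsto:
  assumes "a > 0"
  shows "(\<lambda>j. exp_bump 1 (real (Suc j) * a - 1) * (real (Suc j) * a)) \<longlonglongrightarrow> 0"
    and "(\<lambda>j. exp_bump 0 (real (Suc j) * a - 1)) \<longlonglongrightarrow> 1"
proof -
  have top: "filterlim (\<lambda>j. real (Suc j) * a - 1) at_top sequentially"
  proof -
    have "filterlim (\<lambda>j. a * real (Suc j)) at_top sequentially"
      by (rule filterlim_tendsto_pos_mult_at_top[OF tendsto_const assms])
         (rule filterlim_compose[OF filterlim_real_sequentially filterlim_Suc])
    then have "filterlim (\<lambda>j. - 1 + a * real (Suc j)) at_top sequentially"
      by (rule filterlim_tendsto_add_at_top[OF tendsto_const])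
    then show ?thesis by (simp add: mult.commute algebra_simps)
  qed
  define u where "u t = 1 / t" for t :: real
  have u0: "(u \<longlongrightarrow> 0) at_top" unfolding u_def using tendsto_inverse_0_at_top[OF filterlim_ident] by (simp add: inverse_eq_divide)
  have "((\<lambda>t. (u t + u t * u t) * exp (- u t)) \<longlongrightarrow> (0 + 0 * 0) * exp (- 0)) at_top"
    by (intro tendsto_intros u0)
  moreover have "eventually (\<lambda>t. (u t + u t * u t) * exp (- u t) = exp_bump 1 t * (t + 1)) at_top"
    using eventually_gt_at_top[of 0]
    by eventually_elim (simp add: u_def exp_bump_def power2_eq_square field_simps)
  ultimately have "((\<lambda>t. exp_bump 1 t * (t + 1)) \<longlongrightarrow> (0 + 0 * 0) * exp (- 0)) at_top"
    by (rule Lim_transform_eventually)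
  then have "((\<lambda>t. exp_bump 1 t * (t + 1)) \<longlongrightarrow> 0) at_top" by simp
  from filterlim_compose[OF this top]
  show "(\<lambda>j. exp_bump 1 (real (Suc j) * a - 1) * (real (Suc j) * a)) \<longlonglongrightarrow> 0" by simp
  have "((\<lambda>t. exp (- u t)) \<longlongrightarrow> exp (- 0)) at_top" by (intro tendsto_intros u0)
  moreover have "eventually (\<lambda>t. exp (- u t) = exp_bump 0 t) at_top"
    using eventually_gt_at_top[of 0] by eventually_elim (simp add: u_def exp_bump_def)
  ultimately have "(exp_bump 0 \<longlongrightarrow> exp (- 0)) at_top" by (rule Lim_transform_eventually)
  then have "(exp_bump 0 \<longlongrightarrow> 1) at_top" by simp
  from filterlim_compose[OF this top]
  show "(\<lambda>j. exp_bump 0 (real (Suc j) * a - 1)) \<longlonglongrightarrow> 1" .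
qed

text \<open>The approximating test functions are \<open>w\<close> times the smoothed spline, cut off
  where (j + 1) w is at most 1. Values and gradients stay bounded, because the growing gradient of
  the cutoff is always multiplied by \<open>w\<close>, and both converge everywhere in
  \<open>U\<close>.\<close>

lemma weighted_spline_H0space:
  fixes w :: "real^'m \<Rightarrow> real" and U :: "(real^'m) set"
  assumes U: "open U" "bounded U" and ne: "frontier U \<noteq> {}" and w: "smooth_on U w"
    and wpos: "\<And>x. x \<in> U \<Longrightarrow> w x > 0" and c2: "c2 > 0" "\<And>x. x \<in> U \<Longrightarrow> w x \<le> c2 * infdist x (frontier U)"
    and W: "\<And>x. x \<in> U \<Longrightarrow> w x \<le> W" "\<And>x i. x \<in> U \<Longrightarrow> \<bar>partial_deriv i w x\<bar> \<le> W"
    and n: "n \<ge> 2" and h: "h > 0" and S: "finite S"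
    and v: "\<And>x. x \<in> U \<Longrightarrow> v x = w x * (\<Sum>k\<in>S. c k * bspline n h k x)"
  shows "v \<in> H0space 1 U"
    and "AE x in lebesgue_on U. weak_deriv U (axis i 1) v x
      = partial_deriv i w x * (\<Sum>k\<in>S. c k * bspline n h k x) + w x * (\<Sum>k\<in>S. c k * bspline_deriv n h k i x)"
proof -
  define s where "s j x = (\<Sum>k\<in>S. c k * gen_tensor (sqrt_abs j) n h k x)" for j x
  define s' where "s' j i x = (\<Sum>k\<in>S. c k * gen_tensor_deriv (sqrt_abs j) (sqrt_abs' j) n h k i x)" for j i x
  define \<Phi> where "\<Phi> j x = (if x \<in> U then exp_bump 0 (real (Suc j) * w x - 1) * (w x * s j x) else 0)" for j x
  have sq: "sqrt_abs j differentiable at t" for j t using DERIV_sqrt_abs real_differentiable_def by blast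
  have sm_s: "smooth_on A (s j)" if A: "open A" for j A
    unfolding s_def gen_tensor_def
  proof (intro smooth_on_sum smooth_on_mult smooth_on_const smooth_on_prod A smooth_on_gen_bspline smooth_on_sqrt_abs)
    fix k \<nu>
    have "smooth_on A (\<lambda>x. 1 / h * x $ \<nu> - of_int (k $ \<nu>))"
      by (intro smooth_on_diff smooth_on_mult smooth_on_const smooth_on_component A)
    then show "smooth_on A (\<lambda>x. x $ \<nu> / h - of_int (k $ \<nu>))" by simp
  qed
  have ds: "partial_deriv i (s j) x = s' j i x" for i j x
  proof -
    have d: "gen_tensor (sqrt_abs j) n h k differentiable at x" "partial_deriv i (gen_tensor (sqrt_abs j) n h k) x = gen_tensor_deriv (sqrt_abs j) (sqrt_abs' j) n h k i x" for k
      using gen_tensor_partial_deriv[of "sqrt_abs j" "sqrt_abs' j"] DERIV_sqrt_abs by blast+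
    have "(\<lambda>x. \<Sum>k\<in>T. c k * gen_tensor (sqrt_abs j) n h k x) differentiable at x \<and>
      partial_deriv i (\<lambda>x. \<Sum>k\<in>T. c k * gen_tensor (sqrt_abs j) n h k x) x = (\<Sum>k\<in>T. c k * gen_tensor_deriv (sqrt_abs j) (sqrt_abs' j) n h k i x)"
      if "finite T" for T
      using that by (induction T) (auto simp: partial_deriv_add partial_deriv_mult d)
    then show ?thesis unfolding s_def[abs_def] s'_def using S by blast
  qed
  define E where "E j x = exp_bump 0 (real (Suc j) * w x - 1)" for j x
  have sm_E: "smooth_on U (E j)" for j unfolding E_def
    by (intro smooth_on_exp_bump smooth_on_diff smooth_on_mult smooth_on_const U w)
  have sm_\<Phi>: "smooth_on U (\<lambda>x. E j x * (w x * s j x))" for j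
    by (intro smooth_on_mult sm_E w sm_s U)
  have test: "\<Phi> j \<in> test_functions U" for j
  proof (rule test_functionsI[OF U(1)])
    \<comment> \<open>Since \<open>w\<close> is at most c2 times the boundary distance, the cutoff
      vanishes wherever the distance is below 1 / ((j + 1) c2).\<close>
    let ?K = "closure U \<inter> {x. 1 / (real (Suc j) * c2) \<le> infdist x (frontier U)}"
    show "compact ?K"
      using U(2) by (intro compact_Int_closed closed_Collect_le continuous_intros) auto
    show "?K \<subseteq> U"
    proof
      fix x assume x: "x \<in> ?K"
      have "0 < 1 / (real (Suc j) * c2)" using c2(1) by simp
      then have "x \<notin> frontier U" using x by auto
      then show "x \<in> U" using x U(1) by (auto simp: frontier_def interior_open)
    qed
    show "smooth_on U (\<Phi> j)"
      using smooth_on_cong[OF U(1), of "\<lambda>x. E j x * (w x * s j x)" "\<Phi> j"] sm_\<Phi> by (simp add: \<Phi>_def E_def)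
    show "\<Phi> j x = 0" if x: "x \<notin> ?K" for x
    proof (cases "x \<in> U")
      case True
      then have "infdist x (frontier U) < 1 / (real (Suc j) * c2)" using x closure_subset by auto
      then have "infdist x (frontier U) * (real (Suc j) * c2) < 1"
        using c2(1) by (simp only: pos_less_divide_eq mult_pos_pos of_nat_0_less_iff zero_less_Suc)
      then have "real (Suc j) * (c2 * infdist x (frontier U)) < 1" by (simp only: mult_ac)
      moreover have "real (Suc j) * w x \<le> real (Suc j) * (c2 * infdist x (frontier U))"
        using c2(2)[OF True] by (intro mult_left_mono) auto
      ultimately have "real (Suc j) * w x - 1 < 0" by linarith
      then show ?thesis by (simp add: \<Phi>_def exp_bump_def)
    qed (simp add: \<Phi>_def)
  qed
  have dE: "partial_deriv i (E j) x = exp_bump 1 (real (Suc j) * w x - 1) * (real (Suc j) * partial_deriv i w x)" if x: "x \<in> U" for i j x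
  proof -
    have wd: "w differentiable at x" by (rule smooth_on_imp_differentiable[OF w U(1) x])
    have "((\<lambda>t. exp_bump 0 (real (Suc j) * t - 1)) has_real_derivative exp_bump 1 (real (Suc j) * w x - 1) * real (Suc j)) (at (w x))"
      by (rule DERIV_chain2[OF DERIV_exp_bump[of 0, unfolded One_nat_def[symmetric]]]) (auto intro!: derivative_eq_intros)
    from partial_deriv_compose(2)[OF wd this, of i] show ?thesis by (simp add: E_def[abs_def] mult_ac)
  qed
  have d\<Phi>: "partial_deriv i (\<Phi> j) x = (exp_bump 1 (real (Suc j) * w x - 1) * (real (Suc j) * w x) + E j x) * partial_deriv i w x * s j x
      + E j x * w x * s' j i x" if x: "x \<in> U" for i j x
  proof -
    have wd: "w differentiable at x" "E j differentiable at x" "s j differentiable at x"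
      using smooth_on_imp_differentiable[OF _ U(1) x] w sm_E sm_s[OF U(1)] by auto
    then have "(\<lambda>x. w x * s j x) differentiable at x" by (intro differentiable_mult)
    have "partial_deriv i (\<Phi> j) x = partial_deriv i (\<lambda>x. E j x * (w x * s j x)) x"
      by (rule partial_deriv_cong_open[OF U(1) x]) (simp add: \<Phi>_def E_def)
    also have "\<dots> = partial_deriv i (E j) x * (w x * s j x) + E j x * (partial_deriv i w x * s j x + w x * s' j i x)"
      using wd \<open>(\<lambda>x. w x * s j x) differentiable at x\<close> by (simp add: partial_deriv_mult ds)
    finally show ?thesis unfolding dE[OF x] by (simp add: algebra_simps)
  qed
  obtain B where B: "\<And>x. x \<in> U \<Longrightarrow> norm x \<le> B" using U(2) by (auto simp: bounded_iff)
  \<comment> \<open>Bounds the arguments of all univariate splines that occur, for every point of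
    \<open>U\<close> and every index in \<open>S\<close>.\<close>
  define R where "R = \<bar>B\<bar> / h + (\<Sum>k\<in>S. norm ((\<chi> \<nu>. of_int (k $ \<nu>)) :: real^'m))"
  have R0: "R \<ge> 0" using h unfolding R_def by (intro add_nonneg_nonneg sum_nonneg) auto
  have Rb: "\<bar>x $ \<nu> / h - of_int (k $ \<nu>)\<bar> \<le> R" if x: "x \<in> U" and k: "k \<in> S" for x k \<nu>
  proof -
    have "\<bar>x $ \<nu>\<bar> \<le> \<bar>B\<bar>" using component_le_norm_cart[of x \<nu>] B[OF x] by linarith
    then have 1: "\<bar>x $ \<nu> / h\<bar> \<le> \<bar>B\<bar> / h" using h by (simp add: divide_right_mono)
    have "\<bar>real_of_int (k $ \<nu>)\<bar> \<le> norm ((\<chi> \<nu>. of_int (k $ \<nu>)) :: real^'m)"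
      using component_le_norm_cart[of "(\<chi> \<nu>. of_int (k $ \<nu>)) :: real^'m" \<nu>] by simp
    also have "\<dots> \<le> (\<Sum>k\<in>S. norm ((\<chi> \<nu>. of_int (k $ \<nu>)) :: real^'m))"
      by (rule member_le_sum[OF k]) (use S in auto)
    finally show ?thesis using 1 abs_triangle_ineq4[of "x $ \<nu> / h" "of_int (k $ \<nu>)"]
      unfolding R_def by linarith
  qed
  obtain K0 where K0: "K0 > 0" "\<And>h q q' k x i. h > 0 \<Longrightarrow> (\<And>t. \<bar>q t\<bar> \<le> \<bar>t\<bar> + 1) \<Longrightarrow> (\<And>t. \<bar>q' t\<bar> \<le> 1) \<Longrightarrow>
     (\<And>\<nu>. \<bar>x $ \<nu> / h - of_int (k $ \<nu>)\<bar> \<le> R) \<Longrightarrow>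
     \<bar>gen_tensor q n h (k :: int^'m) x\<bar> \<le> K0 \<and> \<bar>gen_tensor_deriv q q' n h k i x\<bar> \<le> K0 / h"
    using gen_tensor_bounded[OF R0, where 'm = 'm and n = n] by (metis (no_types, lifting))
  define Ks where "Ks = (\<Sum>k\<in>S. \<bar>c k\<bar> * (K0 + K0 / h))"
  have Ks0: "Ks \<ge> 0" using K0(1) h unfolding Ks_def by (intro sum_nonneg) auto
  have sb: "\<bar>s j x\<bar> \<le> Ks" "\<bar>s' j i x\<bar> \<le> Ks" if x: "x \<in> U" for j i x
  proof -
    have b: "\<bar>gen_tensor (sqrt_abs j) n h k x\<bar> \<le> K0 + K0 / h" "\<bar>gen_tensor_deriv (sqrt_abs j) (sqrt_abs' j) n h k i x\<bar> \<le> K0 + K0 / h"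
      if k: "k \<in> S" for k
      using K0(2)[of h "sqrt_abs j" "sqrt_abs' j" x k i, OF h sqrt_abs_bounds(1) sqrt_abs_bounds(2) Rb[OF x k]] K0(1) h by (auto intro: order_trans simp: add_increasing add_increasing2)
    have tri: "\<bar>\<Sum>k\<in>S. c k * a k\<bar> \<le> Ks" if "\<And>k. k \<in> S \<Longrightarrow> \<bar>a k\<bar> \<le> K0 + K0 / h" for a
      unfolding Ks_def using that by (intro order_trans[OF sum_abs sum_mono]) (simp add: abs_mult mult_left_mono)
    show "\<bar>s j x\<bar> \<le> Ks" "\<bar>s' j i x\<bar> \<le> Ks" unfolding s_def s'_def by (intro tri b; assumption)+
  qed
  have Eb: "0 \<le> E j x" "E j x \<le> 1" for j x using exp_bump_0_bounds by (auto simp: E_def)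
  \<comment> \<open>The factor 4 consists of the 3 from \<open>exp_bump_1_bound\<close> and 1 for
    the cutoff itself; the second summand is for the derivative of the spline.\<close>
  define K where "K = 4 * \<bar>W\<bar> * Ks + \<bar>W\<bar> * Ks"
  have wW: "\<bar>w x\<bar> \<le> \<bar>W\<bar>" "\<bar>partial_deriv i w x\<bar> \<le> \<bar>W\<bar>" if "x \<in> U" for x i
    using W[OF that] wpos[OF that] by (auto intro: order_trans)
  have bd1: "\<bar>\<Phi> j x\<bar> \<le> K" if x: "x \<in> U" for j x
  proof -
    have "\<bar>E j x * (w x * s j x)\<bar> \<le> 1 * (\<bar>W\<bar> * Ks)"
      unfolding abs_mult using Eb wW x sb Ks0 by (intro mult_mono) auto
    also have "\<dots> \<le> K" using Ks0 by (simp add: K_def)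
    finally show ?thesis using x by (simp add: \<Phi>_def E_def)
  qed
  have bd2: "\<bar>partial_deriv i (\<Phi> j) x\<bar> \<le> K" if x: "x \<in> U" for i j x
  proof -
    have "\<bar>exp_bump 1 (real (Suc j) * w x - 1) * (real (Suc j) * w x) + E j x\<bar> \<le> 4"
      using exp_bump_1_bound[of "real (Suc j) * w x"] Eb[of j x] by linarith
    then have "\<bar>(exp_bump 1 (real (Suc j) * w x - 1) * (real (Suc j) * w x) + E j x) * partial_deriv i w x * s j x\<bar> \<le> 4 * \<bar>W\<bar> * Ks"
      unfolding abs_mult using wW x sb Ks0 by (intro mult_mono) auto
    moreover have "\<bar>E j x * w x * s' j i x\<bar> \<le> 1 * \<bar>W\<bar> * Ks"
      unfolding abs_mult using Eb wW x sb Ks0 by (intro mult_mono) auto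
    ultimately show ?thesis unfolding d\<Phi>[OF x] K_def by linarith
  qed
  have lim_s: "(\<lambda>j. s j x) \<longlonglongrightarrow> (\<Sum>k\<in>S. c k * bspline n h k x)" for x
    unfolding s_def gen_tensor_abs[OF n, symmetric] gen_tensor_def
    by (intro tendsto_intros gen_bspline_tendsto sqrt_abs_tendsto)
  have lim_s': "(\<lambda>j. s' j i x) \<longlonglongrightarrow> (\<Sum>k\<in>S. c k * bspline_deriv n h k i x)" for x i
    unfolding s'_def gen_tensor_deriv_def
    by (intro tendsto_intros gen_bspline_tendsto gen_bspline_deriv_tendsto sqrt_abs_tendsto sqrt_abs'_tendsto) (use h in auto)
  have lim1: "(\<lambda>j. \<Phi> j x) \<longlonglongrightarrow> v x" if x: "x \<in> U" for x
  proof -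
    have "(\<lambda>j. E j x * (w x * s j x)) \<longlonglongrightarrow> 1 * (w x * (\<Sum>k\<in>S. c k * bspline n h k x))"
      unfolding E_def by (intro tendsto_intros lim_s exp_bump_1_tendsto wpos x)
    then show ?thesis using x v by (simp add: \<Phi>_def E_def)
  qed
  have lim2: "(\<lambda>j. partial_deriv i (\<Phi> j) x) \<longlonglongrightarrow> partial_deriv i w x * (\<Sum>k\<in>S. c k * bspline n h k x) + w x * (\<Sum>k\<in>S. c k * bspline_deriv n h k i x)"
    if x: "x \<in> U" for x i
  proof -
    have "(\<lambda>j. (exp_bump 1 (real (Suc j) * w x - 1) * (real (Suc j) * w x) + E j x) * partial_deriv i w x * s j x
      + E j x * w x * s' j i x) \<longlonglongrightarrow> (0 + 1) * partial_deriv i w x * (\<Sum>k\<in>S. c k * bspline n h k x) + 1 * w x * (\<Sum>k\<in>S. c k * bspline_deriv n h k i x)"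
      unfolding E_def by (intro tendsto_intros lim_s lim_s' exp_bump_1_tendsto wpos x)
    then show ?thesis using x by (simp add: d\<Phi>)
  qed
  have AEU: "AE x in lebesgue_on U. P x" if "\<And>x. x \<in> U \<Longrightarrow> P x" for P
    using that by (intro AE_I2) (simp add: space_restrict_space)
  note L = H0space_limit[OF U test bd1 bd2 AEU[OF lim1] AEU[OF lim2]]
  show "v \<in> H0space 1 U" by (rule L(1))
  show "AE x in lebesgue_on U. weak_deriv U (axis i 1) v x
      = partial_deriv i w x * (\<Sum>k\<in>S. c k * bspline n h k x) + w x * (\<Sum>k\<in>S. c k * bspline_deriv n h k i x)"
    by (rule L(2))
qed

section \<open>Pointwise error of the weighted quasi-interpolant\<close>

definition grid_point :: "real \<Rightarrow> int^'m \<Rightarrow> real^'m" where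
  "grid_point h k = (\<chi> \<nu>. h * of_int (k $ \<nu>))"

definition cell_index :: "real \<Rightarrow> real^'m \<Rightarrow> int^'m" where
  "cell_index h x = (\<chi> \<nu>. \<lfloor>x $ \<nu> / h\<rfloor>)"

text \<open>The distance is measured at the grid point, the lower corner of the support of the
  B-spline, so that being far depends on the index alone.\<close>

definition far_indices :: "(real^'m) set \<Rightarrow> real \<Rightarrow> real \<Rightarrow> (int^'m) set" where
  "far_indices U A h = {k. grid_point h k \<in> U \<and> A * h \<le> infdist (grid_point h k) (frontier U)}"

definition energy_density :: "(real^'m) set \<Rightarrow> nat \<Rightarrow> (real^'m \<Rightarrow> real) \<Rightarrow> real^'m \<Rightarrow> ennreal" where
  "energy_density U n f x = ennreal (weighted_energy U n f x) * indicator U x"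

text \<open>A common majorant for the error at \<open>x\<close>: the energy at the point itself, at
  all sampling points of nearby indices, and along the segments to them, where Taylor remainders
  live.\<close>

definition sampled_energy :: "(real^'m) set \<Rightarrow> nat \<Rightarrow> (real^'m \<Rightarrow> real) \<Rightarrow> real \<Rightarrow> real^'m \<Rightarrow> real^'m \<Rightarrow> ennreal" where
  "sampled_energy U n f h y x = energy_density U n f x +
     (\<Sum>k\<in>index_box (cell_index h x) n. \<Sum>l\<in>sample_offsets n.
        energy_density U n f (sample_point h k l y)
        + (\<integral>\<^sup>+t\<in>{0..1}. energy_density U n f (x + t *\<^sub>R (sample_point h k l y - x)) \<partial>lborel))"

text \<open>Each coordinate of the differences in question is at most (n + 2) h; the sum over the
  coordinates bounds the Euclidean norm.\<close>

definition sample_radius :: "'m::finite itself \<Rightarrow> nat \<Rightarrow> real" where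
  "sample_radius _ n = real CARD('m) * (real n + 2)"

lemma sample_radius_ge_1: "sample_radius TYPE('m::finite) n \<ge> 1"
proof -
  have "1 * 1 \<le> real CARD('m) * (real n + 2)"
    using zero_less_card_finite[where 'a='m] by (intro mult_mono) (auto simp: Suc_le_eq)
  then show ?thesis by (simp add: sample_radius_def)
qed

lemma norm_le_sample_radius:
  fixes v :: "real^'m"
  assumes "h > 0" "\<And>\<nu>. \<bar>v $ \<nu>\<bar> \<le> h * (real n + 2)"
  shows "norm v \<le> sample_radius TYPE('m) n * h"
proof -
  have "norm v \<le> (\<Sum>\<nu>\<in>UNIV. \<bar>v $ \<nu>\<bar>)" by (rule norm_le_l1_cart)
  also have "\<dots> \<le> (\<Sum>\<nu>\<in>(UNIV::'m set). h * (real n + 2))" by (rule sum_mono) (rule assms(2))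
  finally show ?thesis by (simp add: sample_radius_def mult_ac)
qed

lemma sample_distances:
  fixes x y :: "real^'m"
  assumes h: "h > 0" and k: "k \<in> index_box (cell_index h x) n" and l: "l \<in> sample_offsets n"
    and y: "\<And>\<nu>. y $ \<nu> \<in> {0..1}"
  shows "norm (sample_point h k l y - x) \<le> sample_radius TYPE('m) n * h"
    and "norm (grid_point h k - x) \<le> sample_radius TYPE('m) n * h"
    and "norm (sample_point h k l y - grid_point h k) \<le> sample_radius TYPE('m) n * h"
proof -
  have kb: "real_of_int (k $ \<nu>) \<le> x $ \<nu> / h" "x $ \<nu> / h \<le> real_of_int (k $ \<nu>) + real n + 1" for \<nu>
    using k unfolding index_box_def cell_index_def by (auto dest!: spec[of _ \<nu>]) linarith+
  have lb: "0 \<le> real (l \<nu>)" "real (l \<nu>) \<le> real n" for \<nu>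
    using l by (auto simp: sample_offsets_def PiE_def dest!: spec[of _ \<nu>] less_imp_le)
  have yb: "0 \<le> y $ \<nu>" "y $ \<nu> \<le> 1" for \<nu> using y[of \<nu>] by auto
  have m: "\<bar>h * a\<bar> \<le> h * (real n + 2)" if "\<bar>a\<bar> \<le> real n + 2" for a
    using that h by (simp add: abs_mult)
  have e1: "(sample_point h k l y - x) $ \<nu> = h * (of_int (k $ \<nu>) + real (l \<nu>) + y $ \<nu> - x $ \<nu> / h)" for \<nu>
    using h by (simp add: sample_point_def right_diff_distrib)
  have e2: "(grid_point h k - x) $ \<nu> = h * (of_int (k $ \<nu>) - x $ \<nu> / h)" for \<nu>
    using h by (simp add: grid_point_def right_diff_distrib)
  have e3: "(sample_point h k l y - grid_point h k) $ \<nu> = h * (real (l \<nu>) + y $ \<nu>)" for \<nu>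
    by (simp add: sample_point_def grid_point_def algebra_simps)
  show "norm (sample_point h k l y - x) \<le> sample_radius TYPE('m) n * h"
    by (rule norm_le_sample_radius[OF h], unfold e1, rule m) (use kb lb yb in \<open>smt (verit)\<close>)
  show "norm (grid_point h k - x) \<le> sample_radius TYPE('m) n * h"
    by (rule norm_le_sample_radius[OF h], unfold e2, rule m) (use kb in \<open>smt (verit) of_nat_0_le_iff\<close>)
  show "norm (sample_point h k l y - grid_point h k) \<le> sample_radius TYPE('m) n * h"
    by (rule norm_le_sample_radius[OF h], unfold e3, rule m) (use lb yb in \<open>smt (verit)\<close>)
qed

lemma energy_density_in: "x \<in> U \<Longrightarrow> energy_density U n f x = ennreal (weighted_energy U n f x)"
  by (simp add: energy_density_def)

lemma sampled_energy_ge: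
  assumes "x \<in> U"
  shows "ennreal (weighted_energy U n f x) \<le> sampled_energy U n f h y x"
    and "(\<Sum>k\<in>index_box (cell_index h x) n. \<Sum>l\<in>sample_offsets n. energy_density U n f (sample_point h k l y)) \<le> sampled_energy U n f h y x"
    and "(\<Sum>k\<in>index_box (cell_index h x) n. \<Sum>l\<in>sample_offsets n. \<integral>\<^sup>+t\<in>{0..1}. energy_density U n f (x + t *\<^sub>R (sample_point h k l y - x)) \<partial>lborel) \<le> sampled_energy U n f h y x"
proof -
  show "ennreal (weighted_energy U n f x) \<le> sampled_energy U n f h y x"
    using assms by (simp add: sampled_energy_def energy_density_in)
  show "(\<Sum>k\<in>index_box (cell_index h x) n. \<Sum>l\<in>sample_offsets n. energy_density U n f (sample_point h k l y)) \<le> sampled_energy U n f h y x"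
    unfolding sampled_energy_def by (rule order_trans[OF _ add_increasing[OF zero_le order_refl]]) (intro sum_mono, simp)
  show "(\<Sum>k\<in>index_box (cell_index h x) n. \<Sum>l\<in>sample_offsets n. \<integral>\<^sup>+t\<in>{0..1}. energy_density U n f (x + t *\<^sub>R (sample_point h k l y - x)) \<partial>lborel) \<le> sampled_energy U n f h y x"
    unfolding sampled_energy_def by (rule order_trans[OF _ add_increasing[OF zero_le order_refl]]) (intro sum_mono, simp)
qed

lemma ennreal_double_sum:
  "(\<And>k l. 0 \<le> a k l) \<Longrightarrow> (\<Sum>k\<in>S. \<Sum>l\<in>L. ennreal (a k l)) = ennreal (\<Sum>k\<in>S. \<Sum>l\<in>L. a k l)"
  by (simp add: sum_nonneg)

lemma abs_le_imp_power2_le: "\<bar>a\<bar> \<le> b \<Longrightarrow> a\<^sup>2 \<le> b\<^sup>2" for a b :: real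
  using power_mono[of "\<bar>a\<bar>" b 2] by simp

lemma double_sum_square_le:
  fixes a :: "'a \<Rightarrow> 'b \<Rightarrow> real"
  shows "(\<Sum>k\<in>S. \<Sum>l\<in>L. a k l)\<^sup>2 \<le> (\<Sum>k\<in>S. \<Sum>l\<in>L. (a k l)\<^sup>2) * (real (card S) * real (card L))"
  using sum_squared_le_sum_of_squares[of "\<lambda>(k, l). a k l" "S \<times> L"]
  by (simp add: sum.cartesian_product card_cartesian_product case_prod_unfold)

lemma card_index_box: "card (index_box (k0 :: int^'m) n) = (n + 1) ^ CARD('m)"
proof -
  have "card (index_box k0 n) = card (PiE UNIV (\<lambda>\<nu>. {k0 $ \<nu> - int n..k0 $ \<nu>}))"
    by (rule bij_betw_same_card[OF bij_index_box, symmetric])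
  also have "\<dots> = (\<Prod>\<nu>\<in>(UNIV::'m set). card {k0 $ \<nu> - int n..k0 $ \<nu>})" by (rule card_PiE) simp
  also have "\<dots> = (n + 1) ^ CARD('m)" by (simp add: nat_add_distrib)
  finally show ?thesis .
qed

text \<open>The properties of the weight function in the form in which they are used: derivatives
  along lists, explicit constants, and a separate bound \<open>W\<close> for the gradient.\<close>

locale weighted_domain =
  fixes U :: "(real^'m) set" and w :: "real^'m \<Rightarrow> real" and c1 c2 W r :: real and n :: nat
  assumes open_domain: "open U" and bounded_domain: "bounded U" and frontier_ne: "frontier U \<noteq> {}"
    and order_ge_2: "n \<ge> 2" and r_eq: "r = sample_radius TYPE('m) n"
    and smooth_weight: "smooth_on U w" and c_pos: "c1 > 0" "c2 > 0"
    and weight_lower: "\<And>x. x \<in> U \<Longrightarrow> c1 * infdist x (frontier U) \<le> w x"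
    and weight_upper: "\<And>x. x \<in> U \<Longrightarrow> w x \<le> c2 * infdist x (frontier U)"
    and weight_grad: "\<And>x i. x \<in> U \<Longrightarrow> \<bar>partial_deriv i w x\<bar> \<le> W"
    and weight_derivs: "\<And>is. \<exists>c. \<forall>x\<in>U. \<bar>iter_partial is w x\<bar> \<le> c * infdist x (frontier U) / infdist x (frontier U) ^ length is"
begin

abbreviation d :: "real^'m \<Rightarrow> real" where "d x \<equiv> infdist x (frontier U)"

lemmas sample_dist = sample_distances[where 'm = 'm and n = n, folded r_eq]

lemma r_ge_1: "r \<ge> 1"
  unfolding r_eq by (rule sample_radius_ge_1)

lemma d_pos: "x \<in> U \<Longrightarrow> 0 < d x"
  using open_domain by (intro infdist_pos_not_in_closed frontier_closed frontier_ne)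
    (auto simp: frontier_def interior_open)

lemma weight_pos: "x \<in> U \<Longrightarrow> 0 < w x"
  using weight_lower[of x] d_pos[of x] c_pos(1) by (smt (verit) mult_pos_pos)

lemma in_domain: "x \<in> U \<Longrightarrow> norm (z - x) < d x \<Longrightarrow> z \<in> U"
  using ball_infdist_frontier_subset[of x U z] by (simp add: dist_norm norm_minus_commute)

lemma d_diff: "d z \<le> d x + norm (z - x)" "d x \<le> d z + norm (z - x)"
  using infdist_diff_le[of x "frontier U" z] by (auto simp: dist_norm norm_minus_commute)

lemma smooth_quotient: "smooth_on U f \<Longrightarrow> smooth_on U (\<lambda>x. f x * (1 / w x))"
  by (intro smooth_on_mult smooth_on_inverse open_domain smooth_weight weight_pos)

lemma W_nonneg: "U \<noteq> {} \<Longrightarrow> 0 \<le> W"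
  using weight_grad by (metis abs_ge_zero all_not_in_conv order_trans)

lemma power_2n: "a ^ (2 * n) = a\<^sup>2 * a ^ (2 * (n - 1))" for a :: real
proof -
  have "2 * n = 2 + 2 * (n - 1)" using order_ge_2 by simp
  then show ?thesis by (simp only: power_add)
qed

text \<open>Stated for an arbitrary quantity \<open>v\<close> so that it serves the value and every
  partial derivative alike: \<beta> k is the value or the derivative of \<open>w\<close> times the
  B-spline, and \<open>v\<close> is what these give for the Taylor polynomial. Only remainders are
  left. Their squares carry (r h)^(2 n) by Taylor's formula and (d / h)^2 from \<beta>; the factor
  d^2 is what \<open>quotient_deriv_bound\<close> needs, and h^(2 (n - 1)) remains.\<close>

lemma far_cell_error:
  assumes K: "K > 0" "\<And>\<tau> l. \<tau> \<in> {0..1} \<Longrightarrow> l < n \<Longrightarrow> \<bar>\<mu> \<tau> l\<bar> \<le> K"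
    and B: "B \<ge> 0"
  obtains C where "C \<ge> 0" "\<And>h f x y \<beta> v. h > 0 \<Longrightarrow> smooth_on U f \<Longrightarrow>
     energy_density U n f \<in> borel_measurable borel \<Longrightarrow> x \<in> U \<Longrightarrow> 2 * r * h \<le> d x \<Longrightarrow>
     (\<And>\<nu>. y $ \<nu> \<in> {0..1}) \<Longrightarrow>
     (\<And>k. k \<in> index_box (cell_index h x) n \<Longrightarrow> \<bar>\<beta> k\<bar> \<le> B * d x / h) \<Longrightarrow>
     v = (\<Sum>k\<in>index_box (cell_index h x) n. quasi_coeff \<mu> n h y (taylor_poly n (\<lambda>x. f x * (1 / w x)) x) k * \<beta> k) \<Longrightarrow>
     ennreal ((v - (\<Sum>k\<in>index_box (cell_index h x) n. quasi_coeff \<mu> n h y (\<lambda>x. f x * (1 / w x)) k * \<beta> k))\<^sup>2)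
       \<le> ennreal (C * h ^ (2 * (n - 1))) * sampled_energy U n f h y x"
proof -
  obtain C0 where C0: "C0 > 0" "\<And>f x is. smooth_on U f \<Longrightarrow> x \<in> U \<Longrightarrow> length is = n \<Longrightarrow>
     (d x)\<^sup>2 * (iter_partial is (\<lambda>x. f x * (1 / w x)) x)\<^sup>2 \<le> C0 * weighted_energy U n f x"
    using quotient_deriv_bound[OF open_domain smooth_weight d_pos c_pos(1) weight_lower weight_derivs, of n] by blast
  define Nn where "Nn = real (card {is :: 'm list. length is = n})"
  define KK where "KK = B * K ^ CARD('m)"
  define NN where "NN = real ((n + 1) ^ CARD('m)) * real (card (sample_offsets n :: ('m \<Rightarrow> nat) set))"
  define C where "C = KK\<^sup>2 * NN * Nn * r ^ (2 * n) * (4 * C0 * Nn)"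
  have r0: "r \<ge> 1" by (rule r_ge_1)
  have nn: "0 \<le> Nn" "0 \<le> KK" "0 \<le> NN" using B K(1) by (auto simp: Nn_def KK_def NN_def)
  have "C \<ge> 0" unfolding C_def using nn C0(1) r0 by simp
  moreover have "ennreal ((v - (\<Sum>k\<in>index_box (cell_index h x) n. quasi_coeff \<mu> n h y (\<lambda>x. f x * (1 / w x)) k * \<beta> k))\<^sup>2)
       \<le> ennreal (C * h ^ (2 * (n - 1))) * sampled_energy U n f h y x"
    if h: "h > 0" and f: "smooth_on U f" and ed: "energy_density U n f \<in> borel_measurable borel"
      and x: "x \<in> U" and dx: "2 * r * h \<le> d x"
      and y: "\<And>\<nu>. y $ \<nu> \<in> {0..1}"
      and \<beta>: "\<And>k. k \<in> index_box (cell_index h x) n \<Longrightarrow> \<bar>\<beta> k\<bar> \<le> B * d x / h"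
      and v: "v = (\<Sum>k\<in>index_box (cell_index h x) n. quasi_coeff \<mu> n h y (taylor_poly n (\<lambda>x. f x * (1 / w x)) x) k * \<beta> k)"
    for h f x y \<beta> v
  proof -
    let ?\<psi> = "\<lambda>x. f x * (1 / w x)" and ?KB = "index_box (cell_index h x) n" and ?L = "sample_offsets n :: ('m \<Rightarrow> nat) set"
    define R where "R k l = ?\<psi> (sample_point h k l y) - taylor_poly n ?\<psi> x (sample_point h k l y)" for k l
    define I where "I k l = (\<integral>\<^sup>+t\<in>{0..1}. energy_density U n f (x + t *\<^sub>R (sample_point h k l y - x)) \<partial>lborel)" for k l
    have "v - (\<Sum>k\<in>?KB. quasi_coeff \<mu> n h y ?\<psi> k * \<beta> k)
      = - (\<Sum>k\<in>?KB. quasi_coeff \<mu> n h y (\<lambda>z. ?\<psi> z - taylor_poly n ?\<psi> x z) k * \<beta> k)"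
      unfolding v quasi_coeff_diff by (simp add: left_diff_distrib sum_subtractf)
    also have "\<bar>\<dots>\<bar> \<le> (\<Sum>k\<in>?KB. K ^ CARD('m) * (\<Sum>l\<in>?L. \<bar>R k l\<bar>) * (B * d x / h))"
      unfolding abs_minus_cancel
    proof (rule order_trans[OF sum_abs sum_mono])
      fix k assume k: "k \<in> ?KB"
      show "\<bar>quasi_coeff \<mu> n h y (\<lambda>z. ?\<psi> z - taylor_poly n ?\<psi> x z) k * \<beta> k\<bar> \<le> K ^ CARD('m) * (\<Sum>l\<in>?L. \<bar>R k l\<bar>) * (B * d x / h)"
        unfolding abs_mult R_def
        by (intro mult_mono abs_quasi_coeff_le K y \<beta> k mult_nonneg_nonneg sum_nonneg) (use K(1) in auto)
    qed
    also have "\<dots> = KK * d x / h * (\<Sum>k\<in>?KB. \<Sum>l\<in>?L. \<bar>R k l\<bar>)"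
      by (simp add: KK_def sum_distrib_left sum_distrib_right sum_divide_distrib mult_ac)
    finally have "\<bar>v - (\<Sum>k\<in>?KB. quasi_coeff \<mu> n h y ?\<psi> k * \<beta> k)\<bar> \<le> KK * d x / h * (\<Sum>k\<in>?KB. \<Sum>l\<in>?L. \<bar>R k l\<bar>)" .
    then have "(v - (\<Sum>k\<in>?KB. quasi_coeff \<mu> n h y ?\<psi> k * \<beta> k))\<^sup>2 \<le> (KK * d x / h * (\<Sum>k\<in>?KB. \<Sum>l\<in>?L. \<bar>R k l\<bar>))\<^sup>2"
      by (rule abs_le_imp_power2_le)
    also have "\<dots> = (KK * d x / h)\<^sup>2 * (\<Sum>k\<in>?KB. \<Sum>l\<in>?L. \<bar>R k l\<bar>)\<^sup>2" by (rule power_mult_distrib)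
    also have "\<dots> \<le> (KK * d x / h)\<^sup>2 * ((\<Sum>k\<in>?KB. \<Sum>l\<in>?L. (R k l)\<^sup>2) * NN)"
      using double_sum_square_le[of "\<lambda>k l. \<bar>R k l\<bar>" ?L ?KB] by (intro mult_left_mono) (auto simp: NN_def card_index_box)
    also have "\<dots> = (KK / h)\<^sup>2 * NN * (\<Sum>k\<in>?KB. \<Sum>l\<in>?L. (d x)\<^sup>2 * (R k l)\<^sup>2)"
      by (simp add: sum_distrib_left sum_divide_distrib power_mult_distrib power_divide mult_ac)
    finally have 1: "(v - (\<Sum>k\<in>?KB. quasi_coeff \<mu> n h y ?\<psi> k * \<beta> k))\<^sup>2 \<le> (KK / h)\<^sup>2 * NN * (\<Sum>k\<in>?KB. \<Sum>l\<in>?L. (d x)\<^sup>2 * (R k l)\<^sup>2)" .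
    have 2: "ennreal ((d x)\<^sup>2 * (R k l)\<^sup>2) \<le> ennreal (Nn * (r * h) ^ (2 * n) * (4 * C0 * Nn)) * I k l" if k: "k \<in> ?KB" and l: "l \<in> ?L" for k l
    proof -
      let ?z = "sample_point h k l y"
      have nz: "norm (?z - x) \<le> r * h" by (rule sample_dist(1)[OF h k l y])
      \<comment> \<open>The segment has length at most r h, no more than half of d x, so it stays in
        \<open>U\<close> and the boundary distance drops at most to half.\<close>
      have seg: "x + t *\<^sub>R (?z - x) \<in> U \<and> d x \<le> 2 * d (x + t *\<^sub>R (?z - x))" if t: "t \<in> {0..1}" for t
      proof -
        have "norm (t *\<^sub>R (?z - x)) \<le> 1 * norm (?z - x)"
          unfolding norm_scaleR using t by (intro mult_right_mono) auto
        then have nt: "norm ((x + t *\<^sub>R (?z - x)) - x) \<le> r * h" using nz by simp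
        then have "norm ((x + t *\<^sub>R (?z - x)) - x) < d x" using dx h r0 d_pos[OF x] by linarith
        then show ?thesis using in_domain[OF x] d_diff(2)[of x "x + t *\<^sub>R (?z - x)"] nt dx by (auto simp del: add_diff_cancel_left')
      qed
      have T: "ennreal ((R k l)\<^sup>2) \<le> ennreal (Nn * norm (?z - x) ^ (2 * n))
          * (\<integral>\<^sup>+t\<in>{0..1}. ennreal (\<Sum>is | length is = n. (iter_partial is ?\<psi> (x + t *\<^sub>R (?z - x)))\<^sup>2) \<partial>lborel)"
        unfolding R_def Nn_def
        by (rule taylor_remainder[OF open_domain smooth_quotient[OF f]]) (use order_ge_2 seg in auto)
      have "ennreal ((d x)\<^sup>2 * (R k l)\<^sup>2) = ennreal ((d x)\<^sup>2) * ennreal ((R k l)\<^sup>2)" by (rule ennreal_mult) auto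
      also have "\<dots> \<le> ennreal ((d x)\<^sup>2) * (ennreal (Nn * (r * h) ^ (2 * n)) * (\<integral>\<^sup>+t\<in>{0..1}. ennreal (\<Sum>is | length is = n. (iter_partial is ?\<psi> (x + t *\<^sub>R (?z - x)))\<^sup>2) \<partial>lborel))"
      proof (rule mult_left_mono[OF order_trans[OF T mult_right_mono]])
        show "ennreal (Nn * norm (?z - x) ^ (2 * n)) \<le> ennreal (Nn * (r * h) ^ (2 * n))"
          using nz nn by (intro ennreal_leI mult_left_mono power_mono) auto
      qed auto
      also have "\<dots> = ennreal (Nn * (r * h) ^ (2 * n)) * (ennreal ((d x)\<^sup>2) * (\<integral>\<^sup>+t\<in>{0..1}. ennreal (\<Sum>is | length is = n. (iter_partial is ?\<psi> (x + t *\<^sub>R (?z - x)))\<^sup>2) \<partial>lborel))"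
        by (simp add: mult_ac)
      also have "\<dots> \<le> ennreal (Nn * (r * h) ^ (2 * n)) * (ennreal (4 * C0 * Nn) * I k l)"
      proof (rule mult_left_mono)
        have meas: "(\<lambda>t. ennreal (\<Sum>is | length is = n. (iter_partial is ?\<psi> (x + t *\<^sub>R (?z - x)))\<^sup>2) * indicator {0..1} t) \<in> borel_measurable lborel"
        proof -
          have "continuous_on {0..1} (\<lambda>t. \<Sum>is | length is = n. (iter_partial is ?\<psi> (x + t *\<^sub>R (?z - x)))\<^sup>2)"
            by (intro continuous_intros continuous_on_compose2[OF smooth_on_imp_continuous_on[OF smooth_on_iter_partial[OF smooth_quotient[OF f]]]])
               (use seg in auto)
          then have "(\<lambda>t. indicator {0..1} t *\<^sub>R (\<Sum>is | length is = n. (iter_partial is ?\<psi> (x + t *\<^sub>R (?z - x)))\<^sup>2)) \<in> borel_measurable borel"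
            by (intro borel_measurable_continuous_on_indicator) auto
          then have "(\<lambda>t. ennreal (indicator {0..1} t *\<^sub>R (\<Sum>is | length is = n. (iter_partial is ?\<psi> (x + t *\<^sub>R (?z - x)))\<^sup>2))) \<in> borel_measurable lborel" by simp
          also have "(\<lambda>t. ennreal (indicator {0..1} t *\<^sub>R (\<Sum>is | length is = n. (iter_partial is ?\<psi> (x + t *\<^sub>R (?z - x)))\<^sup>2)))
            = (\<lambda>t. ennreal (\<Sum>is | length is = n. (iter_partial is ?\<psi> (x + t *\<^sub>R (?z - x)))\<^sup>2) * indicator {0..1} t)"
            by (auto simp: indicator_def fun_eq_iff)
          finally show ?thesis .
        qed
        have "ennreal ((d x)\<^sup>2) * (\<integral>\<^sup>+t\<in>{0..1}. ennreal (\<Sum>is | length is = n. (iter_partial is ?\<psi> (x + t *\<^sub>R (?z - x)))\<^sup>2) \<partial>lborel)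
          = (\<integral>\<^sup>+t. ennreal ((d x)\<^sup>2) * (ennreal (\<Sum>is | length is = n. (iter_partial is ?\<psi> (x + t *\<^sub>R (?z - x)))\<^sup>2) * indicator {0..1} t) \<partial>lborel)"
          by (rule nn_integral_cmult[OF meas, symmetric])
        also have "\<dots> \<le> (\<integral>\<^sup>+t. ennreal (4 * C0 * Nn) * (energy_density U n f (x + t *\<^sub>R (?z - x)) * indicator {0..1} t) \<partial>lborel)"
        proof (rule nn_integral_mono)
          fix t :: real
          let ?\<xi> = "x + t *\<^sub>R (?z - x)"
          show "ennreal ((d x)\<^sup>2) * (ennreal (\<Sum>is | length is = n. (iter_partial is ?\<psi> ?\<xi>)\<^sup>2) * indicator {0..1} t)
             \<le> ennreal (4 * C0 * Nn) * (energy_density U n f ?\<xi> * indicator {0..1} t)"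
          proof (cases "t \<in> {0..1}")
            case True
            have \<xi>: "?\<xi> \<in> U" "d x \<le> 2 * d ?\<xi>" using seg[OF True] by auto
            have "(d x)\<^sup>2 \<le> (2 * d ?\<xi>)\<^sup>2" using \<xi>(2) d_pos[OF x] by (intro power_mono) auto
            then have "(d x)\<^sup>2 * (\<Sum>is | length is = n. (iter_partial is ?\<psi> ?\<xi>)\<^sup>2) \<le> (2 * d ?\<xi>)\<^sup>2 * (\<Sum>is | length is = n. (iter_partial is ?\<psi> ?\<xi>)\<^sup>2)"
              by (intro mult_right_mono sum_nonneg) auto
            also have "\<dots> = 4 * (\<Sum>is | length is = n. (d ?\<xi>)\<^sup>2 * (iter_partial is ?\<psi> ?\<xi>)\<^sup>2)"
              by (simp add: power_mult_distrib sum_distrib_left mult.assoc)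
            also have "\<dots> \<le> 4 * (\<Sum>is | length (is :: 'm list) = n. C0 * weighted_energy U n f ?\<xi>)"
              by (intro mult_left_mono sum_mono C0(2) f \<xi>(1)) auto
            also have "\<dots> = 4 * C0 * Nn * weighted_energy U n f ?\<xi>" by (simp add: Nn_def mult_ac)
            finally have "ennreal ((d x)\<^sup>2 * (\<Sum>is | length is = n. (iter_partial is ?\<psi> ?\<xi>)\<^sup>2)) \<le> ennreal (4 * C0 * Nn * weighted_energy U n f ?\<xi>)"
              by (rule ennreal_leI)
            then show ?thesis using True \<xi>(1) C0(1) nn
              by (simp add: energy_density_def ennreal_mult' sum_nonneg weighted_energy_nonneg)
          qed simp
        qed
        also have "\<dots> = ennreal (4 * C0 * Nn) * I k l"
          unfolding I_def
        proof (rule nn_integral_cmult)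
          note [measurable] = ed
          show "(\<lambda>t. energy_density U n f (x + t *\<^sub>R (?z - x)) * indicator {0..1} t) \<in> borel_measurable lborel"
            by measurable
        qed
        finally show "ennreal ((d x)\<^sup>2) * (\<integral>\<^sup>+t\<in>{0..1}. ennreal (\<Sum>is | length is = n. (iter_partial is ?\<psi> (x + t *\<^sub>R (?z - x)))\<^sup>2) \<partial>lborel) \<le> ennreal (4 * C0 * Nn) * I k l" .
      qed simp
      also have "\<dots> = ennreal (Nn * (r * h) ^ (2 * n) * (4 * C0 * Nn)) * I k l"
        using nn C0(1) h r0 by (simp add: ennreal_mult mult.assoc)
      finally show ?thesis .
    qed
    have "ennreal ((v - (\<Sum>k\<in>?KB. quasi_coeff \<mu> n h y ?\<psi> k * \<beta> k))\<^sup>2) \<le> ennreal ((KK / h)\<^sup>2 * NN * (\<Sum>k\<in>?KB. \<Sum>l\<in>?L. (d x)\<^sup>2 * (R k l)\<^sup>2))"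
      by (rule ennreal_leI[OF 1])
    also have "\<dots> = ennreal ((KK / h)\<^sup>2 * NN) * (\<Sum>k\<in>?KB. \<Sum>l\<in>?L. ennreal ((d x)\<^sup>2 * (R k l)\<^sup>2))"
      using nn by (subst ennreal_double_sum, simp, intro ennreal_mult) (auto intro!: sum_nonneg)
    also have "\<dots> \<le> ennreal ((KK / h)\<^sup>2 * NN) * (\<Sum>k\<in>?KB. \<Sum>l\<in>?L. ennreal (Nn * (r * h) ^ (2 * n) * (4 * C0 * Nn)) * I k l)"
      by (intro mult_left_mono sum_mono 2) auto
    also have "\<dots> = ennreal ((KK / h)\<^sup>2 * NN) * ennreal (Nn * (r * h) ^ (2 * n) * (4 * C0 * Nn)) * (\<Sum>k\<in>?KB. \<Sum>l\<in>?L. I k l)"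
      by (simp add: sum_distrib_left mult.assoc)
    also have "ennreal ((KK / h)\<^sup>2 * NN) * ennreal (Nn * (r * h) ^ (2 * n) * (4 * C0 * Nn)) = ennreal (C * h ^ (2 * (n - 1)))"
    proof -
      have "h ^ (2 * n) = h ^ (2 * (n - 1)) * h\<^sup>2" unfolding power_2n by (rule mult.commute)
      then have "(KK / h)\<^sup>2 * NN * (Nn * (r * h) ^ (2 * n) * (4 * C0 * Nn)) = C * h ^ (2 * (n - 1))"
        using h by (simp add: C_def power_mult_distrib power_divide)
      then show ?thesis using nn C0(1) h r0 by (simp flip: ennreal_mult)
    qed
    also have "ennreal (C * h ^ (2 * (n - 1))) * (\<Sum>k\<in>?KB. \<Sum>l\<in>?L. I k l) \<le> ennreal (C * h ^ (2 * (n - 1))) * sampled_energy U n f h y x"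
      unfolding I_def by (intro mult_left_mono sampled_energy_ge(3)[OF x]) simp
    finally show ?thesis .
  qed
  ultimately show ?thesis using that by blast
qed

text \<open>There is no cancellation here; both terms are small. Samples of far indices lie in
  \<open>U\<close> at distance at most (A + 2 r) h from the boundary. There f^2 is at most the
  energy times d^(2 n), and the division by w^2, comparable to d^2, leaves d^(2 (n - 1)).\<close>

lemma boundary_cell_error:
  assumes K: "K > 0" "\<And>\<tau> l. \<tau> \<in> {0..1} \<Longrightarrow> l < n \<Longrightarrow> \<bar>\<mu> \<tau> l\<bar> \<le> K"
    and B: "B \<ge> 0" and A: "A \<ge> r + 1"
  obtains C where "C \<ge> 0" "\<And>h f x y \<beta> v S. h > 0 \<Longrightarrow> x \<in> U \<Longrightarrow> d x \<le> (A + r) * h \<Longrightarrow>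
     (\<And>\<nu>. y $ \<nu> \<in> {0..1}) \<Longrightarrow> S \<subseteq> index_box (cell_index h x) n \<Longrightarrow> S \<subseteq> far_indices U A h \<Longrightarrow>
     (\<And>k. k \<in> S \<Longrightarrow> \<bar>\<beta> k\<bar> \<le> B) \<Longrightarrow>
     v\<^sup>2 \<le> B * h ^ (2 * (n - 1)) * weighted_energy U n f x \<Longrightarrow>
     ennreal ((v - (\<Sum>k\<in>S. quasi_coeff \<mu> n h y (\<lambda>x. f x * (1 / w x)) k * \<beta> k))\<^sup>2)
       \<le> ennreal (C * h ^ (2 * (n - 1))) * sampled_energy U n f h y x"
proof -
  define KK where "KK = B * K ^ CARD('m)"
  define NN where "NN = real ((n + 1) ^ CARD('m)) * real (card (sample_offsets n :: ('m \<Rightarrow> nat) set))"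
  \<comment> \<open>The distance of a sample is at most d x \<le> (A + r) h plus the r h to the
    sample; c1^2 comes from the lower bound on the weight.\<close>
  define D where "D = (A + 2 * r) ^ (2 * (n - 1)) / c1\<^sup>2"
  define C where "C = 2 * B + 2 * KK\<^sup>2 * NN * D"
  have r0: "r \<ge> 1" by (rule r_ge_1)
  have nn: "0 \<le> KK" "0 \<le> NN" "0 \<le> D" using B K(1) A r0 by (auto simp: D_def KK_def NN_def)
  have C0: "C \<ge> 0" unfolding C_def using nn B by simp
  moreover have "ennreal ((v - (\<Sum>k\<in>S. quasi_coeff \<mu> n h y (\<lambda>x. f x * (1 / w x)) k * \<beta> k))\<^sup>2)
       \<le> ennreal (C * h ^ (2 * (n - 1))) * sampled_energy U n f h y x"
    if h: "h > 0" and x: "x \<in> U" and dx: "d x \<le> (A + r) * h"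
      and y: "\<And>\<nu>. y $ \<nu> \<in> {0..1}"
      and S: "S \<subseteq> index_box (cell_index h x) n" "S \<subseteq> far_indices U A h"
      and \<beta>: "\<And>k. k \<in> S \<Longrightarrow> \<bar>\<beta> k\<bar> \<le> B"
      and v: "v\<^sup>2 \<le> B * h ^ (2 * (n - 1)) * weighted_energy U n f x"
    for h f x y \<beta> v S
  proof -
    let ?\<psi> = "\<lambda>x. f x * (1 / w x)" and ?L = "sample_offsets n :: ('m \<Rightarrow> nat) set" and ?H = "h ^ (2 * (n - 1))"
    let ?KB = "index_box (cell_index h x) n"
    define p where "p k l = ?\<psi> (sample_point h k l y)" for k l
    have cardS: "real (card S) * real (card ?L) \<le> NN"
      unfolding NN_def using card_mono[OF finite_index_box S(1)] by (intro mult_right_mono) (auto simp: card_index_box simp flip: of_nat_power)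
    have "\<bar>\<Sum>k\<in>S. quasi_coeff \<mu> n h y ?\<psi> k * \<beta> k\<bar> \<le> (\<Sum>k\<in>S. K ^ CARD('m) * (\<Sum>l\<in>?L. \<bar>p k l\<bar>) * B)"
    proof (rule order_trans[OF sum_abs sum_mono])
      fix k assume k: "k \<in> S"
      show "\<bar>quasi_coeff \<mu> n h y ?\<psi> k * \<beta> k\<bar> \<le> K ^ CARD('m) * (\<Sum>l\<in>?L. \<bar>p k l\<bar>) * B"
        unfolding p_def abs_mult[of "quasi_coeff \<mu> n h y ?\<psi> k"]
        by (rule mult_mono[OF abs_quasi_coeff_le[OF K y] \<beta>[OF k]]) (use K(1) in \<open>simp_all only: abs_ge_zero mult_nonneg_nonneg sum_nonneg zero_le_power less_imp_le\<close>)
    qed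
    also have "\<dots> = KK * (\<Sum>k\<in>S. \<Sum>l\<in>?L. \<bar>p k l\<bar>)"
      by (simp add: KK_def sum_distrib_left sum_distrib_right mult_ac)
    finally have "(\<Sum>k\<in>S. quasi_coeff \<mu> n h y ?\<psi> k * \<beta> k)\<^sup>2 \<le> (KK * (\<Sum>k\<in>S. \<Sum>l\<in>?L. \<bar>p k l\<bar>))\<^sup>2"
      by (rule abs_le_imp_power2_le)
    also have "\<dots> = KK\<^sup>2 * (\<Sum>k\<in>S. \<Sum>l\<in>?L. \<bar>p k l\<bar>)\<^sup>2" by (rule power_mult_distrib)
    also have "\<dots> \<le> KK\<^sup>2 * ((\<Sum>k\<in>S. \<Sum>l\<in>?L. (p k l)\<^sup>2) * NN)"
    proof (rule mult_left_mono)
      have "(\<Sum>k\<in>S. \<Sum>l\<in>?L. \<bar>p k l\<bar>)\<^sup>2 \<le> (\<Sum>k\<in>S. \<Sum>l\<in>?L. (p k l)\<^sup>2) * (real (card S) * real (card ?L))"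
        using double_sum_square_le[of "\<lambda>k l. \<bar>p k l\<bar>" ?L S] by simp
      also have "\<dots> \<le> (\<Sum>k\<in>S. \<Sum>l\<in>?L. (p k l)\<^sup>2) * NN" by (intro mult_left_mono cardS sum_nonneg) auto
      finally show "(\<Sum>k\<in>S. \<Sum>l\<in>?L. \<bar>p k l\<bar>)\<^sup>2 \<le> (\<Sum>k\<in>S. \<Sum>l\<in>?L. (p k l)\<^sup>2) * NN" .
    qed simp
    finally have 1: "(\<Sum>k\<in>S. quasi_coeff \<mu> n h y ?\<psi> k * \<beta> k)\<^sup>2 \<le> KK\<^sup>2 * ((\<Sum>k\<in>S. \<Sum>l\<in>?L. (p k l)\<^sup>2) * NN)" .
    have 2: "ennreal ((p k l)\<^sup>2) \<le> ennreal (D * ?H) * energy_density U n f (sample_point h k l y)" if k: "k \<in> S" and l: "l \<in> ?L" for k l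
    proof -
      let ?z = "sample_point h k l y"
      have kKB: "k \<in> ?KB" using k S by blast
      have kf: "grid_point h k \<in> U" "A * h \<le> d (grid_point h k)" using k S(2) by (auto simp: far_indices_def)
      have n1: "norm (?z - grid_point h k) \<le> r * h" by (rule sample_dist(3)[OF h kKB l y])
      have n2: "norm (?z - x) \<le> r * h" by (rule sample_dist(1)[OF h kKB l y])
      have "(r + 1) * h \<le> A * h" using A h by (intro mult_right_mono) auto
      then have n3: "r * h < d (grid_point h k)" using kf(2) h by (simp add: distrib_right)
      then have z: "?z \<in> U" using in_domain[OF kf(1)] n1 by simp
      have dz: "0 < d ?z" by (rule d_pos[OF z])
      have "d ?z \<le> d x + norm (?z - x)" by (rule d_diff(1))
      also have "\<dots> \<le> (A + 2 * r) * h" using dx n2 by (simp add: algebra_simps)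
      finally have dzu: "d ?z \<le> (A + 2 * r) * h" .
      have "(f ?z)\<^sup>2 \<le> weighted_energy U n f ?z * d ?z ^ (2 * n)"
        using iter_partial_le_weighted_energy[OF dz, of "[]" n f] by simp
      also have "d ?z ^ (2 * n) = (d ?z)\<^sup>2 * d ?z ^ (2 * (n - 1))" by (rule power_2n)
      also have "weighted_energy U n f ?z * ((d ?z)\<^sup>2 * d ?z ^ (2 * (n - 1))) \<le> weighted_energy U n f ?z * ((d ?z)\<^sup>2 * ((A + 2 * r) * h) ^ (2 * (n - 1)))"
        using dz dzu by (intro mult_left_mono power_mono weighted_energy_nonneg) auto
      finally have fz: "(f ?z)\<^sup>2 \<le> weighted_energy U n f ?z * ((d ?z)\<^sup>2 * ((A + 2 * r) * h) ^ (2 * (n - 1)))" .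
      have "(c1 * d ?z)\<^sup>2 \<le> (w ?z)\<^sup>2" using weight_lower[OF z] c_pos dz by (intro power_mono) auto
      then have "(p k l)\<^sup>2 \<le> (f ?z)\<^sup>2 / (c1 * d ?z)\<^sup>2"
        using c_pos dz weight_pos[OF z] by (simp add: p_def power_divide divide_left_mono)
      also have "\<dots> \<le> weighted_energy U n f ?z * ((d ?z)\<^sup>2 * ((A + 2 * r) * h) ^ (2 * (n - 1))) / (c1 * d ?z)\<^sup>2"
        by (intro divide_right_mono fz) simp
      also have "\<dots> = D * ?H * weighted_energy U n f ?z"
        using dz c_pos by (simp add: D_def power_mult_distrib mult_ac)
      finally have "ennreal ((p k l)\<^sup>2) \<le> ennreal (D * ?H * weighted_energy U n f ?z)" by (rule ennreal_leI)
      then show ?thesis using z nn h by (simp add: energy_density_in ennreal_mult' weighted_energy_nonneg)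
    qed
    have "(v - (\<Sum>k\<in>S. quasi_coeff \<mu> n h y ?\<psi> k * \<beta> k))\<^sup>2 \<le> 2 * v\<^sup>2 + 2 * (\<Sum>k\<in>S. quasi_coeff \<mu> n h y ?\<psi> k * \<beta> k)\<^sup>2"
    proof -
      have "(a - b)\<^sup>2 \<le> 2 * a\<^sup>2 + 2 * b\<^sup>2" for a b :: real
        using zero_le_power2[of "a + b"] by (simp add: power2_diff power2_sum)
      then show ?thesis .
    qed
    also have "\<dots> \<le> 2 * B * ?H * weighted_energy U n f x + 2 * KK\<^sup>2 * NN * (\<Sum>k\<in>S. \<Sum>l\<in>?L. (p k l)\<^sup>2)"
      using v 1 by (simp add: mult_ac)
    finally have "ennreal ((v - (\<Sum>k\<in>S. quasi_coeff \<mu> n h y ?\<psi> k * \<beta> k))\<^sup>2)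
      \<le> ennreal (2 * B * ?H * weighted_energy U n f x + 2 * KK\<^sup>2 * NN * (\<Sum>k\<in>S. \<Sum>l\<in>?L. (p k l)\<^sup>2))" by (rule ennreal_leI)
    also have "\<dots> = ennreal (2 * B * ?H) * ennreal (weighted_energy U n f x) + ennreal (2 * KK\<^sup>2 * NN) * (\<Sum>k\<in>S. \<Sum>l\<in>?L. ennreal ((p k l)\<^sup>2))"
      using B h nn weighted_energy_nonneg[of U n f x]
      by (subst ennreal_double_sum) (auto simp: ennreal_plus ennreal_mult sum_nonneg)
    also have "\<dots> \<le> ennreal (2 * B * ?H) * sampled_energy U n f h y x + ennreal (2 * KK\<^sup>2 * NN) * (ennreal (D * ?H) * sampled_energy U n f h y x)"
    proof (intro add_mono mult_left_mono)
      show "ennreal (weighted_energy U n f x) \<le> sampled_energy U n f h y x" by (rule sampled_energy_ge(1)[OF x])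
      have "(\<Sum>k\<in>S. \<Sum>l\<in>?L. ennreal ((p k l)\<^sup>2)) \<le> (\<Sum>k\<in>S. \<Sum>l\<in>?L. ennreal (D * ?H) * energy_density U n f (sample_point h k l y))"
        by (intro sum_mono 2)
      also have "\<dots> \<le> (\<Sum>k\<in>?KB. \<Sum>l\<in>?L. ennreal (D * ?H) * energy_density U n f (sample_point h k l y))"
        by (rule sum_mono2[OF finite_index_box S(1)]) simp
      also have "\<dots> = ennreal (D * ?H) * (\<Sum>k\<in>?KB. \<Sum>l\<in>?L. energy_density U n f (sample_point h k l y))"
        by (simp add: sum_distrib_left)
      also have "\<dots> \<le> ennreal (D * ?H) * sampled_energy U n f h y x"
        by (intro mult_left_mono sampled_energy_ge(2)[OF x]) simp
      finally show "(\<Sum>k\<in>S. \<Sum>l\<in>?L. ennreal ((p k l)\<^sup>2)) \<le> ennreal (D * ?H) * sampled_energy U n f h y x" .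
    qed auto
    also have "\<dots> = ennreal (C * ?H) * sampled_energy U n f h y x"
    proof -
      have "ennreal (2 * B * ?H) + ennreal (2 * KK\<^sup>2 * NN) * ennreal (D * ?H) = ennreal (2 * B * ?H + 2 * KK\<^sup>2 * NN * (D * ?H))"
        using B h nn by (simp add: ennreal_plus ennreal_mult)
      also have "2 * B * ?H + 2 * KK\<^sup>2 * NN * (D * ?H) = C * ?H" by (simp add: C_def algebra_simps)
      finally have eq: "ennreal (2 * B * ?H) + ennreal (2 * KK\<^sup>2 * NN) * ennreal (D * ?H) = ennreal (C * ?H)" .
      show ?thesis by (simp only: mult.assoc[symmetric, of "ennreal _" "ennreal _"] distrib_right[symmetric] eq)
    qed
    finally show ?thesis .
  qed
  ultimately show ?thesis using that by blast
qed

end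

section \<open>B-splines at points off the grid, and the pointwise error\<close>

lemma DERIV_abs_sgn: "t \<noteq> 0 \<Longrightarrow> (abs has_real_derivative sgn t) (at t)" for t :: real
proof (cases "t > 0")
  case True
  have "((\<lambda>t. t) has_real_derivative 1) (at t)" by simp
  then have "(abs has_real_derivative 1) (at t)"
    by (rule has_field_derivative_transform_within_open[where S = "{0<..}"]) (use True in auto)
  then show ?thesis using True by simp
next
  case False
  assume "t \<noteq> 0"
  with False have t: "t < 0" by simp
  have "((\<lambda>t. - t) has_real_derivative - 1) (at t)" by (auto intro!: derivative_eq_intros)
  then have "(abs has_real_derivative - 1) (at t)"
    by (rule has_field_derivative_transform_within_open[where S = "{..<0}"]) (use t in auto)
  then show ?thesis using t by simp
qed

lemma bspline_partial_deriv:
  fixes x :: "real^'m"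
  assumes n: "n \<ge> 2" and off: "\<And>\<nu>. x $ \<nu> / h \<notin> \<int>"
  shows "bspline n h k differentiable at x" "partial_deriv i (bspline n h k) x = bspline_deriv n h k i x"
proof -
  have "(abs has_real_derivative sgn (x $ \<nu> / h - of_int (k $ \<nu>) - real j)) (at (x $ \<nu> / h - of_int (k $ \<nu>) - real j))" for \<nu> and j :: nat
  proof (rule DERIV_abs_sgn)
    show "x $ \<nu> / h - of_int (k $ \<nu>) - real j \<noteq> 0"
    proof
      assume "x $ \<nu> / h - of_int (k $ \<nu>) - real j = 0"
      then have "x $ \<nu> / h = of_int (k $ \<nu> + int j)" by simp
      then show False using off[of \<nu>] by (metis Ints_of_int)
    qed
  qed
  note g = gen_tensor_partial_deriv[where n = n, OF this]
  show "bspline n h k differentiable at x" using g(1) unfolding gen_tensor_abs[OF n] .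
  show "partial_deriv i (bspline n h k) x = bspline_deriv n h k i x" using g(2)[of i] unfolding gen_tensor_abs[OF n] .
qed

text \<open>Around a point off the grid the cell index is constant, so the reproduction of Taylor
  polynomials holds on a whole neighbourhood with one fixed index set and may be
  differentiated.\<close>

lemma cell_neighbourhood:
  fixes x :: "real^'m"
  assumes h: "h > 0" and off: "\<And>\<nu>. x $ \<nu> / h \<notin> \<int>"
  obtains N where "open N" "x \<in> N" "\<And>z \<nu>. z \<in> N \<Longrightarrow> cell_index h x $ \<nu> = \<lfloor>z $ \<nu> / h\<rfloor>"
proof -
  define N where "N = box (grid_point h (cell_index h x)) (\<chi> \<nu>. h * (of_int (cell_index h x $ \<nu>) + 1))"
  have mem: "z \<in> N \<longleftrightarrow> (\<forall>\<nu>. of_int \<lfloor>x $ \<nu> / h\<rfloor> < z $ \<nu> / h \<and> z $ \<nu> / h < of_int \<lfloor>x $ \<nu> / h\<rfloor> + 1)" for z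
    using h by (simp add: N_def mem_box_cart grid_point_def cell_index_def pos_less_divide_eq pos_divide_less_eq mult.commute)
  have "x \<in> N" unfolding mem
  proof (intro allI conjI)
    fix \<nu>
    have "of_int \<lfloor>x $ \<nu> / h\<rfloor> \<noteq> x $ \<nu> / h" using off[of \<nu>] by (metis Ints_of_int)
    moreover have "of_int \<lfloor>x $ \<nu> / h\<rfloor> \<le> x $ \<nu> / h" by simp
    ultimately show "of_int \<lfloor>x $ \<nu> / h\<rfloor> < x $ \<nu> / h" by linarith
    show "x $ \<nu> / h < of_int \<lfloor>x $ \<nu> / h\<rfloor> + 1" by simp
  qed
  moreover have "cell_index h x $ \<nu> = \<lfloor>z $ \<nu> / h\<rfloor>" if "z \<in> N" for z \<nu>
    using that unfolding mem cell_index_def by (auto dest!: spec[of _ \<nu>] intro!: floor_unique[symmetric])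
  moreover have "open N" unfolding N_def by (rule open_box)
  ultimately show ?thesis using that by blast
qed

lemma bspline_deriv_eq_0:
  fixes x :: "real^'m"
  assumes n: "n \<ge> 2" and h: "h > 0" and off: "\<And>\<nu>. x $ \<nu> / h \<notin> \<int>" and k: "k \<notin> index_box (cell_index h x) n"
  shows "bspline n h k x = 0" "bspline_deriv n h k i x = 0"
proof -
  obtain N where N: "open N" "x \<in> N" "\<And>z \<nu>. z \<in> N \<Longrightarrow> cell_index h x $ \<nu> = \<lfloor>z $ \<nu> / h\<rfloor>"
    using cell_neighbourhood[OF h off] by blast
  obtain \<nu> where \<nu>: "k $ \<nu> < cell_index h x $ \<nu> - int n \<or> cell_index h x $ \<nu> < k $ \<nu>"
    using k by (auto simp: index_box_def not_le)
  have z: "bspline n h k z = 0" if "z \<in> N" for z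
    by (rule bspline_eq_0[OF N(3)[OF that] \<nu>])
  show "bspline n h k x = 0" by (rule z[OF N(2)])
  have "partial_deriv i (bspline n h k) x = partial_deriv i (\<lambda>z. 0) x"
    by (rule partial_deriv_cong_open[OF N(1,2) z])
  then show "bspline_deriv n h k i x = 0" using bspline_partial_deriv(2)[OF n off] by simp
qed

lemma bspline_bounds:
  fixes h0 :: real
  obtains K where "K > 0" "\<And>h x k i. h > 0 \<Longrightarrow> k \<in> index_box (cell_index h (x :: real^'m)) n \<Longrightarrow> n \<ge> 2 \<Longrightarrow>
    \<bar>bspline n h k x\<bar> \<le> K \<and> \<bar>bspline_deriv n h k i x\<bar> \<le> K / h"
proof -
  obtain K where K: "K > 0" "\<And>h q q' k x i. h > 0 \<Longrightarrow> (\<And>t. \<bar>q t\<bar> \<le> \<bar>t\<bar> + 1) \<Longrightarrow> (\<And>t. \<bar>q' t\<bar> \<le> 1) \<Longrightarrow>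
     (\<And>\<nu>. \<bar>x $ \<nu> / h - of_int (k $ \<nu>)\<bar> \<le> real n + 1) \<Longrightarrow>
     \<bar>gen_tensor q n h (k :: int^'m) x\<bar> \<le> K \<and> \<bar>gen_tensor_deriv q q' n h k i x\<bar> \<le> K / h"
    using gen_tensor_bounded[of "real n + 1", where 'm = 'm and n = n] by (metis (no_types, lifting) add_nonneg_nonneg of_nat_0_le_iff zero_le_one)
  have "\<bar>bspline n h k x\<bar> \<le> K \<and> \<bar>bspline_deriv n h k i x\<bar> \<le> K / h"
    if h: "h > 0" and k: "k \<in> index_box (cell_index h x) n" and n: "n \<ge> 2" for h k i and x :: "real^'m"
  proof -
    have "\<bar>x $ \<nu> / h - of_int (k $ \<nu>)\<bar> \<le> real n + 1" for \<nu>
      using k unfolding index_box_def cell_index_def by (auto dest!: spec[of _ \<nu>]) linarith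
    from K(2)[of h abs sgn, OF h _ _ this] show ?thesis
      unfolding gen_tensor_abs[OF n] by (auto simp: sgn_if)
  qed
  then show ?thesis using that K(1) by blast
qed

lemma finite_far_indices:
  fixes U :: "(real^'m) set"
  assumes h: "h > 0" and bd: "bounded U"
  shows "finite (far_indices U A h)"
proof -
  obtain B where B: "\<And>x. x \<in> U \<Longrightarrow> norm x \<le> B" using bd by (auto simp: bounded_iff)
  define N where "N = nat \<lceil>B / h\<rceil>"
  \<comment> \<open>An index box reaches down from its corner by its second argument, so this is the
    cube from -N to N.\<close>
  have "far_indices U A h \<subseteq> index_box (\<chi> \<nu>. int N) (2 * N)"
  proof
    fix k assume "k \<in> far_indices U A h"
    then have "norm (grid_point h k) \<le> B" using B by (simp add: far_indices_def)
    then have "\<bar>h * of_int (k $ \<nu>)\<bar> \<le> B" for \<nu>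
      using component_le_norm_cart[of "grid_point h k" \<nu>] by (simp add: grid_point_def)
    then have "\<bar>of_int (k $ \<nu>)\<bar> \<le> B / h" for \<nu> using h by (simp add: abs_mult pos_le_divide_eq mult.commute)
    then have "\<bar>k $ \<nu>\<bar> \<le> \<lceil>B / h\<rceil>" for \<nu> by (metis le_of_int_ceiling of_int_abs of_int_le_iff order_trans)
    then have "\<bar>k $ \<nu>\<bar> \<le> int N" for \<nu> unfolding N_def by (smt (verit) int_nat_eq)
    then have "- int N \<le> k $ \<nu> \<and> k $ \<nu> \<le> int N" for \<nu> by (simp add: abs_le_iff) (smt (verit))
    then show "k \<in> index_box (\<chi> \<nu>. int N) (2 * N)" unfolding index_box_def by auto
  qed
  then show ?thesis using finite_index_box finite_subset by blast
qed

context weighted_domain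
begin

text \<open>If all indices relevant for the cell of \<open>x\<close> are far, the truncated sum is
  the full quasi-interpolant and \<open>far_cell_error\<close> applies. If one of them is not far,
  its grid point is near the boundary, hence so is \<open>x\<close>, and
  \<open>boundary_cell_error\<close> applies. Points on the grid, where the spline need not be
  differentiable, are left out.\<close>

lemma pointwise_error:
  assumes K: "K > 0" "\<And>\<tau> l. \<tau> \<in> {0..1} \<Longrightarrow> l < n \<Longrightarrow> \<bar>\<mu> \<tau> l\<bar> \<le> K"
    and \<mu>: "\<And>\<tau> t t0 i lo hi. i < n \<Longrightarrow> lo \<le> \<lfloor>t\<rfloor> - int n \<Longrightarrow> hi \<ge> \<lfloor>t\<rfloor> \<Longrightarrow>
      (\<Sum>k=lo..hi. (\<Sum>l<n. \<mu> \<tau> l * (real_of_int k + real l + \<tau> - t0) ^ i) * cardinal_bspline n (t - real_of_int k)) = (t - t0) ^ i"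
    and A: "A \<ge> 3 * r + 1" and h0: "h0 > 0" and U_ne: "U \<noteq> {}"
  obtains C where "C \<ge> 0" "\<And>h f x y c. 0 < h \<Longrightarrow> h \<le> h0 \<Longrightarrow> smooth_on U f \<Longrightarrow>
     energy_density U n f \<in> borel_measurable borel \<Longrightarrow> x \<in> U \<Longrightarrow> (\<And>\<nu>. x $ \<nu> / h \<notin> \<int>) \<Longrightarrow>
     (\<And>\<nu>. y $ \<nu> \<in> {0..1}) \<Longrightarrow> c = quasi_coeff \<mu> n h y (\<lambda>x. f x * (1 / w x)) \<Longrightarrow>
     ennreal ((f x - w x * (\<Sum>k\<in>far_indices U A h. c k * bspline n h k x))\<^sup>2
       + (\<Sum>i\<in>UNIV. (partial_deriv i f x - (partial_deriv i w x * (\<Sum>k\<in>far_indices U A h. c k * bspline n h k x)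
            + w x * (\<Sum>k\<in>far_indices U A h. c k * bspline_deriv n h k i x)))\<^sup>2))
     \<le> ennreal (C * h ^ (2 * (n - 1))) * sampled_energy U n f h y x"
proof -
  obtain K0 where K0: "K0 > 0" "\<And>h x k i. h > 0 \<Longrightarrow> k \<in> index_box (cell_index h (x :: real^'m)) n \<Longrightarrow> n \<ge> 2 \<Longrightarrow>
    \<bar>bspline n h k x\<bar> \<le> K0 \<and> \<bar>bspline_deriv n h k i x\<bar> \<le> K0 / h" using bspline_bounds[of n] by blast
  have W0: "W \<ge> 0" by (rule W_nonneg[OF U_ne])
  have r0: "r \<ge> 1" by (rule r_ge_1)
  \<comment> \<open>Bounds the weighted splines and their derivatives in terms of d / h; the factor
    1 + h0 covers the values, which would need one power of h less.\<close>
  define Bg where "Bg = (W + c2) * K0 * (1 + h0)"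
  \<comment> \<open>The first two summands bound the weighted splines and their derivatives, the
    last two are the constants for \<open>f\<close> and for its gradient.\<close>
  define Bb where "Bb = W * K0 + c2 * (A + r) * K0 * (1 + h0) + (A + r) ^ (2 * n) * h0\<^sup>2 + (A + r) ^ (2 * (n - 1))"
  have B0: "Bg \<ge> 0" "Bb \<ge> 0" using W0 K0(1) h0 c_pos A r0 by (auto simp: Bg_def Bb_def)
  have A1: "A \<ge> r + 1" using A r0 by linarith
  let ?KB = "\<lambda>h x. index_box (cell_index h x) n"
  obtain Cg where Cg: "Cg \<ge> 0" "\<And>h f x y \<beta> v. h > 0 \<Longrightarrow> smooth_on U f \<Longrightarrow>
     energy_density U n f \<in> borel_measurable borel \<Longrightarrow> x \<in> U \<Longrightarrow> 2 * r * h \<le> d x \<Longrightarrow>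
     (\<And>\<nu>. y $ \<nu> \<in> {0..1}) \<Longrightarrow>
     (\<And>k. k \<in> ?KB h x \<Longrightarrow> \<bar>\<beta> k\<bar> \<le> Bg * d x / h) \<Longrightarrow>
     v = (\<Sum>k\<in>?KB h x. quasi_coeff \<mu> n h y (taylor_poly n (\<lambda>x. f x * (1 / w x)) x) k * \<beta> k) \<Longrightarrow>
     ennreal ((v - (\<Sum>k\<in>?KB h x. quasi_coeff \<mu> n h y (\<lambda>x. f x * (1 / w x)) k * \<beta> k))\<^sup>2)
       \<le> ennreal (Cg * h ^ (2 * (n - 1))) * sampled_energy U n f h y x"
  proof (rule far_cell_error[where \<mu> = \<mu> and K = K and B = Bg], goal_cases)
    case 1
    show ?case by (rule K(1))
  next
    case (2 \<tau> l)
    show ?case by (rule K(2)) fact+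
  next
    case 3
    show ?case by (rule B0(1))
  next
    case (4 C)
    show ?case by (rule 4(1)[OF 4(2) 4(3)])
  qed
  obtain Cb where Cb: "Cb \<ge> 0" "\<And>h f x y \<beta> v S. h > 0 \<Longrightarrow> x \<in> U \<Longrightarrow> d x \<le> (A + r) * h \<Longrightarrow>
     (\<And>\<nu>. y $ \<nu> \<in> {0..1}) \<Longrightarrow> S \<subseteq> ?KB h x \<Longrightarrow> S \<subseteq> far_indices U A h \<Longrightarrow>
     (\<And>k. k \<in> S \<Longrightarrow> \<bar>\<beta> k\<bar> \<le> Bb) \<Longrightarrow>
     v\<^sup>2 \<le> Bb * h ^ (2 * (n - 1)) * weighted_energy U n f x \<Longrightarrow>
     ennreal ((v - (\<Sum>k\<in>S. quasi_coeff \<mu> n h y (\<lambda>x. f x * (1 / w x)) k * \<beta> k))\<^sup>2)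
       \<le> ennreal (Cb * h ^ (2 * (n - 1))) * sampled_energy U n f h y x"
  proof (rule boundary_cell_error[where \<mu> = \<mu> and K = K and B = Bb and A = A], goal_cases)
    case 1
    show ?case by (rule K(1))
  next
    case (2 \<tau> l)
    show ?case by (rule K(2)) fact+
  next
    case 3
    show ?case by (rule B0(2))
  next
    case 4
    show ?case by (rule A1)
  next
    case (5 C)
    show ?case by (rule 5(1)[OF 5(2) 5(3)])
  qed
  define C where "C = max Cg Cb * (1 + real CARD('m))"
  have "C \<ge> 0" using Cg(1) by (simp add: C_def)
  moreover have "ennreal ((f x - w x * (\<Sum>k\<in>far_indices U A h. c k * bspline n h k x))\<^sup>2
       + (\<Sum>i\<in>UNIV. (partial_deriv i f x - (partial_deriv i w x * (\<Sum>k\<in>far_indices U A h. c k * bspline n h k x)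
            + w x * (\<Sum>k\<in>far_indices U A h. c k * bspline_deriv n h k i x)))\<^sup>2))
     \<le> ennreal (C * h ^ (2 * (n - 1))) * sampled_energy U n f h y x"
    if h: "0 < h" "h \<le> h0" and f: "smooth_on U f" and ed: "energy_density U n f \<in> borel_measurable borel"
      and x: "x \<in> U" and off: "\<And>\<nu>. x $ \<nu> / h \<notin> \<int>"
      and y: "\<And>\<nu>. y $ \<nu> \<in> {0..1}" and c: "c = quasi_coeff \<mu> n h y (\<lambda>x. f x * (1 / w x))" for h f x y c
  proof -
    let ?F = "far_indices U A h" and ?K = "?KB h x" and ?\<psi> = "\<lambda>x. f x * (1 / w x)" and ?H = "h ^ (2 * (n - 1))"
    let ?E = "sampled_energy U n f h y x"
    have finF: "finite ?F" by (rule finite_far_indices[OF h(1) bounded_domain])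
    define \<beta>0 where "\<beta>0 k = w x * bspline n h k x" for k
    define \<beta> where "\<beta> i k = partial_deriv i w x * bspline n h k x + w x * bspline_deriv n h k i x" for i k
    have z: "\<beta>0 k = 0" "\<beta> i k = 0" if "k \<notin> ?K" for i k
      using bspline_deriv_eq_0[OF order_ge_2 h(1) off that] by (auto simp: \<beta>0_def \<beta>_def)
    have e0: "w x * (\<Sum>k\<in>?F. c k * bspline n h k x) = (\<Sum>k\<in>?F \<inter> ?K. c k * \<beta>0 k)"
    proof -
      have "w x * (\<Sum>k\<in>?F. c k * bspline n h k x) = (\<Sum>k\<in>?F. c k * \<beta>0 k)"
        by (simp add: \<beta>0_def sum_distrib_left mult_ac)
      also have "\<dots> = (\<Sum>k\<in>?F \<inter> ?K. c k * \<beta>0 k)"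
        by (rule sum.mono_neutral_right[OF finF]) (use z in auto)
      finally show ?thesis .
    qed
    have e1: "partial_deriv i w x * (\<Sum>k\<in>?F. c k * bspline n h k x) + w x * (\<Sum>k\<in>?F. c k * bspline_deriv n h k i x) = (\<Sum>k\<in>?F \<inter> ?K. c k * \<beta> i k)" for i
    proof -
      have "partial_deriv i w x * (\<Sum>k\<in>?F. c k * bspline n h k x) + w x * (\<Sum>k\<in>?F. c k * bspline_deriv n h k i x) = (\<Sum>k\<in>?F. c k * \<beta> i k)"
        by (simp add: \<beta>_def sum_distrib_left distrib_left sum.distrib mult_ac)
      also have "\<dots> = (\<Sum>k\<in>?F \<inter> ?K. c k * \<beta> i k)"
        by (rule sum.mono_neutral_right[OF finF]) (use z in auto)
      finally show ?thesis .
    qed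
    have wx: "0 < w x" "w x \<le> c2 * d x" using weight_pos[OF x] weight_upper[OF x] by auto
    have dx: "0 < d x" by (rule d_pos[OF x])
    have bb: "\<bar>\<beta>0 k\<bar> \<le> c2 * d x * K0" "\<bar>\<beta> i k\<bar> \<le> W * K0 + c2 * d x * (K0 / h)" if k: "k \<in> ?K" for i k
    proof -
      note b = K0(2)[OF h(1) k order_ge_2]
      show "\<bar>\<beta>0 k\<bar> \<le> c2 * d x * K0"
        unfolding \<beta>0_def abs_mult using wx b dx c_pos by (intro mult_mono) auto
      have "\<bar>partial_deriv i w x * bspline n h k x\<bar> \<le> W * K0"
        unfolding abs_mult using weight_grad[OF x] b W0 by (intro mult_mono) auto
      moreover have "\<bar>w x * bspline_deriv n h k i x\<bar> \<le> c2 * d x * (K0 / h)"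
        unfolding abs_mult using wx b dx c_pos by (intro mult_mono) auto
      ultimately show "\<bar>\<beta> i k\<bar> \<le> W * K0 + c2 * d x * (K0 / h)" unfolding \<beta>_def by linarith
    qed
    have main: "ennreal ((f x - (\<Sum>k\<in>?F \<inter> ?K. c k * \<beta>0 k))\<^sup>2) \<le> ennreal (max Cg Cb * ?H) * ?E \<and>
       (\<forall>i. ennreal ((partial_deriv i f x - (\<Sum>k\<in>?F \<inter> ?K. c k * \<beta> i k))\<^sup>2) \<le> ennreal (max Cg Cb * ?H) * ?E)"
    proof (cases "?K \<subseteq> ?F")
      case True
      have k0: "cell_index h x \<in> ?K" by (simp add: index_box_def)
      then have "A * h \<le> d (grid_point h (cell_index h x))" using True by (auto simp: far_indices_def)
      moreover have "d (grid_point h (cell_index h x)) \<le> d x + r * h"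
      proof -
        have l0: "(\<lambda>_. 0) \<in> (sample_offsets n :: ('m \<Rightarrow> nat) set)" using order_ge_2 by (auto simp: sample_offsets_def)
        show ?thesis using d_diff(1)[of "grid_point h (cell_index h x)" x] sample_dist(2)[OF h(1) k0 l0 y] by linarith
      qed
      ultimately have "(A - r) * h \<le> d x" by (simp add: algebra_simps)
      \<comment> \<open>Here A \<ge> 3 r + 1 enters: 2 r h \<le> d x is the hypothesis of
        \<open>far_cell_error\<close>, and h \<le> d x absorbs the term in which the derivative
        falls on \<open>w\<close>.\<close>
      moreover have "(2 * r + 1) * h \<le> (A - r) * h" using A h by (intro mult_right_mono) auto
      ultimately have dxh: "(2 * r + 1) * h \<le> d x" by linarith
      have "0 \<le> 2 * r * h" using r0 h by simp
      moreover have "2 * r * h + h \<le> d x" using dxh by (simp add: distrib_right)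
      ultimately have h_d: "h \<le> d x" "2 * r * h \<le> d x" using h by linarith+
      have FK: "?F \<inter> ?K = ?K" using True by blast
      have bg: "\<bar>\<beta>0 k\<bar> \<le> Bg * d x / h" "\<bar>\<beta> i k\<bar> \<le> Bg * d x / h" if k: "k \<in> ?K" for i k
      proof -
        have one: "1 \<le> d x / h" using h_d h by simp
        have "c2 * d x * K0 = c2 * K0 * h * (d x / h)" using h by simp
        also have "\<dots> \<le> Bg * (d x / h)"
        proof (rule mult_right_mono)
          have "c2 * K0 * h \<le> c2 * K0 * (1 + h0)" using c_pos K0(1) h by (intro mult_left_mono) auto
          also have "\<dots> \<le> Bg" unfolding Bg_def using W0 K0(1) h0 by (simp add: distrib_right)
          finally show "c2 * K0 * h \<le> Bg" .
        qed (use dx h in simp)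
        finally show "\<bar>\<beta>0 k\<bar> \<le> Bg * d x / h" using bb(1)[OF k] by simp
        have "W * K0 * 1 \<le> W * K0 * (d x / h)" using one W0 K0(1) by (intro mult_left_mono) auto
        then have "W * K0 + c2 * d x * (K0 / h) \<le> (W + c2) * K0 * (d x / h)" by (simp add: algebra_simps)
        also have "\<dots> \<le> Bg * (d x / h)"
        proof (rule mult_right_mono)
          have "(W + c2) * K0 * 1 \<le> (W + c2) * K0 * (1 + h0)" using W0 c_pos K0(1) h0 by (intro mult_left_mono) auto
          then show "(W + c2) * K0 \<le> Bg" by (simp add: Bg_def)
        qed (use dx h in simp)
        finally show "\<bar>\<beta> i k\<bar> \<le> Bg * d x / h" using bb(2)[OF k, of i] by simp
      qed
      obtain N where N: "open N" "x \<in> N" "\<And>z \<nu>. z \<in> N \<Longrightarrow> cell_index h x $ \<nu> = \<lfloor>z $ \<nu> / h\<rfloor>"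
        using cell_neighbourhood[OF h(1) off] by blast
      let ?T = "taylor_poly n ?\<psi> x"
      let ?q = "quasi_coeff \<mu> n h y ?T"
      have rep: "(\<Sum>k\<in>?K. ?q k * bspline n h k z) = ?T z" if "z \<in> N" for z
        by (rule quasi_coeff_taylor[OF h(1) N(3)[OF that] \<mu>])
      have rep0: "(\<Sum>k\<in>?K. ?q k * bspline n h k x) = ?\<psi> x"
        using rep[OF N(2)] taylor_poly_at(1)[OF order_ge_2, of ?\<psi> x] by simp
      have rep1: "(\<Sum>k\<in>?K. ?q k * bspline_deriv n h k i x) = partial_deriv i ?\<psi> x" for i
      proof -
        have "partial_deriv i ?\<psi> x = partial_deriv i ?T x" by (rule taylor_poly_at(3)[OF order_ge_2, symmetric])
        also have "\<dots> = partial_deriv i (\<lambda>z. \<Sum>k\<in>?K. ?q k * bspline n h k z) x"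
          by (rule partial_deriv_cong_open[OF N(1,2)]) (rule rep[symmetric])
        also have "\<dots> = (\<Sum>k\<in>?K. ?q k * partial_deriv i (bspline n h k) x)"
          by (rule differentiable_partial_deriv_sum[THEN conjunct2, OF finite_index_box bspline_partial_deriv(1)[OF order_ge_2 off]])
        finally show ?thesis by (simp add: bspline_partial_deriv(2)[OF order_ge_2 off])
      qed
      have fw: "f z = w z * ?\<psi> z" if "z \<in> U" for z using weight_pos[OF that] by simp
      have v0: "f x = (\<Sum>k\<in>?K. ?q k * \<beta>0 k)"
        using rep0 fw[OF x] by (simp add: \<beta>0_def mult.left_commute flip: sum_distrib_left)
      have v1: "partial_deriv i f x = (\<Sum>k\<in>?K. ?q k * \<beta> i k)" for i
      proof -
        have "partial_deriv i f x = partial_deriv i (\<lambda>z. w z * ?\<psi> z) x"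
          by (rule partial_deriv_cong_open[OF open_domain x fw])
        also have "\<dots> = partial_deriv i w x * ?\<psi> x + w x * partial_deriv i ?\<psi> x"
          by (intro partial_deriv_mult smooth_on_imp_differentiable[OF _ open_domain x] smooth_weight smooth_quotient f)
        also have "\<dots> = partial_deriv i w x * (\<Sum>k\<in>?K. ?q k * bspline n h k x) + w x * (\<Sum>k\<in>?K. ?q k * bspline_deriv n h k i x)"
          by (simp only: rep0 rep1)
        also have "\<dots> = (\<Sum>k\<in>?K. ?q k * \<beta> i k)"
          by (simp add: \<beta>_def sum_distrib_left distrib_left sum.distrib mult_ac)
        finally show ?thesis .
      qed
      have le: "ennreal (Cg * ?H) * ?E \<le> ennreal (max Cg Cb * ?H) * ?E"
        using h by (intro mult_right_mono ennreal_leI) auto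
      show ?thesis unfolding FK c
        by (intro conjI allI; rule order_trans[OF Cg(2)[OF h(1) f ed x h_d(2) y bg(1) v0] le] order_trans[OF Cg(2)[OF h(1) f ed x h_d(2) y bg(2) v1] le])
    next
      case False
      then obtain k where k: "k \<in> ?K" "k \<notin> ?F" by blast
      \<comment> \<open>Grid points of the index box are within r h of \<open>x\<close>. Were
        \<open>x\<close> farther from the boundary, they would all keep distance at least A h, and
        every index would be far.\<close>
      have dxA: "d x \<le> (A + r) * h"
      proof (rule ccontr)
        assume "\<not> ?thesis"
        then have gt: "(A + r) * h < d x" by simp
        have l0: "(\<lambda>_. 0) \<in> (sample_offsets n :: ('m \<Rightarrow> nat) set)" using order_ge_2 by (auto simp: sample_offsets_def)
        have nk: "norm (grid_point h k - x) \<le> r * h" by (rule sample_dist(2)[OF h(1) k(1) l0 y])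
        have "0 \<le> A * h" using A r0 h by simp
        then have "norm (grid_point h k - x) < d x" using nk gt by (simp add: distrib_right)
        then have "grid_point h k \<in> U" by (rule in_domain[OF x])
        moreover have "A * h \<le> d (grid_point h k)" using d_diff(2)[of x "grid_point h k"] nk gt by (simp add: distrib_right)
        ultimately show False using k(2) by (simp add: far_indices_def)
      qed
      have Ar: "0 \<le> A + r" using A r0 by simp
      have bbd: "\<bar>\<beta>0 k\<bar> \<le> Bb" "\<bar>\<beta> i k\<bar> \<le> Bb" if k: "k \<in> ?F \<inter> ?K" for i k
      proof -
        have k': "k \<in> ?K" using k by blast
        have r1: "0 \<le> W * K0" "0 \<le> (A + r) ^ (2 * n) * h0\<^sup>2" "0 \<le> (A + r) ^ (2 * (n - 1))" using W0 K0(1) Ar by auto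
        have "c2 * d x * K0 \<le> c2 * ((A + r) * h) * K0" using dxA c_pos K0(1) by (intro mult_right_mono mult_left_mono) auto
        also have "\<dots> = c2 * (A + r) * K0 * h" by simp
        also have "\<dots> \<le> c2 * (A + r) * K0 * (1 + h0)" using c_pos K0(1) Ar h by (intro mult_left_mono) auto
        finally show "\<bar>\<beta>0 k\<bar> \<le> Bb" using bb(1)[OF k'] r1 unfolding Bb_def by linarith
        have "c2 * d x * (K0 / h) \<le> c2 * ((A + r) * h) * (K0 / h)" using dxA c_pos K0(1) h by (intro mult_right_mono mult_left_mono) auto
        also have "\<dots> = c2 * (A + r) * K0 * 1" using h by simp
        also have "\<dots> \<le> c2 * (A + r) * K0 * (1 + h0)" using c_pos K0(1) Ar h0 by (intro mult_left_mono) auto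
        finally show "\<bar>\<beta> i k\<bar> \<le> Bb" using bb(2)[OF k', of i] r1 unfolding Bb_def by linarith
      qed
      have Bb_ge: "(A + r) ^ (2 * n) * h0\<^sup>2 \<le> Bb" "(A + r) ^ (2 * (n - 1)) \<le> Bb"
        using W0 K0(1) Ar c_pos h0 by (auto simp: Bb_def)
      note G0 = weighted_energy_nonneg[of U n f x]
      have v0: "(f x)\<^sup>2 \<le> Bb * ?H * weighted_energy U n f x"
      proof -
        have "(f x)\<^sup>2 \<le> weighted_energy U n f x * d x ^ (2 * n)"
          using iter_partial_le_weighted_energy[OF dx, of "[]" n f] by simp
        also have "\<dots> \<le> weighted_energy U n f x * ((A + r) * h) ^ (2 * n)"
          using dx dxA G0 by (intro mult_left_mono power_mono) auto
        also have "((A + r) * h) ^ (2 * n) = (A + r) ^ (2 * n) * (h\<^sup>2 * ?H)"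
        proof -
          have "2 * n = 2 + 2 * (n - 1)" using order_ge_2 by simp
          then have "h ^ (2 * n) = h\<^sup>2 * ?H" by (simp only: power_add)
          then show ?thesis by (simp add: power_mult_distrib)
        qed
        also have "weighted_energy U n f x * ((A + r) ^ (2 * n) * (h\<^sup>2 * ?H)) \<le> weighted_energy U n f x * ((A + r) ^ (2 * n) * (h0\<^sup>2 * ?H))"
          using G0 Ar h by (intro mult_left_mono mult_right_mono power_mono) auto
        also have "\<dots> = (A + r) ^ (2 * n) * h0\<^sup>2 * (?H * weighted_energy U n f x)" by simp
        also have "\<dots> \<le> Bb * (?H * weighted_energy U n f x)" using Bb_ge(1) G0 h by (intro mult_right_mono) auto
        finally show ?thesis by (simp add: mult.assoc)
      qed
      have v1: "(partial_deriv i f x)\<^sup>2 \<le> Bb * ?H * weighted_energy U n f x" for i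
      proof -
        have "(partial_deriv i f x)\<^sup>2 \<le> weighted_energy U n f x * d x ^ (2 * (n - 1))"
          using iter_partial_le_weighted_energy[OF dx, of "[i]" n f] order_ge_2 by (simp add: iter_partial_Cons)
        also have "\<dots> \<le> weighted_energy U n f x * ((A + r) * h) ^ (2 * (n - 1))"
          using dx dxA G0 by (intro mult_left_mono power_mono) auto
        also have "\<dots> = (A + r) ^ (2 * (n - 1)) * (?H * weighted_energy U n f x)" by (simp add: power_mult_distrib)
        also have "\<dots> \<le> Bb * (?H * weighted_energy U n f x)" using Bb_ge(2) G0 h by (intro mult_right_mono) auto
        finally show ?thesis by (simp add: mult.assoc)
      qed
      have le: "ennreal (Cb * ?H) * ?E \<le> ennreal (max Cg Cb * ?H) * ?E"
        using h by (intro mult_right_mono ennreal_leI) auto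
      have SS: "?F \<inter> ?K \<subseteq> ?K" "?F \<inter> ?K \<subseteq> ?F" by auto
      show ?thesis unfolding c
        by (intro conjI allI; rule order_trans[OF Cb(2)[OF h(1) x dxA y SS bbd(1) v0] le] order_trans[OF Cb(2)[OF h(1) x dxA y SS bbd(2) v1] le])
    qed
    have "ennreal ((f x - w x * (\<Sum>k\<in>?F. c k * bspline n h k x))\<^sup>2
       + (\<Sum>i\<in>UNIV. (partial_deriv i f x - (partial_deriv i w x * (\<Sum>k\<in>?F. c k * bspline n h k x)
            + w x * (\<Sum>k\<in>?F. c k * bspline_deriv n h k i x)))\<^sup>2))
      = ennreal ((f x - (\<Sum>k\<in>?F \<inter> ?K. c k * \<beta>0 k))\<^sup>2) + (\<Sum>i\<in>UNIV. ennreal ((partial_deriv i f x - (\<Sum>k\<in>?F \<inter> ?K. c k * \<beta> i k))\<^sup>2))"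
      unfolding e0 e1 by (subst ennreal_plus) (auto simp: sum_nonneg)
    also have "\<dots> \<le> ennreal (max Cg Cb * ?H) * ?E + (\<Sum>i\<in>(UNIV::'m set). ennreal (max Cg Cb * ?H) * ?E)"
      using main by (intro add_mono sum_mono) auto
    also have "\<dots> = ennreal (C * ?H) * ?E"
    proof -
      have "ennreal (max Cg Cb * ?H) * ?E + (\<Sum>i\<in>(UNIV::'m set). ennreal (max Cg Cb * ?H) * ?E)
        = (1 + of_nat CARD('m)) * (ennreal (max Cg Cb * ?H) * ?E)" by (simp add: distrib_right)
      also have "(1 + of_nat CARD('m)) = ennreal (1 + real CARD('m))"
        by (simp add: ennreal_plus ennreal_of_nat_eq_real_of_nat)
      also have "\<dots> * (ennreal (max Cg Cb * ?H) * ?E) = ennreal ((1 + real CARD('m)) * (max Cg Cb * ?H)) * ?E"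
        using Cg(1) h by (subst ennreal_mult) (auto simp: mult.assoc)
      finally show ?thesis by (simp add: C_def mult_ac)
    qed
    finally show ?thesis .
  qed
  ultimately show ?thesis using that by blast
qed

end

section \<open>Averaging over the shift of the sampling points\<close>

lemma borel_measurable_vec_nth [measurable]: "(\<lambda>x :: real^'m. x $ i) \<in> borel_measurable borel"
  by (intro borel_measurable_continuous_onI continuous_intros)

lemma borel_measurable_vecI:
  fixes f :: "'a \<Rightarrow> real^'m"
  assumes "\<And>i. (\<lambda>p. f p $ i) \<in> borel_measurable M"
  shows "f \<in> borel_measurable M"
proof (subst borel_measurable_euclidean_space, intro ballI)
  fix b :: "real^'m" assume "b \<in> Basis"
  then obtain i where "b = axis i 1" by (auto simp: Basis_vec_def)
  then show "(\<lambda>p. f p \<bullet> b) \<in> borel_measurable M" using assms[of i] by (simp add: inner_axis)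
qed

text \<open>Averaging over the shift \<open>y\<close> turns the sampled values into integrals over a ball around \<open>x\<close>,
  which are estimated using nothing but translations.\<close>

lemma shift_average:
  fixes G :: "real^'m \<Rightarrow> real^'m \<Rightarrow> ennreal" and x c :: "real^'m"
  assumes h: "h > 0" and [measurable]: "(\<lambda>p. G (fst p) (snd p)) \<in> borel_measurable borel"
    and Y: "\<And>y. y \<in> Y \<Longrightarrow> norm (y + c) \<le> r"
    and [measurable]: "Y \<in> sets borel"
  shows "(\<integral>\<^sup>+y\<in>Y. G x (x + h *\<^sub>R (y + c)) \<partial>lborel) \<le> (\<integral>\<^sup>+y\<in>cball 0 r. G x (x + h *\<^sub>R y) \<partial>lborel)"
proof -
  have [measurable]: "cball (0 :: real^'m) r \<in> sets borel" by (rule borel_closed[OF closed_cball])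
  have [measurable]: "(\<lambda>z. G x z) \<in> borel_measurable borel"
  proof -
    have "(\<lambda>z. (x, z)) \<in> borel \<rightarrow>\<^sub>M borel" by (intro borel_measurable_continuous_onI continuous_intros)
    from measurable_compose[OF this assms(2)] show ?thesis by simp
  qed
  have "(\<integral>\<^sup>+y\<in>Y. G x (x + h *\<^sub>R (y + c)) \<partial>lborel) \<le> (\<integral>\<^sup>+y. G x (x + h *\<^sub>R (y + c)) * indicator (cball 0 r) (y + c) \<partial>lborel)"
    by (rule nn_integral_mono) (use Y in \<open>auto simp: indicator_def\<close>)
  also have "\<dots> = (\<integral>\<^sup>+y\<in>cball 0 r. G x (x + h *\<^sub>R y) \<partial>lborel)"
    by (rule nn_integral_translate[of "\<lambda>y. G x (x + h *\<^sub>R y) * indicator (cball 0 r) y" c]) measurable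
  finally show ?thesis .
qed

text \<open>For fixed \<open>y\<close> and \<open>t\<close> the argument is a translate of
  \<open>x\<close>. Integrating over \<open>x\<close> before \<open>t\<close> and \<open>y\<close>
  therefore produces no Jacobian, which for the segments would degenerate at t = 0.\<close>

lemma ball_average:
  fixes E :: "real^'m \<Rightarrow> ennreal"
  assumes [measurable]: "E \<in> borel_measurable borel"
  shows "(\<integral>\<^sup>+x. (\<integral>\<^sup>+y\<in>cball 0 r. E (x + h *\<^sub>R y) \<partial>lborel) \<partial>lborel)
      = emeasure lborel (cball (0 :: real^'m) r) * (\<integral>\<^sup>+x. E x \<partial>lborel)"
    and "(\<integral>\<^sup>+x. (\<integral>\<^sup>+y\<in>cball 0 r. (\<integral>\<^sup>+t\<in>{0..1}. E (x + t *\<^sub>R (h *\<^sub>R y)) \<partial>lborel) \<partial>lborel) \<partial>lborel)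
      = emeasure lborel (cball (0 :: real^'m) r) * (\<integral>\<^sup>+x. E x \<partial>lborel)"
proof -
  have [measurable]: "cball (0 :: real^'m) r \<in> sets borel" by (rule borel_closed[OF closed_cball])
  have *: "(\<integral>\<^sup>+x. E (x + v) * c \<partial>lborel) = (\<integral>\<^sup>+x. E x \<partial>lborel) * c" for v c
    by (subst nn_integral_multc, measurable) (simp add: nn_integral_translate)
  have "(\<integral>\<^sup>+x. (\<integral>\<^sup>+y\<in>cball 0 r. E (x + h *\<^sub>R y) \<partial>lborel) \<partial>lborel)
    = (\<integral>\<^sup>+y. \<integral>\<^sup>+x. E (x + h *\<^sub>R y) * indicator (cball 0 r) y \<partial>lborel \<partial>lborel)"
    by (rule lborel_pair.Fubini') measurable
  also have "\<dots> = emeasure lborel (cball (0 :: real^'m) r) * (\<integral>\<^sup>+x. E x \<partial>lborel)"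
    by (simp only: *) (subst nn_integral_cmult_indicator, simp_all add: mult.commute)
  finally show "(\<integral>\<^sup>+x. (\<integral>\<^sup>+y\<in>cball 0 r. E (x + h *\<^sub>R y) \<partial>lborel) \<partial>lborel)
      = emeasure lborel (cball (0 :: real^'m) r) * (\<integral>\<^sup>+x. E x \<partial>lborel)" .
  have "(\<integral>\<^sup>+x. (\<integral>\<^sup>+y\<in>cball 0 r. (\<integral>\<^sup>+t\<in>{0..1}. E (x + t *\<^sub>R (h *\<^sub>R y)) \<partial>lborel) \<partial>lborel) \<partial>lborel)
    = (\<integral>\<^sup>+y. \<integral>\<^sup>+x. (\<integral>\<^sup>+t\<in>{0..1}. E (x + t *\<^sub>R (h *\<^sub>R y)) \<partial>lborel) * indicator (cball 0 r) y \<partial>lborel \<partial>lborel)"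
    by (rule lborel_pair.Fubini') measurable
  also have "\<dots> = (\<integral>\<^sup>+y. (\<integral>\<^sup>+x. E x \<partial>lborel) * indicator (cball (0 :: real^'m) r) y \<partial>lborel)"
  proof -
    have eq: "(\<integral>\<^sup>+x. (\<integral>\<^sup>+t\<in>{0..1}. E (x + t *\<^sub>R (h *\<^sub>R y)) \<partial>lborel) * indicator (cball 0 r) y \<partial>lborel)
      = (\<integral>\<^sup>+x. E x \<partial>lborel) * indicator (cball 0 r) y" for y :: "real^'m"
    proof -
    have "(\<integral>\<^sup>+x. (\<integral>\<^sup>+t\<in>{0..1}. E (x + t *\<^sub>R (h *\<^sub>R y)) \<partial>lborel) \<partial>lborel)
      = (\<integral>\<^sup>+t. \<integral>\<^sup>+x. E (x + t *\<^sub>R (h *\<^sub>R y)) * indicator {0..1::real} t \<partial>lborel \<partial>lborel)"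
      by (rule lborel_pair.Fubini') measurable
    also have "\<dots> = (\<integral>\<^sup>+x. E x \<partial>lborel)" by (simp add: * nn_integral_cmult_indicator)
    finally show ?thesis
      by (subst nn_integral_multc) simp_all
    qed
    show ?thesis by (simp only: eq)
  qed
  also have "\<dots> = emeasure lborel (cball (0 :: real^'m) r) * (\<integral>\<^sup>+x. E x \<partial>lborel)"
    by (subst nn_integral_cmult_indicator) (simp_all add: mult.commute)
  finally show "(\<integral>\<^sup>+x. (\<integral>\<^sup>+y\<in>cball 0 r. (\<integral>\<^sup>+t\<in>{0..1}. E (x + t *\<^sub>R (h *\<^sub>R y)) \<partial>lborel) \<partial>lborel) \<partial>lborel)
      = emeasure lborel (cball (0 :: real^'m) r) * (\<integral>\<^sup>+x. E x \<partial>lborel)" .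
qed

text \<open>Makes the index set independent of the cell of \<open>x\<close>, so that the sum can be
  taken out of the integral over \<open>x\<close>.\<close>

lemma sum_index_box_shift:
  fixes g :: "int^'m \<Rightarrow> 'a::comm_monoid_add"
  shows "(\<Sum>k\<in>index_box k0 n. g k) = (\<Sum>k\<in>index_box (\<chi> \<nu>. int n) n. g (k0 - k))"
  by (rule sum.reindex_bij_witness[of _ "\<lambda>k. k0 - k" "\<lambda>k. k0 - k"]) (auto simp: index_box_def algebra_simps)

definition shift_cube :: "(real^'m) set" where
  "shift_cube = cbox 0 (\<chi> \<nu>. 1)"

lemma mem_shift_cube: "y \<in> shift_cube \<longleftrightarrow> (\<forall>\<nu>. y $ \<nu> \<in> {0..1})"
  by (auto simp: shift_cube_def mem_box_cart)

lemma emeasure_shift_cube: "emeasure lborel (shift_cube :: (real^'m) set) = 1"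
proof -
  have "(\<chi> \<nu>. (1 :: real)) \<bullet> b = 1" if "b \<in> Basis" for b :: "real^'m"
    using that by (auto simp: Basis_vec_def inner_axis)
  then show ?thesis
    unfolding shift_cube_def by (subst emeasure_lborel_cbox_eq) auto
qed

lemma energy_density_measurable:
  assumes "open U" "f \<in> test_functions U"
  shows "energy_density U n f \<in> borel_measurable borel"
proof -
  have [measurable]: "iter_partial is f \<in> borel_measurable borel" for "is"
    by (rule borel_measurable_test[OF test_functions_iter_partial[OF assms(2)]])
  have [measurable]: "(\<lambda>y. infdist y (frontier U)) \<in> borel_measurable borel"
    by (intro borel_measurable_continuous_onI continuous_intros)
  have [measurable]: "U \<in> sets borel" using assms(1) by simp
  show ?thesis unfolding energy_density_def weighted_energy_def by measurable
qed

lemma set_nn_integral_add_sum: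
  fixes g :: "real^'m \<Rightarrow> ennreal"
  assumes [measurable]: "S \<in> sets borel" "g \<in> borel_measurable borel"
    "\<And>k l. a k l \<in> borel_measurable borel" "\<And>k l. b k l \<in> borel_measurable borel"
  shows "(\<integral>\<^sup>+x\<in>S. (g x + (\<Sum>k\<in>Q. \<Sum>l\<in>L. a k l x + b k l x)) \<partial>lborel)
    = (\<integral>\<^sup>+x\<in>S. g x \<partial>lborel) + (\<Sum>k\<in>Q. \<Sum>l\<in>L. (\<integral>\<^sup>+x\<in>S. a k l x \<partial>lborel) + (\<integral>\<^sup>+x\<in>S. b k l x \<partial>lborel))"
proof -
  have 1: "(\<integral>\<^sup>+x. (a k l x * indicator S x + b k l x * indicator S x) \<partial>lborel) = (\<integral>\<^sup>+x\<in>S. a k l x \<partial>lborel) + (\<integral>\<^sup>+x\<in>S. b k l x \<partial>lborel)" for k l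
    by (rule nn_integral_add) measurable
  have 2: "(\<integral>\<^sup>+x. (\<Sum>l\<in>L. a k l x * indicator S x + b k l x * indicator S x) \<partial>lborel)
    = (\<Sum>l\<in>L. (\<integral>\<^sup>+x. (a k l x * indicator S x + b k l x * indicator S x) \<partial>lborel))" for k
    by (rule nn_integral_sum) measurable
  have 3: "(\<integral>\<^sup>+x. (\<Sum>k\<in>Q. \<Sum>l\<in>L. a k l x * indicator S x + b k l x * indicator S x) \<partial>lborel)
    = (\<Sum>k\<in>Q. (\<integral>\<^sup>+x. (\<Sum>l\<in>L. a k l x * indicator S x + b k l x * indicator S x) \<partial>lborel))"
    by (rule nn_integral_sum) measurable
  have "(\<integral>\<^sup>+x\<in>S. (g x + (\<Sum>k\<in>Q. \<Sum>l\<in>L. a k l x + b k l x)) \<partial>lborel)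
    = (\<integral>\<^sup>+x. (g x * indicator S x + (\<Sum>k\<in>Q. \<Sum>l\<in>L. a k l x * indicator S x + b k l x * indicator S x)) \<partial>lborel)"
    by (simp only: distrib_right sum_distrib_right)
  also have "\<dots> = (\<integral>\<^sup>+x\<in>S. g x \<partial>lborel) + (\<integral>\<^sup>+x. (\<Sum>k\<in>Q. \<Sum>l\<in>L. a k l x * indicator S x + b k l x * indicator S x) \<partial>lborel)"
    by (rule nn_integral_add) measurable
  finally show ?thesis by (simp only: 1 2 3)
qed

text \<open>The constant is pinned to an explicit value in the last conclusion, so that its
  independence of \<open>h\<close> and \<open>f\<close> is visible to the caller.\<close>

lemma sampled_energy_average:
  fixes U :: "(real^'m) set"
  assumes h: "h > 0" and [measurable]: "U \<in> sets borel"
    and ed: "energy_density U n f \<in> borel_measurable borel"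
  obtains C where "C > 0"
    "(\<integral>\<^sup>+y\<in>shift_cube. (\<integral>\<^sup>+x\<in>U. sampled_energy U n f h y x \<partial>lborel) \<partial>lborel) \<le> ennreal C * (\<integral>\<^sup>+x. energy_density U n f x \<partial>lborel)"
    "C = 1 + real (card (index_box (\<chi> \<nu>. int n :: int^'m) n)) * real (card (sample_offsets n :: ('m \<Rightarrow> nat) set))
        * (2 * measure lborel (cball (0 :: real^'m) (sample_radius TYPE('m) n)))"
proof -
  let ?E = "energy_density U n f" and ?Q = "index_box (\<chi> \<nu>. int n :: int^'m) n" and ?L = "sample_offsets n :: ('m \<Rightarrow> nat) set"
  let ?r = "sample_radius TYPE('m) n"
  note [measurable] = ed
  have [measurable]: "shift_cube \<in> sets (borel :: (real^'m) measure)" by (simp add: shift_cube_def)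
  define s where "s k l y x = sample_point h (cell_index h x - k) l y" for k l and y x :: "real^'m"
  define I where "I x z = (\<integral>\<^sup>+t\<in>{0..1}. ?E (x + t *\<^sub>R (z - x)) \<partial>lborel)" for x z
  have SE: "sampled_energy U n f h y x = ?E x + (\<Sum>k\<in>?Q. \<Sum>l\<in>?L. ?E (s k l y x) + I x (s k l y x))" for y x
    unfolding sampled_energy_def s_def I_def by (subst sum_index_box_shift) (rule refl)
  have ms: "(\<lambda>p. s k l (fst p) (snd p)) \<in> borel_measurable (borel \<Otimes>\<^sub>M borel)" for k l
    by (rule borel_measurable_vecI) (simp add: s_def sample_point_def cell_index_def, measurable)
  \<comment> \<open>For fixed \<open>x\<close> the sample depends on the shift only through y plus a
    constant vector, which is the form that \<open>shift_average\<close> handles.\<close>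
  have s_sub: "s k l y x = x + h *\<^sub>R (y + ((1 / h) *\<^sub>R s k l 0 x - (1 / h) *\<^sub>R x))" for k l y x
    using h by (simp add: s_def sample_point_def vec_eq_iff algebra_simps)
  have s_norm: "norm (y + ((1 / h) *\<^sub>R s k l 0 x - (1 / h) *\<^sub>R x)) \<le> ?r" if k: "k \<in> ?Q" and l: "l \<in> ?L" and y: "y \<in> shift_cube" for k l y x
  proof -
    have k': "cell_index h x - k \<in> index_box (cell_index h x) n" using k by (auto simp: index_box_def)
    have "norm (s k l y x - x) \<le> ?r * h"
      unfolding s_def by (rule sample_distances(1)[OF h k' l]) (use y mem_shift_cube in blast)
    moreover have "s k l y x - x = h *\<^sub>R (y + ((1 / h) *\<^sub>R s k l 0 x - (1 / h) *\<^sub>R x))"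
      by (subst (1) s_sub) simp
    ultimately show ?thesis using h by (simp add: mult.commute)
  qed
  have mI: "(\<lambda>p. I (fst p) (snd p)) \<in> borel_measurable (borel \<Otimes>\<^sub>M borel)"
    unfolding I_def by measurable
  have mE: "(\<lambda>p. ?E (snd p)) \<in> borel_measurable ((borel :: (real^'m) measure) \<Otimes>\<^sub>M borel)" by measurable
  have avgG: "(\<integral>\<^sup>+y\<in>shift_cube. (\<integral>\<^sup>+x\<in>U. G x (s k l y x) \<partial>lborel) \<partial>lborel)
      \<le> (\<integral>\<^sup>+x. (\<integral>\<^sup>+y\<in>cball 0 ?r. G x (x + h *\<^sub>R y) \<partial>lborel) \<partial>lborel)"
    if G: "(\<lambda>p. G (fst p) (snd p)) \<in> borel_measurable (borel \<Otimes>\<^sub>M borel)" and k: "k \<in> ?Q" and l: "l \<in> ?L"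
    for G :: "real^'m \<Rightarrow> real^'m \<Rightarrow> ennreal" and k l
  proof -
    have mG: "(\<lambda>p. G (snd p) (s k l (fst p) (snd p))) \<in> borel_measurable (borel \<Otimes>\<^sub>M borel)"
    proof -
      have "(\<lambda>p. (snd p, s k l (fst p) (snd p))) \<in> borel \<Otimes>\<^sub>M borel \<rightarrow>\<^sub>M borel \<Otimes>\<^sub>M borel"
        using ms by measurable
      from measurable_compose[OF this G] show ?thesis by simp
    qed
    have "(\<integral>\<^sup>+y\<in>shift_cube. (\<integral>\<^sup>+x\<in>U. G x (s k l y x) \<partial>lborel) \<partial>lborel)
      \<le> (\<integral>\<^sup>+y. \<integral>\<^sup>+x. G x (s k l y x) * indicator shift_cube y \<partial>lborel \<partial>lborel)"
    proof (rule nn_integral_mono)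
      fix y :: "real^'m"
      show "(\<integral>\<^sup>+x\<in>U. G x (s k l y x) \<partial>lborel) * indicator shift_cube y \<le> (\<integral>\<^sup>+x. G x (s k l y x) * indicator shift_cube y \<partial>lborel)"
        by (cases "y \<in> shift_cube") (auto intro!: nn_integral_mono simp: indicator_def)
    qed
    also have "\<dots> = (\<integral>\<^sup>+x. (\<integral>\<^sup>+y\<in>shift_cube. G x (s k l y x) \<partial>lborel) \<partial>lborel)"
    proof (rule lborel_pair.Fubini')
      have mi: "(\<lambda>p. indicator shift_cube (snd p) :: ennreal) \<in> borel_measurable ((lborel :: (real^'m) measure) \<Otimes>\<^sub>M (lborel :: (real^'m) measure))"
        by measurable
      have sw: "(\<lambda>p. (snd p, fst p)) \<in> (lborel :: (real^'m) measure) \<Otimes>\<^sub>M (lborel :: (real^'m) measure) \<rightarrow>\<^sub>M borel \<Otimes>\<^sub>M borel"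
        by measurable
      have "(\<lambda>p. G (fst p) (s k l (snd p) (fst p)) * indicator shift_cube (snd p)) \<in> borel_measurable ((lborel :: (real^'m) measure) \<Otimes>\<^sub>M (lborel :: (real^'m) measure))"
        by (rule borel_measurable_times_ennreal[OF measurable_compose[OF sw mG, unfolded fst_conv snd_conv] mi])
      then show "(\<lambda>(x, y). G x (s k l y x) * indicator shift_cube y) \<in> borel_measurable ((lborel :: (real^'m) measure) \<Otimes>\<^sub>M (lborel :: (real^'m) measure))"
        by (simp only: case_prod_unfold)
    qed
    also have "\<dots> \<le> (\<integral>\<^sup>+x. (\<integral>\<^sup>+y\<in>cball 0 ?r. G x (x + h *\<^sub>R y) \<partial>lborel) \<partial>lborel)"
    proof (rule nn_integral_mono)
      fix x :: "real^'m"
      have "(\<integral>\<^sup>+y\<in>shift_cube. G x (s k l y x) \<partial>lborel)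
        = (\<integral>\<^sup>+y\<in>shift_cube. G x (x + h *\<^sub>R (y + ((1 / h) *\<^sub>R s k l 0 x - (1 / h) *\<^sub>R x))) \<partial>lborel)"
        by (rule nn_integral_cong, rule arg_cong2[where f = "(*)", OF arg_cong[where f = "G x", OF s_sub] refl])
      also have "\<dots> \<le> (\<integral>\<^sup>+y\<in>cball 0 ?r. G x (x + h *\<^sub>R y) \<partial>lborel)"
        by (rule shift_average[OF h]) (use G s_norm[OF k l] in \<open>simp_all add: borel_prod shift_cube_def\<close>)
      finally show "(\<integral>\<^sup>+y\<in>shift_cube. G x (s k l y x) \<partial>lborel) \<le> (\<integral>\<^sup>+y\<in>cball 0 ?r. G x (x + h *\<^sub>R y) \<partial>lborel)" .
    qed
    finally show ?thesis .
  qed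
  let ?V = "emeasure lborel (cball (0 :: real^'m) ?r)" and ?T = "\<integral>\<^sup>+x. ?E x \<partial>lborel"
  have avg: "(\<integral>\<^sup>+y\<in>shift_cube. (\<integral>\<^sup>+x\<in>U. ?E (s k l y x) \<partial>lborel) \<partial>lborel) \<le> ?V * ?T"
    "(\<integral>\<^sup>+y\<in>shift_cube. (\<integral>\<^sup>+x\<in>U. I x (s k l y x) \<partial>lborel) \<partial>lborel) \<le> ?V * ?T"
    if "k \<in> ?Q" "l \<in> ?L" for k l
    using avgG[OF mE that] avgG[OF mI that] ball_average[OF ed, of h ?r] by (simp_all add: I_def)
  have mJ: "(\<lambda>p. ?E (s k l (fst p) (snd p))) \<in> borel_measurable (borel \<Otimes>\<^sub>M borel)"
    "(\<lambda>p. I (snd p) (s k l (fst p) (snd p))) \<in> borel_measurable (borel \<Otimes>\<^sub>M borel)" for k l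
  proof -
    show "(\<lambda>p. ?E (s k l (fst p) (snd p))) \<in> borel_measurable (borel \<Otimes>\<^sub>M borel)"
      by (rule measurable_compose[OF ms ed])
    have "(\<lambda>p. (snd p, s k l (fst p) (snd p))) \<in> borel \<Otimes>\<^sub>M borel \<rightarrow>\<^sub>M borel \<Otimes>\<^sub>M borel"
      using ms by measurable
    from measurable_compose[OF this mI] show "(\<lambda>p. I (snd p) (s k l (fst p) (snd p))) \<in> borel_measurable (borel \<Otimes>\<^sub>M borel)" by simp
  qed
  have m1: "(\<lambda>x. ?E (s k l y x)) \<in> borel_measurable borel" "(\<lambda>x. I x (s k l y x)) \<in> borel_measurable borel" for k l y
  proof -
    have p: "(\<lambda>x. (y, x)) \<in> borel \<rightarrow>\<^sub>M borel \<Otimes>\<^sub>M borel" by measurable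
    show "(\<lambda>x. ?E (s k l y x)) \<in> borel_measurable borel" "(\<lambda>x. I x (s k l y x)) \<in> borel_measurable borel"
      using measurable_compose[OF p mJ(1)] measurable_compose[OF p mJ(2)] by simp_all
  qed
  have inner: "(\<integral>\<^sup>+x\<in>U. sampled_energy U n f h y x \<partial>lborel)
     = (\<integral>\<^sup>+x\<in>U. ?E x \<partial>lborel) + (\<Sum>k\<in>?Q. \<Sum>l\<in>?L. (\<integral>\<^sup>+x\<in>U. ?E (s k l y x) \<partial>lborel) + (\<integral>\<^sup>+x\<in>U. I x (s k l y x) \<partial>lborel))" for y
    unfolding SE by (rule set_nn_integral_add_sum[OF assms(2) ed m1])
  have m2: "(\<lambda>y. \<integral>\<^sup>+x\<in>U. ?E (s k l y x) \<partial>lborel) \<in> borel_measurable borel"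
    "(\<lambda>y. \<integral>\<^sup>+x\<in>U. I x (s k l y x) \<partial>lborel) \<in> borel_measurable borel" for k l
  proof -
    have sets: "sets ((borel :: (real^'m) measure) \<Otimes>\<^sub>M (lborel :: (real^'m) measure)) = sets (borel \<Otimes>\<^sub>M borel)"
      by (rule sets_pair_measure_cong) simp_all
    have mi: "(\<lambda>p. indicator U (snd p) :: ennreal) \<in> borel_measurable ((borel :: (real^'m) measure) \<Otimes>\<^sub>M (borel :: (real^'m) measure))"
      by measurable
    show "(\<lambda>y. \<integral>\<^sup>+x\<in>U. ?E (s k l y x) \<partial>lborel) \<in> borel_measurable borel"
      "(\<lambda>y. \<integral>\<^sup>+x\<in>U. I x (s k l y x) \<partial>lborel) \<in> borel_measurable borel"
      by (rule lborel.borel_measurable_nn_integral, unfold case_prod_unfold measurable_cong_sets[OF sets refl],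
          rule borel_measurable_times_ennreal[OF mJ(1) mi] borel_measurable_times_ennreal[OF mJ(2) mi])+
  qed
  have "(\<integral>\<^sup>+y\<in>shift_cube. (\<integral>\<^sup>+x\<in>U. sampled_energy U n f h y x \<partial>lborel) \<partial>lborel)
    = (\<integral>\<^sup>+y\<in>shift_cube. (\<integral>\<^sup>+x\<in>U. ?E x \<partial>lborel) \<partial>(lborel :: (real^'m) measure))
      + (\<Sum>k\<in>?Q. \<Sum>l\<in>?L. (\<integral>\<^sup>+y\<in>shift_cube. (\<integral>\<^sup>+x\<in>U. ?E (s k l y x) \<partial>lborel) \<partial>lborel)
          + (\<integral>\<^sup>+y\<in>shift_cube. (\<integral>\<^sup>+x\<in>U. I x (s k l y x) \<partial>lborel) \<partial>lborel))"
    unfolding inner by (rule set_nn_integral_add_sum) (rule m2 | simp add: shift_cube_def)+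
  also have "\<dots> \<le> ?T + (\<Sum>k\<in>?Q. \<Sum>l\<in>?L. ?V * ?T + ?V * ?T)"
  proof (intro add_mono sum_mono avg)
    have "(\<integral>\<^sup>+y\<in>shift_cube. (\<integral>\<^sup>+x\<in>U. ?E x \<partial>lborel) \<partial>(lborel :: (real^'m) measure)) = (\<integral>\<^sup>+x\<in>U. ?E x \<partial>lborel)"
      by (simp add: nn_integral_cmult_indicator emeasure_shift_cube)
    also have "\<dots> \<le> ?T" by (rule nn_integral_mono) (simp add: indicator_def)
    finally show "(\<integral>\<^sup>+y\<in>shift_cube. (\<integral>\<^sup>+x\<in>U. ?E x \<partial>lborel) \<partial>(lborel :: (real^'m) measure)) \<le> ?T" .
  qed
  also have "\<dots> = (1 + of_nat (card ?Q) * of_nat (card ?L) * (2 * ?V)) * ?T"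
    by (simp add: distrib_right mult_2 algebra_simps)
  also have "1 + of_nat (card ?Q) * of_nat (card ?L) * (2 * ?V) = ennreal (1 + real (card ?Q) * real (card ?L) * (2 * measure lborel (cball (0 :: real^'m) ?r)))"
  proof -
    have "?V = ennreal (measure lborel (cball (0 :: real^'m) ?r))"
      by (rule emeasure_eq_ennreal_measure) (use emeasure_bounded_finite[OF bounded_cball, of "0 :: real^'m" ?r] in \<open>auto simp: infinity_ennreal_def\<close>)
    then show ?thesis by (simp add: ennreal_plus ennreal_mult ennreal_of_nat_eq_real_of_nat mult_ac)
  qed
  finally have "(\<integral>\<^sup>+y\<in>shift_cube. (\<integral>\<^sup>+x\<in>U. sampled_energy U n f h y x \<partial>lborel) \<partial>lborel)
    \<le> ennreal (1 + real (card ?Q) * real (card ?L) * (2 * measure lborel (cball (0 :: real^'m) ?r))) * ?T" .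
  moreover have "1 + real (card ?Q) * real (card ?L) * (2 * measure lborel (cball (0 :: real^'m) ?r)) > 0"
    by (intro add_pos_nonneg) auto
  ultimately show ?thesis using that by blast
qed

section \<open>Approximation of test functions\<close>

lemma test_function_iter_partial_norm:
  assumes \<phi>: "\<phi> \<in> test_functions U" and U: "open U"
  shows "(\<integral>\<^sup>+x. ennreal ((iter_partial is \<phi> x)\<^sup>2) \<partial>lborel)
    = ennreal (\<integral>x. (weak_deriv U (\<chi> i. count_list is i) \<phi> x)\<^sup>2 \<partial>lebesgue_on U)"
proof -
  let ?g = "iter_partial is \<phi>"
  have g: "?g \<in> test_functions U" by (rule test_functions_iter_partial[OF \<phi>])
  have L2: "?g \<in> L2 U" by (rule test_function_L2[OF g U])
  have m: "(\<lambda>x. (?g x)\<^sup>2) \<in> borel_measurable borel" using borel_measurable_test[OF g] by simp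
  have z: "(?g x)\<^sup>2 = 0" if "x \<notin> U" for x
    using that test_functionsD(3)[OF g] not_in_support[of x ?g] by auto
  note eq = lebesgue_on_integral_eq[OF sets_lebesgue_open[OF U] m z]
  have "integrable lborel (\<lambda>x. (?g x)\<^sup>2)" using L2 eq(2) by (simp add: L2_def)
  then have "(\<integral>\<^sup>+x. ennreal ((?g x)\<^sup>2) \<partial>lborel) = ennreal (\<integral>x. (?g x)\<^sup>2 \<partial>lborel)"
    by (rule nn_integral_eq_integral) simp
  also have "(\<integral>x. (?g x)\<^sup>2 \<partial>lborel) = (\<integral>x. (?g x)\<^sup>2 \<partial>lebesgue_on U)" by (rule eq(1)[symmetric])
  also have "(\<integral>x. (?g x)\<^sup>2 \<partial>lebesgue_on U) = (\<integral>x. (weak_deriv U (\<chi> i. count_list is i) \<phi> x)\<^sup>2 \<partial>lebesgue_on U)"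
  proof (rule L2_cong_AE(2)[OF U L2])
    show "AE x in lebesgue_on U. ?g x = weak_deriv U (\<chi> i. count_list is i) \<phi> x"
      using test_function_Hspace(2)[OF \<phi> U, of "\<chi> i. count_list is i"]
      by eventually_elim (simp add: iter_partial_eq_mi_deriv[OF open_UNIV test_functionsD(1)[OF \<phi>]])
  qed
  finally show ?thesis .
qed

lemma weak_deriv_le_Hnorm:
  "mi_order \<beta> \<le> l \<Longrightarrow> (\<integral>x. (weak_deriv U \<beta> v x)\<^sup>2 \<partial>lebesgue_on U) \<le> (Hnorm l U v)\<^sup>2"
  unfolding Hnorm_power2
  by (rule member_le_sum[where f = "\<lambda>\<beta>. \<integral>x. (weak_deriv U \<beta> v x)\<^sup>2 \<partial>lebesgue_on U"]) (auto simp: finite_mi_order)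

lemma deriv_energy_le_Hnorm:
  fixes U :: "(real^'m) set"
  assumes \<phi>: "\<phi> \<in> test_functions U" and U: "open U"
  shows "deriv_energy n \<phi> \<le> ennreal (real (card {is :: 'm list. length is \<le> n}) * (Hnorm n U \<phi>)\<^sup>2)"
proof -
  have "deriv_energy n \<phi> = (\<Sum>is\<in>{is :: 'm list. length is \<le> n}. \<integral>\<^sup>+x. ennreal ((iter_partial is \<phi> x)\<^sup>2) \<partial>lborel)"
    by (simp add: deriv_energy_def)
  also have "\<dots> \<le> (\<Sum>is\<in>{is :: 'm list. length is \<le> n}. ennreal ((Hnorm n U \<phi>)\<^sup>2))"
    by (rule sum_mono) (auto simp: test_function_iter_partial_norm[OF \<phi> U] mi_order_count intro!: ennreal_leI weak_deriv_le_Hnorm)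
  also have "\<dots> = ennreal (real (card {is :: 'm list. length is \<le> n}) * (Hnorm n U \<phi>)\<^sup>2)"
    by (simp add: ennreal_mult ennreal_of_nat_eq_real_of_nat)
  finally show ?thesis .
qed

lemma energy_density_le_Hnorm:
  fixes U :: "(real^'m) set"
  assumes bd: "bounded U" and lip: "lipschitz_domain U"
  obtains C where "C > 0" "\<And>\<phi>. \<phi> \<in> test_functions U \<Longrightarrow> (\<integral>\<^sup>+x. energy_density U n \<phi> x \<partial>lborel) \<le> ennreal (C * (Hnorm n U \<phi>)\<^sup>2)"
proof -
  let ?I = "{is :: 'm list. length is \<le> n}" and ?d = "\<lambda>x. infdist x (frontier U)"
  have U: "open U" using lip by (simp add: lipschitz_domain_def)
  obtain C0 where C0: "C0 > 0" "\<And>f is k. f \<in> test_functions U \<Longrightarrow> length is + k \<le> n \<Longrightarrow>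
    (\<integral>\<^sup>+y\<in>U. ennreal ((iter_partial is f y)\<^sup>2 / infdist y (frontier U) ^ (2 * k)) \<partial>lborel)
      \<le> ennreal C0 * deriv_energy n f"
    by (rule hardy_lipschitz_domain[OF bd lip]) (rule that)
  let ?c = "real (card ?I)"
  have c0: "?c > 0" using finite_lists_le[where 'm = 'm, of n] by (auto simp: card_gt_0_iff intro: exI[of _ "[]"])
  have "(\<integral>\<^sup>+x. energy_density U n \<phi> x \<partial>lborel) \<le> ennreal (?c * (C0 * ?c) * (Hnorm n U \<phi>)\<^sup>2)"
    if \<phi>: "\<phi> \<in> test_functions U" for \<phi>
  proof -
    have [measurable]: "iter_partial is \<phi> \<in> borel_measurable borel" for "is"
      by (rule borel_measurable_test[OF test_functions_iter_partial[OF \<phi>]])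
    have [measurable]: "?d \<in> borel_measurable borel"
      by (intro borel_measurable_continuous_onI continuous_intros)
    have [measurable]: "U \<in> sets borel" using U by simp
    let ?t = "\<lambda>is x. ennreal ((iter_partial is \<phi> x)\<^sup>2 / ?d x ^ (2 * (n - length is))) * indicator U x"
    have "energy_density U n \<phi> x = (\<Sum>is\<in>?I. ?t is x)" for x
      unfolding energy_density_def weighted_energy_def sum_distrib_right[symmetric]
      by (subst sum_ennreal) (auto simp: power_mult)
    then have "(\<integral>\<^sup>+x. energy_density U n \<phi> x \<partial>lborel) = (\<Sum>is\<in>?I. \<integral>\<^sup>+x. ?t is x \<partial>lborel)"
      by (simp only:) (rule nn_integral_sum, measurable)
    also have "\<dots> \<le> (\<Sum>is\<in>?I. ennreal C0 * deriv_energy n \<phi>)"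
      by (rule sum_mono) (auto intro!: C0(2)[OF \<phi>])
    also have "\<dots> = of_nat (card ?I) * (ennreal C0 * deriv_energy n \<phi>)" by simp
    also have "\<dots> \<le> of_nat (card ?I) * (ennreal C0 * ennreal (?c * (Hnorm n U \<phi>)\<^sup>2))"
      by (intro mult_left_mono deriv_energy_le_Hnorm \<phi> U) auto
    also have "\<dots> = ennreal (?c * (C0 * ?c) * (Hnorm n U \<phi>)\<^sup>2)"
      using C0(1) by (simp add: ennreal_mult ennreal_of_nat_eq_real_of_nat mult.assoc)
    finally show ?thesis .
  qed
  moreover have "?c * (C0 * ?c) > 0" using c0 C0(1) by simp
  ultimately show ?thesis using that by blast
qed

text \<open>The grid is a countable union of hyperplanes.\<close>

lemma AE_off_grid:
  assumes h: "h > 0"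
  shows "AE x :: real^'m in lborel. \<forall>\<nu>. x $ \<nu> / h \<notin> \<int>"
proof -
  have "AE x :: real^'m in lborel. \<forall>\<nu>\<in>UNIV. \<forall>z::int. x $ \<nu> \<noteq> h * of_int z"
  proof (rule AE_finite_allI[OF finite], subst AE_all_countable, rule allI)
    fix \<nu> :: 'm and z :: int
    have "{x :: real^'m. x $ \<nu> = h * of_int z} \<in> null_sets lebesgue"
      using negligible_standard_hyperplane[of "axis \<nu> 1 :: real^'m" "h * of_int z"]
      by (auto simp: negligible_iff_null_sets Basis_vec_def inner_axis)
    then have "AE x :: real^'m in lebesgue. x \<notin> {x. x $ \<nu> = h * of_int z}" by (rule AE_not_in)
    then show "AE x :: real^'m in lborel. x $ \<nu> \<noteq> h * of_int z" by (simp add: AE_completion_iff)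
  qed
  then show ?thesis
  proof eventually_elim
    case (elim x)
    show ?case
    proof (intro allI notI)
      fix \<nu> assume "x $ \<nu> / h \<in> \<int>"
      then obtain z where "x $ \<nu> / h = of_int z" by (auto elim: Ints_cases)
      then have "x $ \<nu> = h * of_int z" using h by (simp add: field_simps)
      then show False using elim by blast
    qed
  qed
qed

text \<open>The cube of shifts has measure one, so not all shifts can exceed the average. The
  surplus \<epsilon> makes the contradiction survive integration, where a strict pointwise
  inequality would only give a weak one.\<close>

lemma good_shift:
  fixes U :: "(real^'m) set"
  obtains C where "C > 0" "\<And>h f \<epsilon>. h > 0 \<Longrightarrow> U \<in> sets borel \<Longrightarrow> energy_density U n f \<in> borel_measurable borel \<Longrightarrow>
     \<epsilon> > 0 \<Longrightarrow> (\<integral>\<^sup>+x. energy_density U n f x \<partial>lborel) < \<infinity> \<Longrightarrow>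
     \<exists>y. (\<forall>\<nu>. y $ \<nu> \<in> {0..1}) \<and> (\<integral>\<^sup>+x\<in>U. sampled_energy U n f h y x \<partial>lborel)
       \<le> ennreal C * (\<integral>\<^sup>+x. energy_density U n f x \<partial>lborel) + ennreal \<epsilon>"
proof -
  define C where "C = 1 + real (card (index_box (\<chi> \<nu>. int n :: int^'m) n)) * real (card (sample_offsets n :: ('m \<Rightarrow> nat) set))
        * (2 * measure lborel (cball (0 :: real^'m) (sample_radius TYPE('m) n)))"
  have "C > 0" unfolding C_def by (intro add_pos_nonneg) auto
  moreover have "\<exists>y. (\<forall>\<nu>. y $ \<nu> \<in> {0..1}) \<and> (\<integral>\<^sup>+x\<in>U. sampled_energy U n f h y x \<partial>lborel)
       \<le> ennreal C * (\<integral>\<^sup>+x. energy_density U n f x \<partial>lborel) + ennreal \<epsilon>"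
    if h: "h > 0" and U: "U \<in> sets borel" and ed: "energy_density U n f \<in> borel_measurable borel" and \<epsilon>: "\<epsilon> > 0"
      and fin: "(\<integral>\<^sup>+x. energy_density U n f x \<partial>lborel) < \<infinity>" for h f \<epsilon>
  proof (rule ccontr)
    let ?T = "\<integral>\<^sup>+x. energy_density U n f x \<partial>lborel" and ?S = "\<lambda>y. (\<integral>\<^sup>+x\<in>U. sampled_energy U n f h y x \<partial>lborel)"
    assume no: "\<not> ?thesis"
    have gt: "ennreal C * ?T + ennreal \<epsilon> < ?S y" if "y \<in> shift_cube" for y
    proof -
      have "\<forall>\<nu>. y $ \<nu> \<in> {0..1}" by (rule iffD1[OF mem_shift_cube that])
      then have "\<not> ?S y \<le> ennreal C * ?T + ennreal \<epsilon>" using no by blast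
      then show ?thesis by simp
    qed
    have "ennreal C * ?T + ennreal \<epsilon> = (\<integral>\<^sup>+y\<in>shift_cube. (ennreal C * ?T + ennreal \<epsilon>) \<partial>(lborel :: (real^'m) measure))"
    proof -
      have "(shift_cube :: (real^'m) set) \<in> sets lborel" by (simp add: shift_cube_def)
      then show ?thesis by (simp add: nn_integral_cmult_indicator emeasure_shift_cube)
    qed
    also have "\<dots> \<le> (\<integral>\<^sup>+y\<in>shift_cube. ?S y \<partial>lborel)"
    proof (rule nn_integral_mono)
      fix y :: "real^'m"
      show "(ennreal C * ?T + ennreal \<epsilon>) * indicator shift_cube y \<le> ?S y * indicator shift_cube y"
        using gt[of y] by (cases "y \<in> shift_cube") (auto intro: less_imp_le)
    qed
    also have "\<dots> \<le> ennreal C * ?T"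
    proof -
      obtain C' where "C' = C" "(\<integral>\<^sup>+y\<in>shift_cube. ?S y \<partial>lborel) \<le> ennreal C' * ?T"
        by (rule sampled_energy_average[OF h U ed]) (simp add: C_def)
      then show ?thesis by simp
    qed
    finally have le: "ennreal C * ?T + ennreal \<epsilon> \<le> ennreal C * ?T" .
    have "ennreal C * ?T < \<infinity>" using fin by (simp add: ennreal_mult_less_top)
    \<comment> \<open>The cancellation in the extended reals is where finiteness of the energy is
      used.\<close>
    then have "ennreal C * ?T + 0 < ennreal C * ?T + ennreal \<epsilon>"
      using \<epsilon> by (intro ennreal_add_left_cancel_less[THEN iffD2] conjI) auto
    then show False using le by simp
  qed
  ultimately show ?thesis using that by blast
qed

lemma H1_energy_nn_integral:
  fixes U :: "(real^'m) set"
  assumes U: "open U" and v: "v \<in> Hspace 1 U" and c: "c \<ge> 0"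
  shows "ennreal (c * H1_energy U v) = (\<integral>\<^sup>+x\<in>U. ennreal (c * ((v x)\<^sup>2 + (norm (weak_grad U v x))\<^sup>2)) \<partial>lborel)"
proof -
  have "ennreal (c * H1_energy U v) = ennreal (\<integral>x. c * ((v x)\<^sup>2 + (norm (weak_grad U v x))\<^sup>2) \<partial>lebesgue_on U)"
    by (simp add: H1_energy_def)
  also have "\<dots> = (\<integral>\<^sup>+x. ennreal (c * ((v x)\<^sup>2 + (norm (weak_grad U v x))\<^sup>2)) \<partial>lebesgue_on U)"
    by (rule nn_integral_eq_integral[symmetric])
       (use H1_energy_integrable(3)[OF U v] c in auto)
  also have "\<dots> = (\<integral>\<^sup>+x\<in>U. ennreal (c * ((v x)\<^sup>2 + (norm (weak_grad U v x))\<^sup>2)) \<partial>lborel)"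
    by (subst nn_integral_restrict_space) (use sets_lebesgue_open[OF U] in \<open>simp_all add: nn_integral_completion\<close>)
  finally show ?thesis .
qed

context weighted_domain
begin

lemma weighted_spline:
  assumes h: "h > 0" and S: "finite S" and v: "\<And>x. x \<in> U \<Longrightarrow> v x = w x * (\<Sum>k\<in>S. c k * bspline n h k x)"
  shows "v \<in> H0space 1 U"
    and "AE x in lebesgue_on U. weak_deriv U (axis i 1) v x
      = partial_deriv i w x * (\<Sum>k\<in>S. c k * bspline n h k x) + w x * (\<Sum>k\<in>S. c k * bspline_deriv n h k i x)"
proof -
  obtain p where p: "p \<in> frontier U" using frontier_ne by blast
  obtain D where D: "\<And>x. x \<in> U \<Longrightarrow> dist p x \<le> D" using bounded_domain bounded_any_center[of U p] by blast
  have W1: "w x \<le> max W (c2 * D)" if "x \<in> U" for x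
  proof -
    have "d x \<le> D" using infdist_le[OF p, of x] D[OF that] by (simp add: dist_commute)
    then have "c2 * d x \<le> c2 * D" using c_pos by simp
    then show ?thesis using weight_upper[OF that] by linarith
  qed
  have W2: "\<bar>partial_deriv i w x\<bar> \<le> max W (c2 * D)" if "x \<in> U" for x i using weight_grad[OF that, of i] by linarith
  note * = weighted_spline_H0space[OF open_domain bounded_domain frontier_ne smooth_weight weight_pos c_pos(2) weight_upper W1 W2 order_ge_2 h S v]
  show "v \<in> H0space 1 U" by (rule *(1))
  show "AE x in lebesgue_on U. weak_deriv U (axis i 1) v x
      = partial_deriv i w x * (\<Sum>k\<in>S. c k * bspline n h k x) + w x * (\<Sum>k\<in>S. c k * bspline_deriv n h k i x)"
    by (rule *(2))
qed

text \<open>The coefficients are those of the quasi-interpolant of \<phi> / w for a good shift. The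
  shift depends on \<phi> and \<open>h\<close>, the constant on neither.\<close>

lemma test_function_approximation:
  assumes lip: "lipschitz_domain U" and A: "A \<ge> 3 * r + 1" and h0: "h0 > 0"
  obtains C where "C \<ge> 0" "\<And>h \<phi> \<epsilon>. 0 < h \<Longrightarrow> h \<le> h0 \<Longrightarrow> \<phi> \<in> test_functions U \<Longrightarrow> \<epsilon> > 0 \<Longrightarrow>
    \<exists>c. H1_energy U (\<lambda>x. \<phi> x - w x * (\<Sum>k\<in>far_indices U A h. c k * bspline n h k x))
      \<le> C * h ^ (2 * (n - 1)) * ((Hnorm n U \<phi>)\<^sup>2 + \<epsilon>)"
proof -
  have ne: "U \<noteq> {}" using lip by (simp add: lipschitz_domain_def)
  have n1: "n \<ge> 1" using order_ge_2 by simp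
  obtain \<mu> K where \<mu>: "K > 0" "\<And>\<tau> l. \<tau> \<in> {0..1} \<Longrightarrow> l < n \<Longrightarrow> \<bar>\<mu> \<tau> l\<bar> \<le> K"
    "\<And>\<tau> t t0 i lo hi. i < n \<Longrightarrow> lo \<le> \<lfloor>t\<rfloor> - int n \<Longrightarrow> hi \<ge> \<lfloor>t\<rfloor> \<Longrightarrow>
      (\<Sum>k=lo..hi. (\<Sum>l<n. \<mu> \<tau> l * (real_of_int k + real l + \<tau> - t0) ^ i) * cardinal_bspline n (t - real_of_int k)) = (t - t0) ^ i"
    by (rule quasi_interpolation_weights[OF n1]) (rule that)
  let ?F = "far_indices U A"
  obtain C1 where C1: "C1 \<ge> 0" "\<And>h f x y c. 0 < h \<Longrightarrow> h \<le> h0 \<Longrightarrow> smooth_on U f \<Longrightarrow>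
     energy_density U n f \<in> borel_measurable borel \<Longrightarrow> x \<in> U \<Longrightarrow> (\<And>\<nu>. x $ \<nu> / h \<notin> \<int>) \<Longrightarrow>
     (\<And>\<nu>. y $ \<nu> \<in> {0..1}) \<Longrightarrow> c = quasi_coeff \<mu> n h y (\<lambda>x. f x * (1 / w x)) \<Longrightarrow>
     ennreal ((f x - w x * (\<Sum>k\<in>?F h. c k * bspline n h k x))\<^sup>2
       + (\<Sum>i\<in>UNIV. (partial_deriv i f x - (partial_deriv i w x * (\<Sum>k\<in>?F h. c k * bspline n h k x)
            + w x * (\<Sum>k\<in>?F h. c k * bspline_deriv n h k i x)))\<^sup>2))
     \<le> ennreal (C1 * h ^ (2 * (n - 1))) * sampled_energy U n f h y x"
  proof (rule pointwise_error[where \<mu> = \<mu> and K = K and A = A and ?h0.0 = h0], goal_cases)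
    case 1
    show ?case by (rule \<mu>(1))
  next
    case (2 \<tau> l)
    show ?case by (rule \<mu>(2)) fact+
  next
    case (3 \<tau> t t0 i lo hi)
    show ?case by (rule \<mu>(3)) fact+
  next
    case 4
    show ?case by (rule A)
  next
    case 5
    show ?case by (rule h0)
  next
    case 6
    show ?case by (rule ne)
  next
    case (7 C)
    show ?case by (rule 7(1)[OF 7(2) 7(3)])
  qed
  obtain C2 where C2: "C2 > 0" "\<And>h f \<epsilon>. h > 0 \<Longrightarrow> U \<in> sets borel \<Longrightarrow> energy_density U n f \<in> borel_measurable borel \<Longrightarrow>
     \<epsilon> > 0 \<Longrightarrow> (\<integral>\<^sup>+x. energy_density U n f x \<partial>lborel) < \<infinity> \<Longrightarrow>
     \<exists>y. (\<forall>\<nu>. y $ \<nu> \<in> {0..1}) \<and> (\<integral>\<^sup>+x\<in>U. sampled_energy U n f h y x \<partial>lborel)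
       \<le> ennreal C2 * (\<integral>\<^sup>+x. energy_density U n f x \<partial>lborel) + ennreal \<epsilon>"
    by (rule good_shift[where U = U and n = n]) (rule that)
  obtain C3 where C3: "C3 > 0" "\<And>\<phi>. \<phi> \<in> test_functions U \<Longrightarrow> (\<integral>\<^sup>+x. energy_density U n \<phi> x \<partial>lborel) \<le> ennreal (C3 * (Hnorm n U \<phi>)\<^sup>2)"
    by (rule energy_density_le_Hnorm[OF bounded_domain lip, of n]) (rule that)
  define C where "C = (C1 + 1) * (C2 * C3 + 1)"
  have "C \<ge> 0" using C1(1) C2(1) C3(1) by (simp add: C_def)
  moreover have "\<exists>c. H1_energy U (\<lambda>x. \<phi> x - w x * (\<Sum>k\<in>?F h. c k * bspline n h k x))
      \<le> C * h ^ (2 * (n - 1)) * ((Hnorm n U \<phi>)\<^sup>2 + \<epsilon>)"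
    if h: "0 < h" "h \<le> h0" and \<phi>: "\<phi> \<in> test_functions U" and \<epsilon>: "\<epsilon> > 0" for h \<phi> \<epsilon>
  proof -
    let ?T = "\<integral>\<^sup>+x. energy_density U n \<phi> x \<partial>lborel" and ?N = "(Hnorm n U \<phi>)\<^sup>2"
    have Ub: "U \<in> sets borel" using open_domain by simp
    have ed: "energy_density U n \<phi> \<in> borel_measurable borel" by (rule energy_density_measurable[OF open_domain \<phi>])
    have Tfin: "?T < \<infinity>" using C3(2)[OF \<phi>] by (auto simp: le_less_trans)
    obtain y where y: "\<And>\<nu>. y $ \<nu> \<in> {0..1}" and SE: "(\<integral>\<^sup>+x\<in>U. sampled_energy U n \<phi> h y x \<partial>lborel) \<le> ennreal C2 * ?T + ennreal \<epsilon>"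
      using C2(2)[OF h(1) Ub ed \<epsilon> Tfin] by blast
    define c where "c = quasi_coeff \<mu> n h y (\<lambda>x. \<phi> x * (1 / w x))"
    define v where "v x = w x * (\<Sum>k\<in>?F h. c k * bspline n h k x)" for x
    define g where "g i x = partial_deriv i w x * (\<Sum>k\<in>?F h. c k * bspline n h k x) + w x * (\<Sum>k\<in>?F h. c k * bspline_deriv n h k i x)" for i x
    note sp = weighted_spline[OF h(1) finite_far_indices[OF h(1) bounded_domain], where v = v and c = c, OF v_def]
    have vH: "v \<in> Hspace 1 U" using sp(1) by (simp add: H0space_def)
    have \<phi>H: "\<phi> \<in> Hspace 1 U" by (rule test_function_Hspace(1)[OF \<phi> open_domain])
    let ?e = "\<lambda>x. \<phi> x - v x"
    have eH: "?e \<in> Hspace 1 U" by (rule Hspace_diff[OF open_domain \<phi>H vH])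
    \<comment> \<open>The summand 1 makes \<open>D\<close> positive, so that the pointwise estimate
      can be divided by it before it is integrated.\<close>
    define D where "D = (C1 + 1) * h ^ (2 * (n - 1))"
    have D: "D > 0" using C1(1) h by (simp add: D_def)
    have pw: "AE x in lborel. x \<in> U \<longrightarrow> ennreal (1 / D * ((?e x)\<^sup>2 + (norm (weak_grad U ?e x))\<^sup>2)) \<le> sampled_energy U n \<phi> h y x"
    proof -
      have gr: "AE x in lebesgue_on U. \<forall>i\<in>UNIV. weak_deriv U (axis i 1) v x = g i x"
        by (rule AE_finite_allI[OF finite]) (use sp(2) in \<open>simp add: g_def\<close>)
      have gp: "AE x in lebesgue_on U. \<forall>i\<in>UNIV. weak_deriv U (axis i 1) \<phi> x = partial_deriv i \<phi> x"
      proof (rule AE_finite_allI[OF finite])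
        fix i
        show "AE x in lebesgue_on U. weak_deriv U (axis i 1) \<phi> x = partial_deriv i \<phi> x"
          using test_function_Hspace(2)[OF \<phi> open_domain, of "axis i 1"] by (simp only: mi_deriv_axis)
      qed
      have "AE x in lebesgue_on U. (norm (weak_grad U ?e x))\<^sup>2 = (\<Sum>i\<in>UNIV. (partial_deriv i \<phi> x - g i x)\<^sup>2)"
        using weak_grad_diff_AE[OF open_domain \<phi>H vH] gr gp
        by eventually_elim (simp only: norm_power2_vec vector_minus_component weak_grad_def vec_lambda_beta UNIV_I Ball_def simp_thms)
      then have "AE x in lborel. x \<in> U \<longrightarrow> (norm (weak_grad U ?e x))\<^sup>2 = (\<Sum>i\<in>UNIV. (partial_deriv i \<phi> x - g i x)\<^sup>2)"
        by (simp add: AE_lebesgue_on_iff sets_lebesgue_open open_domain)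
      then show ?thesis
        using AE_off_grid[OF h(1)]
      proof eventually_elim
        case (elim x)
        show ?case
        proof
          assume x: "x \<in> U"
          have off: "\<And>\<nu>. x $ \<nu> / h \<notin> \<int>" using elim by blast
          have sm: "smooth_on U \<phi>" by (rule smooth_on_subset[OF test_functionsD(1)[OF \<phi>]]) simp
          have "ennreal ((?e x)\<^sup>2 + (norm (weak_grad U ?e x))\<^sup>2) \<le> ennreal (C1 * h ^ (2 * (n - 1))) * sampled_energy U n \<phi> h y x"
            using C1(2)[OF h sm ed x off y c_def] elim(1) x by (simp add: v_def g_def)
          also have "\<dots> \<le> ennreal D * sampled_energy U n \<phi> h y x"
            unfolding D_def using h by (intro mult_right_mono ennreal_leI) auto
          finally have "ennreal (1 / D) * ennreal ((?e x)\<^sup>2 + (norm (weak_grad U ?e x))\<^sup>2) \<le> ennreal (1 / D) * (ennreal D * sampled_energy U n \<phi> h y x)"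
            by (intro mult_left_mono) auto
          also have "\<dots> = (ennreal (1 / D) * ennreal D) * sampled_energy U n \<phi> h y x" by (simp add: mult.assoc)
          also have "ennreal (1 / D) * ennreal D = 1" using D by (simp flip: ennreal_mult)
          finally show "ennreal (1 / D * ((?e x)\<^sup>2 + (norm (weak_grad U ?e x))\<^sup>2)) \<le> sampled_energy U n \<phi> h y x"
            using D by (simp add: ennreal_mult del: times_divide_eq_left)
        qed
      qed
    qed
    have D1: "1 / D \<ge> 0" using D by simp
    have "ennreal (1 / D * H1_energy U ?e) \<le> (\<integral>\<^sup>+x\<in>U. sampled_energy U n \<phi> h y x \<partial>lborel)"
      unfolding H1_energy_nn_integral[OF open_domain eH D1]
    proof (rule nn_integral_mono_AE)
      show "AE x in lborel. ennreal (1 / D * ((?e x)\<^sup>2 + (norm (weak_grad U ?e x))\<^sup>2)) * indicator U x \<le> sampled_energy U n \<phi> h y x * indicator U x"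
        using pw by eventually_elim (simp add: indicator_def)
    qed
    also have "\<dots> \<le> ennreal C2 * ?T + ennreal \<epsilon>" by (rule SE)
    also have "\<dots> \<le> ennreal C2 * ennreal (C3 * ?N) + ennreal \<epsilon>" by (intro add_right_mono mult_left_mono C3(2)[OF \<phi>]) simp
    also have "\<dots> = ennreal (C2 * (C3 * ?N) + \<epsilon>)" using C2(1) C3(1) \<epsilon> by (simp add: ennreal_mult ennreal_plus)
    finally have "1 / D * H1_energy U ?e \<le> C2 * (C3 * ?N) + \<epsilon>"
      using C2(1) C3(1) \<epsilon> by (subst (asm) ennreal_le_iff) auto
    also have "\<dots> \<le> (C2 * C3 + 1) * (?N + \<epsilon>)"
      using C2(1) C3(1) \<epsilon> by (simp add: algebra_simps)
    finally have "H1_energy U ?e \<le> D * ((C2 * C3 + 1) * (?N + \<epsilon>))" using D by (simp add: field_simps)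
    also have "\<dots> = C * h ^ (2 * (n - 1)) * (?N + \<epsilon>)" by (simp add: C_def D_def)
    finally show ?thesis unfolding v_def by blast
  qed
  ultimately show ?thesis using that by blast
qed

end

section \<open>Approximation from the web-spline space\<close>

lemma Hnorm_le_add:
  assumes U: "open U" and u: "u \<in> Hspace l U" and v: "v \<in> Hspace l U"
  shows "(Hnorm l U v)\<^sup>2 \<le> 2 * (Hnorm l U u)\<^sup>2 + 2 * (Hnorm l U (\<lambda>x. u x - v x))\<^sup>2"
proof -
  let ?z = "\<lambda>x. u x - v x"
  have z: "?z \<in> Hspace l U" by (rule Hspace_diff[OF U u v])
  have "(\<integral>x. (weak_deriv U \<beta> v x)\<^sup>2 \<partial>lebesgue_on U)
    \<le> 2 * (\<integral>x. (weak_deriv U \<beta> u x)\<^sup>2 \<partial>lebesgue_on U) + 2 * (\<integral>x. (weak_deriv U \<beta> ?z x)\<^sup>2 \<partial>lebesgue_on U)"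
    if b: "mi_order \<beta> \<le> l" for \<beta>
  proof -
    have I: "integrable (lebesgue_on U) (\<lambda>x. (weak_deriv U \<beta> y x)\<^sup>2)" if "y \<in> Hspace l U" for y
      using Hspace_weak_deriv(2)[OF U that b] by (simp add: L2_def)
    have "(\<integral>x. (weak_deriv U \<beta> v x)\<^sup>2 \<partial>lebesgue_on U)
      \<le> (\<integral>x. 2 * (weak_deriv U \<beta> u x)\<^sup>2 + 2 * (weak_deriv U \<beta> ?z x)\<^sup>2 \<partial>lebesgue_on U)"
    proof (rule integral_mono_AE)
      show "AE x in lebesgue_on U. (weak_deriv U \<beta> v x)\<^sup>2 \<le> 2 * (weak_deriv U \<beta> u x)\<^sup>2 + 2 * (weak_deriv U \<beta> ?z x)\<^sup>2"
        using weak_deriv_diff_AE[OF U u v b]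
      proof eventually_elim
        case (elim x)
        have "b\<^sup>2 \<le> 2 * a\<^sup>2 + 2 * (a - b)\<^sup>2" for a b :: real
          using zero_le_power2[of "2 * a - b"] by (simp add: power2_eq_square algebra_simps)
        then show ?case unfolding elim .
      qed
    qed (intro Bochner_Integration.integrable_add integrable_mult_right I u v z)+
    also have "\<dots> = 2 * (\<integral>x. (weak_deriv U \<beta> u x)\<^sup>2 \<partial>lebesgue_on U) + 2 * (\<integral>x. (weak_deriv U \<beta> ?z x)\<^sup>2 \<partial>lebesgue_on U)"
      by (subst Bochner_Integration.integral_add) (intro integrable_mult_right I u, intro integrable_mult_right I z, simp only: integral_mult_right_zero)
    finally show ?thesis .
  qed
  then show ?thesis unfolding Hnorm_power2 sum_distrib_left sum.distrib[symmetric] by (intro sum_mono) auto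
qed

lemma Hspace_mono: "u \<in> Hspace l U \<Longrightarrow> k \<le> l \<Longrightarrow> u \<in> Hspace k U"
  by (auto simp: Hspace_def)

text \<open>Only the multi-indices 0 and the unit vectors are kept from the sum; they are pairwise
  different, so no term is counted twice.\<close>

lemma H1_energy_le_Hnorm:
  fixes U :: "(real^'m) set"
  assumes U: "open U" and v: "v \<in> Hspace n U" and n: "n \<ge> 1"
  shows "H1_energy U v \<le> (Hnorm n U v)\<^sup>2"
proof -
  let ?I = "\<lambda>\<beta>. \<integral>x. (weak_deriv U \<beta> v x)\<^sup>2 \<partial>lebesgue_on U" and ?a = "\<lambda>i :: 'm. axis i 1 :: nat^'m"
  have v1: "v \<in> Hspace 1 U" by (rule Hspace_mono[OF v n])
  have vL: "v \<in> L2 U" using v by (simp add: Hspace_def)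
  have 0: "(\<integral>x. (v x)\<^sup>2 \<partial>lebesgue_on U) = ?I 0"
  proof (rule L2_cong_AE(2)[OF U vL])
    show "AE x in lebesgue_on U. v x = weak_deriv U 0 v x"
      using weak_deriv_AE_eq[OF U has_weak_deriv_0[OF L2_locally_integrable[OF U vL]]] by eventually_elim simp
  qed
  have 1: "(\<integral>x. (norm (weak_grad U v x))\<^sup>2 \<partial>lebesgue_on U) = (\<Sum>i\<in>UNIV. ?I (?a i))"
    unfolding norm_power2_vec using Hspace_1_L2(2)[OF U v1]
    by (subst Bochner_Integration.integral_sum) (auto simp: L2_def weak_grad_def)
  have inj: "inj ?a" by (auto simp: inj_on_def axis_eq_axis)
  have "?a i \<noteq> 0" for i using mi_order_axis[of i] mi_order_0 by force
  then have z: "0 \<notin> range ?a" by (metis imageE)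
  have "H1_energy U v = ?I 0 + (\<Sum>i\<in>UNIV. ?I (?a i))"
    unfolding H1_energy_def 0[symmetric] 1[symmetric]
    by (rule Bochner_Integration.integral_add[OF H1_energy_integrable(1,2)[OF U v1]])
  also have "\<dots> = (\<Sum>\<beta>\<in>insert 0 (range ?a). ?I \<beta>)"
    by (simp only: sum.insert[OF finite_imageI[OF finite] z] sum.reindex[OF inj] o_def)
  also have "\<dots> \<le> (Hnorm n U v)\<^sup>2"
    unfolding Hnorm_power2
    by (rule sum_mono2[OF finite_mi_order]) (use n mi_order_axis in auto)
  finally show ?thesis .
qed

section \<open>Far indices inside the web-spline space\<close>

lemma bspline_support:
  fixes k :: "int^'m"
  assumes h: "h > 0"
  shows "support (bspline n h k) \<subseteq> cbox (grid_point h k) (\<chi> \<nu>. h * (of_int (k $ \<nu>) + real n))"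
proof (rule support_subset[OF closed_cbox])
  fix x :: "real^'m"
  assume "x \<notin> cbox (grid_point h k) (\<chi> \<nu>. h * (of_int (k $ \<nu>) + real n))"
  then obtain \<nu> where "x $ \<nu> < h * of_int (k $ \<nu>) \<or> h * (of_int (k $ \<nu>) + real n) < x $ \<nu>"
    by (auto simp: mem_box_cart grid_point_def not_le)
  then have "x $ \<nu> / h - of_int (k $ \<nu>) < 0 \<or> real n \<le> x $ \<nu> / h - of_int (k $ \<nu>)"
    using h by (auto simp: field_simps)
  then have "cardinal_bspline n (x $ \<nu> / h - of_int (k $ \<nu>)) = 0" by (rule cardinal_bspline_eq_0)
  then show "bspline n h k x = 0" unfolding bspline_def by (intro prod_zero) auto
qed

context weighted_domain
begin

lemma relevant_near:
  assumes h: "h > 0" and k: "k \<in> relevant_indices U n h"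
  obtains x where "x \<in> U" "norm (grid_point h k - x) \<le> r * h"
proof -
  obtain x where x: "x \<in> support (bspline n h k)" "x \<in> U" using k by (auto simp: relevant_indices_def)
  then have b: "x \<in> cbox (grid_point h k) (\<chi> \<nu>. h * (of_int (k $ \<nu>) + real n))" using bspline_support[OF h] by blast
  have "norm (grid_point h k - x) \<le> r * h"
    unfolding r_eq
  proof (rule norm_le_sample_radius[OF h])
    fix \<nu>
    have "grid_point h k $ \<nu> \<le> x $ \<nu>" "x $ \<nu> \<le> grid_point h k $ \<nu> + h * real n"
      using b by (auto simp: mem_box_cart grid_point_def distrib_left)
    then show "\<bar>(grid_point h k - x) $ \<nu>\<bar> \<le> h * (real n + 2)"
      using h by (simp add: distrib_left)
  qed
  then show ?thesis using x(2) that by blast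
qed

lemma finite_relevant_indices:
  assumes h: "h > 0"
  shows "finite (relevant_indices U n h)"
proof -
  obtain b where b: "\<And>x. x \<in> U \<Longrightarrow> norm x \<le> b" using bounded_domain by (auto simp: bounded_iff)
  \<comment> \<open>With threshold 0 the far indices of a large ball are just the grid points in it,
    so their finiteness can be reused.\<close>
  have "relevant_indices U n h \<subseteq> far_indices (cball 0 (b + r * h)) 0 h"
  proof
    fix k assume "k \<in> relevant_indices U n h"
    then obtain x where "x \<in> U" "norm (grid_point h k - x) \<le> r * h" by (rule relevant_near[OF h])
    then have "norm (grid_point h k) \<le> b + r * h" using b[of x] norm_triangle_sub[of "grid_point h k" x] by linarith
    then show "k \<in> far_indices (cball 0 (b + r * h)) 0 h" by (simp add: far_indices_def infdist_nonneg)
  qed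
  then show ?thesis using finite_far_indices[OF h bounded_cball] finite_subset by blast
qed

lemma grid_cell_near:
  fixes x :: "real^'m"
  assumes h: "h > 0" and l: "\<And>\<nu>. 0 \<le> l $ \<nu> \<and> l $ \<nu> \<le> int n - 1" and x: "x \<in> grid_cell h (k + l)"
  shows "norm (x - grid_point h k) \<le> r * h"
  unfolding r_eq
proof (rule norm_le_sample_radius[OF h])
  fix \<nu>
  have x': "h * of_int (k $ \<nu> + l $ \<nu>) \<le> x $ \<nu>" "x $ \<nu> \<le> h * (of_int (k $ \<nu> + l $ \<nu>) + 1)"
    using x by (auto simp: grid_cell_def)
  have "0 \<le> h * real_of_int (l $ \<nu>)" using h l[of \<nu>] by simp
  moreover have "h * (real_of_int (l $ \<nu>) + 1) \<le> h * real n"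
  proof (rule mult_left_mono)
    have "real_of_int (l $ \<nu>) \<le> real_of_int (int n - 1)" using l[of \<nu>] by (simp only: of_int_le_iff)
    then show "real_of_int (l $ \<nu>) + 1 \<le> real n" by simp
  qed (use h in simp)
  moreover have "0 \<le> h * 2" using h by simp
  ultimately show "\<bar>(x - grid_point h k) $ \<nu>\<bar> \<le> h * (real n + 2)"
    using x' by (simp add: grid_point_def distrib_left)
qed

lemma near_far_index:
  assumes k: "k \<in> far_indices U A h" and x: "norm (x - grid_point h k) < A * h"
  shows "x \<in> U"
  by (rule in_domain[of "grid_point h k"]) (use k x in \<open>auto simp: far_indices_def\<close>)

text \<open>Offset 0 is a witness: the cell whose corner is the far grid point lies within r h < A h
  of it and hence in the domain.\<close>

lemma far_index_inner:
  assumes h: "h > 0" and A: "A > r" and k: "k \<in> far_indices U A h" "k \<in> relevant_indices U n h"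
  shows "k \<in> inner_indices U n h"
proof -
  have "grid_cell h (k + 0) \<subseteq> U"
  proof
    fix x assume x: "x \<in> grid_cell h (k + 0)"
    have "norm (x - grid_point h k) \<le> r * h" by (rule grid_cell_near[OF h _ x]) (use order_ge_2 in auto)
    also have "r * h < A * h" using A h by simp
    finally show "x \<in> U" by (rule near_far_index[OF k(1)])
  qed
  then have "0 \<in> inner_offsets U n h k" using closure_subset[of U] order_ge_2 by (auto simp: inner_offsets_def)
  then show ?thesis using k(2) by (auto simp: inner_indices_def)
qed

text \<open>If \<open>j\<close> were closer than \<open>M\<close> to the far index, its first cell
  would lie within M h + r h \<le> A h of the far grid point and so inside the domain; then
  \<open>j\<close> would be inner. Hence the distance is at least \<open>M\<close>, where extension
  coefficients vanish.\<close>

lemma far_index_coeff_0: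
  assumes h: "h > 0" and A: "A \<ge> M + r" and k: "k \<in> far_indices U A h" "k \<in> inner_indices U n h"
    and j: "j \<in> outer_indices U n h" and web: "web_data U w n M h l e"
  shows "e k j = 0"
proof -
  let ?v = "(\<chi> \<nu>. of_int (k $ \<nu> - j $ \<nu>)) :: real^'m"
  have "M \<le> norm ?v"
  proof (rule ccontr)
    assume "\<not> M \<le> norm ?v"
    then have lt: "norm ?v < M" by simp
    have "grid_point h k - grid_point h j = h *\<^sub>R ?v"
      by (simp add: vec_eq_iff grid_point_def right_diff_distrib)
    then have nv: "norm (grid_point h j - grid_point h k) = h * norm ?v" using h by (subst norm_minus_commute) simp
    have "grid_cell h (j + 0) \<subseteq> U"
    proof
      fix x assume x: "x \<in> grid_cell h (j + 0)"
      have "norm (x - grid_point h j) \<le> r * h" by (rule grid_cell_near[OF h _ x]) (use order_ge_2 in auto)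
      moreover have "h * norm ?v < h * M" using lt h by (rule mult_strict_left_mono)
      moreover have "h * M + r * h \<le> A * h" using mult_right_mono[OF A, of h] h by (simp add: algebra_simps)
      moreover have "norm (x - grid_point h k) \<le> norm (x - grid_point h j) + norm (grid_point h j - grid_point h k)"
        using norm_triangle_ineq[of "x - grid_point h j" "grid_point h j - grid_point h k"] by simp
      ultimately have "norm (x - grid_point h k) < A * h" using nv by linarith
      then show "x \<in> U" by (rule near_far_index[OF k(1)])
    qed
    then have "0 \<in> inner_offsets U n h j" using closure_subset[of U] order_ge_2 by (auto simp: inner_offsets_def)
    then show False using j by (auto simp: outer_indices_def inner_indices_def)
  qed
  then show ?thesis using web k(2) j by (auto simp: web_data_def)
qed

text \<open>For a far index the web-spline reduces to the weighted B-spline divided by the value of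
  \<open>w\<close> at the cell center, so its coefficient is multiplied by that value.\<close>

lemma far_spline_in_web_space:
  assumes h: "h > 0" and A: "A > r" "A \<ge> M + r" and web: "web_data U w n M h l e"
  shows "(\<lambda>x. w x * (\<Sum>k\<in>far_indices U A h. c k * bspline n h k x)) \<in> web_space U w n h l e"
  unfolding web_space_def
proof (intro CollectI exI ballI)
  let ?F = "far_indices U A h" and ?I = "inner_indices U n h"
  define c' where "c' i = (if i \<in> ?F then c i * w (cell_center h (i + l i)) else 0)" for i
  fix x assume x: "x \<in> U"
  have finI: "finite ?I" using finite_relevant_indices[OF h] by (rule rev_finite_subset) (auto simp: inner_indices_def)
  have t: "c i * w (cell_center h (i + l i)) * webspline U w n h l e i x = w x * (c i * bspline n h i x)"
    if i: "i \<in> ?I" "i \<in> ?F" for i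
  proof -
    have li: "l i \<in> inner_offsets U n h i" using web i by (auto simp: web_data_def)
    have "cell_center h (i + l i) \<in> grid_cell h (i + l i)"
      using h by (auto simp: cell_center_def grid_cell_def)
    then have "norm (cell_center h (i + l i) - grid_point h i) \<le> r * h"
      by (rule grid_cell_near[OF h, rotated]) (use li in \<open>auto simp: inner_offsets_def\<close>)
    also have "r * h < A * h" using A h by simp
    finally have "w (cell_center h (i + l i)) > 0" by (intro weight_pos near_far_index[OF i(2)])
    moreover have "(\<Sum>j\<in>outer_indices U n h. e i j * bspline n h j x) = 0"
      by (rule sum.neutral) (use far_index_coeff_0[OF h A(2) i(2,1) _ web] in auto)
    ultimately show ?thesis by (simp add: webspline_def)
  qed
  have "w x * (\<Sum>k\<in>?F. c k * bspline n h k x) = w x * (\<Sum>k\<in>?F \<inter> ?I. c k * bspline n h k x)"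
  proof -
    \<comment> \<open>A far index that is not inner is not relevant, so its B-spline vanishes on the
      domain.\<close>
    have "bspline n h k x = 0" if "k \<in> ?F - ?I" for k
    proof -
      have "k \<notin> relevant_indices U n h" using that far_index_inner[OF h A(1)] by blast
      then show ?thesis using x not_in_support[of x "bspline n h k"] by (auto simp: relevant_indices_def)
    qed
    then show ?thesis
      by (intro arg_cong[where f = "(*) (w x)"] sum.mono_neutral_right finite_far_indices[OF h bounded_domain]) auto
  qed
  also have "\<dots> = (\<Sum>i\<in>?F \<inter> ?I. c' i * webspline U w n h l e i x)"
    unfolding sum_distrib_left by (intro sum.cong refl) (simp add: t c'_def)
  also have "\<dots> = (\<Sum>i\<in>?I. c' i * webspline U w n h l e i x)"
    by (rule sum.mono_neutral_left[OF finI]) (auto simp: c'_def)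
  finally show "w x * (\<Sum>k\<in>?F. c k * bspline n h k x) = (\<Sum>i\<in>?I. c' i * webspline U w n h l e i x)" .
qed

text \<open>A combination of web-splines is \<open>w\<close> times a finite B-spline sum: inner
  indices keep their own coefficient, and outer ones collect the contributions of all
  extensions.\<close>

lemma web_space_H0space:
  assumes h: "h > 0" and v: "v \<in> web_space U w n h l e"
  shows "v \<in> H0space 1 U"
proof -
  let ?I = "inner_indices U n h" and ?J = "outer_indices U n h" and ?K = "relevant_indices U n h"
  obtain c where c: "\<And>x. x \<in> U \<Longrightarrow> v x = (\<Sum>i\<in>?I. c i * webspline U w n h l e i x)"
    using v by (auto simp: web_space_def)
  define a where "a i = c i / w (cell_center h (i + l i))" for i
  define c' where "c' k = (if k \<in> ?I then a k else (\<Sum>i\<in>?I. a i * e i k))" for k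
  have finK: "finite ?K" by (rule finite_relevant_indices[OF h])
  have sub: "?I \<subseteq> ?K" and J: "?J = ?K - ?I" by (auto simp: inner_indices_def outer_indices_def)
  have "v x = w x * (\<Sum>k\<in>?K. c' k * bspline n h k x)" if x: "x \<in> U" for x
  proof -
    have "(\<Sum>k\<in>?K. c' k * bspline n h k x) = (\<Sum>k\<in>?J. c' k * bspline n h k x) + (\<Sum>k\<in>?I. c' k * bspline n h k x)"
      unfolding J by (rule sum.subset_diff[OF sub finK])
    also have "(\<Sum>k\<in>?I. c' k * bspline n h k x) = (\<Sum>i\<in>?I. a i * bspline n h i x)" by (simp add: c'_def)
    also have "(\<Sum>k\<in>?J. c' k * bspline n h k x) = (\<Sum>k\<in>?J. \<Sum>i\<in>?I. a i * e i k * bspline n h k x)"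
      by (intro sum.cong refl) (auto simp: c'_def J sum_distrib_right)
    also have "\<dots> = (\<Sum>i\<in>?I. \<Sum>k\<in>?J. a i * e i k * bspline n h k x)" by (rule sum.swap)
    also have "\<dots> + (\<Sum>i\<in>?I. a i * bspline n h i x) = (\<Sum>i\<in>?I. a i * (bspline n h i x + (\<Sum>k\<in>?J. e i k * bspline n h k x)))"
      by (simp add: sum.distrib distrib_left sum_distrib_left mult.assoc)
    finally have "w x * (\<Sum>k\<in>?K. c' k * bspline n h k x) = (\<Sum>i\<in>?I. w x * (a i * (bspline n h i x + (\<Sum>k\<in>?J. e i k * bspline n h k x))))"
      by (simp add: sum_distrib_left)
    also have "\<dots> = (\<Sum>i\<in>?I. c i * webspline U w n h l e i x)"
      by (intro sum.cong refl) (simp add: webspline_def a_def)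
    finally show ?thesis using c[OF x] by simp
  qed
  then show ?thesis by (rule weighted_spline(1)[OF h finK])
qed

text \<open>Passes from test functions to the Sobolev space by density. The additive \<epsilon>
  comes from the test function being only close to \<open>u\<close>; the constant does not depend on
  it.\<close>

lemma web_approximation:
  fixes M h0 :: real
  assumes lip: "lipschitz_domain U" and h0: "h0 > 0"
  obtains C where "C \<ge> 0" "\<And>h l e u \<epsilon>. 0 < h \<Longrightarrow> h \<le> h0 \<Longrightarrow> web_data U w n M h l e \<Longrightarrow> u \<in> H0space n U \<Longrightarrow> \<epsilon> > 0 \<Longrightarrow>
    \<exists>v\<in>web_space U w n h l e. H1_energy U (\<lambda>x. u x - v x) \<le> C * h ^ (2 * (n - 1)) * (Hnorm n U u)\<^sup>2 + \<epsilon>"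
proof -
  define A where "A = max (3 * r + 1) (M + r)"
  have A: "A \<ge> 3 * r + 1" "A \<ge> M + r" "A > r" using r_ge_1 by (auto simp: A_def)
  obtain C0 where C0: "C0 \<ge> 0" "\<And>h \<phi> \<epsilon>. 0 < h \<Longrightarrow> h \<le> h0 \<Longrightarrow> \<phi> \<in> test_functions U \<Longrightarrow> \<epsilon> > 0 \<Longrightarrow>
    \<exists>c. H1_energy U (\<lambda>x. \<phi> x - w x * (\<Sum>k\<in>far_indices U A h. c k * bspline n h k x))
      \<le> C0 * h ^ (2 * (n - 1)) * ((Hnorm n U \<phi>)\<^sup>2 + \<epsilon>)"
    by (rule test_function_approximation[OF lip A(1) h0]) (rule that)
  have "4 * C0 \<ge> 0" using C0(1) by simp
  moreover have "\<exists>v\<in>web_space U w n h l e. H1_energy U (\<lambda>x. u x - v x) \<le> 4 * C0 * h ^ (2 * (n - 1)) * (Hnorm n U u)\<^sup>2 + \<epsilon>"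
    if h: "0 < h" "h \<le> h0" and web: "web_data U w n M h l e" and u: "u \<in> H0space n U" and \<epsilon>: "\<epsilon> > 0" for h l e u \<epsilon>
  proof -
    define T where "T = C0 * h ^ (2 * (n - 1))"
    have T: "T \<ge> 0" using C0(1) h by (simp add: T_def)
    \<comment> \<open>Chosen so that everything left over from the density argument, 2 \<delta>^2
      from the distance to the test function and 6 T \<delta>^2 from its norm and the surplus, sums
      up to \<epsilon>.\<close>
    define \<delta> where "\<delta> = sqrt (\<epsilon> / (2 + 6 * T))"
    have \<delta>: "\<delta> > 0" "\<delta>\<^sup>2 * (2 + 6 * T) = \<epsilon>" using \<epsilon> T by (auto simp: \<delta>_def)
    have uH: "u \<in> Hspace n U" using u by (simp add: H0space_def)
    obtain \<phi> where \<phi>: "\<phi> \<in> test_functions U" "Hnorm n U (\<lambda>x. u x - \<phi> x) < \<delta>"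
      using u \<delta>(1) by (auto simp: H0space_def)
    have \<phi>H: "\<phi> \<in> Hspace l U" for l by (rule test_function_Hspace(1)[OF \<phi>(1) open_domain])
    have n1: "n \<ge> 1" using order_ge_2 by simp
    have sq: "(Hnorm n U (\<lambda>x. u x - \<phi> x))\<^sup>2 \<le> \<delta>\<^sup>2"
      using \<phi>(2) Hnorm_nonneg by (intro power_mono) auto
    have \<delta>2: "\<delta>\<^sup>2 > 0" using \<delta>(1) by simp
    obtain c where c: "H1_energy U (\<lambda>x. \<phi> x - w x * (\<Sum>k\<in>far_indices U A h. c k * bspline n h k x))
      \<le> T * ((Hnorm n U \<phi>)\<^sup>2 + \<delta>\<^sup>2)"
      using C0(2)[OF h \<phi>(1) \<delta>2] unfolding T_def by blast
    define v where "v x = w x * (\<Sum>k\<in>far_indices U A h. c k * bspline n h k x)" for x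
    have vW: "v \<in> web_space U w n h l e"
      using far_spline_in_web_space[OF h(1) A(3,2) web, of c] by (simp add: v_def[abs_def])
    have vH: "v \<in> Hspace 1 U" using web_space_H0space[OF h(1) vW] by (simp add: H0space_def)
    have "H1_energy U (\<lambda>x. u x - v x) \<le> 2 * H1_energy U (\<lambda>x. u x - \<phi> x) + 2 * H1_energy U (\<lambda>x. \<phi> x - v x)"
      by (rule H1_energy_add_le[OF open_domain Hspace_mono[OF uH n1] vH \<phi>H])
    also have "\<dots> \<le> 2 * \<delta>\<^sup>2 + 2 * (T * ((Hnorm n U \<phi>)\<^sup>2 + \<delta>\<^sup>2))"
      using H1_energy_le_Hnorm[OF open_domain Hspace_diff[OF open_domain uH \<phi>H] n1] sq c by (simp add: v_def)
    also have "\<dots> \<le> 2 * \<delta>\<^sup>2 + 2 * (T * ((2 * (Hnorm n U u)\<^sup>2 + 2 * \<delta>\<^sup>2) + \<delta>\<^sup>2))"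
      using Hnorm_le_add[OF open_domain uH \<phi>H] sq T by (intro add_left_mono mult_left_mono add_right_mono) auto
    also have "\<dots> = 4 * T * (Hnorm n U u)\<^sup>2 + \<delta>\<^sup>2 * (2 + 6 * T)" by (simp add: algebra_simps)
    finally have "H1_energy U (\<lambda>x. u x - v x) \<le> 4 * T * (Hnorm n U u)\<^sup>2 + \<epsilon>" unfolding \<delta>(2) .
    then have "H1_energy U (\<lambda>x. u x - v x) \<le> 4 * C0 * h ^ (2 * (n - 1)) * (Hnorm n U u)\<^sup>2 + \<epsilon>"
      by (simp only: T_def mult.assoc)
    then show ?thesis using vW by blast
  qed
  ultimately show ?thesis using that by blast
qed

end

lemma weight_function_weighted_domain:
  fixes U :: "(real^'m) set"
  assumes bd: "bounded U" and lip: "lipschitz_domain U" and n: "n \<ge> 2" and w: "weight_function U w"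
  obtains c1 c2 W where "weighted_domain U w c1 c2 W (sample_radius TYPE('m) n) n"
proof -
  have U: "open U" and ne: "U \<noteq> {}" using lip by (auto simp: lipschitz_domain_def)
  let ?d = "\<lambda>x. infdist x (frontier U)"
  have fr: "frontier U \<noteq> {}" using bd ne not_bounded_UNIV by (intro frontier_not_empty) auto
  have d: "0 < ?d x" if "x \<in> U" for x
    using U that by (intro infdist_pos_not_in_closed frontier_closed fr) (auto simp: frontier_def interior_open)
  obtain c1 c2 where c: "c1 > 0" "c2 > 0" "\<And>x. x \<in> U \<Longrightarrow> c1 * ?d x \<le> w x" "\<And>x. x \<in> U \<Longrightarrow> w x \<le> c2 * ?d x"
    and sm: "smooth_on U w" and D: "\<And>\<beta>. \<exists>c. \<forall>x\<in>U. \<bar>mi_deriv \<beta> w x\<bar> \<le> c * ?d x powi (1 - int (mi_order \<beta>))"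
    using w unfolding weight_function_def by metis
  have "\<exists>c. \<forall>x\<in>U. \<bar>partial_deriv i w x\<bar> \<le> c" for i
    using D[of "axis i 1"] mi_deriv_axis[of i w] mi_order_axis[of i] by (simp only: of_nat_1 diff_self power_int_0_right mult_1_right)
  then obtain b where b: "\<And>i x. x \<in> U \<Longrightarrow> \<bar>partial_deriv i w x\<bar> \<le> b i" by metis
  have W: "\<bar>partial_deriv i w x\<bar> \<le> (\<Sum>i\<in>UNIV. \<bar>b i\<bar>)" if "x \<in> U" for x i
    using b[OF that, of i] member_le_sum[of i UNIV "\<lambda>i. \<bar>b i\<bar>"] by simp
  have "\<exists>c. \<forall>x\<in>U. \<bar>iter_partial is w x\<bar> \<le> c * ?d x / ?d x ^ length is" for "is"
  proof -
    obtain c where c: "\<And>x. x \<in> U \<Longrightarrow> \<bar>mi_deriv (\<chi> i. count_list is i) w x\<bar> \<le> c * ?d x powi (1 - int (length is))"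
      using D[of "\<chi> i. count_list is i"] by (auto simp: mi_order_count)
    have "\<bar>iter_partial is w x\<bar> \<le> c * ?d x / ?d x ^ length is" if x: "x \<in> U" for x
    proof -
      have "?d x powi (1 - int (length is)) = ?d x / ?d x ^ length is"
        using d[OF x] by (simp add: power_int_diff)
      then show ?thesis using c[OF x] iter_partial_eq_mi_deriv[OF U sm x, of "is"] by simp
    qed
    then show ?thesis by blast
  qed
  then have "weighted_domain U w c1 c2 (\<Sum>i\<in>UNIV. \<bar>b i\<bar>) (sample_radius TYPE('m) n) n"
    by unfold_locales (use U bd fr n sm c W in auto)
  then show ?thesis by (rule that)
qed

lemma web_space_diff:
  assumes "u \<in> web_space U w n h l e" "v \<in> web_space U w n h l e"
  shows "(\<lambda>x. u x - v x) \<in> web_space U w n h l e"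
proof -
  obtain a b where "\<forall>x\<in>U. u x = (\<Sum>i\<in>inner_indices U n h. a i * webspline U w n h l e i x)"
    "\<forall>x\<in>U. v x = (\<Sum>i\<in>inner_indices U n h. b i * webspline U w n h l e i x)"
    using assms by (auto simp: web_space_def)
  then have "\<forall>x\<in>U. u x - v x = (\<Sum>i\<in>inner_indices U n h. (a i - b i) * webspline U w n h l e i x)"
    by (simp add: left_diff_distrib sum_subtractf)
  then show ?thesis unfolding web_space_def by (intro CollectI exI)
qed

theorem theorem2:
  fixes \<Omega> :: "(real^'m) set"
    and P :: "real^'m \<Rightarrow> real^'m^'m"
    and R :: "real^'m \<Rightarrow> real^'m"
    and q1 q2 w :: "real^'m \<Rightarrow> real"
    and \<alpha> h0 :: real
    and n :: nat
    and B :: "real \<Rightarrow> (real^'m \<Rightarrow> real) set"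
  assumes domain: "bounded \<Omega>" "lipschitz_domain \<Omega>"
    and P_bounded: "\<And>i j. (\<lambda>x. P x $ i $ j) \<in> Linf \<Omega>"
    and R_bounded: "\<And>k. (\<lambda>x. R x $ k) \<in> Linf \<Omega>"
    and q_bounded: "q1 \<in> Linf \<Omega>" "q2 \<in> Linf \<Omega>"
    and P_symmetric: "AE x in lebesgue_on \<Omega>. transpose (P x) = P x"
    and alpha_pos: "\<alpha> > 0"
    and P_elliptic: "AE x in lebesgue_on \<Omega>. \<forall>A. A \<bullet> (P x *v A) \<ge> \<alpha> * (A \<bullet> A)"
    and q1_lower: "essinf \<Omega> q1 \<ge>
      ereal (\<alpha> / 2 + 1 / (2 * \<alpha>) * (\<Sum>k\<in>UNIV. (Linf_norm \<Omega> (\<lambda>x. R x $ k))\<^sup>2))"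
    and order: "n \<ge> 2"
    and h0_pos: "h0 > 0"
    and family: "web_family \<Omega> w n h0 B"
  shows "\<exists>C>0. \<forall>f u h uh.
    f \<in> L2 \<Omega> \<times> L2 \<Omega> \<longrightarrow>
    u \<in> H0space 1 \<Omega> \<times> H0space 1 \<Omega> \<longrightarrow>
    (\<forall>v \<in> H0space 1 \<Omega> \<times> H0space 1 \<Omega>.
       bilinear_form \<Omega> P R q1 q2 u v = L2_pairing \<Omega> f v) \<longrightarrow>
    u \<in> H0space n \<Omega> \<times> H0space n \<Omega> \<longrightarrow>
    0 < h \<longrightarrow> h \<le> h0 \<longrightarrow>
    uh \<in> B h \<times> B h \<longrightarrow>
    (\<forall>vh \<in> B h \<times> B h. bilinear_form \<Omega> P R q1 q2 uh vh = L2_pairing \<Omega> f vh) \<longrightarrow>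
    H1_seminorm_pair \<Omega> (diff_pair u uh) \<le> C * h ^ (n - 1) * Hnorm_pair n \<Omega> u"
proof -
  have \<Omega>: "open \<Omega>" using domain(2) by (simp add: lipschitz_domain_def)
  obtain M where w: "weight_function \<Omega> w" and M: "\<And>h. 0 < h \<Longrightarrow> h \<le> h0 \<Longrightarrow> \<exists>l e. web_data \<Omega> w n M h l e \<and> B h = web_space \<Omega> w n h l e"
    using family unfolding web_family_def by blast
  obtain c1 c2 W where "weighted_domain \<Omega> w c1 c2 W (sample_radius TYPE('m) n) n"
    by (rule weight_function_weighted_domain[OF domain order w])
  then interpret weighted_domain \<Omega> w c1 c2 W "sample_radius TYPE('m) n" n .
  obtain Ca where Ca: "Ca \<ge> 0" "\<And>h l e u \<epsilon>. 0 < h \<Longrightarrow> h \<le> h0 \<Longrightarrow> web_data \<Omega> w n M h l e \<Longrightarrow> u \<in> H0space n \<Omega> \<Longrightarrow> \<epsilon> > 0 \<Longrightarrow>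
    \<exists>v\<in>web_space \<Omega> w n h l e. H1_energy \<Omega> (\<lambda>x. u x - v x) \<le> Ca * h ^ (2 * (n - 1)) * (Hnorm n \<Omega> u)\<^sup>2 + \<epsilon>"
    by (rule web_approximation[OF domain(2) h0_pos, of M]) (rule that)
  obtain Cc where Cc: "Cc \<ge> 0" "\<And>u uh vh. u \<in> Hspace 1 \<Omega> \<times> Hspace 1 \<Omega> \<Longrightarrow> uh \<in> Hspace 1 \<Omega> \<times> Hspace 1 \<Omega> \<Longrightarrow>
     vh \<in> Hspace 1 \<Omega> \<times> Hspace 1 \<Omega> \<Longrightarrow>
     bilinear_form \<Omega> P R q1 q2 u (diff_pair vh uh) = bilinear_form \<Omega> P R q1 q2 uh (diff_pair vh uh) \<Longrightarrow>
     H1_energy \<Omega> (fst (diff_pair u uh)) + H1_energy \<Omega> (snd (diff_pair u uh))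
       \<le> Cc * (H1_energy \<Omega> (fst (diff_pair u vh)) + H1_energy \<Omega> (snd (diff_pair u vh)))"
    by (rule cea[OF \<Omega> P_bounded R_bounded q_bounded alpha_pos P_elliptic q1_lower]) (rule that)
  \<comment> \<open>The 2 comes from squaring the sum of the two seminorms, the summand 1 ensures
    positivity.\<close>
  define C where "C = sqrt (2 * (Cc * Ca)) + 1"
  have "C > 0" using Cc(1) Ca(1) by (simp add: C_def add_nonneg_pos)
  moreover have "H1_seminorm_pair \<Omega> (diff_pair u uh) \<le> C * h ^ (n - 1) * Hnorm_pair n \<Omega> u"
    if u1: "u \<in> H0space 1 \<Omega> \<times> H0space 1 \<Omega>"
      and u: "\<forall>v \<in> H0space 1 \<Omega> \<times> H0space 1 \<Omega>. bilinear_form \<Omega> P R q1 q2 u v = L2_pairing \<Omega> f v"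
      and un: "u \<in> H0space n \<Omega> \<times> H0space n \<Omega>" and h: "0 < h" "h \<le> h0" and uh: "uh \<in> B h \<times> B h"
      and gal: "\<forall>vh \<in> B h \<times> B h. bilinear_form \<Omega> P R q1 q2 uh vh = L2_pairing \<Omega> f vh" for f u h uh
  proof -
    obtain l e where web: "web_data \<Omega> w n M h l e" and Bh: "B h = web_space \<Omega> w n h l e" using M[OF h] by blast
    have BH0: "B h \<subseteq> H0space 1 \<Omega>" using web_space_H0space[OF h(1)] Bh by blast
    have H0: "H0space 1 \<Omega> \<subseteq> Hspace 1 \<Omega>" by (auto simp: H0space_def)
    have uH: "u \<in> Hspace 1 \<Omega> \<times> Hspace 1 \<Omega>" and uhH: "uh \<in> Hspace 1 \<Omega> \<times> Hspace 1 \<Omega>" using u1 uh H0 BH0 by auto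
    let ?e = "diff_pair u uh" and ?N = "(Hnorm n \<Omega> (fst u))\<^sup>2 + (Hnorm n \<Omega> (snd u))\<^sup>2" and ?H = "h ^ (2 * (n - 1))"
    let ?E = "H1_energy \<Omega> (fst ?e) + H1_energy \<Omega> (snd ?e)"
    have "?E \<le> Cc * (Ca * ?H * ?N) + \<eta>" if \<eta>: "\<eta> > 0" for \<eta>
    proof -
      \<comment> \<open>Two components contribute Cc times \<epsilon> each; Cc + 1 avoids a division
        by zero.\<close>
      define \<epsilon> where "\<epsilon> = \<eta> / (2 * (Cc + 1))"
      have \<epsilon>: "\<epsilon> > 0" using \<eta> Cc(1) by (simp add: \<epsilon>_def)
      obtain v1 where v1: "v1 \<in> B h" "H1_energy \<Omega> (\<lambda>x. fst u x - v1 x) \<le> Ca * ?H * (Hnorm n \<Omega> (fst u))\<^sup>2 + \<epsilon>"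
        using Ca(2)[OF h web _ \<epsilon>, of "fst u"] un Bh by auto
      obtain v2 where v2: "v2 \<in> B h" "H1_energy \<Omega> (\<lambda>x. snd u x - v2 x) \<le> Ca * ?H * (Hnorm n \<Omega> (snd u))\<^sup>2 + \<epsilon>"
        using Ca(2)[OF h web _ \<epsilon>, of "snd u"] un Bh by auto
      let ?v = "(v1, v2)"
      have vH: "?v \<in> Hspace 1 \<Omega> \<times> Hspace 1 \<Omega>" using v1(1) v2(1) H0 BH0 by auto
      \<comment> \<open>The difference of two discrete functions is admissible in both variational
        equations, which gives Galerkin orthogonality for it.\<close>
      have z: "diff_pair ?v uh \<in> B h \<times> B h"
        using v1(1) v2(1) uh unfolding Bh by (auto simp: diff_pair_def intro: web_space_diff)
      then have z': "diff_pair ?v uh \<in> H0space 1 \<Omega> \<times> H0space 1 \<Omega>" using BH0 by (meson Sigma_mono subsetD)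
      have "bilinear_form \<Omega> P R q1 q2 u (diff_pair ?v uh) = bilinear_form \<Omega> P R q1 q2 uh (diff_pair ?v uh)"
        using bspec[OF u z'] bspec[OF gal z] by simp
      from Cc(2)[OF uH uhH vH this]
      have "?E \<le> Cc * (H1_energy \<Omega> (\<lambda>x. fst u x - v1 x) + H1_energy \<Omega> (\<lambda>x. snd u x - v2 x))"
        by (simp add: diff_pair_def)
      also have "\<dots> \<le> Cc * ((Ca * ?H * (Hnorm n \<Omega> (fst u))\<^sup>2 + \<epsilon>) + (Ca * ?H * (Hnorm n \<Omega> (snd u))\<^sup>2 + \<epsilon>))"
        using v1(2) v2(2) Cc(1) by (intro mult_left_mono add_mono)
      also have "\<dots> = Cc * (Ca * ?H * ?N) + 2 * Cc * \<epsilon>" by (simp add: distrib_left)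
      also have "2 * Cc * \<epsilon> \<le> 2 * (Cc + 1) * \<epsilon>" using \<epsilon> by simp
      also have "2 * (Cc + 1) * \<epsilon> = \<eta>" using Cc(1) by (simp add: \<epsilon>_def)
      finally show ?thesis by simp
    qed
    then have E: "?E \<le> Cc * (Ca * ?H * ?N)" by (rule field_le_epsilon)
    have eH: "?e \<in> Hspace 1 \<Omega> \<times> Hspace 1 \<Omega>" by (rule diff_pair_Hspace[OF \<Omega> uH uhH])
    have s: "(H1_seminorm \<Omega> (fst ?e))\<^sup>2 + (H1_seminorm \<Omega> (snd ?e))\<^sup>2 \<le> ?E"
      using eH by (intro add_mono H1_seminorm_le_energy[OF \<Omega>]) auto
    have hh: "h ^ (n - 1) \<ge> 0" using h by simp
    have Nn: "Hnorm_pair n \<Omega> u \<ge> 0" using Hnorm_nonneg[of n \<Omega>] by (simp add: Hnorm_pair_def)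
    have "(H1_seminorm_pair \<Omega> ?e)\<^sup>2 \<le> 2 * ((H1_seminorm \<Omega> (fst ?e))\<^sup>2 + (H1_seminorm \<Omega> (snd ?e))\<^sup>2)"
      using zero_le_power2[of "H1_seminorm \<Omega> (fst ?e) - H1_seminorm \<Omega> (snd ?e)"]
      by (simp add: H1_seminorm_pair_def power2_diff power2_sum)
    also have "\<dots> \<le> 2 * (Cc * (Ca * ?H * ?N))" using s E by simp
    also have "\<dots> \<le> 2 * (Cc * (Ca * ?H * (Hnorm_pair n \<Omega> u)\<^sup>2))"
    proof -
      have "?N \<le> (Hnorm_pair n \<Omega> u)\<^sup>2"
        using Hnorm_nonneg[of n \<Omega> "fst u"] Hnorm_nonneg[of n \<Omega> "snd u"] by (simp add: Hnorm_pair_def power2_sum)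
      then show ?thesis using Cc(1) Ca(1) h by (intro mult_left_mono) auto
    qed
    also have "\<dots> = (sqrt (2 * (Cc * Ca)) * h ^ (n - 1) * Hnorm_pair n \<Omega> u)\<^sup>2"
    proof -
      have "(h ^ (n - 1))\<^sup>2 = ?H" by (simp only: power_mult[symmetric] mult.commute)
      then show ?thesis using Cc(1) Ca(1) by (simp only: power_mult_distrib real_sqrt_pow2 mult_nonneg_nonneg zero_le_numeral mult_ac)
    qed
    finally have "H1_seminorm_pair \<Omega> ?e \<le> sqrt (2 * (Cc * Ca)) * h ^ (n - 1) * Hnorm_pair n \<Omega> u"
      by (rule power2_le_imp_le) (use Cc(1) Ca(1) hh Nn in simp)
    also have "\<dots> \<le> C * h ^ (n - 1) * Hnorm_pair n \<Omega> u"
      using hh Nn by (intro mult_right_mono) (auto simp: C_def)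
    finally show ?thesis .
  qed
  ultimately show ?thesis by blast
qed

end
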